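(* There is a one-to-one correspondence (bijection) between the set of all graph-knots and the set of all homotopy classes of looped graphs with the following additional property: if $K$ is a knot, $\mathfrak{F}$ is the graph-knot constructed from $K$ (by means of a rotating circuit of a diagram of $K$), and $\mathfrak{L}$ is the homotopy class of looped graphs constructed from $K$ (by means of the Gauss diagram of a diagram of $K$), then $\mathfrak{F}$ and $\mathfrak{L}$ are related by this correspondence.
   Context: All graphs are finite and are considered up to isomorphism (preserving labels or loops). All matrices, determinants, ranks and coranks are over $\mathbb{Z}_2$; $E$ is the identity matrix; the determinant of the empty matrix is $1$. $N(v)$ is the set of vertices adjacent to $v$. **Labeled graphs.** A labeled graph is a simple graph in which every vertex $v$ carries a pair $(a,\alpha)$, with $a\in\{0,1\}$ the framing and $\alpha\in\{+,-\}$ the sign of $v$. Its adjacency matrix $A(G)=(a_{ij})$ over $\mathbb{Z}_2$ (vertices enumerated $v_1,\dots,v_n$) has $a_{ii}$ = framing of $v_i$ and, for $i\neq j$, $a_{ij}=1$ iff $v_i,v_j$ are adjacent. $\operatorname{LC}(G;v)$ (local complementation) is obtained from $G$ by toggling the adjacency of $a,b$ for all $a\ne b$ in $N(v)$. $\operatorname{piv}(G;u,v)$ ($u\neq v$) is obtained from $G$ by toggling the adjacency of all pairs $x,y\notin\{u,v\}$ such that $x\in N(u)$, $y\in N(v)$ and either $x\notin N(v)$ or $y\notin N(u)$. **Graph-moves.** - $\Omega_g1$: addition/removal of an isolated vertex labeled $(0,\alpha)$, $\alpha\in\{\pm\}$. - $\Omega_g2$: addition/removal of two non-adjacent vertices labeled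 $(0,\alpha),(0,-\alpha)$, or of two adjacent vertices labeled $(1,\alpha),(1,-\alpha)$, which have the same adjacencies with all other vertices. - $\Omega_g3$: let $u,v,w$ be three vertices all labeled $(0,-)$ such that $u$ is adjacent only to $v$ and $w$, and $v,w$ are not adjacent. Toggle the adjacency of $u$ with $v$, with $w$, and with each $t\in (N(v)\setminus N(w))\cup(N(w)\setminus N(v))$, $t\neq u$; no other adjacencies change; switch the signs of $v$ and $w$ to $+$. The inverse operation is also an $\Omega_g3$ move. - $\Omega_g4$: for adjacent vertices $u,v$ labeled $(0,\alpha)$, $(0,\beta)$, replace $G$ by $\operatorname{piv}(G;u,v)$ and change the sign of $u$ to $-\beta$ and the sign of $v$ to $-\alpha$. - $\Omega_g4'$: for a vertex $v$ labeled $(1,\alpha)$, replace $G$ by $\operatorname{LC}(G;v)$, change the sign of $v$, and change the framing of each $u\in N(v)$. A graph-link is an equivalence class of labeled simple graphs modulo these moves. The number $\operatorname{corank}(A(G)+E)$ depends only on the graph-link of $G$; a graph-knot is a graph-link whose representatives $G$ satisfy $\operatorname{corank}(A(G)+E)=0$. **Looped graphs.** A looped graph is a graph without multiple edges in which loops are allowed. Moves: - $\Omega1$: addition/removal of an isolated looped or unlooped vertex. - $\Omega2$: addition/removal of two vertices having the same adjacencies with the other vertices, one of which is looped and the other unlooped. - $\Omega3$: let $u,v,w$ be three vertices such that $v$ is looped, $w$ is unlooped, $v$ and $w$ are adjacent, $u$ is adjacent to neither $v$ nor $w$, and every vertex $x\notin\{u,v,w\}$ is adjacent to either $0$ or precisely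 two of $u,v,w$. Toggle all three non-loop adjacencies $uv,uw,vw$ (remove $vw$, add $uv$ and $uw$). The inverse operation is also an $\Omega3$ move. A homotopy class of looped graphs is an equivalence class of looped graphs modulo $\Omega1,\Omega2,\Omega3$. **Knots and the two constructions.** A virtual diagram is a generically immersed $4$-valent graph in $\mathbb{R}^2$ in which each crossing either has over/under information (classical) or is marked virtual; a virtual link is an equivalence class of such diagrams modulo the usual Reidemeister moves on classical crossings and the detour move (replacing an arc containing only virtual crossings by any other such arc with the same endpoints). A knot here is a one-component (virtual) link. Diagrams are assumed connected (the $4$-graph whose vertices are the classical crossings is connected) and to have at least one classical crossing. *Rotating circuit construction.* A rotating circuit $C$ of a diagram of $K$ is a closed tour traversing every edge once, going straight through each virtual crossing, and at each classical crossing turning from a half-edge to an adjacent (non-opposite) half-edge. Connecting the two preimages of each classical crossing on the circle $S^1$ by a chord gives a chord diagram. The sign of a chord is $+$ if at that crossing $C$ agrees with the $A$-smoothing of the Kauffman bracket, and $-$ if it agrees with the $B$-smoothing. The framing of a chord is $0$ if two opposite half-edges at the crossing, as parts of one strand, are traversed by $C$ in opposite directions (both towards or both away from the crossing), and $1$ if in the same direction. The labeled intersection graph has one vertex per chord, with the label of the chord, two vertices being adjacent iff the chords are linked (their endpoints alternate on the circle). The graph-knot constructed from $K$ is the graph-link class of this labeled graph; it does not depend on the diagram or the circuit. *Gauss diagram construction.* The Gauss diagram of a diagram of $K$ is the chord diagram on the circle parametrizing the knot (passing straight through all crossings), with a chord joining the two preimages of each classical crossing. The looped graph of the diagram is the intersection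 graph of this chord diagram with a loop added at each vertex corresponding to a crossing of negative writhe ($-1$). The homotopy class of looped graphs constructed from $K$ is the class of this looped graph; it does not depend on the diagram. *)

theory Defs
  imports
    "HOL-Analysis.Derivative"
    "HOL-Library.Z2"
    "Jordan_Normal_Form.DL_Rank"
begin

section \<open>Graphs\<close>

text \<open>An edge is the set of its ends, so a loop at \<open>v\<close> is the singleton \<open>{v}\<close>.\<close>

record 'v graph =
  verts :: "'v set"
  edges :: "'v set set"

definition nbhd :: "('v, 'z) graph_scheme \<Rightarrow> 'v \<Rightarrow> 'v set" where
  "nbhd G v = {u. u \<noteq> v \<and> {u, v} \<in> edges G}"

definition toggle :: "'v set set \<Rightarrow> ('v, 'z) graph_scheme \<Rightarrow> ('v, 'z) graph_scheme" where
  "toggle P G = G\<lparr>edges := sym_diff (edges G) P\<rparr>"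

definition iso_by ::
    "('v \<Rightarrow> 'w) \<Rightarrow> ('v, 'y) graph_scheme \<Rightarrow> ('w, 'z) graph_scheme \<Rightarrow> bool" where
  "iso_by f G H \<longleftrightarrow> bij_betw f (verts G) (verts H) \<and> edges H = image f ` edges G"


section \<open>Labeled graphs and graph-knots\<close>

datatype vsign = Plus | Minus

fun flip :: "vsign \<Rightarrow> vsign" where
  "flip Plus = Minus"
| "flip Minus = Plus"

record 'v lgraph = "'v graph" +
  framing :: "'v \<Rightarrow> bit"
  vsign :: "'v \<Rightarrow> vsign"

definition labeled_graph :: "'v lgraph \<Rightarrow> bool" where
  "labeled_graph G \<longleftrightarrow> finite (verts G) \<and>
     (\<forall>e\<in>edges G. \<exists>u\<in>verts G. \<exists>v\<in>verts G. u \<noteq> v \<and> e = {u, v})"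

text \<open>Labels outside the vertex set carry no meaning; isomorphisms ignore them.\<close>

definition lgraph_iso :: "'v lgraph \<Rightarrow> 'w lgraph \<Rightarrow> bool" where
  "lgraph_iso G H \<longleftrightarrow> (\<exists>f. iso_by f G H \<and>
     (\<forall>v\<in>verts G. framing H (f v) = framing G v \<and> vsign H (f v) = vsign G v))"

definition adj_matrix :: "('v::linorder) lgraph \<Rightarrow> bit mat" where
  "adj_matrix G = (let vs = sorted_list_of_set (verts G); n = length vs in
     Matrix.mat n n (\<lambda>(i, j). if i = j then framing G (vs ! i)
                              else of_bool ({vs ! i, vs ! j} \<in> edges G)))"

definition corank :: "bit mat \<Rightarrow> nat" where
  "corank A = dim_col A - vec_space.rank (dim_row A) A"

definition LC :: "'v lgraph \<Rightarrow> 'v \<Rightarrow> 'v lgraph" where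
  "LC G v = toggle {{a, b} | a b. a \<in> nbhd G v \<and> b \<in> nbhd G v \<and> a \<noteq> b} G"

definition piv :: "'v lgraph \<Rightarrow> 'v \<Rightarrow> 'v \<Rightarrow> 'v lgraph" where
  "piv G u v = toggle {{x, y} | x y. x \<notin> {u, v} \<and> y \<notin> {u, v} \<and>
     x \<in> nbhd G u \<and> y \<in> nbhd G v \<and> (x \<notin> nbhd G v \<or> y \<notin> nbhd G u)} G"

text \<open>
  Each move is given in one direction only (for the first two moves, the addition); the inverse
  directions enter through the equivalence closure.
\<close>

definition omega_g1 :: "'v lgraph \<Rightarrow> 'v lgraph \<Rightarrow> bool" where
  "omega_g1 G H \<longleftrightarrow> (\<exists>v \<alpha>. v \<notin> verts G \<and>
     H = G\<lparr>verts := insert v (verts G),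
           framing := (framing G)(v := 0),
           vsign := (vsign G)(v := \<alpha>)\<rparr>)"

definition omega_g2 :: "'v lgraph \<Rightarrow> 'v lgraph \<Rightarrow> bool" where
  "omega_g2 G H \<longleftrightarrow> (\<exists>u v \<alpha> N adjacent. u \<notin> verts G \<and> v \<notin> verts G \<and> u \<noteq> v \<and> N \<subseteq> verts G \<and>
     H = G\<lparr>verts := insert u (insert v (verts G)),
           edges := edges G \<union> {{u, x} | x. x \<in> N} \<union> {{v, x} | x. x \<in> N} \<union>
                    (if adjacent then {{u, v}} else {}),
           framing := (framing G)(u := of_bool adjacent, v := of_bool adjacent),
           vsign := (vsign G)(u := \<alpha>, v := flip \<alpha>)\<rparr>)"

definition omega_g3 :: "'v lgraph \<Rightarrow> 'v lgraph \<Rightarrow> bool" where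
  "omega_g3 G H \<longleftrightarrow> (\<exists>u v w. {u, v, w} \<subseteq> verts G \<and> u \<noteq> v \<and> u \<noteq> w \<and> v \<noteq> w \<and>
     (\<forall>x\<in>{u, v, w}. framing G x = 0 \<and> vsign G x = Minus) \<and>
     nbhd G u = {v, w} \<and> v \<notin> nbhd G w \<and>
     H = (toggle ({{u, v}, {u, w}} \<union>
                  {{u, t} | t. t \<in> sym_diff (nbhd G v) (nbhd G w) \<and> t \<noteq> u}) G)
           \<lparr>vsign := (vsign G)(v := Plus, w := Plus)\<rparr>)"

definition omega_g4 :: "'v lgraph \<Rightarrow> 'v lgraph \<Rightarrow> bool" where
  "omega_g4 G H \<longleftrightarrow> (\<exists>u v. u \<in> verts G \<and> v \<in> verts G \<and> u \<in> nbhd G v \<and>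
     framing G u = 0 \<and> framing G v = 0 \<and>
     H = (piv G u v)\<lparr>vsign := (vsign G)(u := flip (vsign G v), v := flip (vsign G u))\<rparr>)"

definition omega_g4' :: "'v lgraph \<Rightarrow> 'v lgraph \<Rightarrow> bool" where
  "omega_g4' G H \<longleftrightarrow> (\<exists>v\<in>verts G. framing G v = 1 \<and>
     H = (LC G v)\<lparr>framing := (\<lambda>u. if u \<in> nbhd G v then framing G u + 1 else framing G u),
                  vsign := (vsign G)(v := flip (vsign G v))\<rparr>)"

definition lgraph_step :: "'v lgraph \<Rightarrow> 'v lgraph \<Rightarrow> bool" where
  "lgraph_step G H \<longleftrightarrow> labeled_graph G \<and> labeled_graph H \<and>
     (lgraph_iso G H \<or> omega_g1 G H \<or> omega_g2 G H \<or> omega_g3 G H \<or> omega_g4 G H \<or> omega_g4' G H)"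

text \<open>Since graphs are taken up to isomorphism, vertices in \<open>nat\<close> suffice.\<close>

definition graph_link_rel :: "(nat lgraph \<times> nat lgraph) set" where
  "graph_link_rel = {(G, H). labeled_graph G \<and> labeled_graph H \<and> equivclp lgraph_step G H}"

definition graph_links :: "nat lgraph set set" where
  "graph_links = {G. labeled_graph G} // graph_link_rel"

definition graph_knots :: "nat lgraph set set" where
  "graph_knots = {F \<in> graph_links.
     \<forall>G\<in>F. corank (adj_matrix G + 1\<^sub>m (card (verts G))) = 0}"

definition graph_link_of :: "'v lgraph \<Rightarrow> nat lgraph set" where
  "graph_link_of G = {H. \<exists>G'. lgraph_iso G G' \<and> (G', H) \<in> graph_link_rel}"


section \<open>Looped graphs and their homotopy classes\<close>

definition looped_graph :: "'v graph \<Rightarrow> bool" where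
  "looped_graph L \<longleftrightarrow> finite (verts L) \<and>
     (\<forall>e\<in>edges L. \<exists>u\<in>verts L. \<exists>v\<in>verts L. e = {u, v})"

definition graph_iso :: "'v graph \<Rightarrow> 'w graph \<Rightarrow> bool" where
  "graph_iso L M \<longleftrightarrow> (\<exists>f. iso_by f L M)"

definition omega1 :: "'v graph \<Rightarrow> 'v graph \<Rightarrow> bool" where
  "omega1 L M \<longleftrightarrow> (\<exists>v looped. v \<notin> verts L \<and>
     M = L\<lparr>verts := insert v (verts L),
           edges := edges L \<union> (if looped then {{v}} else {})\<rparr>)"

definition omega2 :: "'v graph \<Rightarrow> 'v graph \<Rightarrow> bool" where
  "omega2 L M \<longleftrightarrow> (\<exists>u v N adjacent. u \<notin> verts L \<and> v \<notin> verts L \<and> u \<noteq> v \<and> N \<subseteq> verts L \<and>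
     M = L\<lparr>verts := insert u (insert v (verts L)),
           edges := edges L \<union> {{u, x} | x. x \<in> N} \<union> {{v, x} | x. x \<in> N} \<union> {{u}} \<union>
                    (if adjacent then {{u, v}} else {})\<rparr>)"

definition omega3 :: "'v graph \<Rightarrow> 'v graph \<Rightarrow> bool" where
  "omega3 L M \<longleftrightarrow> (\<exists>u v w. {u, v, w} \<subseteq> verts L \<and> u \<noteq> v \<and> u \<noteq> w \<and> v \<noteq> w \<and>
     {v} \<in> edges L \<and> {w} \<notin> edges L \<and>
     {v, w} \<in> edges L \<and> {u, v} \<notin> edges L \<and> {u, w} \<notin> edges L \<and>
     (\<forall>x \<in> verts L - {u, v, w}. card (nbhd L x \<inter> {u, v, w}) \<in> {0, 2}) \<and>
     M = toggle {{u, v}, {u, w}, {v, w}} L)"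

definition looped_step :: "'v graph \<Rightarrow> 'v graph \<Rightarrow> bool" where
  "looped_step L M \<longleftrightarrow> looped_graph L \<and> looped_graph M \<and>
     (graph_iso L M \<or> omega1 L M \<or> omega2 L M \<or> omega3 L M)"

definition homotopy_rel :: "(nat graph \<times> nat graph) set" where
  "homotopy_rel = {(L, M). looped_graph L \<and> looped_graph M \<and> equivclp looped_step L M}"

definition homotopy_classes :: "nat graph set set" where
  "homotopy_classes = {L. looped_graph L} // homotopy_rel"

definition homotopy_class_of :: "'v graph \<Rightarrow> nat graph set" where
  "homotopy_class_of L = {M. \<exists>L'. graph_iso L L' \<and> (L', M) \<in> homotopy_rel}"


section \<open>One-component virtual diagrams\<close>

text \<open>
  A one-component diagram is a generic closed curve, parametrized with period 1, together with
  the set \<open>over\<close> of those times at which it runs along the overpass of a classical crossing.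
  A double point neither of whose times belongs to \<open>over\<close> is a virtual crossing.
  The 4-graph of classical crossings of such a diagram is connected, since it is traced by a
  single closed curve.
\<close>

record vdiagram =
  curve :: "real \<Rightarrow> complex"
  over :: "real set"

abbreviation tangent :: "vdiagram \<Rightarrow> real \<Rightarrow> complex" where
  "tangent D t \<equiv> vector_derivative (curve D) (at t)"

text \<open>The determinant of the pair \<open>w, z\<close> of plane vectors: it is positive iff \<open>z\<close> points
  to the left of \<open>w\<close>.\<close>

definition cross :: "complex \<Rightarrow> complex \<Rightarrow> real" where
  "cross w z = Re w * Im z - Im w * Re z"

definition meets :: "vdiagram \<Rightarrow> real \<Rightarrow> real \<Rightarrow> bool" where
  "meets D s t \<longleftrightarrow> s - t \<notin> \<int> \<and> curve D s = curve D t"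

definition classical :: "vdiagram \<Rightarrow> real \<Rightarrow> real \<Rightarrow> bool" where
  "classical D s t \<longleftrightarrow> meets D s t \<and> (s \<in> over D \<or> t \<in> over D)"

definition knot_diagram :: "vdiagram \<Rightarrow> bool" where
  "knot_diagram D \<longleftrightarrow>
     curve D C1_differentiable_on UNIV \<and>
     (\<forall>t. curve D (t + 1) = curve D t) \<and>
     (\<forall>t. tangent D t \<noteq> 0) \<and>
     finite {t \<in> {0..<1}. \<exists>s. meets D s t} \<and>
     (\<forall>s t. meets D s t \<longrightarrow> cross (tangent D s) (tangent D t) \<noteq> 0) \<and>
     (\<forall>r s t. meets D r s \<and> meets D s t \<longrightarrow> r - t \<in> \<int>) \<and>
     (\<forall>t. t + 1 \<in> over D \<longleftrightarrow> t \<in> over D) \<and>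
     (\<forall>t \<in> over D. \<exists>s. meets D s t \<and> s \<notin> over D)"


subsection \<open>Virtual knots\<close>

definition arc :: "real \<Rightarrow> real \<Rightarrow> real set" where
  "arc a b = {t. \<exists>k::int. a < t + of_int k \<and> t + of_int k < b}"

definition differ_on_arc :: "real \<Rightarrow> real \<Rightarrow> vdiagram \<Rightarrow> vdiagram \<Rightarrow> bool" where
  "differ_on_arc a b D D' \<longleftrightarrow> a < b \<and> b < a + 1 \<and>
     (\<forall>t. t \<notin> arc a b \<longrightarrow> curve D' t = curve D t \<and> (t \<in> over D' \<longleftrightarrow> t \<in> over D))"

text \<open>
  Planar isotopy combined with a change of parameter. A knot is not oriented, so the parameter
  change may reverse the direction; the plane map \<open>h\<close> is an orientation preserving
  diffeomorphism.
\<close>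

definition isotopic :: "vdiagram \<Rightarrow> vdiagram \<Rightarrow> bool" where
  "isotopic D D' \<longleftrightarrow> (\<exists>h h' p p'.
     bij h \<and> (\<forall>z. (h has_derivative h' z) (at z)) \<and>
     (\<forall>w. continuous_on UNIV (\<lambda>z. h' z w)) \<and> (\<forall>z. cross (h' z 1) (h' z \<i>) > 0) \<and>
     (\<forall>t. (p has_real_derivative p' t) (at t)) \<and> continuous_on UNIV p' \<and> (\<forall>t. p' t \<noteq> 0) \<and>
     ((\<forall>t. p (t + 1) = p t + 1) \<or> (\<forall>t. p (t + 1) = p t - 1)) \<and>
     curve D' = h \<circ> curve D \<circ> p \<and> over D' = p -` over D)"

definition detour :: "vdiagram \<Rightarrow> vdiagram \<Rightarrow> bool" where
  "detour D D' \<longleftrightarrow> (\<exists>a b. differ_on_arc a b D D' \<and>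
     (\<forall>t\<in>arc a b. \<forall>s. \<not> classical D s t \<and> \<not> classical D' s t))"

text \<open>
  By planar isotopy, a Reidemeister move may be assumed to take place inside a round disc,
  and to change only one strand there: in the second move this is the upper
  of the two strands, in the third move the strand that lies above the two others.
  The strands that do not change may be assumed straight inside the disc.
\<close>

definition changes_in_disc ::
    "real \<Rightarrow> real \<Rightarrow> complex \<Rightarrow> real \<Rightarrow> vdiagram \<Rightarrow> vdiagram \<Rightarrow> bool" where
  "changes_in_disc a b z r D D' \<longleftrightarrow> differ_on_arc a b D D' \<and>
     (\<forall>t\<in>arc a b. curve D t \<in> ball z r \<and> curve D' t \<in> ball z r) \<and>
     (\<forall>s t. meets D s t \<longrightarrow> curve D s \<notin> sphere z r)"

definition straight_strand :: "real \<Rightarrow> real \<Rightarrow> vdiagram \<Rightarrow> bool" where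
  "straight_strand c d D \<longleftrightarrow> c < d \<and> d < c + 1 \<and>
     (\<exists>x v. \<forall>t. c < t \<and> t < d \<longrightarrow> curve D t = x + t *\<^sub>R v)"

definition crossing_times :: "real \<Rightarrow> real \<Rightarrow> vdiagram \<Rightarrow> real set" where
  "crossing_times a b D = {t. a < t \<and> t < b \<and> (\<exists>s. meets D s t)}"

text \<open>At time \<open>t\<close> the curve passes classically over the strand \<open>arc c d\<close>.\<close>

definition over_strand :: "vdiagram \<Rightarrow> real \<Rightarrow> real \<Rightarrow> real \<Rightarrow> bool" where
  "over_strand D t c d \<longleftrightarrow> t \<in> over D \<and> (\<exists>s\<in>arc c d. meets D s t)"

definition reidemeister1 :: "vdiagram \<Rightarrow> vdiagram \<Rightarrow> bool" where
  "reidemeister1 D D' \<longleftrightarrow> (\<exists>a b z r s t. changes_in_disc a b z r D D' \<and>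
     (\<forall>x. x \<notin> arc a b \<longrightarrow> curve D x \<notin> ball z r) \<and>
     crossing_times a b D = {} \<and>
     crossing_times a b D' = {s, t} \<and> classical D' s t)"

definition reidemeister2 :: "vdiagram \<Rightarrow> vdiagram \<Rightarrow> bool" where
  "reidemeister2 D D' \<longleftrightarrow> (\<exists>a b c d z r s t. changes_in_disc a b z r D D' \<and>
     {x. x \<notin> arc a b \<and> curve D x \<in> ball z r} = arc c d \<and> straight_strand c d D \<and>
     crossing_times a b D = {} \<and>
     s \<noteq> t \<and> crossing_times a b D' = {s, t} \<and> over_strand D' s c d \<and> over_strand D' t c d)"

definition reidemeister3 :: "vdiagram \<Rightarrow> vdiagram \<Rightarrow> bool" where
  "reidemeister3 D D' \<longleftrightarrow> (\<exists>a b c1 d1 c2 d2 z r s1 s2 t1 t2. changes_in_disc a b z r D D' \<and>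
     {x. x \<notin> arc a b \<and> curve D x \<in> ball z r} = arc c1 d1 \<union> arc c2 d2 \<and>
     arc c1 d1 \<inter> arc c2 d2 = {} \<and> straight_strand c1 d1 D \<and> straight_strand c2 d2 D \<and>
     (\<exists>x\<in>arc c1 d1. \<exists>y\<in>arc c2 d2. classical D x y) \<and>
     s1 < s2 \<and> crossing_times a b D = {s1, s2} \<and> over_strand D s1 c1 d1 \<and> over_strand D s2 c2 d2 \<and>
     t2 < t1 \<and> crossing_times a b D' = {t1, t2} \<and> over_strand D' t1 c1 d1 \<and> over_strand D' t2 c2 d2)"

definition vdiagram_step :: "vdiagram \<Rightarrow> vdiagram \<Rightarrow> bool" where
  "vdiagram_step D D' \<longleftrightarrow> knot_diagram D \<and> knot_diagram D' \<and>
     (isotopic D D' \<or> detour D D' \<or>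
      reidemeister1 D D' \<or> reidemeister2 D D' \<or> reidemeister3 D D')"

definition virtual_knot_rel :: "(vdiagram \<times> vdiagram) set" where
  "virtual_knot_rel = {(D, D'). knot_diagram D \<and> knot_diagram D' \<and> equivclp vdiagram_step D D'}"

definition virtual_knots :: "vdiagram set set" where
  "virtual_knots = {D. knot_diagram D} // virtual_knot_rel"


subsection \<open>Chords\<close>

definition classical_times :: "vdiagram \<Rightarrow> real set" where
  "classical_times D = {t \<in> {0..<1}. \<exists>s. classical D s t}"

text \<open>A classical crossing is identified with the set of its two times in the unit interval.\<close>

definition crossings :: "vdiagram \<Rightarrow> real set set" where
  "crossings D = {{s, t} | s t. s \<in> {0..<1} \<and> t \<in> {0..<1} \<and> classical D s t}"

text \<open>For points on a circle cut open at some point: the ends of the two chords alternate.\<close>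

definition linked :: "('a::linorder) set \<Rightarrow> 'a set \<Rightarrow> bool" where
  "linked c d \<longleftrightarrow> (\<exists>p q x y. c = {p, q} \<and> d = {x, y} \<and>
     (p < x \<and> x < q \<and> q < y \<or> x < p \<and> p < y \<and> y < q))"


subsection \<open>The Gauss diagram construction\<close>

text \<open>The writhe of a crossing does not depend on the direction of the curve.\<close>

definition negative_crossing :: "vdiagram \<Rightarrow> real set \<Rightarrow> bool" where
  "negative_crossing D c \<longleftrightarrow>
     (\<exists>s t. c = {s, t} \<and> s \<in> over D \<and> cross (tangent D s) (tangent D t) < 0)"

definition gauss_graph :: "vdiagram \<Rightarrow> real set graph" where
  "gauss_graph D =
     \<lparr>verts = crossings D,
      edges = {{c, d} | c d. c \<in> crossings D \<and> d \<in> crossings D \<and> linked c d} \<union>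
              {{c} | c. c \<in> crossings D \<and> negative_crossing D c}\<rparr>"


subsection \<open>The rotating circuit construction\<close>

text \<open>
  The half-edge \<open>(t, True)\<close> leaves the crossing point at time \<open>t\<close> in the direction of increasing
  time, and \<open>(t, False)\<close> in the direction of decreasing time; these two are opposite.
  The edges of the 4-graph are the pieces of the curve between cyclically consecutive
  classical times; they pass straight through the virtual crossings.
\<close>

type_synonym half_edge = "real \<times> bool"

definition next_time :: "vdiagram \<Rightarrow> real \<Rightarrow> real" where
  "next_time D t = (let T = classical_times D; later = {s \<in> T. t < s} in
     if later = {} then Min T else Min later)"

definition prev_time :: "vdiagram \<Rightarrow> real \<Rightarrow> real" where
  "prev_time D t = (let T = classical_times D; earlier = {s \<in> T. s < t} in
     if earlier = {} then Max T else Max earlier)"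

fun other_end :: "vdiagram \<Rightarrow> half_edge \<Rightarrow> half_edge" where
  "other_end D (t, True) = (next_time D t, False)"
| "other_end D (t, False) = (prev_time D t, True)"

text \<open>The edge containing a half-edge, named by the time at which it starts.\<close>

fun edge_of :: "vdiagram \<Rightarrow> half_edge \<Rightarrow> real" where
  "edge_of D (t, True) = t"
| "edge_of D (t, False) = prev_time D t"

definition adjacent_half_edges :: "vdiagram \<Rightarrow> half_edge \<Rightarrow> half_edge \<Rightarrow> bool" where
  "adjacent_half_edges D h k \<longleftrightarrow> {fst h, fst k} \<in> crossings D"

text \<open>
  A closed tour is the cyclic list of the half-edges by which it departs from the successive
  crossings; after departing by \<open>h\<close> it arrives at the next crossing by \<open>other_end D h\<close>.
\<close>

definition rotating_circuit :: "vdiagram \<Rightarrow> half_edge list \<Rightarrow> bool" where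
  "rotating_circuit D C \<longleftrightarrow>
     (\<forall>h\<in>set C. fst h \<in> classical_times D) \<and>
     bij_betw (\<lambda>i. edge_of D (C ! i)) {..<length C} (classical_times D) \<and>
     (\<forall>i<length C. adjacent_half_edges D (other_end D (C ! i)) (C ! (Suc i mod length C)))"

text \<open>The positions along the tour at which it visits a crossing.\<close>

definition circuit_chord :: "half_edge list \<Rightarrow> real set \<Rightarrow> nat set" where
  "circuit_chord C c = {i. i < length C \<and> fst (C ! i) \<in> c}"

text \<open>
  The tour uses every half-edge once; those in \<open>set C\<close> are traversed away from the crossing, all
  others towards it. So opposite half-edges are traversed in opposite directions
  (both towards or both away) iff both or neither belong to \<open>set C\<close>.
\<close>

definition circuit_framing :: "half_edge list \<Rightarrow> real set \<Rightarrow> bit" where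
  "circuit_framing C c =
     of_bool (\<exists>t\<in>c. ((t, True) \<in> set C) \<noteq> ((t, False) \<in> set C))"

definition half_edge_dir :: "vdiagram \<Rightarrow> half_edge \<Rightarrow> complex" where
  "half_edge_dir D h = (if snd h then tangent D (fst h) else - tangent D (fst h))"

text \<open>
  The \<open>A\<close>-regions at a crossing are those swept by the overpass when it turns counterclockwise
  towards the underpass. The \<open>A\<close>-smoothing merges these two regions, so it joins two adjacent
  half-edges iff the sector between them is a \<open>B\<close>-region, that is, iff the counterclockwise turn
  by less than a half-turn leads from the lower half-edge to the upper one.
\<close>

definition A_joined :: "vdiagram \<Rightarrow> half_edge \<Rightarrow> half_edge \<Rightarrow> bool" where
  "A_joined D h k \<longleftrightarrow>
     fst h \<in> over D \<and> cross (half_edge_dir D k) (half_edge_dir D h) > 0 \<or>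
     fst k \<in> over D \<and> cross (half_edge_dir D h) (half_edge_dir D k) > 0"

definition circuit_sign :: "vdiagram \<Rightarrow> half_edge list \<Rightarrow> real set \<Rightarrow> vsign" where
  "circuit_sign D C c =
     (if \<forall>i<length C. let k = C ! (Suc i mod length C) in
           fst k \<in> c \<longrightarrow> A_joined D (other_end D (C ! i)) k
      then Plus else Minus)"

definition circuit_graph :: "vdiagram \<Rightarrow> half_edge list \<Rightarrow> real set lgraph" where
  "circuit_graph D C =
     \<lparr>verts = crossings D,
      edges = {{c, d} | c d. c \<in> crossings D \<and> d \<in> crossings D \<and>
                             linked (circuit_chord C c) (circuit_chord C d)},
      framing = circuit_framing C,
      vsign = circuit_sign D C\<rparr>"


subsection \<open>The classes constructed from a knot\<close>

definition graph_knot_from :: "vdiagram set \<Rightarrow> nat lgraph set \<Rightarrow> bool" where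
  "graph_knot_from K F \<longleftrightarrow> (\<exists>D\<in>K. \<exists>C. crossings D \<noteq> {} \<and> rotating_circuit D C \<and>
     F = graph_link_of (circuit_graph D C))"

definition homotopy_class_from :: "vdiagram set \<Rightarrow> nat graph set \<Rightarrow> bool" where
  "homotopy_class_from K L \<longleftrightarrow> (\<exists>D\<in>K. crossings D \<noteq> {} \<and>
     L = homotopy_class_of (gauss_graph D))"

end

theory Submission
  imports Defs
begin

text \<open>
  Let \<open>n\<close> be the inverse of \<open>A(G) + E\<close>. The moves \<open>\<Omega>\<^sub>g4\<close> and \<open>\<Omega>\<^sub>g4'\<close> change only the diagonal of \<open>n\<close>,
  and the change of the signs compensates for this. Hence they preserve the looped graph whose
  adjacencies are the off-diagonal entries of \<open>n\<close> and whose loops are the diagonal entries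
  corrected by the signs. Conversely, they connect any two labeled graphs with the same looped
  graph, and every looped graph arises. The other moves become the moves of looped graphs, but a
  third move of looped graphs may have to be prepared by second moves before it comes from \<open>\<Omega>\<^sub>g3\<close>.

  For a diagram, the matrix of a rotating circuit is inverse to the matrix of the Gauss diagram up
  to the diagonal, because both describe the cycle space of the same 4-graph; the corrected
  diagonal entries are the writhes. The homotopy class of the Gauss diagram is invariant under
  Reidemeister moves, so the choice of the diagram does not matter.
\<close>

section \<open>Symmetric inverses over the field of two elements\<close>

text \<open>Changing one diagonal entry of the inverse is a rank-one change of
  \<open>A(G) + E\<close>, changing two is a rank-two change; these are local complementation and
  pivot, the latter up to exchanging its two vertices. If two inverses differ on part of the
  diagonal, one of these changes is always applicable there, since otherwise one of the inverses
  would be singular.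

  The obstacle is the third move. The entries of the looped graph at the three vertices of an
  \<open>omega_g3\<close> are functions of three bits, and these bits must also be the ones produced
  by the remaining vertices. Added twins adjust the bits; a bigon argument, valid for every
  equivalence that contains isomorphisms and second moves, then yields all required third moves from
  two types of triangles. It serves homotopy as well as equality of graph-links, hence the locale.

  For diagrams, the moving strand is tracked by its signed distance from straight lines through the
  disc, so signs and the intermediate value theorem replace planar topology.\<close>

declare mult_bit_eq_and [simp del] add_bit_eq_xor [simp del]

text \<open>The rules \<open>mult_bit_eq_and\<close> and \<open>add_bit_eq_xor\<close> would turn
  ring operations into boolean ones, to which the laws for finite sums do not apply. Characteristic
  two and idempotence are stated in ring language instead.\<close>

lemma bit_add_self [simp]: "x + x = (0::bit)"
  by (cases x) simp_all

lemma bit_add_left_self [simp]: "x + (x + y) = (y::bit)"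
  by (cases x) simp_all

lemma bit_mult_self [simp]: "x * x = (x::bit)"
  by (cases x) simp_all

lemma bit_mult_left_self [simp]: "x * (x * y) = x * (y::bit)"
  by (cases x) simp_all

lemma bit_add_eq_0_iff [simp]: "x + y = 0 \<longleftrightarrow> x = (y::bit)"
  by (cases x; cases y) simp_all

text \<open>Matrices are indexed by the vertices themselves and arbitrary off \<open>V\<close>, so
  that inserting and renaming vertices needs no enumeration. One product suffices: both factors are
  symmetric, and transposition gives the other product.\<close>

definition sinv :: "'v set \<Rightarrow> ('v \<Rightarrow> 'v \<Rightarrow> bit) \<Rightarrow> ('v \<Rightarrow> 'v \<Rightarrow> bit) \<Rightarrow> bool" where
  "sinv V M N \<longleftrightarrow> finite V \<and> (\<forall>i\<in>V. \<forall>j\<in>V. M i j = M j i) \<and> (\<forall>i\<in>V. \<forall>j\<in>V. N i j = N j i) \<and>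
     (\<forall>i\<in>V. \<forall>j\<in>V. (\<Sum>k\<in>V. M i k * N k j) = of_bool (i = j))"

lemma sinvI:
  assumes "finite V" "\<And>i j. i \<in> V \<Longrightarrow> j \<in> V \<Longrightarrow> M i j = M j i"
    "\<And>i j. i \<in> V \<Longrightarrow> j \<in> V \<Longrightarrow> N i j = N j i"
    "\<And>i j. i \<in> V \<Longrightarrow> j \<in> V \<Longrightarrow> (\<Sum>k\<in>V. M i k * N k j) = of_bool (i = j)"
  shows "sinv V M N"
  using assms unfolding sinv_def by blast

lemma sinvD:
  assumes "sinv V M N"
  shows "finite V" "\<And>i j. i \<in> V \<Longrightarrow> j \<in> V \<Longrightarrow> M i j = M j i"
    "\<And>i j. i \<in> V \<Longrightarrow> j \<in> V \<Longrightarrow> N i j = N j i"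
    "\<And>i j. i \<in> V \<Longrightarrow> j \<in> V \<Longrightarrow> (\<Sum>k\<in>V. M i k * N k j) = of_bool (i = j)"
  using assms unfolding sinv_def by blast+

lemma sinv_cong:
  assumes "\<And>i j. i \<in> V \<Longrightarrow> j \<in> V \<Longrightarrow> M i j = M' i j"
    "\<And>i j. i \<in> V \<Longrightarrow> j \<in> V \<Longrightarrow> N i j = N' i j"
  shows "sinv V M N \<longleftrightarrow> sinv V M' N'"
proof -
  have "(\<Sum>k\<in>V. M i k * N k j) = (\<Sum>k\<in>V. M' i k * N' k j)" if "i \<in> V" "j \<in> V" for i j
    using assms that by (intro sum.cong) auto
  then show ?thesis unfolding sinv_def using assms by auto
qed

lemma sinv_commute: "sinv V M N \<longleftrightarrow> sinv V N M"
proof -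
  have "sinv V N M" if s: "sinv V M N" for M N
  proof (rule sinvI)
    fix i j assume ij: "i \<in> V" "j \<in> V"
    have "(\<Sum>k\<in>V. N i k * M k j) = (\<Sum>k\<in>V. M j k * N k i)"
      using sinvD[OF s] ij by (intro sum.cong) (simp_all add: mult.commute)
    also have "\<dots> = of_bool (i = j)" using sinvD(4)[OF s ij(2,1)] by auto
    finally show "(\<Sum>k\<in>V. N i k * M k j) = of_bool (i = j)" .
  qed (use sinvD[OF s] in auto)
  then show ?thesis by blast
qed

lemma sinv_solve:
  assumes "sinv V M N" "i \<in> V"
  shows "(\<Sum>k\<in>V. M i k * (\<Sum>l\<in>V. N k l * b l)) = b i"
proof -
  have "(\<Sum>k\<in>V. M i k * (\<Sum>l\<in>V. N k l * b l)) = (\<Sum>k\<in>V. \<Sum>l\<in>V. M i k * N k l * b l)"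
    by (simp add: sum_distrib_left mult.assoc)
  also have "\<dots> = (\<Sum>l\<in>V. (\<Sum>k\<in>V. M i k * N k l) * b l)"
    by (subst sum.swap) (simp add: sum_distrib_right)
  also have "\<dots> = (\<Sum>l\<in>V. of_bool (i = l) * b l)"
    using sinvD(4)[OF assms(1)] assms(2) by (intro sum.cong) auto
  also have "\<dots> = b i" using sinvD(1)[OF assms(1)] assms(2)
    by (simp add: of_bool_def if_distrib if_distribR cong: if_cong)
  finally show ?thesis .
qed

text \<open>Evaluating the product of the transpose of \<open>N\<close>, \<open>M\<close> and
  \<open>N\<close> in two ways gives the transpose of \<open>N\<close> and \<open>N\<close> itself;
  so a right inverse of a symmetric matrix is symmetric.\<close>

lemma sinvI':
  assumes "finite V" "\<And>i j. i \<in> V \<Longrightarrow> j \<in> V \<Longrightarrow> M i j = M j i"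
    "\<And>i j. i \<in> V \<Longrightarrow> j \<in> V \<Longrightarrow> (\<Sum>k\<in>V. M i k * N k j) = of_bool (i = j)"
  shows "sinv V M N"
proof (rule sinvI)
  fix i j assume ij: "i \<in> V" "j \<in> V"
  have "(\<Sum>k\<in>V. \<Sum>l\<in>V. N k i * M k l * N l j) = (\<Sum>k\<in>V. N k i * of_bool (k = j))"
    using assms(3)[OF _ ij(2)] by (intro sum.cong) (auto simp: sum_distrib_left[symmetric] mult.assoc)
  also have "\<dots> = N j i" using assms(1) ij by (simp add: of_bool_def if_distrib cong: if_cong)
  finally have 1: "(\<Sum>k\<in>V. \<Sum>l\<in>V. N k i * M k l * N l j) = N j i" .
  have "(\<Sum>k\<in>V. \<Sum>l\<in>V. N k i * M k l * N l j) = (\<Sum>l\<in>V. \<Sum>k\<in>V. M l k * N k i * N l j)"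
    by (subst sum.swap) (use assms(2) in \<open>auto intro!: sum.cong simp: mult_ac\<close>)
  also have "\<dots> = (\<Sum>l\<in>V. of_bool (l = i) * N l j)"
    using assms(3)[OF _ ij(1)] by (intro sum.cong) (auto simp: sum_distrib_right[symmetric])
  also have "\<dots> = N i j" using assms(1) ij by (simp add: of_bool_def if_distrib if_distribR cong: if_cong)
  finally show "N i j = N j i" using 1 by simp
qed (use assms in auto)

lemma sinv_unique:
  assumes "sinv V M N" "sinv V M N'" "i \<in> V" "j \<in> V"
  shows "N i j = N' i j"
proof -
  have "N' i j = (\<Sum>k\<in>V. N i k * (\<Sum>l\<in>V. M k l * N' l j))"
    using sinv_solve[of V N M i "\<lambda>l. N' l j"] assms sinv_commute by metis
  also have "\<dots> = (\<Sum>k\<in>V. N i k * of_bool (k = j))"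
    using sinvD(4)[OF assms(2)] assms(4) by (intro sum.cong) auto
  also have "\<dots> = N i j" using sinvD(1)[OF assms(1)] assms(4)
    by (simp add: of_bool_def if_distrib cong: if_cong)
  finally show ?thesis by simp
qed

lemma sinv_image:
  assumes "inj_on f V"
  shows "sinv (f ` V) M N \<longleftrightarrow> sinv V (\<lambda>i j. M (f i) (f j)) (\<lambda>i j. N (f i) (f j))"
proof -
  have "(\<Sum>k\<in>f ` V. M i k * N k j) = (\<Sum>k\<in>V. M i (f k) * N (f k) j)" for i j
    using assms by (simp add: sum.reindex)
  moreover have "f i = f j \<longleftrightarrow> i = j" if "i \<in> V" "j \<in> V" for i j
    using assms that by (auto dest: inj_onD)
  ultimately show ?thesis
    unfolding sinv_def using assms by (auto simp: finite_image_iff)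
qed

text \<open>Block-diagonal extension by the entry 1: an isolated vertex of framing 0 contributes 1
  to the diagonal of \<open>A(G) + E\<close>.\<close>

lemma sinv_insert:
  assumes s: "sinv V M N" and x: "x \<notin> V" and "M x x = 1" "N x x = 1"
    and "\<And>y. y \<in> V \<Longrightarrow> M x y = 0 \<and> M y x = 0 \<and> N x y = 0 \<and> N y x = 0"
  shows "sinv (insert x V) M N"
proof (rule sinvI')
  note D = sinvD[OF s]
  show "finite (insert x V)" using D by simp
  fix i j assume "i \<in> insert x V" "j \<in> insert x V"
  then show "M i j = M j i" using D assms by auto
  show "(\<Sum>k\<in>insert x V. M i k * N k j) = of_bool (i = j)"
    using D(1,4) assms \<open>i \<in> _\<close> \<open>j \<in> _\<close> by (auto simp: sum.insert)
qed

lemma sinv_insertD: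
  assumes s: "sinv (insert x V) M N" and x: "x \<notin> V" and xx: "M x x = 1"
    and x0: "\<And>y. y \<in> V \<Longrightarrow> M x y = 0"
  shows "sinv V M N" "N x x = 1" "\<And>y. y \<in> V \<Longrightarrow> N x y = 0"
proof -
  note D = sinvD[OF s]
  have f: "finite V" using D by simp
  have N: "N x j = of_bool (x = j)" if "j \<in> insert x V" for j
    using D(4)[of x j] that x xx x0 f by (simp add: sum.insert)
  show "N x x = 1" "\<And>y. y \<in> V \<Longrightarrow> N x y = 0" using N x by auto
  show "sinv V M N"
  proof (rule sinvI')
    fix i j assume ij: "i \<in> V" "j \<in> V"
    then show "M i j = M j i" using D(2) by blast
    show "(\<Sum>k\<in>V. M i k * N k j) = of_bool (i = j)"
      using D(4)[of i j] D(2)[of x i] ij x x0 f by (auto simp: sum.insert)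
  qed (use f in auto)
qed

text \<open>The two new rows of \<open>M\<close> add up to the sum of two unit vectors, so the
  inverse has twins again: their common row is \<open>c = N b\<close>, and \<epsilon> is replaced by
  \<open>\<epsilon> + q\<close>, where \<open>q\<close> is the quadratic form of \<open>N\<close> at
  \<open>b\<close>. As the shape is kept, the lemma serves both from labeled to looped graphs and
  back.\<close>

lemma sinv_twins:
  assumes s: "sinv V M N" and uv: "u \<notin> V" "v \<notin> V" "u \<noteq> v"
    and b: "\<And>y. y \<in> V \<Longrightarrow> M u y = b y \<and> M y u = b y \<and> M v y = b y \<and> M y v = b y"
    and M: "M u u = 1 + \<epsilon>" "M v v = 1 + \<epsilon>" "M u v = \<epsilon>" "M v u = \<epsilon>"
    and c: "\<And>y. y \<in> V \<Longrightarrow> c y = (\<Sum>k\<in>V. N y k * b k)" and q: "q = (\<Sum>k\<in>V. b k * c k)"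
    and nc: "\<And>y. y \<in> V \<Longrightarrow> N u y = c y \<and> N y u = c y \<and> N v y = c y \<and> N y v = c y"
    and N: "N u u = 1 + \<epsilon> + q" "N v v = 1 + \<epsilon> + q" "N u v = \<epsilon> + q" "N v u = \<epsilon> + q"
  shows "sinv (insert u (insert v V)) M N"
proof (rule sinvI')
  note D = sinvD[OF s]
  show "finite (insert u (insert v V))" using D by simp
  fix i j assume ij: "i \<in> insert u (insert v V)" "j \<in> insert u (insert v V)"
  then show "M i j = M j i" using D M b by auto
  have S: "(\<Sum>k\<in>insert u (insert v V). M i k * N k j)
      = M i u * N u j + (M i v * N v j + (\<Sum>k\<in>V. M i k * N k j))"
    using D uv by (simp add: sum.insert)
  have bN: "(\<Sum>k\<in>V. b k * N k j) = c j" if "j \<in> V" for j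
    using c[OF that] D(3) that by (auto intro!: sum.cong simp: mult_ac)
  have Mc: "(\<Sum>k\<in>V. M i k * c k) = b i" if "i \<in> V" for i
    using sinv_solve[OF s that, of b] c by (simp cong: sum.cong)
  have row: "(\<Sum>k\<in>V. M i k * N k j) = (\<Sum>k\<in>V. b k * N k j)" if "i = u \<or> i = v"
    using b that by (auto intro!: sum.cong)
  have col: "(\<Sum>k\<in>V. f k * N k j) = (\<Sum>k\<in>V. f k * c k)" if "j = u \<or> j = v" for f
    using nc that by (auto intro!: sum.cong)
  \<comment> \<open>By \<open>Mc\<close>, \<open>bN\<close> and the choice of \<open>q\<close>, the
    entries of the product in a row or column of a twin reduce to these expressions.\<close>
  have bits: "(1 + \<epsilon>) * (1 + \<epsilon> + q) + (\<epsilon> * (\<epsilon> + q) + q) = 1"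
    "(1 + \<epsilon>) * (\<epsilon> + q) + (\<epsilon> * (1 + \<epsilon> + q) + q) = 0"
    "\<epsilon> * (1 + \<epsilon> + q) + ((1 + \<epsilon>) * (\<epsilon> + q) + q) = 0"
    "\<epsilon> * (\<epsilon> + q) + ((1 + \<epsilon>) * (1 + \<epsilon> + q) + q) = 1"
    "(1 + \<epsilon>) * r + (\<epsilon> * r + r) = 0" "\<epsilon> * r + ((1 + \<epsilon>) * r + r) = 0"
    "r * (1 + \<epsilon> + q) + (r * (\<epsilon> + q) + r) = 0" "r * (\<epsilon> + q) + (r * (1 + \<epsilon> + q) + r) = 0" for r
    by (cases \<epsilon>; cases q; cases r; simp)+
  show "(\<Sum>k\<in>insert u (insert v V). M i k * N k j) = of_bool (i = j)"
  proof (cases "i \<in> V")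
    case True
    show ?thesis
    proof (cases "j \<in> V")
      case True with \<open>i \<in> V\<close> show ?thesis using S D(4) b nc by simp
    next
      case False
      then have "j = u \<or> j = v" using ij by auto
      then show ?thesis unfolding S using col[of "M i"] Mc[OF True] b[OF True] N bits uv True by auto
    qed
  next
    case False
    then have i: "i = u \<or> i = v" using ij by auto
    show ?thesis
    proof (cases "j \<in> V")
      case True with i show ?thesis unfolding S using row bN[OF True] nc[OF True] M bits uv by auto
    next
      case False
      then have "j = u \<or> j = v" using ij by auto
      with i show ?thesis unfolding S using row col[of b] q[symmetric] M N bits uv by auto
    qed
  qed
qed

text \<open>Adding the equations of rows \<open>u\<close> and \<open>v\<close> cancels everything
  outside the twins and shows that these rows of \<open>N\<close> differ only in columns
  \<open>u\<close> and \<open>v\<close>. In products for the old vertices the two twin terms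
  therefore cancel.\<close>

lemma sinv_twinsD:
  assumes s: "sinv (insert u (insert v V)) M N" and uv: "u \<notin> V" "v \<notin> V" "u \<noteq> v"
    and b: "\<And>y. y \<in> V \<Longrightarrow> M u y = M v y"
    and M: "M u u = 1 + \<epsilon>" "M v v = 1 + \<epsilon>" "M u v = \<epsilon>" "M v u = \<epsilon>"
  shows "sinv V M N" "\<And>y. y \<in> V \<Longrightarrow> N u y = N v y" "N u u = N v v"
proof -
  note D = sinvD[OF s]
  have f: "finite V" using D by simp
  have eq: "N u j + N v j = of_bool (u = j) + of_bool (v = j)" if "j \<in> insert u (insert v V)" for j
  proof -
    have "(\<Sum>k\<in>V. M u k * N k j) = (\<Sum>k\<in>V. M v k * N k j)" using b by (intro sum.cong) auto
    moreover have "M u u * N u j + (M u v * N v j + (\<Sum>k\<in>V. M u k * N k j)) = of_bool (u = j)"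
      "M v u * N u j + (M v v * N v j + (\<Sum>k\<in>V. M v k * N k j)) = of_bool (v = j)"
      using D(4)[of u j] D(4)[of v j] that uv f by (simp_all add: sum.insert)
    ultimately have "of_bool (u = j) + of_bool (v = j) =
        M u u * N u j + (M u v * N v j + (\<Sum>k\<in>V. M v k * N k j)) +
        (M v u * N u j + (M v v * N v j + (\<Sum>k\<in>V. M v k * N k j)))" by simp
    also have "\<dots> = M u u * N u j + M u v * N v j + (M v u * N u j + M v v * N v j)"
      by (simp add: ac_simps)
    finally have "of_bool (u = j) + of_bool (v = j) =
        M u u * N u j + M u v * N v j + (M v u * N u j + M v v * N v j)" .
    then show ?thesis using M by (cases \<epsilon>) (auto simp: add_ac)
  qed
  show Nu: "N u y = N v y" if "y \<in> V" for y
  proof -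
    have "u \<noteq> y" "v \<noteq> y" using that uv by auto
    then show ?thesis using eq[of y] that by simp
  qed
  have "N u v = N v u" using D by blast
  then show "N u u = N v v" using eq[of u] eq[of v] uv by (cases "N u u"; cases "N v v") auto
  show "sinv V M N"
  proof (rule sinvI')
    fix i j assume ij: "i \<in> V" "j \<in> V"
    then show "M i j = M j i" using D(2) by blast
    have "M i u * N u j + (M i v * N v j + (\<Sum>k\<in>V. M i k * N k j)) = of_bool (i = j)"
      using D(4)[of i j] ij uv f by (simp add: sum.insert)
    moreover have "M i u = M i v" using b[OF ij(1)] D(2)[of i u] D(2)[of i v] ij by auto
    ultimately show "(\<Sum>k\<in>V. M i k * N k j) = of_bool (i = j)" using Nu[OF ij(2)] by simp
  qed (use f in auto)
qed

text \<open>The Sherman-Morrison formula for the entry \<open>(v, v)\<close> of \<open>N\<close>;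
  its denominator is \<open>1 + M v v\<close>, which is 1.\<close>

lemma sinv_local_complement:
  assumes s: "sinv V M N" and v: "v \<in> V" "M v v = 0"
  shows "sinv V (\<lambda>i j. M i j + M i v * M v j) (\<lambda>i j. N i j + of_bool (i = v \<and> j = v))"
proof (rule sinvI')
  note D = sinvD[OF s]
  show "finite V" using D by simp
  fix i j assume ij: "i \<in> V" "j \<in> V"
  then show "M i j + M i v * M v j = M j i + M j v * M v i" using D v by (simp add: mult_ac)
  have "(\<Sum>k\<in>V. (M i k + M i v * M v k) * (N k j + of_bool (k = v \<and> j = v))) =
    (\<Sum>k\<in>V. M i k * N k j) + M i v * (\<Sum>k\<in>V. M v k * N k j)
      + (\<Sum>k\<in>V. if k = v then (M i v + M i v * M v v) * of_bool (j = v) else 0)"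
    by (simp only: sum_distrib_left sum.distrib[symmetric]) (intro sum.cong, auto simp: algebra_simps)
  also have "\<dots> = of_bool (i = j)"
    using D(1,4) ij v by (auto simp: sum.delta)
  finally show "(\<Sum>k\<in>V. (M i k + M i v * M v k) * (N k j + of_bool (k = v \<and> j = v))) = of_bool (i = j)" .
qed

text \<open>The rank-two update for the entries \<open>(u, u)\<close> and \<open>(v, v)\<close> of
  \<open>N\<close>. The two-by-two correction matrix is the identity plus the all-ones matrix, that
  is, the exchange matrix, which is its own inverse; hence the mixed products of rows
  \<open>u\<close> and \<open>v\<close>.\<close>

lemma sinv_pivot:
  assumes s: "sinv V M N" and uv: "u \<in> V" "v \<in> V" "u \<noteq> v" "M u u = 1" "M v v = 1" "M u v = 1"
  shows "sinv V (\<lambda>i j. M i j + M i u * M v j + M i v * M u j)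
    (\<lambda>i j. N i j + of_bool (i = j \<and> (i = u \<or> i = v)))"
proof (rule sinvI')
  note D = sinvD[OF s]
  have vu: "M v u = 1" using D uv by metis
  show "finite V" using D by simp
  fix i j assume ij: "i \<in> V" "j \<in> V"
  then show "M i j + M i u * M v j + M i v * M u j = M j i + M j u * M v i + M j v * M u i"
    using D(2)[of i j] D(2)[of i u] D(2)[of i v] D(2)[of j u] D(2)[of j v] uv by (simp add: mult_ac add_ac)
  let ?d = "\<lambda>k. of_bool (k = j \<and> (k = u \<or> k = v)) :: bit"
  have "(\<Sum>k\<in>V. (M i k + M i u * M v k + M i v * M u k) * (N k j + ?d k)) =
    (\<Sum>k\<in>V. M i k * N k j) + M i u * (\<Sum>k\<in>V. M v k * N k j) + M i v * (\<Sum>k\<in>V. M u k * N k j)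
      + (\<Sum>k\<in>V. if k = j then (M i j + M i u * M v j + M i v * M u j) * of_bool (j = u \<or> j = v) else 0)"
    by (simp only: sum_distrib_left sum.distrib[symmetric]) (intro sum.cong, auto simp: algebra_simps)
  also have "\<dots> = of_bool (i = j)"
    using D(1,4) ij uv vu by (auto simp: sum.delta)
  finally show "(\<Sum>k\<in>V. (M i k + M i u * M v k + M i v * M u k) * (N k j + ?d k)) = of_bool (i = j)" .
qed

text \<open>Vertices are added one at a time. The new diagonal entry is free and is chosen so that
  the Schur complement of the old block is 1.\<close>

lemma ex_sinv_diagonal:
  assumes "finite V" "\<And>i j. i \<in> V \<Longrightarrow> j \<in> V \<Longrightarrow> n i j = n j i"
  shows "\<exists>d M. sinv V M (\<lambda>i j. if i = j then d i else n i j)"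
  using assms
proof (induction V)
  case empty
  then show ?case by (auto simp: sinv_def)
next
  case (insert x V)
  then obtain d M where s: "sinv V M (\<lambda>i j. if i = j then d i else n i j)" by auto
  define N where "N = (\<lambda>i j. if i = j then d i else n i j)"
  have s: "sinv V M N" using s N_def by simp
  note D = sinvD[OF s]
  \<comment> \<open>\<open>m\<close> is the old inverse applied to the new column and
    \<open>q\<close> the value of its quadratic form there; the diagonal entry \<open>1 + q\<close>
    gives Schur complement 1, and \<open>M'\<close> is the usual block inverse.\<close>
  define m where "m i = (\<Sum>k\<in>V. M i k * n k x)" for i
  define q where "q = (\<Sum>k\<in>V. m k * n k x)"
  define M' where "M' i j = (if i = x then if j = x then 1 else m j
    else if j = x then m i else M i j + m i * m j)" for i j
  define N' where "N' = (\<lambda>i j. if i = j then (d(x := 1 + q)) i else n i j)"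
  have mN: "(\<Sum>k\<in>V. m k * N k j) = n j x" if "j \<in> V" for j
    using sinv_solve[of V N M j "\<lambda>l. n l x"] s that sinv_commute[of V M N] D(3)
    by (simp add: m_def mult.commute cong: sum.cong)
  have NN: "N' k j = N k j" if "k \<in> V" "j \<in> V" for k j
    using that insert.hyps unfolding N_def N'_def by auto
  have Nx: "N' k x = n k x" "N' x k = n k x" if "k \<in> V" for k
    using that insert.hyps insert.prems unfolding N'_def by auto
  have Nxx: "N' x x = 1 + q" by (simp add: N'_def)
  have "sinv (insert x V) M' N'"
  proof (rule sinvI')
    show "finite (insert x V)" using insert by simp
    fix i j assume ij: "i \<in> insert x V" "j \<in> insert x V"
    show "M' i j = M' j i" using ij D(2) by (auto simp: M'_def mult_ac)
    have S: "(\<Sum>k\<in>insert x V. M' i k * N' k j) = M' i x * N' x j + (\<Sum>k\<in>V. M' i k * N' k j)"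
      using insert.hyps by simp
    have V: "(\<Sum>k\<in>V. M' i k * f k) = (\<Sum>k\<in>V. M i k * f k) + m i * (\<Sum>k\<in>V. m k * f k)" if "i \<in> V" for f
    proof -
      have "M' i k * f k = M i k * f k + m i * (m k * f k)" if "k \<in> V" for k
        using that \<open>i \<in> V\<close> insert.hyps by (auto simp: M'_def algebra_simps)
      then show ?thesis by (simp add: sum.distrib sum_distrib_left cong: sum.cong)
    qed
    have X: "(\<Sum>k\<in>V. M' x k * f k) = (\<Sum>k\<in>V. m k * f k)" for f
      using insert.hyps by (intro sum.cong) (auto simp: M'_def)
    have c: "(\<Sum>k\<in>V. M' i k * N' k j) = (\<Sum>k\<in>V. M' i k * (if j = x then n k x else N k j))"
      using ij NN Nx by (intro sum.cong) auto
    have Mx: "M' i x = m i" if "i \<in> V" using that insert.hyps by (auto simp: M'_def)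
    have Mxx: "M' x x = 1" by (simp add: M'_def)
    show "(\<Sum>k\<in>insert x V. M' i k * N' k j) = of_bool (i = j)"
    proof (cases "i = x")
      case True
      show ?thesis unfolding S c unfolding True X Mxx using ij Nxx Nx mN insert.hyps
        by (auto simp: q_def[symmetric])
    next
      case False
      then have i: "i \<in> V" using ij by simp
      show ?thesis
      proof (cases "j = x")
        case True
        then show ?thesis unfolding S c V[OF i] Mx[OF i] using Nxx False
          by (simp add: q_def[symmetric] m_def[symmetric] algebra_simps)
      next
        case jx: False
        then have "j \<in> V" using ij by simp
        with jx show ?thesis unfolding S c V[OF i] Mx[OF i] using Nx mN D(4)[OF i]
          by (simp add: insert.prems i algebra_simps)
      qed
    qed
  qed
  then show ?case unfolding N'_def by blast
qed

text \<open>If \<open>M\<close> were the identity on \<open>S\<close>, the changed matrix would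
  annihilate column \<open>v\<close> of \<open>M\<close> for \<open>v\<close> in \<open>S\<close>:
  \<open>N\<close> sends it to the unit vector of \<open>v\<close>, and the added diagonal produces
  the same vector again. So \<open>S\<close> contains a diagonal entry 0, or two distinct vertices
  joined by an entry 1.\<close>

lemma sinv_diagonal_step:
  assumes s: "sinv V M N" and s': "sinv V M' (\<lambda>i j. N i j + of_bool (i = j \<and> i \<in> S))"
    and "S \<subseteq> V" "S \<noteq> {}"
  obtains v where "v \<in> S" "M v v = 0"
  | u v where "u \<in> S" "v \<in> S" "u \<noteq> v" "M u u = 1" "M v v = 1" "M u v = 1"
proof -
  define N' where "N' = (\<lambda>i j. N i j + of_bool (i = j \<and> i \<in> S))"
  have False if no: "\<forall>v\<in>S. M v v = 1" "\<forall>u\<in>S. \<forall>v\<in>S. u \<noteq> v \<longrightarrow> M u v = 0"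
  proof -
    obtain v where v: "v \<in> S" "v \<in> V" using assms by blast
    note D = sinvD[OF s] and C = s[unfolded sinv_commute[of V M]]
    have "(\<Sum>k\<in>V. N' i k * M k v) = 0" if i: "i \<in> V" for i
    proof -
      have "(\<Sum>k\<in>V. N' i k * M k v) =
          (\<Sum>k\<in>V. N i k * M k v) + (\<Sum>k\<in>V. if k = i then of_bool (i \<in> S) * M i v else 0)"
        unfolding N'_def sum.distrib[symmetric] by (intro sum.cong) (auto simp: algebra_simps)
      also have "\<dots> = of_bool (i = v) + of_bool (i \<in> S) * M i v"
        using sinvD(4)[OF C i v(2)] D(1) i by (simp add: sum.delta)
      also have "\<dots> = 0" using no v by auto
      finally show ?thesis .
    qed
    moreover have "(\<Sum>k\<in>V. M' v k * (\<Sum>l\<in>V. N' k l * M l v)) = M v v"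
      using sinv_solve[OF s' v(2)] unfolding N'_def .
    ultimately show False using no v by simp
  qed
  then show ?thesis using that by (metis bit_not_one_iff bit_not_zero_iff)
qed

text \<open>The effect of \<open>omega_g3\<close> on the inverse. The equations of \<open>M\<close>
  for column \<rho> j and those of \<open>M'\<close> for column j are linear recombinations of each
  other. Being an equivalence, the lemma also transfers invertibility in both directions.\<close>

lemma sinv_triangle:
  fixes p q :: "'v \<Rightarrow> bit"
  assumes V: "V = insert u (insert v (insert w V0))" "u \<notin> V0" "v \<notin> V0" "w \<notin> V0"
      "u \<noteq> v" "u \<noteq> w" "v \<noteq> w" "finite V0"
    and M: "M u u = 1" "M v v = 1" "M w w = 1" "M u v = 1" "M u w = 1" "M v w = 0"
      "\<And>x. x \<in> V0 \<Longrightarrow> M u x = 0 \<and> M v x = p x \<and> M w x = q x"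
    and sM: "\<And>i j. i \<in> V \<Longrightarrow> j \<in> V \<Longrightarrow> M i j = M j i"
    and M': "M' u u = 1" "M' v v = 1" "M' w w = 1" "M' u v = 0" "M' u w = 0" "M' v w = 0"
      "\<And>x. x \<in> V0 \<Longrightarrow> M' u x = p x + q x \<and> M' v x = p x \<and> M' w x = q x"
    and sM': "\<And>i j. i \<in> V \<Longrightarrow> j \<in> V \<Longrightarrow> M' i j = M' j i"
    and MM: "\<And>x y. x \<in> V0 \<Longrightarrow> y \<in> V0 \<Longrightarrow> M' x y = M x y"
    and \<rho>: "\<rho> = (\<lambda>i. if i = v then w else if i = w then v else i)"
    and N': "\<And>i j. i \<in> V \<Longrightarrow> j \<in> V \<Longrightarrow> N' i j = N (\<rho> i) (\<rho> j) +
      of_bool (i \<in> {u, v, w} \<and> j \<in> {u, v, w} \<and> (i, j) \<noteq> (u, u))"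
  shows "sinv V M N \<longleftrightarrow> sinv V M' N'"
proof -
  let ?T = "\<lambda>i j. of_bool (i \<in> {u, v, w} \<and> j \<in> {u, v, w} \<and> (i, j) \<noteq> (u, u)) :: bit"
  have sum3: "(\<Sum>k\<in>V. f k) = f u + (f v + (f w + (\<Sum>k\<in>V0. f k)))" for f :: "'v \<Rightarrow> bit"
    using V by (simp add: sum.insert)
  have \<rho>V: "\<rho> i \<in> V" if "i \<in> V" for i using that V \<rho> by auto
  have \<rho>\<rho>: "\<rho> (\<rho> i) = i" for i using V \<rho> by auto
  have \<rho>0: "\<rho> x = x" if "x \<in> V0" for x using that V \<rho> by auto
  \<comment> \<open>The contributions of the remaining vertices to rows \<open>v\<close> and
    \<open>w\<close>; they are common to both matrices.\<close>
  define P where "P f j = (\<Sum>k\<in>V0. p k * f k j)" for f and j :: 'v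
  define Q where "Q f j = (\<Sum>k\<in>V0. q k * f k j)" for f and j :: 'v
  have row: "(\<Sum>k\<in>V. M u k * f k j) = f u j + (f v j + f w j)"
    "(\<Sum>k\<in>V. M v k * f k j) = f u j + (f v j + P f j)"
    "(\<Sum>k\<in>V. M w k * f k j) = f u j + (f w j + Q f j)" for f j
    unfolding sum3 using M sM V by (simp_all add: P_def Q_def)
  have rowx: "(\<Sum>k\<in>V. M x k * f k j) = p x * f v j + (q x * f w j + (\<Sum>k\<in>V0. M x k * f k j))"
    if "x \<in> V0" for f j x
    unfolding sum3 using M(7)[OF that] sM[of x u] sM[of x v] sM[of x w] that V by simp
  have row': "(\<Sum>k\<in>V. M' u k * f k j) = f u j + (P f j + Q f j)"
    "(\<Sum>k\<in>V. M' v k * f k j) = f v j + P f j"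
    "(\<Sum>k\<in>V. M' w k * f k j) = f w j + Q f j" for f j
    unfolding sum3 using M' sM' V by (simp_all add: P_def Q_def algebra_simps sum.distrib)
  have rowx': "(\<Sum>k\<in>V. M' x k * f k j) =
      (p x + q x) * f u j + (p x * f v j + (q x * f w j + (\<Sum>k\<in>V0. M x k * f k j)))"
    if "x \<in> V0" for f j x
    unfolding sum3 using M'(7)[OF that] sM'[of x u] sM'[of x v] sM'[of x w] that V MM by simp
  have NV0: "N' k j = N k (\<rho> j)" if "k \<in> V0" "j \<in> V" for k j
    using N'[of k j] that V \<rho>0 by auto
  have PQ: "P N' j = P N (\<rho> j)" "Q N' j = Q N (\<rho> j)"
    "(\<Sum>k\<in>V0. M x k * N' k j) = (\<Sum>k\<in>V0. M x k * N k (\<rho> j))" if "j \<in> V" for j x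
    using NV0 that by (auto simp: P_def Q_def intro!: sum.cong)
  have uvw: "u \<in> V" "v \<in> V" "w \<in> V" using V by auto
  have N3: "N' u j = N u (\<rho> j) + ?T u j" "N' v j = N w (\<rho> j) + ?T v j" "N' w j = N v (\<rho> j) + ?T w j"
    if "j \<in> V" for j
    using N' that uvw V \<rho> by simp_all
  have key: "(\<forall>i\<in>V. (\<Sum>k\<in>V. M i k * N k (\<rho> j)) = of_bool (i = \<rho> j)) \<longleftrightarrow>
      (\<forall>i\<in>V. (\<Sum>k\<in>V. M' i k * N' k j) = of_bool (i = j))" if j: "j \<in> V" for j
  proof -
    define a b c P' Q' where "a = N u (\<rho> j)" and "b = N v (\<rho> j)" and "c = N w (\<rho> j)"
      and "P' = P N (\<rho> j)" and "Q' = Q N (\<rho> j)"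
    define R where "R x = (\<Sum>k\<in>V0. M x k * N k (\<rho> j))" for x
    have j': "j = u \<or> j = v \<or> j = w \<or> j \<in> V0 \<and> j \<noteq> u \<and> j \<noteq> v \<and> j \<noteq> w" using j V by auto
    have \<rho>j: "u = \<rho> j \<longleftrightarrow> j = u" "v = \<rho> j \<longleftrightarrow> j = w" "w = \<rho> j \<longleftrightarrow> j = v"
      using V(5-7) \<rho> by auto
    have \<rho>x: "x = \<rho> j \<longleftrightarrow> x = j" if "x \<in> V0" for x using that \<rho>\<rho> \<rho>0 by metis
    have ballV: "(\<forall>i\<in>V. F i) \<longleftrightarrow> F u \<and> F v \<and> F w \<and> (\<forall>x\<in>V0. F x)" for F using V(1) by blast
    have L: "(\<forall>i\<in>V. (\<Sum>k\<in>V. M i k * N k (\<rho> j)) = of_bool (i = \<rho> j)) \<longleftrightarrow>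
      a + (b + c) = of_bool (j = u) \<and> a + (b + P') = of_bool (j = w) \<and>
      a + (c + Q') = of_bool (j = v) \<and> (\<forall>x\<in>V0. p x * b + (q x * c + R x) = of_bool (x = j))"
      unfolding ballV row \<rho>j a_def b_def c_def P'_def Q'_def R_def by (auto simp: rowx \<rho>x)
    have L': "(\<forall>i\<in>V. (\<Sum>k\<in>V. M' i k * N' k j) = of_bool (i = j)) \<longleftrightarrow>
      a + ?T u j + (P' + Q') = of_bool (u = j) \<and> c + ?T v j + P' = of_bool (v = j) \<and>
      b + ?T w j + Q' = of_bool (w = j) \<and>
      (\<forall>x\<in>V0. (p x + q x) * (a + ?T u j) + (p x * (c + ?T v j) + (q x * (b + ?T w j) + R x)) = of_bool (x = j))"
      unfolding ballV row' a_def b_def c_def P'_def Q'_def R_def N3[OF j] PQ[OF j]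
      by (simp only: rowx' N3[OF j] PQ[OF j] cong: ball_cong)
    \<comment> \<open>The equations at the remaining vertices coincide once row \<open>u\<close> of
      \<open>M\<close> is used to eliminate \<open>a\<close>.\<close>
    have x: "p x * b + (q x * c + R x) =
       (p x + q x) * (a + ?T u j) + (p x * (c + ?T v j) + (q x * (b + ?T w j) + R x))"
      if "a + (b + c) = of_bool (j = u)" for x
    proof -
      have "a = of_bool (j = u) + b + c" using that by (cases a; cases b; cases c) auto
      then show ?thesis using j' V(5-7) by (cases "p x"; cases "q x"; cases b; cases c) auto
    qed
    have *: "a + (b + c) = of_bool (j = u) \<and> a + (b + P') = of_bool (j = w) \<and> a + (c + Q') = of_bool (j = v)
      \<longleftrightarrow> a + ?T u j + (P' + Q') = of_bool (u = j) \<and> c + ?T v j + P' = of_bool (v = j) \<and>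
      b + ?T w j + Q' = of_bool (w = j)"
      using j' V(5-7) by (cases a; cases b; cases c; cases P'; cases Q') auto
    show ?thesis unfolding L L' using x * by (metis (no_types, lifting))
  qed
  have "(\<forall>j\<in>V. \<forall>i\<in>V. (\<Sum>k\<in>V. M i k * N k j) = of_bool (i = j)) \<longleftrightarrow>
      (\<forall>j\<in>V. \<forall>i\<in>V. (\<Sum>k\<in>V. M i k * N k (\<rho> j)) = of_bool (i = \<rho> j))"
    using \<rho>V \<rho>\<rho> by metis
  also have "\<dots> \<longleftrightarrow> (\<forall>j\<in>V. \<forall>i\<in>V. (\<Sum>k\<in>V. M' i k * N' k j) = of_bool (i = j))" using key by blast
  finally have "(\<forall>i\<in>V. \<forall>j\<in>V. (\<Sum>k\<in>V. M i k * N k j) = of_bool (i = j)) \<longleftrightarrow>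
      (\<forall>i\<in>V. \<forall>j\<in>V. (\<Sum>k\<in>V. M' i k * N' k j) = of_bool (i = j))" by blast
  moreover have "finite V" using V by simp
  have "sinv V M N \<longleftrightarrow> (\<forall>i\<in>V. \<forall>j\<in>V. (\<Sum>k\<in>V. M i k * N k j) = of_bool (i = j))"
    using sinvI'[of V M N] \<open>finite V\<close> sM sinvD(4)[of V M N] by blast
  moreover have "sinv V M' N' \<longleftrightarrow> (\<forall>i\<in>V. \<forall>j\<in>V. (\<Sum>k\<in>V. M' i k * N' k j) = of_bool (i = j))"
    using sinvI'[of V M' N'] \<open>finite V\<close> sM' sinvD(4)[of V M' N'] by blast
  ultimately show ?thesis by simp
qed

section \<open>Corank zero and symmetric inverses\<close>

lemma ex_right_inverse_iff_corank_0:
  fixes A :: "bit mat"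
  assumes A: "A \<in> carrier_mat n n"
  shows "corank A = 0 \<longleftrightarrow> (\<exists>B\<in>carrier_mat n n. A * B = 1\<^sub>m n)"
proof -
  have "corank A = 0 \<longleftrightarrow> n \<le> vec_space.rank n A"
    using A unfolding corank_def by auto
  also have "\<dots> \<longleftrightarrow> vec_space.rank n A = n"
    using vec_space.rank_le_nc[OF A] by auto
  also have "\<dots> \<longleftrightarrow> det A \<noteq> 0"
    using vec_space.det_rank_iff[OF A] by simp
  also have "\<dots> \<longleftrightarrow> (\<exists>B\<in>carrier_mat n n. A * B = 1\<^sub>m n)"
  proof
    assume "det A \<noteq> 0"
    from det_non_zero_imp_unit[OF A this]
    show "\<exists>B\<in>carrier_mat n n. A * B = 1\<^sub>m n"
      unfolding Units_def ring_mat_def by auto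
  next
    assume "\<exists>B\<in>carrier_mat n n. A * B = 1\<^sub>m n"
    then obtain B where B: "B \<in> carrier_mat n n" "A * B = 1\<^sub>m n" by blast
    then show "det A \<noteq> 0" using det_mult[OF A B(1)] by (metis det_one mult_zero_left zero_neq_one)
  qed
  finally show ?thesis .
qed

text \<open>This is \<open>A(G) + E\<close> without an enumeration of the vertices.\<close>

definition label_matrix :: "'v lgraph \<Rightarrow> 'v \<Rightarrow> 'v \<Rightarrow> bit" where
  "label_matrix G i j = (if i = j then framing G i + 1 else of_bool ({i, j} \<in> edges G))"

lemma label_matrix_commute: "label_matrix G i j = label_matrix G j i"
  by (simp add: label_matrix_def insert_commute)

text \<open>The sorted list of vertices translates between matrices and functions; the symmetry that
  \<open>sinv\<close> demands of the inverse is supplied by \<open>sinvI'\<close>.\<close>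

lemma corank_0_iff_sinv:
  assumes "labeled_graph G"
  shows "corank (adj_matrix G + 1\<^sub>m (card (verts G))) = 0 \<longleftrightarrow> (\<exists>N. sinv (verts G) (label_matrix G) N)"
proof -
  define vs n where "vs = sorted_list_of_set (verts G)" and "n = card (verts G)"
  have fin: "finite (verts G)" using assms by (simp add: labeled_graph_def)
  have vs: "length vs = n" "distinct vs" "set vs = verts G" unfolding vs_def n_def using fin by auto
  have bij: "bij_betw ((!) vs) {..<n} (verts G)" using vs bij_betw_nth by blast
  define A where "A = adj_matrix G + 1\<^sub>m n"
  have A: "A \<in> carrier_mat n n" unfolding A_def adj_matrix_def Let_def by auto
  have Aij: "A $$ (i, j) = label_matrix G (vs ! i) (vs ! j)" if "i < n" "j < n" for i j
    using that vs unfolding A_def adj_matrix_def Let_def vs_def[symmetric]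
    by (auto simp: label_matrix_def nth_eq_iff_index_eq)
  have AB: "A * B = 1\<^sub>m n \<longleftrightarrow>
      (\<forall>i<n. \<forall>j<n. (\<Sum>k<n. label_matrix G (vs ! i) (vs ! k) * B $$ (k, j)) = of_bool (i = j))"
    if "B \<in> carrier_mat n n" for B
  proof -
    have "(A * B) $$ (i, j) = (\<Sum>k<n. label_matrix G (vs ! i) (vs ! k) * B $$ (k, j))" if "i < n" "j < n" for i j
      using A \<open>B \<in> _\<close> that by (simp add: scalar_prod_def Aij atLeast0LessThan)
    then show ?thesis using A that by (auto simp: mat_eq_iff)
  qed
  have sumV: "(\<Sum>k\<in>verts G. f k) = (\<Sum>k<n. f (vs ! k))" for f :: "'a \<Rightarrow> bit"
    by (rule sum.reindex_bij_betw[OF bij, symmetric])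
  have "(\<exists>B\<in>carrier_mat n n. A * B = 1\<^sub>m n) \<longleftrightarrow> (\<exists>N. sinv (verts G) (label_matrix G) N)"
  proof
    assume "\<exists>B\<in>carrier_mat n n. A * B = 1\<^sub>m n"
    then obtain B where B: "B \<in> carrier_mat n n" "A * B = 1\<^sub>m n" by blast
    define idx where "idx = the_inv_into {..<n} ((!) vs)"
    have idx: "idx (vs ! k) = k" if "k < n" for k
      unfolding idx_def using that bij by (intro the_inv_into_f_f) (auto simp: bij_betw_def)
    have "sinv (verts G) (label_matrix G) (\<lambda>x y. B $$ (idx x, idx y))"
    proof (rule sinvI'[OF fin label_matrix_commute])
      fix x y assume "x \<in> verts G" "y \<in> verts G"
      then obtain i j where ij: "i < n" "j < n" "x = vs ! i" "y = vs ! j"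
        using vs by (metis in_set_conv_nth)
      have "(\<Sum>k\<in>verts G. label_matrix G x k * B $$ (idx k, idx y)) =
          (\<Sum>k<n. label_matrix G (vs ! i) (vs ! k) * B $$ (k, j))"
        unfolding sumV using ij idx by (intro sum.cong) auto
      also have "\<dots> = of_bool (i = j)" using B AB ij by blast
      finally show "(\<Sum>k\<in>verts G. label_matrix G x k * B $$ (idx k, idx y)) = of_bool (x = y)"
        using ij vs by (simp add: nth_eq_iff_index_eq)
    qed
    then show "\<exists>N. sinv (verts G) (label_matrix G) N" by blast
  next
    assume "\<exists>N. sinv (verts G) (label_matrix G) N"
    then obtain N where N: "sinv (verts G) (label_matrix G) N" by blast
    define B where "B = Matrix.mat n n (\<lambda>(i, j). N (vs ! i) (vs ! j))"
    have "(\<Sum>k<n. label_matrix G (vs ! i) (vs ! k) * B $$ (k, j)) = of_bool (i = j)" if "i < n" "j < n" for i j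
    proof -
      have "vs ! i \<in> verts G" "vs ! j \<in> verts G" using that vs by (metis nth_mem)+
      then have "(\<Sum>k<n. label_matrix G (vs ! i) (vs ! k) * N (vs ! k) (vs ! j)) = of_bool (vs ! i = vs ! j)"
        using sinvD(4)[OF N] unfolding sumV by blast
      then show ?thesis using that vs by (simp add: B_def nth_eq_iff_index_eq)
    qed
    moreover have "B \<in> carrier_mat n n" by (simp add: B_def)
    ultimately show "\<exists>B\<in>carrier_mat n n. A * B = 1\<^sub>m n" using AB by blast
  qed
  then show ?thesis using ex_right_inverse_iff_corank_0[OF A] unfolding A_def n_def by simp
qed

section \<open>Looped graphs as symmetric matrices\<close>

lemma of_bool_xor: "of_bool (P \<noteq> Q) = of_bool P + (of_bool Q :: bit)"
  by simp

definition loop_matrix :: "'v graph \<Rightarrow> 'v \<Rightarrow> 'v \<Rightarrow> bit" where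
  "loop_matrix L i j = of_bool ({i, j} \<in> edges L)"

text \<open>A normal form of looped graphs, in which moves become pointwise statements about a
  matrix that is symmetric on \<open>V\<close>.\<close>

definition looped_of :: "'v set \<Rightarrow> ('v \<Rightarrow> 'v \<Rightarrow> bit) \<Rightarrow> 'v graph" where
  "looped_of V n = \<lparr>verts = V, edges = {{i, j} | i j. i \<in> V \<and> j \<in> V \<and> n i j = 1}\<rparr>"

definition sym_mat :: "'v set \<Rightarrow> ('v \<Rightarrow> 'v \<Rightarrow> bit) \<Rightarrow> bool" where
  "sym_mat V n \<longleftrightarrow> (\<forall>i\<in>V. \<forall>j\<in>V. n i j = n j i)"

lemma sym_matD: "sym_mat V n \<Longrightarrow> i \<in> V \<Longrightarrow> j \<in> V \<Longrightarrow> n i j = n j i"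
  by (auto simp: sym_mat_def)

lemma loop_matrix_commute: "loop_matrix L i j = loop_matrix L j i"
  by (simp add: loop_matrix_def insert_commute)

lemma sym_mat_loop_matrix: "sym_mat V (loop_matrix L)"
  by (simp add: sym_mat_def loop_matrix_commute)

lemma verts_looped_of [simp]: "verts (looped_of V n) = V"
  by (simp add: looped_of_def)

lemma looped_graph_looped_of: "finite V \<Longrightarrow> looped_graph (looped_of V n)"
  by (auto simp: looped_graph_def looped_of_def)

lemma edge_looped_of:
  "sym_mat V n \<Longrightarrow> {i, j} \<in> edges (looped_of V n) \<longleftrightarrow> i \<in> V \<and> j \<in> V \<and> n i j = 1"
  by (auto simp: looped_of_def doubleton_eq_iff dest: sym_matD)

lemma loop_matrix_looped_of:
  "sym_mat V n \<Longrightarrow> i \<in> V \<Longrightarrow> j \<in> V \<Longrightarrow> loop_matrix (looped_of V n) i j = n i j"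
  by (cases "n i j") (auto simp: loop_matrix_def edge_looped_of)

lemma looped_of_loop_matrix:
  assumes "looped_graph L"
  shows "looped_of (verts L) (loop_matrix L) = L"
proof -
  have "e \<in> {{i, j} | i j. i \<in> verts L \<and> j \<in> verts L \<and> {i, j} \<in> edges L}" if e: "e \<in> edges L" for e
  proof -
    obtain u v where "u \<in> verts L" "v \<in> verts L" "e = {u, v}"
      using e assms unfolding looped_graph_def by auto
    then show ?thesis using e by auto
  qed
  then have "{{i, j} | i j. i \<in> verts L \<and> j \<in> verts L \<and> {i, j} \<in> edges L} = edges L" by auto
  then show ?thesis by (simp add: looped_of_def loop_matrix_def)
qed

lemma looped_of_cong:
  assumes "V = W" "\<And>i j. i \<in> W \<Longrightarrow> j \<in> W \<Longrightarrow> n i j = m i j"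
  shows "looped_of V n = looped_of W m"
proof -
  have "{{i, j} | i j. i \<in> W \<and> j \<in> W \<and> n i j = 1} = {{i, j} | i j. i \<in> W \<and> j \<in> W \<and> m i j = 1}"
    using assms(2) by (intro Collect_cong) metis
  then show ?thesis using assms(1) by (simp add: looped_of_def)
qed

lemma iso_by_looped_of:
  assumes "bij_betw f V W" "\<And>i j. i \<in> V \<Longrightarrow> j \<in> V \<Longrightarrow> m (f i) (f j) = n i j"
  shows "iso_by f (looped_of V n) (looped_of W m)"
proof -
  have W: "W = f ` V" using assms(1) by (auto simp: bij_betw_def)
  have "{{i, j} | i j. i \<in> f ` V \<and> j \<in> f ` V \<and> m i j = 1} = (`) f ` {{i, j} | i j. i \<in> V \<and> j \<in> V \<and> n i j = 1}"
    (is "?A = ?B")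
  proof
    show "?A \<subseteq> ?B"
    proof
      fix e assume "e \<in> ?A"
      then obtain i j where "i \<in> V" "j \<in> V" "n i j = 1" "e = f ` {i, j}" using assms(2) by auto
      then show "e \<in> ?B" by blast
    qed
    show "?B \<subseteq> ?A"
    proof
      fix e assume "e \<in> ?B"
      then obtain i j where "i \<in> V" "j \<in> V" "n i j = 1" "e = f ` {i, j}" by blast
      then have "e = {f i, f j}" "f i \<in> f ` V" "f j \<in> f ` V" "m (f i) (f j) = 1" using assms(2) by auto
      then show "e \<in> ?A" by blast
    qed
  qed
  then show ?thesis using assms(1) unfolding iso_by_def looped_of_def W by simp
qed

lemma iso_by_loop_matrix:
  assumes "iso_by f L M" "looped_graph L" "i \<in> verts L" "j \<in> verts L"
  shows "loop_matrix M (f i) (f j) = loop_matrix L i j"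
proof -
  have inj: "inj_on f (verts L)" using assms(1) by (auto simp: iso_by_def bij_betw_def)
  have "{f i, f j} \<in> (`) f ` edges L \<longleftrightarrow> {i, j} \<in> edges L"
  proof
    assume "{f i, f j} \<in> (`) f ` edges L"
    then obtain e where e: "e \<in> edges L" "f ` {i, j} = f ` e" by auto
    then have "e \<subseteq> verts L" using assms(2) by (auto simp: looped_graph_def)
    then have "{i, j} = e" using e(2) inj_on_image_eq_iff[OF inj, of "{i, j}" e] assms by auto
    then show "{i, j} \<in> edges L" using e by simp
  next
    assume "{i, j} \<in> edges L"
    then have "f ` {i, j} \<in> (`) f ` edges L" by (rule imageI)
    then show "{f i, f j} \<in> (`) f ` edges L" by simp
  qed
  then show ?thesis using assms(1) by (simp add: loop_matrix_def iso_by_def)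
qed

lemma graph_iso_looped_ofI:
  assumes "bij_betw f V W" "\<And>i j. i \<in> V \<Longrightarrow> j \<in> V \<Longrightarrow> m (f i) (f j) = n i j"
  shows "graph_iso (looped_of V n) (looped_of W m)"
proof -
  have "iso_by f (looped_of V n) (looped_of W m)" by (rule iso_by_looped_of) (use assms in auto)
  then show ?thesis by (auto simp: graph_iso_def)
qed

lemma graph_iso_looped_graph:
  assumes "graph_iso L M" "looped_graph L"
  shows "looped_graph M"
proof -
  obtain f where f: "bij_betw f (verts L) (verts M)" "edges M = (`) f ` edges L"
    using assms(1) by (auto simp: graph_iso_def iso_by_def)
  have "\<exists>u\<in>verts M. \<exists>v\<in>verts M. e = {u, v}" if e: "e \<in> edges M" for e
  proof -
    obtain d where d: "d \<in> edges L" "e = f ` d" using e f(2) by auto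
    then obtain u v where "u \<in> verts L" "v \<in> verts L" "e = f ` {u, v}"
      using assms(2) unfolding looped_graph_def by auto
    then show ?thesis using f(1) by (auto simp: bij_betw_def)
  qed
  then show ?thesis using f(1) assms(2) bij_betw_finite[OF f(1)] by (auto simp: looped_graph_def)
qed

lemma graph_iso_trans: "graph_iso L M \<Longrightarrow> graph_iso M N \<Longrightarrow> graph_iso L N"
  unfolding graph_iso_def iso_by_def
  by (elim exE conjE, rule_tac x = "fa \<circ> f" in exI) (auto simp: image_comp intro: bij_betw_trans)

lemma graph_iso_sym:
  assumes "graph_iso L M" "looped_graph L"
  shows "graph_iso M L"
proof -
  obtain f where f: "iso_by f L M" using assms(1) by (auto simp: graph_iso_def)
  then have b: "bij_betw f (verts L) (verts M)" by (auto simp: iso_by_def)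
  let ?g = "the_inv_into (verts L) f"
  have M: "looped_graph M" using graph_iso_looped_graph assms by blast
  have "iso_by ?g (looped_of (verts M) (loop_matrix M)) (looped_of (verts L) (loop_matrix L))"
  proof (rule iso_by_looped_of)
    show "bij_betw ?g (verts M) (verts L)" using b by (rule bij_betw_the_inv_into)
    fix i j assume ij: "i \<in> verts M" "j \<in> verts M"
    have g: "?g k \<in> verts L \<and> f (?g k) = k" if "k \<in> verts M" for k
      using that f_the_inv_into_f_bij_betw[OF b] bij_betw_apply[OF bij_betw_the_inv_into[OF b]] by simp
    show "loop_matrix L (?g i) (?g j) = loop_matrix M i j"
      using iso_by_loop_matrix[OF f assms(2), of "?g i" "?g j"] g ij by simp
  qed
  then show ?thesis
    using looped_of_loop_matrix[OF M] looped_of_loop_matrix[OF assms(2)] by (auto simp: graph_iso_def)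
qed

lemma omega1_looped_of:
  assumes "x \<notin> V" "sym_mat (insert x V) n" "\<And>y. y \<in> V \<Longrightarrow> n x y = 0"
  shows "omega1 (looped_of V n) (looped_of (insert x V) n)"
proof -
  have "n y x = 0" if "y \<in> V" for y using assms sym_matD[of "insert x V" n y x] that by simp
  then have "{{i, j} | i j. i \<in> insert x V \<and> j \<in> insert x V \<and> n i j = 1} =
      {{i, j} | i j. i \<in> V \<and> j \<in> V \<and> n i j = 1} \<union> (if n x x = 1 then {{x}} else {})"
    using assms by (auto 0 3)
  then show ?thesis
    unfolding omega1_def looped_of_def using assms(1) by (intro exI[of _ x] exI[of _ "n x x = 1"]) simp
qed

lemma omega1D:
  assumes "omega1 L M" "looped_graph L"
  obtains x where "x \<notin> verts L" "verts M = insert x (verts L)"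
    "\<And>i j. i \<in> verts L \<Longrightarrow> j \<in> verts L \<Longrightarrow> loop_matrix M i j = loop_matrix L i j"
    "\<And>y. y \<in> verts L \<Longrightarrow> loop_matrix M x y = 0"
proof -
  obtain x looped where x: "x \<notin> verts L" and M: "M = L\<lparr>verts := insert x (verts L),
      edges := edges L \<union> (if looped then {{x}} else {})\<rparr>"
    using assms(1) unfolding omega1_def by blast
  have "{x, y} \<notin> edges L" for y using x assms(2) by (auto simp: looped_graph_def doubleton_eq_iff)
  then show ?thesis
    by (intro that[of x]) (use x in \<open>auto simp: M loop_matrix_def doubleton_eq_iff\<close>)
qed

lemma omega2_looped_of:
  assumes "u \<notin> V" "v \<notin> V" "u \<noteq> v" "sym_mat (insert u (insert v V)) n"
    "\<And>y. y \<in> V \<Longrightarrow> n u y = n v y" "n u u = 1" "n v v = 0"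
  shows "omega2 (looped_of V n) (looped_of (insert u (insert v V)) n)"
proof -
  define N where "N = {y \<in> V. n u y = 1}"
  have s: "n i j = n j i" if "i \<in> insert u (insert v V)" "j \<in> insert u (insert v V)" for i j
    using assms(4) that by (auto simp: sym_mat_def)
  have "{{i, j} | i j. i \<in> insert u (insert v V) \<and> j \<in> insert u (insert v V) \<and> n i j = 1} =
      {{i, j} | i j. i \<in> V \<and> j \<in> V \<and> n i j = 1} \<union> {{u, x} | x. x \<in> N} \<union> {{v, x} | x. x \<in> N} \<union> {{u}} \<union>
      (if n u v = 1 then {{u, v}} else {})" (is "?A = ?B")
  proof
    have mem: "{i, j} \<in> ?A"
      if "i \<in> insert u (insert v V)" "j \<in> insert u (insert v V)" "n i j = 1" for i j
      using that by blast
    show "?B \<subseteq> ?A"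
    proof
      fix e assume "e \<in> ?B"
      then consider "\<exists>i j. e = {i, j} \<and> i \<in> V \<and> j \<in> V \<and> n i j = 1"
        | x where "e = {u, x}" "x \<in> N" | x where "e = {v, x}" "x \<in> N"
        | "e = {u, u}" | "e = {u, v}" "n u v = 1"
        by (auto split: if_splits)
      then show "e \<in> ?A"
      proof cases
        case 1
        then obtain i j where ij: "e = {i, j}" "i \<in> V" "j \<in> V" "n i j = 1" by blast
        show ?thesis unfolding ij(1) by (rule mem) (use ij in auto)
      next
        case 2
        show ?thesis unfolding 2(1) by (rule mem) (use 2 in \<open>auto simp: N_def\<close>)
      next
        case 3
        then have "x \<in> V" "n v x = 1" using assms(5)[of x] by (auto simp: N_def)
        then show ?thesis unfolding 3(1) by (intro mem) auto
      next
        case 4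
        show ?thesis unfolding 4(1) by (rule mem) (use assms(6) in auto)
      next
        case 5
        show ?thesis unfolding 5(1) by (rule mem) (use 5 in auto)
      qed
    qed
    show "?A \<subseteq> ?B"
    proof
      fix e assume "e \<in> ?A"
      then obtain i j where ij: "e = {i, j}" "i \<in> insert u (insert v V)" "j \<in> insert u (insert v V)" "n i j = 1"
        by blast
      have B: "{k, l} \<in> ?B" if "k \<in> insert u (insert v V)" "l \<in> V" "n k l = 1" for k l
      proof -
        from that consider "k = u" | "k = v" | "k \<in> V" by blast
        then show ?thesis
        proof cases
          case 1
          then have "l \<in> N" using that unfolding N_def by simp
          then show ?thesis unfolding 1 by blast
        next
          case 2
          then have "l \<in> N" using that assms(5)[OF that(2)] unfolding N_def by simp
          then show ?thesis unfolding 2 by blast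
        next
          case 3
          then show ?thesis using that by blast
        qed
      qed
      consider "j \<in> V" | "i \<in> V" | "i = u" "j = u" | "i = v" "j = v" | "i = u" "j = v" | "i = v" "j = u"
        using ij by blast
      then show "e \<in> ?B"
      proof cases
        case 1
        show ?thesis unfolding ij(1) by (rule B[OF ij(2) 1 ij(4)])
      next
        case 2
        have "{j, i} \<in> ?B" using B[OF ij(3) 2] s[OF ij(2,3)] ij(4) by simp
        then show ?thesis unfolding ij(1) by (simp only: insert_commute)
      qed (use ij assms(7) s[of u v] in \<open>auto simp: insert_commute\<close>)
    qed
  qed
  then show ?thesis
    unfolding omega2_def looped_of_def using assms(1-3)
    by (intro exI[of _ u] exI[of _ v] exI[of _ N] exI[of _ "n u v = 1"]) (simp add: N_def)
qed

lemma omega2D: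
  assumes "omega2 L M" "looped_graph L"
  obtains u v where "u \<notin> verts L" "v \<notin> verts L" "u \<noteq> v" "verts M = insert u (insert v (verts L))"
    "\<And>i j. i \<in> verts L \<Longrightarrow> j \<in> verts L \<Longrightarrow> loop_matrix M i j = loop_matrix L i j"
    "\<And>y. y \<in> verts L \<Longrightarrow> loop_matrix M u y = loop_matrix M v y"
    "loop_matrix M u u = 1" "loop_matrix M v v = 0"
proof -
  obtain u v N adjacent where uv: "u \<notin> verts L" "v \<notin> verts L" "u \<noteq> v" "N \<subseteq> verts L"
    and M: "M = L\<lparr>verts := insert u (insert v (verts L)),
           edges := edges L \<union> {{u, x} | x. x \<in> N} \<union> {{v, x} | x. x \<in> N} \<union> {{u}} \<union>
                    (if adjacent then {{u, v}} else {})\<rparr>"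
    using assms(1) unfolding omega2_def by blast
  have "{u, y} \<notin> edges L" "{v, y} \<notin> edges L" for y
    using uv assms(2) by (auto simp: looped_graph_def doubleton_eq_iff)
  moreover from this have "{u} \<notin> edges L" "{v} \<notin> edges L" by (metis insert_absorb2)+
  ultimately show ?thesis
    by (intro that[of u v]) (use uv in \<open>auto simp: M loop_matrix_def doubleton_eq_iff\<close>)
qed

section \<open>The third move of looped graphs in matrix form\<close>

definition toggle3 :: "'v \<Rightarrow> 'v \<Rightarrow> 'v \<Rightarrow> ('v \<Rightarrow> 'v \<Rightarrow> bit) \<Rightarrow> 'v \<Rightarrow> 'v \<Rightarrow> bit" where
  "toggle3 x y z n i j = n i j + of_bool (i \<noteq> j \<and> i \<in> {x, y, z} \<and> j \<in> {x, y, z})"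

lemma sym_mat_toggle3: "sym_mat V n \<Longrightarrow> sym_mat V (toggle3 x y z n)"
  by (auto simp: sym_mat_def toggle3_def)

text \<open>Among three vertices, 0 or 2 neighbours means an even number of them, so the side
  condition of the third move is linear.\<close>

lemma card_nbhd_even:
  assumes "x \<noteq> y" "x \<noteq> z" "y \<noteq> z" "k \<notin> {x, y, z}"
  shows "card (nbhd L k \<inter> {x, y, z}) \<in> {0, 2} \<longleftrightarrow>
    loop_matrix L k x + loop_matrix L k y + loop_matrix L k z = 0"
proof -
  have "nbhd L k \<inter> {x, y, z} = (if loop_matrix L k x = 1 then {x} else {}) \<union>
     (if loop_matrix L k y = 1 then {y} else {}) \<union> (if loop_matrix L k z = 1 then {z} else {})"
    using assms by (auto simp: nbhd_def loop_matrix_def insert_commute split: if_splits)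
  then show ?thesis using assms
    by (cases "loop_matrix L k x"; cases "loop_matrix L k y"; cases "loop_matrix L k z") auto
qed

lemma omega3D:
  assumes "omega3 L M" "looped_graph L"
  obtains u v w where "{u, v, w} \<subseteq> verts L" "u \<noteq> v" "u \<noteq> w" "v \<noteq> w" "verts M = verts L"
    "loop_matrix L v v = 1" "loop_matrix L w w = 0"
    "loop_matrix L v w = 1" "loop_matrix L u v = 0" "loop_matrix L u w = 0"
    "\<And>k. k \<in> verts L - {u, v, w} \<Longrightarrow> loop_matrix L k u + loop_matrix L k v + loop_matrix L k w = 0"
    "\<And>i j. loop_matrix M i j = toggle3 u v w (loop_matrix L) i j"
proof -
  obtain u v w where uvw: "{u, v, w} \<subseteq> verts L" "u \<noteq> v" "u \<noteq> w" "v \<noteq> w"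
     "{v} \<in> edges L" "{w} \<notin> edges L" "{v, w} \<in> edges L" "{u, v} \<notin> edges L" "{u, w} \<notin> edges L"
     "\<forall>x \<in> verts L - {u, v, w}. card (nbhd L x \<inter> {u, v, w}) \<in> {0, 2}"
     and M: "M = toggle {{u, v}, {u, w}, {v, w}} L"
    using assms(1) unfolding omega3_def by blast
  have "loop_matrix M i j = toggle3 u v w (loop_matrix L) i j" for i j
  proof -
    have t: "{i, j} \<in> {{u, v}, {u, w}, {v, w}} \<longleftrightarrow> i \<noteq> j \<and> i \<in> {u, v, w} \<and> j \<in> {u, v, w}"
      using uvw(2-4) by (auto simp: doubleton_eq_iff)
    have "{i, j} \<in> edges M \<longleftrightarrow> ({i, j} \<in> edges L) \<noteq> ({i, j} \<in> {{u, v}, {u, w}, {v, w}})"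
    proof -
      have "edges M = sym_diff (edges L) {{u, v}, {u, w}, {v, w}}" by (simp add: M toggle_def)
      then show ?thesis unfolding Un_iff Diff_iff by blast
    qed
    then have "loop_matrix M i j = of_bool (({i, j} \<in> edges L) \<noteq> (i \<noteq> j \<and> i \<in> {u, v, w} \<and> j \<in> {u, v, w}))"
      unfolding loop_matrix_def t by (rule arg_cong[where f = of_bool])
    then show ?thesis unfolding of_bool_xor loop_matrix_def toggle3_def .
  qed
  moreover have "loop_matrix L k u + loop_matrix L k v + loop_matrix L k w = 0" if "k \<in> verts L - {u, v, w}" for k
    using uvw(10) that card_nbhd_even[OF uvw(2-4)] by blast
  moreover have "verts M = verts L" by (simp add: M toggle_def)
  ultimately show ?thesis using uvw(1-9)
    by (intro that[of u v w]) (simp_all add: loop_matrix_def)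
qed

lemma omega3_looped_of:
  assumes "{u, v, w} \<subseteq> V" "u \<noteq> v" "u \<noteq> w" "v \<noteq> w" "sym_mat V n"
    "n v v = 1" "n w w = 0" "n v w = 1" "n u v = 0" "n u w = 0"
    "\<And>k. k \<in> V - {u, v, w} \<Longrightarrow> n k u + n k v + n k w = 0"
  shows "omega3 (looped_of V n) (looped_of V (toggle3 u v w n))"
proof -
  let ?L = "looped_of V n"
  have e: "{i, j} \<in> edges ?L \<longleftrightarrow> i \<in> V \<and> j \<in> V \<and> n i j = 1" for i j
    using assms(5) by (rule edge_looped_of)
  have e1: "{i} \<in> edges ?L \<longleftrightarrow> i \<in> V \<and> n i i = 1" for i using e[of i i] by simp
  have c: "\<forall>x \<in> verts ?L - {u, v, w}. card (nbhd ?L x \<inter> {u, v, w}) \<in> {0, 2}"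
  proof
    fix k assume k: "k \<in> verts ?L - {u, v, w}"
    then show "card (nbhd ?L k \<inter> {u, v, w}) \<in> {0, 2}"
      using card_nbhd_even[OF assms(2-4), of k ?L] assms(11)[of k] assms(1)
      by (simp add: loop_matrix_looped_of[OF assms(5)])
  qed
  have "edges (looped_of V (toggle3 u v w n)) = sym_diff (edges ?L) {{u, v}, {u, w}, {v, w}}" (is "?A = ?B")
  proof (rule Set.set_eqI)
    fix e
    show "e \<in> ?A \<longleftrightarrow> e \<in> ?B"
    proof (cases "\<exists>i\<in>V. \<exists>j\<in>V. e = {i, j}")
      case True
      then obtain i j where ij: "i \<in> V" "j \<in> V" "e = {i, j}" by blast
      have t: "{i, j} \<in> {{u, v}, {u, w}, {v, w}} \<longleftrightarrow> i \<noteq> j \<and> i \<in> {u, v, w} \<and> j \<in> {u, v, w}"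
        using assms(2-4) by (auto simp: doubleton_eq_iff)
      have eL: "{i, j} \<in> edges ?L \<longleftrightarrow> n i j = 1" using e ij(1,2) by simp
      have "e \<in> ?A \<longleftrightarrow> toggle3 u v w n i j = 1"
        using edge_looped_of[OF sym_mat_toggle3[OF assms(5)]] ij by simp
      also have "\<dots> \<longleftrightarrow> (n i j = 1) \<noteq> (i \<noteq> j \<and> i \<in> {u, v, w} \<and> j \<in> {u, v, w})"
        unfolding toggle3_def by (cases "n i j") auto
      also have "\<dots> \<longleftrightarrow> ({i, j} \<in> edges ?L) \<noteq> ({i, j} \<in> {{u, v}, {u, w}, {v, w}})"
        unfolding t eL ..
      also have "\<dots> \<longleftrightarrow> e \<in> ?B" unfolding ij(3) Un_iff Diff_iff by blast
      finally show ?thesis .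
    next
      case False
      then have "e \<notin> ?A" "e \<notin> edges ?L" by (auto simp: looped_of_def)
      moreover have "e \<notin> {{u, v}, {u, w}, {v, w}}" using False assms(1) by blast
      ultimately show ?thesis by simp
    qed
  qed
  then have "looped_of V (toggle3 u v w n) = toggle {{u, v}, {u, w}, {v, w}} ?L"
    unfolding toggle_def by (simp add: looped_of_def)
  then show ?thesis unfolding omega3_def
    by (intro exI[of _ u] exI[of _ v] exI[of _ w]) (use assms e e1 c in simp)
qed

section \<open>The third move in general\<close>

text \<open>Instantiated twice, by homotopy and by equality of the graph-links of realizing labeled
  graphs. The third move is left out on purpose: its general form is to be derived from special
  cases by second moves.\<close>

locale looped_equivalence =
  fixes E :: "nat graph \<Rightarrow> nat graph \<Rightarrow> bool"
  assumes refl: "looped_graph L \<Longrightarrow> E L L"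
    and sym: "E L M \<Longrightarrow> E M L"
    and trans: "E L M \<Longrightarrow> E M N \<Longrightarrow> E L N"
    and iso: "looped_graph L \<Longrightarrow> looped_graph M \<Longrightarrow> graph_iso L M \<Longrightarrow> E L M"
    and omega2: "looped_graph L \<Longrightarrow> looped_graph M \<Longrightarrow> omega2 L M \<Longrightarrow> E L M"
begin

lemma twins:
  assumes "finite V" "u \<notin> V" "v \<notin> V" "u \<noteq> v" "sym_mat (insert u (insert v V)) n"
    "\<And>y. y \<in> V \<Longrightarrow> n u y = n v y" "n u u \<noteq> n v v"
  shows "E (looped_of V n) (looped_of (insert u (insert v V)) n)"
proof (cases "n u u = 1")
  case True
  then have "n v v = 0" using assms(7) by (cases "n v v") auto
  then show ?thesis using assms True
    by (intro omega2 omega2_looped_of looped_graph_looped_of) auto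
next
  case False
  then have "n u u = 0" "n v v = 1" using assms(7) by (cases "n v v"; auto)+
  moreover have "sym_mat (insert v (insert u V)) n" using assms(5) by (simp add: insert_commute)
  ultimately have "E (looped_of V n) (looped_of (insert v (insert u V)) n)" using assms
    by (intro omega2 omega2_looped_of looped_graph_looped_of) auto
  then show ?thesis by (simp add: insert_commute)
qed

text \<open>The six bits are the adjacencies and loops of the triangle, and the rest of the graph is
  arbitrary up to parity. Deriving one third move from another thereby becomes a computation with
  bits.\<close>

definition R3 :: "bit \<Rightarrow> bit \<Rightarrow> bit \<Rightarrow> bit \<Rightarrow> bit \<Rightarrow> bit \<Rightarrow> bool" where
  "R3 xy xz yz xx yy zz \<longleftrightarrow> (\<forall>V n x y z. finite V \<and> sym_mat V n \<and> {x, y, z} \<subseteq> V \<and>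
     x \<noteq> y \<and> x \<noteq> z \<and> y \<noteq> z \<and> n x y = xy \<and> n x z = xz \<and> n y z = yz \<and>
     n x x = xx \<and> n y y = yy \<and> n z z = zz \<and>
     (\<forall>k\<in>V - {x, y, z}. n k x + n k y + n k z = 0) \<longrightarrow>
     E (looped_of V n) (looped_of V (toggle3 x y z n)))"

lemma R3D:
  assumes "R3 (n x y) (n x z) (n y z) (n x x) (n y y) (n z z)" "finite V" "sym_mat V n"
    "{x, y, z} \<subseteq> V" "x \<noteq> y" "x \<noteq> z" "y \<noteq> z" "\<And>k. k \<in> V - {x, y, z} \<Longrightarrow> n k x + n k y + n k z = 0"
  shows "E (looped_of V n) (looped_of V (toggle3 x y z n))"
  by (rule assms(1)[unfolded R3_def, rule_format, of V n x y z]) (use assms(2-) in \<open>simp add: Ball_def\<close>)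

lemma R3_swap:
  assumes "R3 xy xz yz xx yy zz"
  shows "R3 xy yz xz yy xx zz"
  unfolding R3_def
proof (intro allI impI, elim conjE)
  fix V :: "nat set" and n x y z
  assume *: "finite V" "sym_mat V n" "{x, y, z} \<subseteq> V" "x \<noteq> y" "x \<noteq> z" "y \<noteq> z" "n x y = xy" "n x z = yz"
    "n y z = xz" "n x x = yy" "n y y = xx" "n z z = zz" "\<forall>k\<in>V - {x, y, z}. n k x + n k y + n k z = 0"
  have "n y x = xy" using * sym_matD[of V n y x] by simp
  then have "E (looped_of V n) (looped_of V (toggle3 y x z n))"
    using assms * by (intro R3D) (auto simp: add_ac)
  moreover have "toggle3 y x z n = toggle3 x y z n" by (simp add: fun_eq_iff toggle3_def insert_commute)
  ultimately show "E (looped_of V n) (looped_of V (toggle3 x y z n))" by simp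
qed

lemma R3_rotate:
  assumes "R3 xy xz yz xx yy zz"
  shows "R3 yz xy xz yy zz xx"
  unfolding R3_def
proof (intro allI impI, elim conjE)
  fix V :: "nat set" and n x y z
  assume *: "finite V" "sym_mat V n" "{x, y, z} \<subseteq> V" "x \<noteq> y" "x \<noteq> z" "y \<noteq> z" "n x y = yz" "n x z = xy"
    "n y z = xz" "n x x = yy" "n y y = zz" "n z z = xx" "\<forall>k\<in>V - {x, y, z}. n k x + n k y + n k z = 0"
  have "n z x = xy" "n z y = xz" using * sym_matD[of V n z x] sym_matD[of V n z y] by auto
  then have "E (looped_of V n) (looped_of V (toggle3 z x y n))"
    using assms * by (intro R3D) (auto simp: add_ac)
  moreover have "toggle3 z x y n = toggle3 x y z n" by (simp add: fun_eq_iff toggle3_def insert_commute)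
  ultimately show "E (looped_of V n) (looped_of V (toggle3 x y z n))" by simp
qed

lemma R3_inverse:
  assumes "R3 xy xz yz xx yy zz"
  shows "R3 (xy + 1) (xz + 1) (yz + 1) xx yy zz"
  unfolding R3_def
proof (intro allI impI, elim conjE)
  fix V :: "nat set" and n x y z
  assume *: "finite V" "sym_mat V n" "{x, y, z} \<subseteq> V" "x \<noteq> y" "x \<noteq> z" "y \<noteq> z" "n x y = xy + 1" "n x z = xz + 1"
    "n y z = yz + 1" "n x x = xx" "n y y = yy" "n z z = zz" "\<forall>k\<in>V - {x, y, z}. n k x + n k y + n k z = 0"
  have "E (looped_of V (toggle3 x y z n)) (looped_of V (toggle3 x y z (toggle3 x y z n)))"
    using assms * by (intro R3D sym_mat_toggle3) (auto simp: toggle3_def add.assoc)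
  moreover have "toggle3 x y z (toggle3 x y z n) = n" by (simp add: fun_eq_iff toggle3_def add.assoc)
  ultimately show "E (looped_of V n) (looped_of V (toggle3 x y z n))" using sym by simp
qed

text \<open>
  Geometrically, the two strands that cross at \<open>z\<close> are made to cross twice more, at \<open>s\<close> and \<open>t\<close>,
  beyond the strand through \<open>x\<close> and \<open>y\<close>. The move of the triangle \<open>x, y, t\<close> brings \<open>t\<close> next to \<open>z\<close>,
  where the two cancel, so that \<open>s\<close> takes the place of \<open>z\<close>.
\<close>

lemma R3_bigon:
  assumes "R3 xy (xz + 1) (yz + 1) xx yy (zz + 1)"
  shows "R3 xy xz yz xx yy zz"
  unfolding R3_def
proof (intro allI impI, elim conjE)
  fix V :: "nat set" and n x y z
  assume *: "finite V" "sym_mat V n" "{x, y, z} \<subseteq> V" "x \<noteq> y" "x \<noteq> z" "y \<noteq> z" "n x y = xy" "n x z = xz"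
    "n y z = yz" "n x x = xx" "n y y = yy" "n z z = zz" "\<forall>k\<in>V - {x, y, z}. n k x + n k y + n k z = 0"
  obtain s where s: "s \<notin> V" using *(1) ex_new_if_finite[OF infinite_UNIV_nat] by blast
  obtain t where "t \<notin> insert s V" using *(1) ex_new_if_finite[OF infinite_UNIV_nat, of "insert s V"] by auto
  then have t: "t \<notin> V" "s \<noteq> t" by auto
  \<comment> \<open>The adjacency of \<open>s\<close> and \<open>t\<close>, forced by the parity
    condition of the triangle \<open>x, y, t\<close> at \<open>z\<close> and at \<open>s\<close>.
    The common row \<open>c\<close> of \<open>s\<close> and \<open>t\<close> copies that of
    \<open>z\<close> except at \<open>x\<close> and \<open>y\<close>, so that toggling
    \<open>x, y, t\<close> makes \<open>t\<close> a twin of \<open>z\<close> with the opposite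
    loop.\<close>
  define e where "e = xz + yz"
  define c where "c k = (if k = x then xz + 1 else if k = y then yz + 1 else if k = z then e else n z k)" for k
  define m where "m i j = (if i \<in> V \<and> j \<in> V then n i j else if i \<in> V then c i else if j \<in> V then c j
    else if i \<noteq> j then e else if i = s then zz else zz + 1)" for i j
  let ?W = "insert s (insert t V)"
  have sm: "sym_mat ?W m" using *(2) s t by (auto simp: sym_mat_def m_def)
  have ne: "x \<noteq> s" "y \<noteq> s" "z \<noteq> s" "x \<noteq> t" "y \<noteq> t" "z \<noteq> t" and xyz: "x \<in> V" "y \<in> V" "z \<in> V"
    using *(3) s t by auto
  have nz: "n z x = xz" "n z y = yz" "n y x = xy" using * sym_matD[of V n] xyz by metis+
  have 1: "E (looped_of V n) (looped_of ?W m)"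
  proof -
    have "looped_of V n = looped_of V m" by (intro looped_of_cong) (auto simp: m_def)
    moreover have "E (looped_of V m) (looped_of ?W m)"
      using s t sm *(1) by (intro twins) (auto simp: m_def)
    ultimately show ?thesis by simp
  qed
  have 2: "E (looped_of ?W m) (looped_of ?W (toggle3 x y t m))"
  proof (rule R3D)
    have "m x y = xy" "m x t = xz + 1" "m y t = yz + 1" "m x x = xx" "m y y = yy" "m t t = zz + 1"
      using xyz s t ne *(4-12) by (auto simp: m_def c_def)
    then show "R3 (m x y) (m x t) (m y t) (m x x) (m y y) (m t t)" using assms by simp
    fix k assume k: "k \<in> ?W - {x, y, t}"
    show "m k x + m k y + m k t = 0"
    proof (cases "k \<in> V - {x, y, z}")
      case True
      then have "m k x + m k y + m k t = n k x + n k y + n z k" using xyz s t by (auto simp: m_def c_def)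
      moreover have "n z k = n k z" using *(2) True xyz by (auto simp: sym_mat_def)
      ultimately show ?thesis using True *(13) by simp
    next
      case False
      then have "k = z \<or> k = s" using k by auto
      then show ?thesis using xyz s t ne *(4-6) nz by (auto simp: m_def c_def e_def ac_simps)
    qed
  qed (use xyz ne *(1,4) sm in auto)
  define n3 where "n3 = toggle3 x y t m"
  define U where "U = insert s (V - {z})"
  have W: "?W = insert z (insert t U)" using xyz unfolding U_def by auto
  have c': "n z k = c k" if "k \<in> V - {x, y, z}" for k using that by (simp add: c_def)
  have 3: "E (looped_of U n3) (looped_of ?W n3)"
    unfolding W
  proof (rule twins)
    show "sym_mat (insert z (insert t U)) n3" unfolding n3_def W[symmetric] by (rule sym_mat_toggle3[OF sm])
    show "n3 z z \<noteq> n3 t t" using xyz t ne s *(12) by (auto simp: n3_def toggle3_def m_def)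
    fix k assume "k \<in> U"
    then consider "k = s" | "k = x" | "k = y" | "k \<in> V - {x, y, z}" unfolding U_def by auto
    then show "n3 z k = n3 t k"
      using xyz s t ne *(4-6) nz by cases (auto simp: n3_def toggle3_def m_def c_def ac_simps)
  qed (use *(1) ne t in \<open>auto simp: U_def\<close>)
  \<comment> \<open>Once \<open>z\<close> and \<open>t\<close> are removed, \<open>s\<close> is the
    vertex \<open>z\<close> with its adjacencies to \<open>x\<close> and \<open>y\<close>
    toggled.\<close>
  let ?f = "\<lambda>k. if k = z then s else k"
  have 4: "graph_iso (looped_of V (toggle3 x y z n)) (looped_of U n3)"
  proof (rule graph_iso_looped_ofI)
    show "bij_betw ?f V U" using s xyz unfolding U_def
      by (intro bij_betwI[where g = "\<lambda>k. if k = s then z else k"]) auto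
    fix i j assume ij: "i \<in> V" "j \<in> V"
    have V: "k \<in> V \<longleftrightarrow> k = x \<or> k = y \<or> k = z \<or> k \<in> V - {x, y, z}" for k using xyz by auto
    have cz: "n k z = c k" if "k \<in> V - {x, y, z}" for k using c'[OF that] *(2) that xyz by (auto simp: sym_mat_def)
    show "n3 (?f i) (?f j) = toggle3 x y z n i j"
    proof (cases "i = z")
      case True
      show ?thesis
      proof (cases "j = z")
        case True
        then show ?thesis using \<open>i = z\<close> s t ne *(12) by (auto simp: n3_def toggle3_def m_def)
      next
        case False
        then show ?thesis using \<open>i = z\<close> ij s t ne *(4-6) nz by (auto simp: n3_def toggle3_def m_def c_def)
      qed
    next
      case iz: False
      show ?thesis
      proof (cases "j = z")
        case True
        then show ?thesis using iz ij s t ne *(4-9) cz[of i] by (auto simp: n3_def toggle3_def m_def c_def)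
      next
        case False
        then show ?thesis using iz ij t by (auto simp: n3_def toggle3_def m_def)
      qed
    qed
  qed
  have "E (looped_of V (toggle3 x y z n)) (looped_of U n3)"
    using *(1) by (intro iso 4 looped_graph_looped_of) (auto simp: U_def)
  then show "E (looped_of V n) (looped_of V (toggle3 x y z n))"
    using 1 2 3 unfolding n3_def[symmetric] by (meson sym trans)
qed

end

context looped_equivalence
begin

text \<open>Up to inverses the edge between \<open>x\<close> and \<open>y\<close> is absent, and the
  hypothesis leaves four values of \<open>(xz, yz)\<close>. Renamings move the exceptional vertex
  around, and \<open>R3_bigon\<close> exchanges triangles with \<open>xz = yz = 1\<close> for
  triangles with \<open>xz = yz = 0\<close>; alternating the two reaches every case. In a diagram,
  \<open>x\<close> and \<open>y\<close> are the crossings on the uppermost strand.\<close>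

lemma R3_general:
  assumes base: "\<And>l. R3 0 0 1 l 1 0" and "xz + yz = 1 + xx + yy"
  shows "R3 xy xz yz xx yy zz"
proof -
  have rot: "R3 1 0 0 1 0 l" for l using R3_rotate[OF base] .
  have edge_xy: "R3 1 0 0 l (l + 1) m" for l m
    using rot[of m] R3_swap[OF rot[of m]] by (cases l) auto
  have edge_xz: "R3 0 1 0 l m (l + 1)" for l m
    using R3_rotate[OF edge_xy[of "l + 1" m]] by (simp add: add.assoc)
  have edge_yz: "R3 0 0 1 m l (l + 1)" for l m using R3_swap[OF edge_xz[of l m]] .
  have zero: "R3 0 0 0 l (l + 1) m" for l m
    by (rule R3_bigon) (use R3_inverse[OF edge_xy[of l "m + 1"]] in simp)
  have zero': "R3 0 0 0 l l (l + 1)" for l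
    using R3_rotate[OF zero[of "l + 1" l]] by (simp add: add.assoc)
  have eq_xy: "R3 1 0 0 l l l" for l by (rule R3_bigon) (use R3_inverse[OF zero'[of l]] in simp)
  have eq_xz: "R3 0 1 0 l l l" for l using R3_rotate[OF eq_xy[of l]] .
  have eq_yz: "R3 0 0 1 l l l" for l using R3_swap[OF eq_xz[of l]] .
  have half: "R3 0 xz' yz' xx yy zz" if eq: "xz' + yz' = 1 + xx + yy" for xz' yz'
  proof -
    consider "xz' = 0" "yz' = 0" | "xz' = 1" "yz' = 1" | "xz' = 1" "yz' = 0" | "xz' = 0" "yz' = 1"
      by (cases xz'; cases yz') auto
    then show ?thesis
    proof cases
      case 1
      then have "yy = xx + 1" using eq by (cases xx; cases yy) auto
      then show ?thesis using 1 zero by simp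
    next
      case 2
      then have "yy = xx + 1" using eq by (cases xx; cases yy) auto
      then show ?thesis using 2 R3_inverse[OF edge_xy[of xx zz]] by simp
    next
      case 3
      then have "yy = xx" using eq by (cases xx; cases yy) auto
      moreover have "zz = xx \<or> zz = xx + 1" by (cases zz; cases xx) auto
      ultimately show ?thesis using 3 edge_xz[of xx xx] eq_xz[of xx] by auto
    next
      case 4
      then have "yy = xx" using eq by (cases xx; cases yy) auto
      moreover have "zz = xx \<or> zz = xx + 1" by (cases zz; cases xx) auto
      ultimately show ?thesis using 4 edge_yz[of xx xx] eq_yz[of xx] by auto
    qed
  qed
  show ?thesis
  proof (cases xy)
    case zero
    then show ?thesis using half assms(2) by simp
  next
    case one
    have "xz + 1 + (yz + 1) = 1 + xx + yy" using assms(2) by (simp add: ac_simps)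
    from R3_inverse[OF half[OF this]] show ?thesis using one by (simp add: add.assoc)
  qed
qed

text \<open>The assumptions are the types (0, 0, 0) and (1, 0, 0) of \<open>triangle_type\<close>,
  which \<open>omega_g3\<close> provides. A bigon turns the first into the case
  \<open>l = 0\<close>, renaming turns the second into \<open>l = 1\<close>.\<close>

lemma R3_base:
  assumes "R3 0 0 0 0 1 1" "R3 1 0 0 1 0 1"
  shows "R3 0 0 1 l 1 0"
proof (cases l)
  case zero
  have "R3 0 1 1 0 1 0" by (rule R3_bigon) (use assms(1) in simp)
  from R3_inverse[OF this] have "R3 1 0 0 0 1 0" by simp
  from R3_rotate[OF R3_rotate[OF R3_swap[OF this]]] show ?thesis using zero by simp
next
  case one
  then show ?thesis using R3_rotate[OF R3_rotate[OF assms(2)]] by simp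
qed

end

section \<open>Homotopy classes of looped graphs\<close>

abbreviation homotopic :: "nat graph \<Rightarrow> nat graph \<Rightarrow> bool" where
  "homotopic L M \<equiv> (L, M) \<in> homotopy_rel"

lemma homotopic_step: "looped_step L M \<Longrightarrow> homotopic L M"
  by (auto simp: homotopy_rel_def looped_step_def intro: r_into_equivclp)

lemma equiv_homotopy_rel: "equiv {L. looped_graph L} homotopy_rel"
proof (rule equivI)
  show "refl_on {L. looped_graph L} homotopy_rel" by (auto simp: refl_on_def homotopy_rel_def)
  show "homotopy_rel \<subseteq> {L. looped_graph L} \<times> {L. looped_graph L}" by (auto simp: homotopy_rel_def)
  show "Relation.sym homotopy_rel" by (auto simp: sym_def homotopy_rel_def intro: equivclp_sym)
  show "Relation.trans homotopy_rel" unfolding trans_def homotopy_rel_def by (auto intro: equivclp_trans)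
qed

interpretation homotopy: looped_equivalence homotopic
proof
  show "looped_graph L \<Longrightarrow> homotopic L L" for L by (simp add: homotopy_rel_def)
  show "homotopic L M \<Longrightarrow> homotopic M L" for L M by (auto simp: homotopy_rel_def intro: equivclp_sym)
  show "homotopic L M \<Longrightarrow> homotopic M N \<Longrightarrow> homotopic L N" for L M N
    unfolding homotopy_rel_def by (auto intro: equivclp_trans)
  show "looped_graph L \<Longrightarrow> looped_graph M \<Longrightarrow> graph_iso L M \<Longrightarrow> homotopic L M" for L M
    by (rule homotopic_step) (simp add: looped_step_def)
  show "looped_graph L \<Longrightarrow> looped_graph M \<Longrightarrow> omega2 L M \<Longrightarrow> homotopic L M" for L M
    by (rule homotopic_step) (simp add: looped_step_def)
qed

text \<open>\<open>omega3\<close> leaves the loop at its first vertex open, so it is the base case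
  for both values of \<open>l\<close>.\<close>

lemma homotopy_R3:
  assumes "xz + yz = 1 + xx + yy"
  shows "homotopy.R3 xy xz yz xx yy zz"
proof (rule homotopy.R3_general[OF _ assms])
  show "homotopy.R3 0 0 1 l 1 0" for l
    unfolding homotopy.R3_def
  proof (intro allI impI, elim conjE)
    fix V :: "nat set" and n x y z
    assume *: "finite V" "sym_mat V n" "{x, y, z} \<subseteq> V" "x \<noteq> y" "x \<noteq> z" "y \<noteq> z" "n x y = 0" "n x z = 0"
      "n y z = 1" "n x x = l" "n y y = 1" "n z z = 0" "\<forall>k\<in>V - {x, y, z}. n k x + n k y + n k z = 0"
    then have "omega3 (looped_of V n) (looped_of V (toggle3 x y z n))" by (intro omega3_looped_of) auto
    then show "homotopic (looped_of V n) (looped_of V (toggle3 x y z n))"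
      using *(1) by (intro homotopic_step) (simp add: looped_step_def looped_graph_looped_of)
  qed
qed

section \<open>Homotopy classes of graphs on arbitrary vertex types\<close>

lemma homotopy_class_of_eq:
  assumes "graph_iso L L'" "looped_graph L"
  shows "homotopy_class_of L = homotopy_rel `` {L'}"
proof -
  have L': "looped_graph L'" using graph_iso_looped_graph assms by blast
  have "homotopic L' M" if "graph_iso L L''" "homotopic L'' M" for L'' M
  proof -
    have "graph_iso L' L''" using graph_iso_trans[OF graph_iso_sym[OF assms] that(1)] .
    then have "homotopic L' L''" using L' graph_iso_looped_graph[OF that(1) assms(2)] homotopy.iso by blast
    then show ?thesis using that(2) homotopy.trans by blast
  qed
  then show ?thesis unfolding homotopy_class_of_def using assms(1) by blast
qed

lemma ex_nat_copy:
  assumes "finite V"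
  obtains f :: "'v \<Rightarrow> nat" where "inj_on f V"
proof -
  obtain f :: "'v \<Rightarrow> nat" and n :: nat where "f ` V = {i. i < n} \<and> inj_on f V"
    using finite_imp_inj_to_nat_seg[OF assms] by (elim exE)
  then have "inj_on f V" ..
  then show ?thesis by (rule that)
qed

lemma sym_mat_comp:
  assumes "sym_mat V n" "\<And>i. i \<in> W \<Longrightarrow> g i \<in> V"
  shows "sym_mat W (\<lambda>i j. n (g i) (g j))"
  unfolding sym_mat_def using sym_matD[OF assms(1)] assms(2) by simp

lemma homotopy_class_of_looped_of:
  fixes f :: "'v \<Rightarrow> nat"
  assumes "finite V" "V \<subseteq> W" "inj_on f W"
  shows "homotopy_class_of (looped_of V n) =
    homotopy_rel `` {looped_of (f ` V) (\<lambda>i j. n (the_inv_into W f i) (the_inv_into W f j))}"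
proof (rule homotopy_class_of_eq[OF _ looped_graph_looped_of[OF assms(1)]])
  have "inj_on f V" using assms(2,3) inj_on_subset by blast
  then show "graph_iso (looped_of V n)
      (looped_of (f ` V) (\<lambda>i j. n (the_inv_into W f i) (the_inv_into W f j)))"
    using assms(2) by (intro graph_iso_looped_ofI[where f = f])
      (auto simp: bij_betw_def the_inv_into_f_f[OF assms(3)] subset_iff)
qed

text \<open>The vertices coming from diagrams are sets of reals. Two graphs on such vertices are
  compared through a single injection of a common vertex set into the naturals.\<close>

lemma homotopy_class_of_eqI:
  fixes f :: "'v \<Rightarrow> nat"
  assumes "finite V" "V \<subseteq> W" "finite V'" "V' \<subseteq> W" "inj_on f W"
    "homotopic (looped_of (f ` V) (\<lambda>i j. n (the_inv_into W f i) (the_inv_into W f j)))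
      (looped_of (f ` V') (\<lambda>i j. n' (the_inv_into W f i) (the_inv_into W f j)))"
  shows "homotopy_class_of (looped_of V n) = homotopy_class_of (looped_of V' n')"
  unfolding homotopy_class_of_looped_of[OF assms(1,2,5)] homotopy_class_of_looped_of[OF assms(3,4,5)]
  using equiv_class_eq[OF equiv_homotopy_rel assms(6)] .

lemma homotopy_class_of_iso:
  fixes L :: "'v graph" and M :: "'w graph"
  assumes "graph_iso L M" "looped_graph L"
  shows "homotopy_class_of L = homotopy_class_of M"
proof -
  have M: "looped_graph M" using graph_iso_looped_graph assms by blast
  have "finite (verts M)" using M by (simp add: looped_graph_def)
  then obtain f :: "'w \<Rightarrow> nat" where f: "inj_on f (verts M)" by (rule ex_nat_copy)
  let ?N = "looped_of (f ` verts M) (\<lambda>i j. loop_matrix M (the_inv_into (verts M) f i) (the_inv_into (verts M) f j))"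
  have "graph_iso (looped_of (verts M) (loop_matrix M)) ?N"
    using f by (intro graph_iso_looped_ofI[where f = f]) (auto simp: bij_betw_def the_inv_into_f_f)
  then have "graph_iso M ?N" using looped_of_loop_matrix[OF M] by simp
  then show ?thesis
    using homotopy_class_of_eq[OF graph_iso_trans[OF assms(1)] assms(2)] homotopy_class_of_eq[OF _ M] by metis
qed

lemma homotopy_class_of_isolated:
  assumes "finite V" "x \<notin> V" "sym_mat (insert x V) n" "\<And>y. y \<in> V \<Longrightarrow> n x y = 0"
  shows "homotopy_class_of (looped_of V n) = homotopy_class_of (looped_of (insert x V) n)"
proof -
  let ?W = "insert x V"
  have "finite ?W" using assms(1) by simp
  then obtain f :: "'a \<Rightarrow> nat" where f: "inj_on f ?W" by (rule ex_nat_copy)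
  let ?g = "the_inv_into ?W f" and ?m = "\<lambda>i j. n (the_inv_into ?W f i) (the_inv_into ?W f j)"
  have g: "?g (f k) = k" if "k \<in> ?W" for k using the_inv_into_f_f[OF f that] .
  have "omega1 (looped_of (f ` V) ?m) (looped_of (insert (f x) (f ` V)) ?m)"
  proof (rule omega1_looped_of)
    show "f x \<notin> f ` V" using f assms(2) by auto
    show "sym_mat (insert (f x) (f ` V)) ?m" using g by (intro sym_mat_comp[OF assms(3)]) auto
    show "?m (f x) y = 0" if y: "y \<in> f ` V" for y
    proof -
      obtain l where "l \<in> V" "y = f l" using y by blast
      then show ?thesis using g[of x] g[of l] assms(4) by simp
    qed
  qed
  then have "homotopic (looped_of (f ` V) ?m) (looped_of (f ` ?W) ?m)"
    using assms(1) by (intro homotopic_step) (simp add: looped_step_def looped_graph_looped_of)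
  then show ?thesis using assms(1) f by (intro homotopy_class_of_eqI) auto
qed

lemma homotopy_class_of_twins:
  assumes "finite V" "u \<notin> V" "v \<notin> V" "u \<noteq> v" "sym_mat (insert u (insert v V)) n"
    "\<And>y. y \<in> V \<Longrightarrow> n u y = n v y" "n u u \<noteq> n v v"
  shows "homotopy_class_of (looped_of V n) = homotopy_class_of (looped_of (insert u (insert v V)) n)"
proof -
  let ?W = "insert u (insert v V)"
  have "finite ?W" using assms(1) by simp
  then obtain f :: "'a \<Rightarrow> nat" where f: "inj_on f ?W" by (rule ex_nat_copy)
  let ?g = "the_inv_into ?W f" and ?m = "\<lambda>i j. n (the_inv_into ?W f i) (the_inv_into ?W f j)"
  have g: "?g (f k) = k" if "k \<in> ?W" for k using the_inv_into_f_f[OF f that] .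
  have "homotopic (looped_of (f ` V) ?m) (looped_of (insert (f u) (insert (f v) (f ` V))) ?m)"
  proof (rule homotopy.twins)
    show "f u \<notin> f ` V" "f v \<notin> f ` V" "f u \<noteq> f v" using f assms(2-4) by (auto dest: inj_onD)
    show "sym_mat (insert (f u) (insert (f v) (f ` V))) ?m"
      using g by (intro sym_mat_comp[OF assms(5)]) auto
    show "?m (f u) y = ?m (f v) y" if y: "y \<in> f ` V" for y
    proof -
      obtain l where "l \<in> V" "y = f l" using y by blast
      then show ?thesis using g[of u] g[of v] g[of l] assms(6) by simp
    qed
    show "?m (f u) (f u) \<noteq> ?m (f v) (f v)" using g assms(7) by simp
  qed (use assms(1) in simp)
  then show ?thesis using assms(1) f by (intro homotopy_class_of_eqI[where f = f and W = ?W]) auto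
qed

text \<open>The last assumption is that of \<open>R3_general\<close>; for a Reidemeister triangle it
  relates the writhes of two crossings to their linking with the third.\<close>

lemma homotopy_class_of_toggle3:
  assumes "finite V" "sym_mat V n" "x \<in> V" "y \<in> V" "z \<in> V" "x \<noteq> y" "x \<noteq> z" "y \<noteq> z"
    "\<And>k. k \<in> V - {x, y, z} \<Longrightarrow> n k x + n k y + n k z = 0"
    "n x z + n y z = 1 + n x x + n y y"
  shows "homotopy_class_of (looped_of V n) = homotopy_class_of (looped_of V (toggle3 x y z n))"
proof -
  obtain f :: "'a \<Rightarrow> nat" where f: "inj_on f V" using assms(1) by (rule ex_nat_copy)
  let ?g = "the_inv_into V f" and ?m = "\<lambda>i j. n (the_inv_into V f i) (the_inv_into V f j)"
  have g: "?g (f k) = k" if "k \<in> V" for k using the_inv_into_f_f[OF f that] .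
  have ne: "f k = f l \<longleftrightarrow> k = l" if "k \<in> V" "l \<in> V" for k l using f that by (auto dest: inj_onD)
  have "homotopic (looped_of (f ` V) ?m) (looped_of (f ` V) (toggle3 (f x) (f y) (f z) ?m))"
  proof (rule homotopy.R3D)
    show "homotopy.R3 (?m (f x) (f y)) (?m (f x) (f z)) (?m (f y) (f z)) (?m (f x) (f x)) (?m (f y) (f y)) (?m (f z) (f z))"
      using assms(3-5,10) g by (intro homotopy_R3) simp
    show "sym_mat (f ` V) ?m" using g by (intro sym_mat_comp[OF assms(2)]) auto
    show "?m k (f x) + ?m k (f y) + ?m k (f z) = 0" if k: "k \<in> f ` V - {f x, f y, f z}" for k
    proof -
      obtain l where "l \<in> V" "k = f l" "l \<notin> {x, y, z}" using k by auto
      then show ?thesis using assms(3-5,9) g by simp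
    qed
  qed (use assms ne in auto)
  also have "looped_of (f ` V) (toggle3 (f x) (f y) (f z) ?m) =
      looped_of (f ` V) (\<lambda>i j. toggle3 x y z n (?g i) (?g j))"
  proof (rule looped_of_cong)
    fix i j assume "i \<in> f ` V" "j \<in> f ` V"
    then obtain k l where kl: "i = f k" "j = f l" "k \<in> V" "l \<in> V" by blast
    then show "toggle3 (f x) (f y) (f z) ?m i j = toggle3 x y z n (?g i) (?g j)"
      using assms(3-5) by (simp add: toggle3_def g ne)
  qed simp
  finally show ?thesis using assms(1) f by (intro homotopy_class_of_eqI) auto
qed

section \<open>Labeled graphs as symmetric matrices\<close>

text \<open>Since \<open>M\<close> stands for \<open>A(G) + E\<close>, the framing is recovered by
  adding 1 to the diagonal.\<close>

definition labeled_of :: "'v set \<Rightarrow> ('v \<Rightarrow> 'v \<Rightarrow> bit) \<Rightarrow> ('v \<Rightarrow> vsign) \<Rightarrow> 'v lgraph" where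
  "labeled_of V M s = \<lparr>verts = V, edges = {{i, j} | i j. i \<in> V \<and> j \<in> V \<and> i \<noteq> j \<and> M i j = 1},
     framing = (\<lambda>i. M i i + 1), vsign = s\<rparr>"

lemma labeled_of_sel [simp]: "verts (labeled_of V M s) = V" "vsign (labeled_of V M s) = s"
  by (simp_all add: labeled_of_def)

lemma labeled_graph_labeled_of: "finite V \<Longrightarrow> labeled_graph (labeled_of V M s)"
  by (auto simp: labeled_graph_def labeled_of_def)

lemma label_matrix_labeled_of:
  assumes "sym_mat V M" "i \<in> V" "j \<in> V"
  shows "label_matrix (labeled_of V M s) i j = M i j"
proof -
  have "{i, j} \<in> edges (labeled_of V M s) \<longleftrightarrow> i \<noteq> j \<and> M i j = 1"
    using assms by (auto simp: labeled_of_def doubleton_eq_iff dest: sym_matD)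
  then show ?thesis by (cases "M i j") (auto simp: label_matrix_def labeled_of_def)
qed

lemma lgraph_isoI:
  assumes G: "labeled_graph G" and H: "labeled_graph H" and f: "bij_betw f (verts G) (verts H)"
    and m: "\<And>i j. i \<in> verts G \<Longrightarrow> j \<in> verts G \<Longrightarrow> label_matrix H (f i) (f j) = label_matrix G i j"
    and s: "\<And>v. v \<in> verts G \<Longrightarrow> vsign H (f v) = vsign G v"
  shows "lgraph_iso G H"
proof -
  have inj: "f i = f j \<longleftrightarrow> i = j" if "i \<in> verts G" "j \<in> verts G" for i j
    using f that by (auto simp: bij_betw_def dest: inj_onD)
  have e: "{f i, f j} \<in> edges H \<longleftrightarrow> {i, j} \<in> edges G" if "i \<in> verts G" "j \<in> verts G" "i \<noteq> j" for i j
    using m[of i j] inj[of i j] that by (auto simp: label_matrix_def split: if_splits)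
  have "edges H = image f ` edges G"
  proof (rule subset_antisym; rule subsetI)
    fix d assume d: "d \<in> edges H"
    then obtain x y where xy: "x \<in> verts H" "y \<in> verts H" "x \<noteq> y" "d = {x, y}"
      using H unfolding labeled_graph_def by auto
    then have "x \<in> f ` verts G" "y \<in> f ` verts G" using f by (simp_all add: bij_betw_def)
    then obtain i j where ij: "i \<in> verts G" "j \<in> verts G" "x = f i" "y = f j" by blast
    then have "{i, j} \<in> edges G" using e[of i j] d xy by auto
    moreover have "d = f ` {i, j}" using xy ij by simp
    ultimately show "d \<in> image f ` edges G" by blast
  next
    fix d assume "d \<in> image f ` edges G"
    then obtain c where c: "c \<in> edges G" "d = f ` c" by blast
    then obtain i j where ij: "i \<in> verts G" "j \<in> verts G" "i \<noteq> j" "c = {i, j}"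
      using G unfolding labeled_graph_def by auto
    then show "d \<in> edges H" using e[of i j] c by simp
  qed
  moreover have "framing H (f v) = framing G v" if "v \<in> verts G" for v
    using m[of v v] that by (simp add: label_matrix_def)
  ultimately show ?thesis unfolding lgraph_iso_def iso_by_def using f s by blast
qed

lemma lgraph_isoE:
  assumes "lgraph_iso G H" "labeled_graph G"
  obtains f where "bij_betw f (verts G) (verts H)"
    "\<And>i j. i \<in> verts G \<Longrightarrow> j \<in> verts G \<Longrightarrow> label_matrix H (f i) (f j) = label_matrix G i j"
    "\<And>v. v \<in> verts G \<Longrightarrow> vsign H (f v) = vsign G v"
proof -
  obtain f where f: "bij_betw f (verts G) (verts H)" "edges H = image f ` edges G"
    "\<forall>v\<in>verts G. framing H (f v) = framing G v \<and> vsign H (f v) = vsign G v"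
    using assms(1) unfolding lgraph_iso_def iso_by_def by auto
  have inj: "inj_on f (verts G)" using f(1) by (auto simp: bij_betw_def)
  have "label_matrix H (f i) (f j) = label_matrix G i j" if ij: "i \<in> verts G" "j \<in> verts G" for i j
  proof -
    have "f ` {i, j} \<in> image f ` edges G \<longleftrightarrow> {i, j} \<in> edges G"
    proof
      assume "f ` {i, j} \<in> image f ` edges G"
      then obtain c where c: "c \<in> edges G" "f ` {i, j} = f ` c" by blast
      then have "c \<subseteq> verts G" using assms(2) by (auto simp: labeled_graph_def)
      then have "{i, j} = c" using c(2) inj_on_image_eq_iff[OF inj, of "{i, j}" c] ij by simp
      then show "{i, j} \<in> edges G" using c(1) by simp
    qed (rule imageI)
    then show ?thesis using f ij inj by (simp add: label_matrix_def inj_on_eq_iff)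
  qed
  then show ?thesis using f by (intro that[of f]) auto
qed

section \<open>Equality of graph-links\<close>

abbreviation linked_to :: "nat lgraph \<Rightarrow> nat lgraph \<Rightarrow> bool" where
  "linked_to G H \<equiv> (G, H) \<in> graph_link_rel"

lemma linked_to_step: "lgraph_step G H \<Longrightarrow> linked_to G H"
  by (auto simp: graph_link_rel_def lgraph_step_def intro: r_into_equivclp)

lemma equiv_graph_link_rel: "equiv {G. labeled_graph G} graph_link_rel"
proof (rule equivI)
  show "refl_on {L. labeled_graph L} graph_link_rel" by (auto simp: refl_on_def graph_link_rel_def)
  show "graph_link_rel \<subseteq> {L. labeled_graph L} \<times> {L. labeled_graph L}" by (auto simp: graph_link_rel_def)
  show "Relation.sym graph_link_rel" by (auto simp: sym_def graph_link_rel_def intro: equivclp_sym)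
  show "Relation.trans graph_link_rel" unfolding trans_def graph_link_rel_def by (auto intro: equivclp_trans)
qed

lemma linked_to_sym: "linked_to G H \<Longrightarrow> linked_to H G"
  by (auto simp: graph_link_rel_def intro: equivclp_sym)

lemma linked_to_trans: "linked_to G H \<Longrightarrow> linked_to H K \<Longrightarrow> linked_to G K"
  unfolding graph_link_rel_def by (auto intro: equivclp_trans)

lemma linked_to_iso: "labeled_graph G \<Longrightarrow> labeled_graph H \<Longrightarrow> lgraph_iso G H \<Longrightarrow> linked_to G H"
  by (rule linked_to_step) (simp add: lgraph_step_def)

section \<open>The looped graph of a labeled graph\<close>

text \<open>
  The looped graph has the off-diagonal entries of the inverse of \<open>A(G) + E\<close>; its loop at a vertex
  records the diagonal entry corrected by the sign, the writhe number of that vertex.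
\<close>

definition realizes :: "'v lgraph \<Rightarrow> 'v graph \<Rightarrow> bool" where
  "realizes G L \<longleftrightarrow> labeled_graph G \<and> looped_graph L \<and> verts L = verts G \<and>
     sinv (verts G) (label_matrix G) (\<lambda>i j. loop_matrix L i j + of_bool (i = j \<and> vsign G i = Minus))"

lemma realizesI:
  assumes "labeled_graph G" "looped_graph L" "verts L = verts G" "sinv (verts G) M N"
    "\<And>i j. i \<in> verts G \<Longrightarrow> j \<in> verts G \<Longrightarrow> label_matrix G i j = M i j"
    "\<And>i j. i \<in> verts G \<Longrightarrow> j \<in> verts G \<Longrightarrow> i \<noteq> j \<Longrightarrow> loop_matrix L i j = N i j"
    "\<And>i. i \<in> verts G \<Longrightarrow> N i i = loop_matrix L i i + of_bool (vsign G i = Minus)"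
  shows "realizes G L"
proof -
  have "sinv (verts G) (label_matrix G) (\<lambda>i j. loop_matrix L i j + of_bool (i = j \<and> vsign G i = Minus))
    \<longleftrightarrow> sinv (verts G) M N"
  proof (rule sinv_cong)
    fix i j assume "i \<in> verts G" "j \<in> verts G"
    then show "loop_matrix L i j + of_bool (i = j \<and> vsign G i = Minus) = N i j"
      using assms(6)[of i j] assms(7)[of i] by (cases "i = j") auto
  qed (use assms(5) in blast)
  then show ?thesis unfolding realizes_def using assms(1-4) by blast
qed

lemma sinv_sym_mat: "sinv V M N \<Longrightarrow> sym_mat V M" "sinv V M N \<Longrightarrow> sym_mat V N"
  unfolding sinv_def sym_mat_def by blast+

lemma ex_realizes:
  assumes "labeled_graph G" "sinv (verts G) (label_matrix G) N"
  shows "\<exists>L. realizes G L"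
proof -
  let ?n = "\<lambda>i j. N i j + of_bool (i = j \<and> vsign G i = Minus)"
  have s: "sym_mat (verts G) ?n" using sinv_sym_mat(2)[OF assms(2)] unfolding sym_mat_def by auto
  have "realizes G (looped_of (verts G) ?n)"
  proof (rule realizesI[OF assms(1) _ _ assms(2)])
    show "looped_graph (looped_of (verts G) ?n)"
      using assms(1) by (intro looped_graph_looped_of) (simp add: labeled_graph_def)
  qed (simp_all add: loop_matrix_looped_of[OF s] add.assoc)
  then show ?thesis ..
qed

lemma realizes_unique:
  assumes "realizes G L" "realizes G L'"
  shows "L = L'"
proof -
  have L: "looped_graph L" "looped_graph L'" "verts L = verts G" "verts L' = verts G"
    using assms by (auto simp: realizes_def)
  have "loop_matrix L i j = loop_matrix L' i j" if "i \<in> verts G" "j \<in> verts G" for i j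
  proof -
    have "loop_matrix L i j + of_bool (i = j \<and> vsign G i = Minus) =
        loop_matrix L' i j + of_bool (i = j \<and> vsign G i = Minus)"
      using sinv_unique[OF conjunct2[OF conjunct2[OF conjunct2[OF assms(1)[unfolded realizes_def]]]]
        conjunct2[OF conjunct2[OF conjunct2[OF assms(2)[unfolded realizes_def]]]] that] .
    then show ?thesis by simp
  qed
  then have "looped_of (verts L) (loop_matrix L) = looped_of (verts L') (loop_matrix L')"
    using L(3,4) by (intro looped_of_cong) auto
  then show ?thesis using looped_of_loop_matrix[OF L(1)] looped_of_loop_matrix[OF L(2)] by simp
qed

lemma realizes_labeled_of:
  assumes "sinv V M N" "looped_graph L" "verts L = V"
    "\<And>i j. i \<in> V \<Longrightarrow> j \<in> V \<Longrightarrow> i \<noteq> j \<Longrightarrow> loop_matrix L i j = N i j"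
    "\<And>i. i \<in> V \<Longrightarrow> N i i = loop_matrix L i i + of_bool (s i = Minus)"
  shows "realizes (labeled_of V M s) L"
  using assms
  by (intro realizesI[where M = M and N = N])
    (simp_all add: labeled_graph_labeled_of sinvD(1) label_matrix_labeled_of[OF sinv_sym_mat(1)[OF assms(1)]])

definition sign_of_bit :: "bit \<Rightarrow> vsign" where
  "sign_of_bit b = (if b = 1 then Minus else Plus)"

lemma of_bool_sign_of_bit [simp]: "of_bool (sign_of_bit b = Minus) = b"
  by (cases b) (auto simp: sign_of_bit_def)

text \<open>The signs absorb the diagonal of the inverse: any diagonal that makes the matrix
  invertible will do, and the sign of a vertex records whether its diagonal entry differs from its
  loop.\<close>

lemma ex_realized:
  assumes "looped_graph L"
  shows "\<exists>G. realizes G L"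
proof -
  have "finite (verts L)" using assms by (simp add: looped_graph_def)
  then have "\<exists>d M. sinv (verts L) M (\<lambda>i j. if i = j then d i else loop_matrix L i j)"
    by (rule ex_sinv_diagonal) (rule loop_matrix_commute)
  then obtain d M where s: "sinv (verts L) M (\<lambda>i j. if i = j then d i else loop_matrix L i j)"
    by (elim exE)
  have "realizes (labeled_of (verts L) M (\<lambda>i. sign_of_bit (d i + loop_matrix L i i))) L"
    by (rule realizes_labeled_of[OF s assms]) (simp_all add: ac_simps)
  then show ?thesis ..
qed

lemma realizesD:
  assumes "realizes G L"
  shows "labeled_graph G" "looped_graph L" "verts L = verts G" "finite (verts G)"
    "sinv (verts G) (label_matrix G) (\<lambda>i j. loop_matrix L i j + of_bool (i = j \<and> vsign G i = Minus))"
  using assms by (auto simp: realizes_def labeled_graph_def)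

lemma realizes_iso:
  assumes "realizes G L" "lgraph_iso G H" "labeled_graph H"
  shows "\<exists>M. realizes H M \<and> graph_iso L M"
proof -
  note D = realizesD[OF assms(1)]
  obtain f where f: "bij_betw f (verts G) (verts H)"
    "\<And>i j. i \<in> verts G \<Longrightarrow> j \<in> verts G \<Longrightarrow> label_matrix H (f i) (f j) = label_matrix G i j"
    "\<And>v. v \<in> verts G \<Longrightarrow> vsign H (f v) = vsign G v"
    using lgraph_isoE[OF assms(2) D(1)] by metis
  have V: "verts H = f ` verts G" "inj_on f (verts G)" using f(1) by (auto simp: bij_betw_def)
  let ?g = "the_inv_into (verts G) f"
  have g: "?g (f i) = i" if "i \<in> verts G" for i using the_inv_into_f_f[OF V(2) that] .
  define n where "n i j = loop_matrix L (?g i) (?g j)" for i j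
  define M where "M = looped_of (verts H) n"
  have sn: "sym_mat (verts H) n" by (simp add: sym_mat_def n_def loop_matrix_commute)
  have n: "loop_matrix M (f i) (f j) = loop_matrix L i j" if "i \<in> verts G" "j \<in> verts G" for i j
    unfolding M_def using that V by (subst loop_matrix_looped_of[OF sn]) (simp_all add: n_def g)
  have "sinv (f ` verts G) (label_matrix H) (\<lambda>i j. loop_matrix M i j + of_bool (i = j \<and> vsign H i = Minus))"
    unfolding sinv_image[OF V(2)]
  proof (rule iffD1[OF sinv_cong D(5)])
    fix i j assume ij: "i \<in> verts G" "j \<in> verts G"
    then show "label_matrix G i j = label_matrix H (f i) (f j)" using f(2) by simp
    show "loop_matrix L i j + of_bool (i = j \<and> vsign G i = Minus) =
        loop_matrix M (f i) (f j) + of_bool (f i = f j \<and> vsign H (f i) = Minus)"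
      using ij n[OF ij] f(3)[OF ij(1)] inj_on_eq_iff[OF V(2) ij] by simp
  qed
  then have "realizes H M" unfolding realizes_def V(1)[symmetric]
    using assms(3) by (auto simp: M_def looped_graph_looped_of labeled_graph_def)
  moreover have "graph_iso (looped_of (verts L) (loop_matrix L)) M"
    unfolding M_def using f(1) D(3) by (intro graph_iso_looped_ofI[where f = f]) (auto simp: n_def g)
  ultimately show ?thesis using looped_of_loop_matrix[OF D(2)] by auto
qed

lemma realized_iso:
  assumes "realizes G L" "graph_iso L M"
  shows "\<exists>H. realizes H M \<and> lgraph_iso G H"
proof -
  note D = realizesD[OF assms(1)]
  obtain f where f: "iso_by f L M" using assms(2) by (auto simp: graph_iso_def)
  have M: "looped_graph M" using graph_iso_looped_graph[OF assms(2) D(2)] .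
  have V: "verts M = f ` verts G" "inj_on f (verts G)" "bij_betw f (verts G) (verts M)"
    using f D(3) by (auto simp: iso_by_def bij_betw_def)
  let ?g = "the_inv_into (verts G) f"
  have g: "?g (f i) = i" if "i \<in> verts G" for i using the_inv_into_f_f[OF V(2) that] .
  define A where "A i j = label_matrix G (?g i) (?g j)" for i j
  define s where "s i = vsign G (?g i)" for i
  define H where "H = labeled_of (verts M) A s"
  have sA: "sym_mat (verts M) A" by (simp add: sym_mat_def A_def label_matrix_commute)
  have fin: "finite (verts M)" using M by (simp add: looped_graph_def)
  have lG: "labeled_graph H" unfolding H_def by (rule labeled_graph_labeled_of[OF fin])
  have A: "label_matrix H (f i) (f j) = label_matrix G i j" if "i \<in> verts G" "j \<in> verts G" for i j
    unfolding H_def using that V by (subst label_matrix_labeled_of[OF sA]) (simp_all add: A_def g)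
  have vH: "verts H = f ` verts G" by (simp add: H_def V)
  have sH: "vsign H (f i) = vsign G i" if "i \<in> verts G" for i using that by (simp add: H_def s_def g)
  have iso: "lgraph_iso G H" using V vH sH A by (intro lgraph_isoI[OF D(1) lG, where f = f]) auto
  have "sinv (f ` verts G) (label_matrix H) (\<lambda>i j. loop_matrix M i j + of_bool (i = j \<and> vsign H i = Minus))"
    unfolding sinv_image[OF V(2)]
  proof (rule iffD1[OF sinv_cong D(5)])
    fix i j assume ij: "i \<in> verts G" "j \<in> verts G"
    then show "label_matrix G i j = label_matrix H (f i) (f j)" using A by simp
    show "loop_matrix L i j + of_bool (i = j \<and> vsign G i = Minus) =
        loop_matrix M (f i) (f j) + of_bool (f i = f j \<and> vsign H (f i) = Minus)"
      using ij iso_by_loop_matrix[OF f D(2)] D(3) sH[OF ij(1)] inj_on_eq_iff[OF V(2) ij] by simp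
  qed
  then have "realizes H M" unfolding realizes_def using lG M vH V(1) by simp
  then show ?thesis using iso by blast
qed

section \<open>Labeled graphs with the same looped graph\<close>

lemma label_matrix_eq_1:
  "label_matrix G i j = 1 \<longleftrightarrow> (if i = j then framing G i = 0 else {i, j} \<in> edges G)"
  by (auto simp: label_matrix_def)

lemma edge_toggle:
  "edges (toggle P G) = sym_diff (edges G) P" "verts (toggle P G) = verts G"
  by (simp_all add: toggle_def)

lemma label_matrix_xor:
  assumes "framing H i = framing G i + of_bool Q"
    "i \<noteq> j \<Longrightarrow> {i, j} \<in> edges H \<longleftrightarrow> ({i, j} \<in> edges G) \<noteq> R"
  shows "label_matrix H i j = label_matrix G i j + of_bool (if i = j then Q else R)"
proof (cases "i = j")
  case True
  then show ?thesis using assms(1) by (simp add: label_matrix_def ac_simps)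
next
  case False
  have "of_bool ({i, j} \<in> edges H) = (of_bool (({i, j} \<in> edges G) \<noteq> R) :: bit)"
    using assms(2)[OF False] by (rule arg_cong[where f = of_bool])
  then show ?thesis by (simp only: label_matrix_def False if_False of_bool_xor)
qed

text \<open>Toggling the pairs of neighbours together with their framings adds the product of column
  and row \<open>v\<close>, diagonal included. This is the update of
  \<open>sinv_local_complement\<close>, so the inverse changes at \<open>(v, v)\<close> only, and
  the new sign of \<open>v\<close> absorbs the change.\<close>

lemma local_complement_realizes:
  assumes "realizes G L" "v \<in> verts G" "framing G v = 1"
    and H_def: "H = (LC G v)\<lparr>framing := (\<lambda>u. if u \<in> nbhd G v then framing G u + 1 else framing G u),
                  vsign := (vsign G)(v := flip (vsign G v))\<rparr>"
  shows "labeled_graph H" "realizes H L"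
proof -
  note D = realizesD[OF assms(1)]
  let ?P = "{{a, b} | a b. a \<in> nbhd G v \<and> b \<in> nbhd G v \<and> a \<noteq> b}"
  have H: "verts H = verts G" "edges H = sym_diff (edges G) ?P"
    "framing H = (\<lambda>u. if u \<in> nbhd G v then framing G u + 1 else framing G u)"
    "vsign H = (vsign G)(v := flip (vsign G v))"
    unfolding H_def LC_def by (simp_all add: toggle_def)
  have nb: "nbhd G v \<subseteq> verts G"
    using D(1) unfolding labeled_graph_def nbhd_def by (auto simp: doubleton_eq_iff)
  show lH: "labeled_graph H"
  proof -
    have "\<exists>u\<in>verts G. \<exists>v\<in>verts G. u \<noteq> v \<and> d = {u, v}" if d: "d \<in> edges H" for d
    proof -
      consider "d \<in> edges G" | a b where "a \<in> nbhd G v" "b \<in> nbhd G v" "a \<noteq> b" "d = {a, b}"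
        using d H(2) by auto
      then show ?thesis
      proof cases
        case 1
        then show ?thesis using D(1) unfolding labeled_graph_def by simp
      next
        case 2
        then show ?thesis using nb by blast
      qed
    qed
    then show ?thesis unfolding labeled_graph_def H(1) using D(4) by blast
  qed
  have nbm: "i \<in> nbhd G v \<longleftrightarrow> label_matrix G i v = 1" if "i \<noteq> v" for i
    using that by (simp add: nbhd_def label_matrix_eq_1)
  have vv: "label_matrix G v v = 0" using assms(3) by (simp add: label_matrix_def)
  have nbm': "i \<in> nbhd G v \<longleftrightarrow> label_matrix G i v = 1" for i
    using nbm[of i] vv by (cases "i = v") (auto simp: nbhd_def)
  have m: "label_matrix H i j = label_matrix G i j + label_matrix G i v * label_matrix G v j" for i j
  proof -
    have "label_matrix H i j = label_matrix G i j +
        of_bool (if i = j then i \<in> nbhd G v else i \<in> nbhd G v \<and> j \<in> nbhd G v)"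
    proof (rule label_matrix_xor)
      show "framing H i = framing G i + of_bool (i \<in> nbhd G v)" by (simp add: H)
      assume "i \<noteq> j"
      then have "{i, j} \<in> ?P \<longleftrightarrow> i \<in> nbhd G v \<and> j \<in> nbhd G v" by (auto simp: doubleton_eq_iff)
      then show "{i, j} \<in> edges H \<longleftrightarrow> ({i, j} \<in> edges G) \<noteq> (i \<in> nbhd G v \<and> j \<in> nbhd G v)"
        unfolding H(2) by blast
    qed
    also have "(if i = j then i \<in> nbhd G v else i \<in> nbhd G v \<and> j \<in> nbhd G v) \<longleftrightarrow>
        label_matrix G i v = 1 \<and> label_matrix G j v = 1"
      by (simp add: nbm')
    also have "of_bool \<dots> = label_matrix G i v * label_matrix G v j"
      unfolding label_matrix_commute[of G v j]
      by (cases "label_matrix G i v"; cases "label_matrix G j v") simp_all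
    finally show ?thesis .
  qed
  show "realizes H L"
  proof (rule realizesI[OF lH D(2)])
    show "sinv (verts H) (\<lambda>i j. label_matrix G i j + label_matrix G i v * label_matrix G v j)
      (\<lambda>i j. loop_matrix L i j + of_bool (i = j \<and> vsign G i = Minus) + of_bool (i = v \<and> j = v))"
      unfolding H(1) by (rule sinv_local_complement[OF D(5) assms(2) vv])
    fix i assume "i \<in> verts H"
    show "loop_matrix L i i + of_bool (i = i \<and> vsign G i = Minus) + of_bool (i = v \<and> i = v) =
      loop_matrix L i i + of_bool (vsign H i = Minus)"
      by (cases "vsign G v") (simp_all add: H(4))
  qed (use D m H in auto)
qed

text \<open>In the rank-two update the new row \<open>u\<close> is the old row \<open>v\<close> and
  conversely, whereas \<open>piv\<close> leaves the neighbourhoods of \<open>u\<close> and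
  \<open>v\<close> alone; hence the exchange \<sigma>.\<close>

lemma label_matrix_piv:
  assumes "labeled_graph G" "u \<noteq> v" "i \<in> verts G" "j \<in> verts G" "\<sigma> = (\<lambda>i. if i = u then v else if i = v then u else i)"
    "framing G u = 0" "framing G v = 0" "{u, v} \<in> edges G"
    "edges H = edges (piv G u v)" "framing H = framing G"
  shows "label_matrix H (\<sigma> i) (\<sigma> j) = label_matrix G i j + label_matrix G i u * label_matrix G v j
    + label_matrix G i v * label_matrix G u j"
proof -
  let ?M = "label_matrix G"
  let ?P = "{{x, y} | x y. x \<notin> {u, v} \<and> y \<notin> {u, v} \<and>
     x \<in> nbhd G u \<and> y \<in> nbhd G v \<and> (x \<notin> nbhd G v \<or> y \<notin> nbhd G u)}"
  have eH: "edges H = sym_diff (edges G) ?P" using assms(9) by (simp add: piv_def edge_toggle)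
  have M1: "?M u u = 1" "?M v v = 1" "?M u v = 1" "?M v u = 1"
    using assms by (auto simp: label_matrix_def insert_commute)
  have nb: "x \<in> nbhd G u \<longleftrightarrow> ?M x u = 1" "x \<in> nbhd G v \<longleftrightarrow> ?M x v = 1" if "x \<notin> {u, v}" for x
    using that by (auto simp: nbhd_def label_matrix_eq_1)
  have m: "label_matrix H x y = ?M x y + of_bool (if x = y then False else {x, y} \<in> ?P)" for x y
    by (rule label_matrix_xor) (use assms(10) eH in auto)
  have P0: "{x, y} \<notin> ?P" if "x \<in> {u, v}" for x y
    using that by (auto simp: doubleton_eq_iff)
  \<comment> \<open>A pair is toggled if it qualifies in either order. If both vertices are adjacent
    to both \<open>u\<close> and \<open>v\<close>, the two products cancel, in agreement with the
    exclusion in \<open>piv\<close>.\<close>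
  have bits: "of_bool ((a = 1 \<and> d = 1 \<and> (b \<noteq> 1 \<or> c \<noteq> 1)) \<or> (c = 1 \<and> b = 1 \<and> (d \<noteq> 1 \<or> a \<noteq> 1))) = a * d + b * c"
    for a b c d :: bit
    by (cases a; cases b; cases c; cases d) simp_all
  have P: "of_bool (if x = y then False else {x, y} \<in> ?P) = ?M x u * ?M y v + ?M x v * ?M y u"
    if "x \<notin> {u, v}" "y \<notin> {u, v}" for x y
  proof (cases "x = y")
    case True
    then show ?thesis by (simp add: mult.commute)
  next
    case False
    have "{x, y} \<in> ?P \<longleftrightarrow> (x \<in> nbhd G u \<and> y \<in> nbhd G v \<and> (x \<notin> nbhd G v \<or> y \<notin> nbhd G u)) \<or>
      (y \<in> nbhd G u \<and> x \<in> nbhd G v \<and> (y \<notin> nbhd G v \<or> x \<notin> nbhd G u))"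
      using that by (auto simp: doubleton_eq_iff)
    then show ?thesis unfolding nb[OF that(1)] nb[OF that(2)] by (simp only: False if_False bits)
  qed
  show ?thesis
  proof (cases "i \<in> {u, v} \<or> j \<in> {u, v}")
    case True
    have "label_matrix H x y = ?M x y" if "x \<in> {u, v} \<or> y \<in> {u, v}" for x y
    proof -
      have "{x, y} \<notin> ?P" using P0[of x y] P0[of y x] that insert_commute[of x y "{}"] by metis
      then show ?thesis using m[of x y] by simp
    qed
    then have "label_matrix H (\<sigma> i) (\<sigma> j) = ?M (\<sigma> i) (\<sigma> j)" using True assms(5) by auto
    moreover have "?M i u = ?M u i" "?M i v = ?M v i" "?M j u = ?M u j" "?M j v = ?M v j"
      by (simp_all add: label_matrix_commute)
    ultimately show ?thesis using True assms(2,5) M1 by (auto simp: add_ac)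
  next
    case False
    then have "\<sigma> i = i" "\<sigma> j = j" using assms(5) by auto
    then show ?thesis using m[of i j] P[of i j] False
      by (simp add: label_matrix_commute[of G v j] label_matrix_commute[of G u j] add.assoc)
  qed
qed

text \<open>\<open>K\<close> is the rank-two update itself, with the signs of \<open>u\<close> and
  \<open>v\<close> flipped in place. Exchanging \<open>u\<close> and \<open>v\<close> turns it into
  the result of \<open>omega_g4\<close>, which explains the crosswise signs of that move.\<close>

lemma pivot_realizes:
  assumes "realizes G L" "u \<in> verts G" "v \<in> verts G" "u \<in> nbhd G v" "framing G u = 0" "framing G v = 0"
    and H: "H = (piv G u v)\<lparr>vsign := (vsign G)(u := flip (vsign G v), v := flip (vsign G u))\<rparr>"
  obtains K where "labeled_graph H" "realizes K L" "lgraph_iso K H"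
    "vsign K = (vsign G)(u := flip (vsign G u), v := flip (vsign G v))" "verts K = verts G"
proof -
  note D = realizesD[OF assms(1)]
  let ?P = "{{x, y} | x y. x \<notin> {u, v} \<and> y \<notin> {u, v} \<and>
     x \<in> nbhd G u \<and> y \<in> nbhd G v \<and> (x \<notin> nbhd G v \<or> y \<notin> nbhd G u)}"
  have ne: "u \<noteq> v" and uv: "{u, v} \<in> edges G" using assms(4) by (auto simp: nbhd_def)
  have Hs: "verts H = verts G" "edges H = edges (piv G u v)" "framing H = framing G"
    "vsign H = (vsign G)(u := flip (vsign G v), v := flip (vsign G u))"
    unfolding H by (simp_all add: piv_def toggle_def)
  have eH: "edges H = sym_diff (edges G) ?P" using Hs(2) by (simp add: piv_def edge_toggle)
  have nb: "nbhd G x \<subseteq> verts G" for x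
    using D(1) unfolding labeled_graph_def nbhd_def by (auto simp: doubleton_eq_iff)
  have lH: "labeled_graph H"
  proof -
    have "\<exists>a\<in>verts G. \<exists>b\<in>verts G. a \<noteq> b \<and> d = {a, b}" if d: "d \<in> edges H" for d
    proof -
      consider "d \<in> edges G" | x y where "x \<in> nbhd G u" "y \<in> nbhd G v" "x \<noteq> y" "d = {x, y}"
        using d eH by auto
      then show ?thesis
      proof cases
        case 1
        then show ?thesis using D(1) unfolding labeled_graph_def by simp
      next
        case 2
        then show ?thesis using nb by blast
      qed
    qed
    then show ?thesis unfolding labeled_graph_def Hs(1) using D(4) by blast
  qed
  define \<sigma> where "\<sigma> = (\<lambda>i. if i = u then v else if i = v then u else i)"
  define M where "M i j = label_matrix G i j + label_matrix G i u * label_matrix G v j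
    + label_matrix G i v * label_matrix G u j" for i j
  define s where "s = (vsign G)(u := flip (vsign G u), v := flip (vsign G v))"
  define K where "K = labeled_of (verts G) M s"
  have M1: "label_matrix G u u = 1" "label_matrix G v v = 1" "label_matrix G u v = 1"
    using assms(5,6) uv ne by (auto simp: label_matrix_def)
  have sM: "sinv (verts G) M (\<lambda>i j. loop_matrix L i j + of_bool (i = j \<and> vsign G i = Minus) +
      of_bool (i = j \<and> (i = u \<or> i = v)))"
    unfolding M_def by (rule sinv_pivot[OF D(5) assms(2,3) ne M1])
  have "realizes K L"
    unfolding K_def
  proof (rule realizes_labeled_of[OF sM D(2,3)])
    fix i assume "i \<in> verts G"
    show "loop_matrix L i i + of_bool (i = i \<and> vsign G i = Minus) + of_bool (i = i \<and> (i = u \<or> i = v)) =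
      loop_matrix L i i + of_bool (s i = Minus)"
      using ne by (cases "vsign G i") (auto simp: s_def)
  qed simp
  moreover have "lgraph_iso K H"
  proof (rule lgraph_isoI)
    show "labeled_graph K" unfolding K_def by (rule labeled_graph_labeled_of[OF D(4)])
    show "bij_betw \<sigma> (verts K) (verts H)"
      unfolding K_def Hs(1) labeled_of_sel
      by (rule bij_betwI[where g = \<sigma>]) (use assms(2,3) ne in \<open>auto simp: \<sigma>_def\<close>)
    fix i j assume ij: "i \<in> verts K" "j \<in> verts K"
    have "label_matrix K i j = M i j"
      unfolding K_def using ij by (intro label_matrix_labeled_of[OF sinv_sym_mat(1)[OF sM]]) (auto simp: K_def)
    then show "label_matrix H (\<sigma> i) (\<sigma> j) = label_matrix K i j"
      using label_matrix_piv[OF D(1) ne _ _ \<sigma>_def assms(5,6) uv Hs(2,3)] ij by (simp add: K_def M_def)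
    show "vsign H (\<sigma> i) = vsign K i" using ne by (simp add: K_def Hs(4) s_def \<sigma>_def)
  qed (rule lH)
  ultimately show ?thesis using that[OF lH] by (simp add: K_def s_def)
qed

text \<open>Induction on the number of vertices with different signs. The inverses differ exactly on
  that part of the diagonal, so \<open>sinv_diagonal_step\<close> offers a local complementation or
  a pivot there, which removes one or two differences. Once the signs agree, so do the inverses and
  hence the matrices.\<close>

lemma same_looped_graph:
  fixes G H :: "nat lgraph"
  assumes "realizes G L" "realizes H L"
  shows "linked_to G H"
  using assms
proof (induction "card {i \<in> verts L. vsign G i \<noteq> vsign H i}" arbitrary: G rule: less_induct)
  case less
  note D = realizesD[OF less.prems(1)] and D' = realizesD[OF less.prems(2)]
  define S where "S = {i \<in> verts L. vsign G i \<noteq> vsign H i}"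
  have fin: "finite (verts L)" using D by simp
  have s': "sinv (verts L) (label_matrix H) (\<lambda>i j. loop_matrix L i j + of_bool (i = j \<and> vsign G i = Minus) +
      of_bool (i = j \<and> i \<in> S))"
  proof (rule iffD1[OF sinv_cong D'(5)[folded D'(3)]])
    fix i j assume "i \<in> verts L" "j \<in> verts L"
    then show "loop_matrix L i j + of_bool (i = j \<and> vsign H i = Minus) =
        loop_matrix L i j + of_bool (i = j \<and> vsign G i = Minus) + of_bool (i = j \<and> i \<in> S)"
      by (cases "vsign G i"; cases "vsign H i") (auto simp: S_def)
  qed simp
  note s = D(5)[folded D(3)]
  show ?case
  proof (cases "S = {}")
    case True
    have "lgraph_iso G H"
    proof (rule lgraph_isoI[OF D(1) D'(1), where f = "\<lambda>x. x"])
      show "bij_betw (\<lambda>x. x) (verts G) (verts H)" using D(3) D'(3) by (simp add: bij_betw_def)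
      show "vsign H v = vsign G v" if "v \<in> verts G" for v using that True D(3) by (auto simp: S_def)
      fix i j assume "i \<in> verts G" "j \<in> verts G"
      then have ij: "i \<in> verts L" "j \<in> verts L" using D(3) by simp_all
      have "sinv (verts L) (label_matrix H) (\<lambda>i j. loop_matrix L i j + of_bool (i = j \<and> vsign G i = Minus))"
        using s' True by simp
      from sinv_unique[OF this[unfolded sinv_commute[of _ "label_matrix H"]] s[unfolded sinv_commute[of _ "label_matrix G"]] ij]
      show "label_matrix H i j = label_matrix G i j" .
    qed
    then show ?thesis using linked_to_iso D(1) D'(1) by blast
  next
    case False
    have "S \<subseteq> verts L" by (auto simp: S_def)
    from sinv_diagonal_step[OF s s' this False]
    consider (1) v where "v \<in> S" "label_matrix G v v = 0"
      | (2) u v where "u \<in> S" "v \<in> S" "u \<noteq> v" "label_matrix G u u = 1" "label_matrix G v v = 1" "label_matrix G u v = 1"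
      by blast
    then show ?thesis
    proof cases
      case 1
      then have v: "v \<in> verts G" "framing G v = 1" using D(3) by (auto simp: S_def label_matrix_def)
      define K where "K = (LC G v)\<lparr>framing := (\<lambda>u. if u \<in> nbhd G v then framing G u + 1 else framing G u),
          vsign := (vsign G)(v := flip (vsign G v))\<rparr>"
      have "omega_g4' G K" unfolding omega_g4'_def K_def using v by blast
      moreover have "vsign K = (vsign G)(v := flip (vsign G v))" by (simp add: K_def LC_def toggle_def)
      ultimately have K: "omega_g4' G K" "labeled_graph K" "realizes K L"
          "vsign K = (vsign G)(v := flip (vsign G v))"
        using local_complement_realizes[OF less.prems(1) v K_def] by simp_all
      have "{i \<in> verts L. vsign K i \<noteq> vsign H i} = S - {v}"
        using 1(1) by (cases "vsign G v"; cases "vsign H v") (auto simp: S_def K(4))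
      then have "card {i \<in> verts L. vsign K i \<noteq> vsign H i} < card S"
        using 1(1) fin by (simp add: S_def card_Diff1_less del: card_Diff_insert)
      then have "linked_to K H" using less.hyps[OF _ K(3) less.prems(2)] by (simp add: S_def)
      moreover have "linked_to G K" using K D(1) by (intro linked_to_step) (simp add: lgraph_step_def)
      ultimately show ?thesis using linked_to_trans by blast
    next
      case 2
      have uv: "u \<in> verts G" "v \<in> verts G" "u \<in> nbhd G v" "framing G u = 0" "framing G v = 0"
        using 2 D(3) by (auto simp: S_def label_matrix_eq_1 nbhd_def)
      define K' where "K' = (piv G u v)\<lparr>vsign := (vsign G)(u := flip (vsign G v), v := flip (vsign G u))\<rparr>"
      obtain K where K: "labeled_graph K'" "realizes K L" "lgraph_iso K K'"
          "vsign K = (vsign G)(u := flip (vsign G u), v := flip (vsign G v))"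
        using pivot_realizes[OF less.prems(1) uv K'_def] by metis
      have "{i \<in> verts L. vsign K i \<noteq> vsign H i} = S - {u, v}"
        using 2(1-3) by (cases "vsign G v"; cases "vsign H v"; cases "vsign G u"; cases "vsign H u")
          (auto simp: S_def K(4))
      moreover have "card (S - {u, v}) < card S"
        using 2(1) fin by (intro psubset_card_mono) (auto simp: S_def)
      ultimately have "linked_to K H" using less.hyps[OF _ K(2) less.prems(2)] by (simp add: S_def)
      moreover have "omega_g4 G K'" unfolding omega_g4_def K'_def using uv by blast
      then have "linked_to G K'" using K D(1) by (intro linked_to_step) (simp add: lgraph_step_def)
      moreover have "linked_to K K'" using K realizesD(1)[OF K(2)] by (intro linked_to_iso)
      ultimately show ?thesis using linked_to_trans linked_to_sym by blast
    qed
  qed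
qed

section \<open>Moves of labeled graphs and homotopies of looped graphs\<close>

text \<open>Each half includes the existence of a realized looped graph on the other side, that is,
  invertibility of \<open>A(G) + E\<close> passes between \<open>G\<close> and
  \<open>H\<close>.\<close>

definition compatible :: "nat lgraph \<Rightarrow> nat lgraph \<Rightarrow> bool" where
  "compatible G H \<longleftrightarrow> (\<forall>L. realizes G L \<longrightarrow> (\<exists>M. realizes H M \<and> homotopic L M)) \<and>
     (\<forall>M. realizes H M \<longrightarrow> (\<exists>L. realizes G L \<and> homotopic L M))"

text \<open>The looped graph of \<open>G\<close> is unique, so a homotopy found from the side of
  \<open>H\<close> serves the other half as well.\<close>

lemma compatibleI:
  assumes "\<And>L. realizes G L \<Longrightarrow> \<exists>M. realizes H M"
    and "\<And>M. realizes H M \<Longrightarrow> \<exists>L. realizes G L \<and> homotopic L M"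
  shows "compatible G H"
  unfolding compatible_def
proof (intro conjI allI impI assms(2))
  fix L assume L: "realizes G L"
  obtain M where M: "realizes H M" using assms(1)[OF L] by blast
  obtain L' where L': "realizes G L'" "homotopic L' M" using assms(2)[OF M] by blast
  have "L' = L" using realizes_unique[OF L'(1) L] .
  then show "\<exists>M. realizes H M \<and> homotopic L M" using M L' by blast
qed

lemma compatibleD:
  assumes "compatible G H"
  shows "realizes G L \<Longrightarrow> \<exists>M. realizes H M \<and> homotopic L M"
    "realizes H M \<Longrightarrow> \<exists>L. realizes G L \<and> homotopic L M"
proof -
  show "\<exists>M. realizes H M \<and> homotopic L M" if "realizes G L"
    using assms[unfolded compatible_def, THEN conjunct1, THEN spec, THEN mp, OF that] .
  show "\<exists>L. realizes G L \<and> homotopic L M" if "realizes H M"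
    using assms[unfolded compatible_def, THEN conjunct2, THEN spec, THEN mp, OF that] .
qed

lemma ex_homotopic_commute: "(\<exists>M. P M \<and> homotopic L M) \<longleftrightarrow> (\<exists>M. P M \<and> homotopic M L)"
proof -
  have "homotopic L M \<longleftrightarrow> homotopic M L" for M
    using homotopy.sym[of L M] homotopy.sym[of M L] by (rule iffI)
  then show ?thesis by (intro ex_cong1 conj_cong refl)
qed

lemma compatible_sym:
  assumes "compatible G H"
  shows "compatible H G"
  unfolding compatible_def
proof (intro conjI allI impI)
  fix L assume "realizes H L"
  from compatibleD(2)[OF assms this]
  show "\<exists>M. realizes G M \<and> homotopic L M" by (rule iffD2[OF ex_homotopic_commute])
next
  fix M assume "realizes G M"
  from compatibleD(1)[OF assms this]
  show "\<exists>L. realizes H L \<and> homotopic L M" by (rule iffD1[OF ex_homotopic_commute])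
qed

lemma sinv_congD:
  assumes "sinv V M N" "\<And>i j. i \<in> V \<Longrightarrow> j \<in> V \<Longrightarrow> M i j = M' i j"
  shows "sinv V M' N"
  by (rule iffD1[OF sinv_cong assms(1)]) (simp_all add: assms(2))

lemma compatible_iso:
  assumes "lgraph_iso G H" "labeled_graph G" "labeled_graph H"
  shows "compatible G H"
proof (rule compatible_sym, rule compatibleI)
  fix L assume "realizes G L"
  then obtain M where "realizes H M" "graph_iso L M" using realizes_iso assms by blast
  moreover from this have "homotopic M L"
    using \<open>realizes G L\<close> homotopy.iso homotopy.sym realizesD(2) by blast
  ultimately show "\<exists>M. realizes H M \<and> homotopic M L" by blast
next
  fix M assume M: "realizes H M"
  obtain f where f: "bij_betw f (verts G) (verts H)"
    "\<And>i j. i \<in> verts G \<Longrightarrow> j \<in> verts G \<Longrightarrow> label_matrix H (f i) (f j) = label_matrix G i j"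
    "\<And>v. v \<in> verts G \<Longrightarrow> vsign H (f v) = vsign G v"
    by (rule lgraph_isoE[OF assms(1,2)]) (rule that)
  have V: "f ` verts G = verts H" "inj_on f (verts G)" using f(1) by (auto simp: bij_betw_def)
  have "sinv (f ` verts G) (label_matrix H) (\<lambda>i j. loop_matrix M i j + of_bool (i = j \<and> vsign H i = Minus))"
    using realizesD(5)[OF M] V by simp
  from sinv_congD[OF this[unfolded sinv_image[OF V(2)]] f(2)]
  show "\<exists>L. realizes G L" using ex_realizes[OF assms(2)] by blast
qed

text \<open>Local complementation keeps the neighbourhood of \<open>v\<close>, so performing the
  move twice restores edges, framings and sign.\<close>

lemma omega_g4'_sym:
  assumes "omega_g4' G H"
  shows "omega_g4' H G"
proof -
  obtain v where v: "v \<in> verts G" "framing G v = 1" and H: "H = (LC G v)\<lparr>framing :=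
      (\<lambda>u. if u \<in> nbhd G v then framing G u + 1 else framing G u), vsign := (vsign G)(v := flip (vsign G v))\<rparr>"
    using assms unfolding omega_g4'_def by auto
  let ?P = "{{a, b} | a b. a \<in> nbhd G v \<and> b \<in> nbhd G v \<and> a \<noteq> b}"
  have sel: "verts H = verts G" "edges H = sym_diff (edges G) ?P"
    "framing H = (\<lambda>u. if u \<in> nbhd G v then framing G u + 1 else framing G u)"
    "vsign H = (vsign G)(v := flip (vsign G v))"
    unfolding H LC_def toggle_def by simp_all
  have "{u, v} \<notin> ?P" for u by (auto simp: nbhd_def doubleton_eq_iff)
  then have nb: "nbhd H v = nbhd G v" unfolding nbhd_def sel(2) by blast
  have "v \<notin> nbhd G v" by (simp add: nbhd_def)
  then have fr: "framing H v = 1" "v \<in> verts H" using v by (simp_all add: sel)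
  have "G = (LC H v)\<lparr>framing := (\<lambda>u. if u \<in> nbhd H v then framing H u + 1 else framing H u),
      vsign := (vsign H)(v := flip (vsign H v))\<rparr>" (is "G = ?K")
  proof (rule lgraph.equality)
    show "edges G = edges ?K" unfolding LC_def nb by (simp add: toggle_def sel(2)) blast
    show "framing G = framing ?K" by (simp add: nb sel(3) fun_eq_iff)
    show "vsign G = vsign ?K" by (cases "vsign G v") (simp_all add: sel(4) fun_eq_iff)
  qed (simp_all add: LC_def toggle_def sel)
  with fr show ?thesis unfolding omega_g4'_def by (intro bexI conjI)
qed

text \<open>A pivot keeps the neighbourhoods of \<open>u\<close> and \<open>v\<close>, so the same
  pairs are toggled back; exchanging and flipping the two signs twice restores them.\<close>

lemma omega_g4_sym:
  assumes "omega_g4 G H"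
  shows "omega_g4 H G"
proof -
  obtain u v where uv: "u \<in> verts G" "v \<in> verts G" "u \<in> nbhd G v" "framing G u = 0" "framing G v = 0"
    and H: "H = (piv G u v)\<lparr>vsign := (vsign G)(u := flip (vsign G v), v := flip (vsign G u))\<rparr>"
    using assms unfolding omega_g4_def by (elim exE conjE) (rule that)
  let ?P = "{{x, y} | x y. x \<notin> {u, v} \<and> y \<notin> {u, v} \<and>
     x \<in> nbhd G u \<and> y \<in> nbhd G v \<and> (x \<notin> nbhd G v \<or> y \<notin> nbhd G u)}"
  have sel: "verts H = verts G" "edges H = sym_diff (edges G) ?P" "framing H = framing G"
    "vsign H = (vsign G)(u := flip (vsign G v), v := flip (vsign G u))"
    unfolding H piv_def toggle_def by simp_all
  have "{x, u} \<notin> ?P" "{x, v} \<notin> ?P" for x by (auto simp: doubleton_eq_iff)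
  then have nb: "nbhd H u = nbhd G u" "nbhd H v = nbhd G v" unfolding nbhd_def sel(2) by blast+
  have ne: "u \<noteq> v" using uv by (simp add: nbhd_def)
  have ff: "flip (flip s) = s" for s by (cases s) simp_all
  have "G = (piv H u v)\<lparr>vsign := (vsign H)(u := flip (vsign H v), v := flip (vsign H u))\<rparr>" (is "G = ?K")
  proof (rule lgraph.equality)
    show "edges G = edges ?K" unfolding piv_def nb by (simp add: toggle_def sel(2)) blast
    show "vsign G = vsign ?K" using ne by (simp add: sel(4) fun_eq_iff ff)
  qed (simp_all add: piv_def toggle_def sel)
  moreover have "u \<in> nbhd H v" "u \<in> verts H" "v \<in> verts H" "framing H u = 0" "framing H v = 0"
    using uv nb sel(1,3) by simp_all
  ultimately show ?thesis unfolding omega_g4_def by (intro exI conjI)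
qed

lemma compatible_local_complement:
  assumes "omega_g4' G H"
  shows "compatible G H"
proof -
  have fwd: "realizes H L" if G: "realizes G L" and GH: "omega_g4' G H" for G H :: "nat lgraph" and L
  proof -
    obtain v where v: "v \<in> verts G" "framing G v = 1" and H: "H = (LC G v)\<lparr>framing :=
        (\<lambda>u. if u \<in> nbhd G v then framing G u + 1 else framing G u), vsign := (vsign G)(v := flip (vsign G v))\<rparr>"
      using GH unfolding omega_g4'_def by auto
    show ?thesis by (rule local_complement_realizes(2)[OF G v H])
  qed
  show ?thesis unfolding compatible_def
  proof (intro conjI allI impI)
    fix L assume L: "realizes G L"
    then show "\<exists>M. realizes H M \<and> homotopic L M"
      using fwd[OF L assms] homotopy.refl[OF realizesD(2)[OF L]] by blast
  next
    fix M assume M: "realizes H M"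
    then show "\<exists>L. realizes G L \<and> homotopic L M"
      using fwd[OF M omega_g4'_sym[OF assms]] homotopy.refl[OF realizesD(2)[OF M]] by blast
  qed
qed

lemma compatible_pivot:
  assumes "omega_g4 G H"
  shows "compatible G H"
proof -
  have fwd: "\<exists>M. realizes H M \<and> homotopic L M" if G: "realizes G L" and GH: "omega_g4 G H"
    for G H :: "nat lgraph" and L
  proof -
    obtain u v where uv: "u \<in> verts G" "v \<in> verts G" "u \<in> nbhd G v" "framing G u = 0" "framing G v = 0"
      and H: "H = (piv G u v)\<lparr>vsign := (vsign G)(u := flip (vsign G v), v := flip (vsign G u))\<rparr>"
      using GH unfolding omega_g4_def by (elim exE conjE) (rule that)
    obtain K where "labeled_graph H" "realizes K L" "lgraph_iso K H"
      "vsign K = (vsign G)(u := flip (vsign G u), v := flip (vsign G v))" "verts K = verts G"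
      by (rule pivot_realizes[OF G uv H])
    then show ?thesis using compatibleD(1)[OF compatible_iso[of K H], of L] realizesD(1)[of K L] by simp
  qed
  show ?thesis unfolding compatible_def
  proof (intro conjI allI impI)
    fix L assume "realizes G L"
    then show "\<exists>M. realizes H M \<and> homotopic L M" by (rule fwd[OF _ assms])
  next
    fix M assume "realizes H M"
    then have "\<exists>L. realizes G L \<and> homotopic M L" by (rule fwd[OF _ omega_g4_sym[OF assms]])
    then show "\<exists>L. realizes G L \<and> homotopic L M" by (rule iffD1[OF ex_homotopic_commute])
  qed
qed

lemma labeled_edge_verts:
  "labeled_graph G \<Longrightarrow> {i, j} \<in> edges G \<Longrightarrow> i \<in> verts G \<and> j \<in> verts G"
  unfolding labeled_graph_def by (auto simp: doubleton_eq_iff)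

lemma omega_g1_matrix:
  assumes "x \<notin> verts G" "labeled_graph G"
    and H: "H = G\<lparr>verts := insert x (verts G), framing := (framing G)(x := 0), vsign := (vsign G)(x := \<alpha>)\<rparr>"
  shows "labeled_graph H" "verts H = insert x (verts G)" "label_matrix H x x = 1" "vsign H x = \<alpha>"
    "\<And>y. y \<in> verts G \<Longrightarrow> label_matrix H x y = 0 \<and> label_matrix H y x = 0"
    "\<And>i j. i \<in> verts G \<Longrightarrow> j \<in> verts G \<Longrightarrow> label_matrix H i j = label_matrix G i j"
    "\<And>i. i \<in> verts G \<Longrightarrow> vsign H i = vsign G i"
proof -
  have nx: "{x, y} \<notin> edges G" "{y, x} \<notin> edges G" for y using labeled_edge_verts[OF assms(2)] assms(1) by blast+
  show "labeled_graph H" using assms(2) unfolding H labeled_graph_def by fastforce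
  show "\<And>y. y \<in> verts G \<Longrightarrow> label_matrix H x y = 0 \<and> label_matrix H y x = 0"
    using nx assms(1) unfolding H label_matrix_def by auto
  show "\<And>i j. i \<in> verts G \<Longrightarrow> j \<in> verts G \<Longrightarrow> label_matrix H i j = label_matrix G i j"
    using assms(1) unfolding H label_matrix_def by auto
  show "\<And>i. i \<in> verts G \<Longrightarrow> vsign H i = vsign G i" using assms(1) unfolding H by auto
qed (simp_all add: H label_matrix_def)

lemma compatible_isolated:
  assumes "omega_g1 G H" "labeled_graph G"
  shows "compatible G H"
proof -
  obtain x \<alpha> where x: "x \<notin> verts G" and H: "H = G\<lparr>verts := insert x (verts G),
      framing := (framing G)(x := 0), vsign := (vsign G)(x := \<alpha>)\<rparr>"
    using assms(1) unfolding omega_g1_def by blast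
  note m = omega_g1_matrix[OF x assms(2) H]
  show ?thesis
  proof (rule compatibleI)
    fix L assume L: "realizes G L"
    let ?N = "\<lambda>i j. if i = x \<or> j = x then of_bool (i = j)
      else loop_matrix L i j + of_bool (i = j \<and> vsign G i = Minus)"
    have "sinv (verts G) (label_matrix H) ?N"
    proof (rule iffD1[OF sinv_cong realizesD(5)[OF L]])
      fix i j assume ij: "i \<in> verts G" "j \<in> verts G"
      then show "label_matrix G i j = label_matrix H i j" using m(6) by simp
      have "i \<noteq> x" "j \<noteq> x" using ij x by auto
      then show "loop_matrix L i j + of_bool (i = j \<and> vsign G i = Minus) = ?N i j" by simp
    qed
    then have "sinv (insert x (verts G)) (label_matrix H) ?N"
      by (rule sinv_insert) (use x m(3,5) in auto)
    then show "\<exists>M. realizes H M" by (rule ex_realizes[OF m(1), unfolded m(2)])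
  next
    fix M assume M: "realizes H M"
    note D = realizesD[OF M]
    let ?N = "\<lambda>i j. loop_matrix M i j + of_bool (i = j \<and> vsign H i = Minus)"
    have s: "sinv (insert x (verts G)) (label_matrix H) ?N" using D(5) unfolding m(2) .
    have x0: "label_matrix H x y = 0" if "y \<in> verts G" for y using m(5)[OF that] by simp
    have s1: "sinv (verts G) (label_matrix H) ?N" by (rule sinv_insertD(1)[OF s, OF x, OF m(3)]) (rule x0)
    have s3: "?N x y = 0" if y: "y \<in> verts G" for y
      by (rule sinv_insertD(3)[OF s, OF x, OF m(3), OF _ y]) (rule x0)
    define L where "L = looped_of (verts G) (loop_matrix M)"
    have fin: "finite (verts G)" using assms(2) by (simp add: labeled_graph_def)
    have "realizes G L"
    proof (rule realizesI[OF assms(2) _ _ s1])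
      fix i j assume ij: "i \<in> verts G" "j \<in> verts G"
      show "label_matrix G i j = label_matrix H i j" using m(6) ij by simp
      show "loop_matrix L i j = ?N i j" if "i \<noteq> j"
        using that ij by (simp add: L_def loop_matrix_looped_of sym_mat_loop_matrix)
    next
      fix i assume "i \<in> verts G"
      then show "?N i i = loop_matrix L i i + of_bool (vsign G i = Minus)"
        using m(7) by (simp add: L_def loop_matrix_looped_of sym_mat_loop_matrix)
    qed (simp_all add: L_def looped_graph_looped_of fin)
    moreover have "homotopic L M"
    proof -
      have "omega1 L (looped_of (insert x (verts G)) (loop_matrix M))"
        unfolding L_def
      proof (rule omega1_looped_of[OF x sym_mat_loop_matrix])
        show "loop_matrix M x y = 0" if y: "y \<in> verts G" for y
        proof -
          have "x \<noteq> y" using y x by blast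
          then show ?thesis using s3[OF y] by simp
        qed
      qed
      moreover have "looped_of (insert x (verts G)) (loop_matrix M) = M"
        using looped_of_loop_matrix[OF D(2)] D(3) m(2) by simp
      ultimately show ?thesis using D(2) fin
        by (intro homotopic_step) (simp add: looped_step_def L_def looped_graph_looped_of)
    qed
    ultimately show "\<exists>L. realizes G L \<and> homotopic L M" by blast
  qed
qed

lemma realizes_add_isolated:
  assumes "realizes G L" "omega1 L M" "looped_graph M"
  shows "\<exists>H. omega_g1 G H \<and> realizes H M"
proof -
  note D = realizesD[OF assms(1)]
  obtain x where x: "x \<notin> verts L" "verts M = insert x (verts L)"
    "\<And>i j. i \<in> verts L \<Longrightarrow> j \<in> verts L \<Longrightarrow> loop_matrix M i j = loop_matrix L i j"
    "\<And>y. y \<in> verts L \<Longrightarrow> loop_matrix M x y = 0"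
    by (rule omega1D[OF assms(2) D(2)]) (rule that)
  have xG: "x \<notin> verts G" using x D(3) by simp
  \<comment> \<open>The sign that makes the diagonal entry of the inverse at \<open>x\<close> equal
    to 1.\<close>
  define \<alpha> where "\<alpha> = sign_of_bit (loop_matrix M x x + 1)"
  define H where "H = G\<lparr>verts := insert x (verts G), framing := (framing G)(x := 0), vsign := (vsign G)(x := \<alpha>)\<rparr>"
  note m = omega_g1_matrix[OF xG D(1) H_def]
  let ?N = "\<lambda>i j. loop_matrix M i j + of_bool (i = j \<and> vsign H i = Minus)"
  have "sinv (verts G) (label_matrix H) ?N"
  proof (rule iffD1[OF sinv_cong D(5)])
    fix i j assume ij: "i \<in> verts G" "j \<in> verts G"
    then show "label_matrix G i j = label_matrix H i j" using m(6) by simp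
    show "loop_matrix L i j + of_bool (i = j \<and> vsign G i = Minus) = ?N i j"
      using ij x(3) m(7) D(3) by simp
  qed
  then have "sinv (verts H) (label_matrix H) ?N"
    unfolding m(2)
  proof (rule sinv_insert)
    show "x \<notin> verts G" "label_matrix H x x = 1" by (fact xG, fact m(3))
    show "?N x x = 1" by (simp add: m(4) \<alpha>_def ac_simps)
    show "label_matrix H x y = 0 \<and> label_matrix H y x = 0 \<and> ?N x y = 0 \<and> ?N y x = 0" if y: "y \<in> verts G" for y
    proof -
      have "x \<noteq> y" using y xG by blast
      then show ?thesis using m(5)[OF y] x(4)[of y] y D(3) loop_matrix_commute[of M y x] by simp
    qed
  qed
  then have "realizes H M" unfolding realizes_def using m(1,2) assms(3) x(2) D(3) by simp
  moreover have "omega_g1 G H" unfolding omega_g1_def H_def using xG by blast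
  ultimately show ?thesis by blast
qed

lemma omega_g2_matrix:
  assumes "u \<notin> verts G" "v \<notin> verts G" "u \<noteq> v" "N \<subseteq> verts G" "labeled_graph G"
    and H: "H = G\<lparr>verts := insert u (insert v (verts G)),
           edges := edges G \<union> {{u, x} | x. x \<in> N} \<union> {{v, x} | x. x \<in> N} \<union>
                    (if adjacent then {{u, v}} else {}),
           framing := (framing G)(u := of_bool adjacent, v := of_bool adjacent),
           vsign := (vsign G)(u := \<alpha>, v := flip \<alpha>)\<rparr>"
  shows "labeled_graph H" "verts H = insert u (insert v (verts G))"
    "label_matrix H u u = 1 + of_bool adjacent" "label_matrix H v v = 1 + of_bool adjacent"
    "label_matrix H u v = of_bool adjacent" "label_matrix H v u = of_bool adjacent"
    "vsign H u = \<alpha>" "vsign H v = flip \<alpha>"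
    "\<And>y. y \<in> verts G \<Longrightarrow> label_matrix H u y = of_bool (y \<in> N)"
    "\<And>y. y \<in> verts G \<Longrightarrow> label_matrix H v y = of_bool (y \<in> N)"
    "\<And>i j. i \<in> verts G \<Longrightarrow> j \<in> verts G \<Longrightarrow> label_matrix H i j = label_matrix G i j"
    "\<And>i. i \<in> verts G \<Longrightarrow> vsign H i = vsign G i"
proof -
  have vH: "verts H = insert u (insert v (verts G))"
    and fH: "framing H = (framing G)(u := of_bool adjacent, v := of_bool adjacent)"
    and sH: "vsign H = (vsign G)(u := \<alpha>, v := flip \<alpha>)"
    and eH: "edges H = edges G \<union> {{u, x} | x. x \<in> N} \<union> {{v, x} | x. x \<in> N} \<union>
                    (if adjacent then {{u, v}} else {})" unfolding H by simp_all
  have n: "{u, y} \<notin> edges G" "{v, y} \<notin> edges G" for y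
    using labeled_edge_verts[OF assms(5)] assms(1,2) by blast+
  have uN: "u \<notin> N" "v \<notin> N" using assms by auto
  show "labeled_graph H"
  proof -
    have "\<exists>a\<in>verts H. \<exists>b\<in>verts H. a \<noteq> b \<and> d = {a, b}" if d: "d \<in> edges H" for d
    proof -
      consider "d \<in> edges G" | x where "x \<in> N" "d = {u, x}" | x where "x \<in> N" "d = {v, x}" | "d = {u, v}"
        using d unfolding eH by (auto split: if_splits)
      then show ?thesis
      proof cases
        case 1
        then show ?thesis using assms(5) unfolding labeled_graph_def vH by blast
      next
        case (2 x)
        then have "u \<noteq> x" "x \<in> verts H" using uN assms(4) vH by auto
        then show ?thesis using 2 vH by blast
      next
        case (3 x)
        then have "v \<noteq> x" "x \<in> verts H" using uN assms(4) vH by auto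
        then show ?thesis using 3 vH by blast
      next
        case 4
        then show ?thesis using assms(3) vH by blast
      qed
    qed
    then show ?thesis using assms(5) unfolding labeled_graph_def vH by simp
  qed
  have euv: "{u, v} \<in> edges H \<longleftrightarrow> adjacent"
    using n uN assms(3) unfolding eH by (auto simp: doubleton_eq_iff split: if_splits)
  have "{v, u} = {u, v}" by (rule insert_commute)
  then show "label_matrix H u v = of_bool adjacent" "label_matrix H v u = of_bool adjacent"
    using euv assms(3) by (simp_all add: label_matrix_def)
  show "label_matrix H u y = of_bool (y \<in> N)" if "y \<in> verts G" for y
  proof -
    have y: "y \<noteq> u" "y \<noteq> v" using that assms(1,2) by auto
    then have "{u, y} \<in> edges H \<longleftrightarrow> y \<in> N"
      using n uN assms(3) unfolding eH by (auto simp: doubleton_eq_iff split: if_splits)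
    then show ?thesis using y by (simp add: label_matrix_def)
  qed
  show "label_matrix H v y = of_bool (y \<in> N)" if "y \<in> verts G" for y
  proof -
    have y: "y \<noteq> u" "y \<noteq> v" using that assms(1,2) by auto
    then have "{v, y} \<in> edges H \<longleftrightarrow> y \<in> N"
      using n uN assms(3) unfolding eH by (auto simp: doubleton_eq_iff split: if_splits)
    then show ?thesis using y by (simp add: label_matrix_def)
  qed
  show "label_matrix H i j = label_matrix G i j" if "i \<in> verts G" "j \<in> verts G" for i j
  proof -
    have y: "i \<noteq> u" "i \<noteq> v" "j \<noteq> u" "j \<noteq> v" using that assms(1,2) by auto
    then have "{i, j} \<in> edges H \<longleftrightarrow> {i, j} \<in> edges G"
      unfolding eH by (auto simp: doubleton_eq_iff split: if_splits)
    then show ?thesis using y by (simp add: label_matrix_def fH)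
  qed
  show "\<And>i. i \<in> verts G \<Longrightarrow> vsign H i = vsign G i" using assms(1,2) sH by auto
  show "label_matrix H u u = 1 + of_bool adjacent" "label_matrix H v v = 1 + of_bool adjacent"
    using assms(3) by (simp_all add: label_matrix_def fH)
  show "vsign H u = \<alpha>" "vsign H v = flip \<alpha>" using assms(3) sH by simp_all
  show "verts H = insert u (insert v (verts G))" by (rule vH)
qed

text \<open>Twins of \<open>A(G) + E\<close> become twins of the inverse with equal diagonal
  entries. As their signs are opposite, exactly one of them is looped.\<close>

lemma compatible_twins:
  assumes "omega_g2 G H" "labeled_graph G"
  shows "compatible G H"
proof -
  obtain u v \<alpha> N adjacent where uv: "u \<notin> verts G" "v \<notin> verts G" "u \<noteq> v" "N \<subseteq> verts G" and
    H: "H = G\<lparr>verts := insert u (insert v (verts G)),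
           edges := edges G \<union> {{u, x} | x. x \<in> N} \<union> {{v, x} | x. x \<in> N} \<union>
                    (if adjacent then {{u, v}} else {}),
           framing := (framing G)(u := of_bool adjacent, v := of_bool adjacent),
           vsign := (vsign G)(u := \<alpha>, v := flip \<alpha>)\<rparr>"
    using assms(1) unfolding omega_g2_def by (elim exE conjE) (rule that)
  note m = omega_g2_matrix[OF uv assms(2) H]
  have fin: "finite (verts G)" using assms(2) by (simp add: labeled_graph_def)
  show ?thesis
  proof (rule compatibleI)
    fix L assume L: "realizes G L"
    define N0 where "N0 i j = loop_matrix L i j + of_bool (i = j \<and> vsign G i = Minus)" for i j
    define c where "c y = (\<Sum>k\<in>verts G. N0 y k * of_bool (k \<in> N))" for y
    define q where "q = (\<Sum>k\<in>verts G. of_bool (k \<in> N) * c k)"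
    define e where "e = (of_bool adjacent :: bit)"
    define N1 where "N1 i j = (if i \<in> verts G \<and> j \<in> verts G then N0 i j else if i \<in> verts G then c i
      else if j \<in> verts G then c j else if i = j then 1 + e + q else e + q)" for i j
    have s: "sinv (verts G) (label_matrix H) N1"
    proof (rule iffD1[OF sinv_cong realizesD(5)[OF L]])
      fix i j assume ij: "i \<in> verts G" "j \<in> verts G"
      then show "label_matrix G i j = label_matrix H i j" using m(11) by simp
      show "loop_matrix L i j + of_bool (i = j \<and> vsign G i = Minus) = N1 i j"
        using ij by (simp add: N1_def N0_def)
    qed
    have "sinv (insert u (insert v (verts G))) (label_matrix H) N1"
    proof (rule sinv_twins[OF s uv(1-3), where b = "\<lambda>y. of_bool (y \<in> N)" and c = c and q = q and \<epsilon> = e])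
      fix y assume y: "y \<in> verts G"
      show "label_matrix H u y = of_bool (y \<in> N) \<and> label_matrix H y u = of_bool (y \<in> N) \<and>
        label_matrix H v y = of_bool (y \<in> N) \<and> label_matrix H y v = of_bool (y \<in> N)"
        using m(9,10)[OF y] label_matrix_commute[of H y] by simp
      show "c y = (\<Sum>k\<in>verts G. N1 y k * of_bool (k \<in> N))"
        unfolding c_def using y by (intro sum.cong) (simp_all add: N1_def)
      show "N1 u y = c y \<and> N1 y u = c y \<and> N1 v y = c y \<and> N1 y v = c y"
        using y uv by (simp add: N1_def)
    qed (use uv m(3-6) in \<open>simp_all add: N1_def q_def e_def\<close>)
    then show "\<exists>M. realizes H M" by (rule ex_realizes[OF m(1), unfolded m(2)])
  next
    fix M assume M: "realizes H M"
    note D = realizesD[OF M]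
    let ?N = "\<lambda>i j. loop_matrix M i j + of_bool (i = j \<and> vsign H i = Minus)"
    let ?V = "insert u (insert v (verts G))"
    have s: "sinv ?V (label_matrix H) ?N" using D(5) unfolding m(2) .
    have tw: "label_matrix H u y = label_matrix H v y" if "y \<in> verts G" for y
      using m(9,10)[OF that] by simp
    note twD = sinv_twinsD[OF s, OF uv(1-3), where \<epsilon> = "of_bool adjacent"]
    have s1: "sinv (verts G) (label_matrix H) ?N" by (rule twD(1)) (use m(3-6) tw in simp_all)
    have s2: "?N u y = ?N v y" if y: "y \<in> verts G" for y by (rule twD(2)) (use m(3-6) tw y in simp_all)
    have s3: "?N u u = ?N v v" by (rule twD(3)) (use m(3-6) tw in simp_all)
    define L where "L = looped_of (verts G) (loop_matrix M)"
    have "realizes G L"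
    proof (rule realizesI[OF assms(2) _ _ s1])
      fix i j assume ij: "i \<in> verts G" "j \<in> verts G"
      show "label_matrix G i j = label_matrix H i j" using m(11) ij by simp
      show "loop_matrix L i j = ?N i j" if "i \<noteq> j"
        using that ij by (simp add: L_def loop_matrix_looped_of sym_mat_loop_matrix)
    next
      fix i assume "i \<in> verts G"
      then show "?N i i = loop_matrix L i i + of_bool (vsign G i = Minus)"
        using m(12) by (simp add: L_def loop_matrix_looped_of sym_mat_loop_matrix)
    qed (simp_all add: L_def looped_graph_looped_of fin)
    moreover have "homotopic L M"
    proof -
      have "homotopic L (looped_of ?V (loop_matrix M))"
        unfolding L_def
      proof (rule homotopy.twins[OF fin uv(1-3) sym_mat_loop_matrix])
        show "loop_matrix M u y = loop_matrix M v y" if y: "y \<in> verts G" for y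
        proof -
          have "u \<noteq> y" "v \<noteq> y" using y uv by auto
          then show ?thesis using s2[OF y] by simp
        qed
        show "loop_matrix M u u \<noteq> loop_matrix M v v"
          using s3 m(7,8) by (cases \<alpha>; cases "loop_matrix M u u"; cases "loop_matrix M v v") simp_all
      qed
      moreover have "looped_of ?V (loop_matrix M) = M"
        using looped_of_loop_matrix[OF D(2)] D(3) m(2) by simp
      ultimately show ?thesis by simp
    qed
    ultimately show "\<exists>L. realizes G L \<and> homotopic L M" by blast
  qed
qed

text \<open>\<open>sinv_twins\<close> with the two matrices exchanged: twins of the looped graph are
  inverted to twins of the labeled graph.\<close>

lemma realizes_add_twins:
  assumes "realizes G L" "omega2 L M" "looped_graph M"
  shows "\<exists>H. omega_g2 G H \<and> realizes H M"
proof -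
  note D = realizesD[OF assms(1)]
  obtain u v where uvL: "u \<notin> verts L" "v \<notin> verts L" "u \<noteq> v" "verts M = insert u (insert v (verts L))"
    "\<And>i j. i \<in> verts L \<Longrightarrow> j \<in> verts L \<Longrightarrow> loop_matrix M i j = loop_matrix L i j"
    "\<And>y. y \<in> verts L \<Longrightarrow> loop_matrix M u y = loop_matrix M v y"
    "loop_matrix M u u = 1" "loop_matrix M v v = 0"
    by (rule omega2D[OF assms(2) D(2)]) (rule that)
  have uv: "u \<notin> verts G" "v \<notin> verts G" "u \<noteq> v" using uvL D(3) by simp_all
  \<comment> \<open>\<phi> takes the part of \<epsilon> in \<open>sinv_twins\<close>. The sign
    \<alpha> makes both new diagonal entries equal to \<open>1 + \<phi>\<close>, and
    \<open>\<phi> + q\<close> decides both the adjacency and the framing of the new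
    vertices.\<close>
  define \<phi> where "\<phi> = loop_matrix M u v"
  define c where "c y = (\<Sum>k\<in>verts G. label_matrix G y k * loop_matrix M u k)" for y
  define q where "q = (\<Sum>k\<in>verts G. loop_matrix M u k * c k)"
  define N where "N = {y \<in> verts G. c y = 1}"
  define adjacent where "adjacent \<longleftrightarrow> \<phi> + q = 1"
  define \<alpha> where "\<alpha> = sign_of_bit \<phi>"
  define H where "H = G\<lparr>verts := insert u (insert v (verts G)),
           edges := edges G \<union> {{u, x} | x. x \<in> N} \<union> {{v, x} | x. x \<in> N} \<union>
                    (if adjacent then {{u, v}} else {}),
           framing := (framing G)(u := of_bool adjacent, v := of_bool adjacent),
           vsign := (vsign G)(u := \<alpha>, v := flip \<alpha>)\<rparr>"
  have NG: "N \<subseteq> verts G" by (auto simp: N_def)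
  note m = omega_g2_matrix[OF uv NG D(1) H_def]
  have adj: "of_bool adjacent = \<phi> + q" unfolding adjacent_def by (cases \<phi>; cases q) simp_all
  have inN: "of_bool (y \<in> N) = c y" if "y \<in> verts G" for y using that by (cases "c y") (simp_all add: N_def)
  let ?N = "\<lambda>i j. loop_matrix M i j + of_bool (i = j \<and> vsign H i = Minus)"
  have "sinv (verts G) (label_matrix H) ?N"
  proof (rule iffD1[OF sinv_cong D(5)])
    fix i j assume ij: "i \<in> verts G" "j \<in> verts G"
    then show "label_matrix G i j = label_matrix H i j" using m(11) by simp
    show "loop_matrix L i j + of_bool (i = j \<and> vsign G i = Minus) = ?N i j"
      using ij uvL(5) m(12) D(3) by simp
  qed
  then have s: "sinv (verts G) ?N (label_matrix H)" by (simp only: sinv_commute[of _ "label_matrix H"])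
  have "sinv (insert u (insert v (verts G))) ?N (label_matrix H)"
  proof (rule sinv_twins[OF s uv, where b = "loop_matrix M u" and c = c and q = q and \<epsilon> = \<phi>])
    fix y assume y: "y \<in> verts G"
    have "u \<noteq> y" "v \<noteq> y" using y uv by auto
    then show "?N u y = loop_matrix M u y \<and> ?N y u = loop_matrix M u y \<and>
        ?N v y = loop_matrix M u y \<and> ?N y v = loop_matrix M u y"
      using uvL(6)[of y] y D(3) loop_matrix_commute[of M y] by simp
    show "c y = (\<Sum>k\<in>verts G. label_matrix H y k * loop_matrix M u k)"
      unfolding c_def using y m(11) by (intro sum.cong) simp_all
    show "label_matrix H u y = c y \<and> label_matrix H y u = c y \<and> label_matrix H v y = c y \<and> label_matrix H y v = c y"
      using m(9,10)[OF y] label_matrix_commute[of H y] inN[OF y] by simp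
  next
    show "?N u u = 1 + \<phi>" using uvL(7) m(7) by (simp add: \<alpha>_def)
    show "?N v v = 1 + \<phi>" using uvL(8) m(8) by (cases \<phi>) (simp_all add: \<alpha>_def sign_of_bit_def)
    show "?N u v = \<phi>" "?N v u = \<phi>" using uv loop_matrix_commute[of M v u] by (simp_all add: \<phi>_def)
  qed (use m(3-6) adj in \<open>simp_all add: q_def add.assoc\<close>)
  then have "sinv (verts H) (label_matrix H) ?N" unfolding m(2) by (simp only: sinv_commute[of _ "label_matrix H"])
  then have "realizes H M" unfolding realizes_def using m(1,2) assms(3) uvL(4) D(3) by simp
  moreover have "omega_g2 G H" unfolding omega_g2_def H_def using uv NG by blast
  ultimately show ?thesis by blast
qed

subsection \<open>The third move\<close>

lemma omega_g3_matrix: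
  assumes G: "labeled_graph G" and uvw: "{u, v, w} \<subseteq> verts G" "u \<noteq> v" "u \<noteq> w" "v \<noteq> w"
    and lab: "\<forall>x\<in>{u, v, w}. framing G x = 0 \<and> vsign G x = Minus"
    and nb: "nbhd G u = {v, w}" "v \<notin> nbhd G w"
    and H: "H = (toggle ({{u, v}, {u, w}} \<union>
                  {{u, t} | t. t \<in> sym_diff (nbhd G v) (nbhd G w) \<and> t \<noteq> u}) G)
           \<lparr>vsign := (vsign G)(v := Plus, w := Plus)\<rparr>"
  shows "labeled_graph H" "verts H = verts G" "vsign H = (vsign G)(v := Plus, w := Plus)"
    "\<forall>x\<in>{u, v, w}. label_matrix G x x = 1 \<and> label_matrix H x x = 1"
    "label_matrix G u v = 1" "label_matrix G u w = 1" "label_matrix G v w = 0"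
    "label_matrix H u v = 0" "label_matrix H u w = 0" "label_matrix H v w = 0"
    "\<And>x. x \<in> verts G - {u, v, w} \<Longrightarrow> label_matrix G u x = 0 \<and>
       label_matrix H u x = label_matrix G v x + label_matrix G w x \<and>
       label_matrix H v x = label_matrix G v x \<and> label_matrix H w x = label_matrix G w x"
    "\<And>x y. x \<in> verts G - {u, v, w} \<Longrightarrow> y \<in> verts G - {u, v, w} \<Longrightarrow>
       label_matrix H x y = label_matrix G x y"
proof -
  define S where "S = {t. t = v \<or> t = w \<or> t \<noteq> u \<and> (t \<in> nbhd G v \<longleftrightarrow> t \<notin> nbhd G w)}"
  have P: "{{u, v}, {u, w}} \<union> {{u, t} | t. t \<in> sym_diff (nbhd G v) (nbhd G w) \<and> t \<noteq> u} = {{u, t} | t. t \<in> S}"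
    unfolding S_def using uvw by blast
  have eH: "edges H = sym_diff (edges G) {{u, t} | t. t \<in> S}" unfolding H P by (simp add: toggle_def)
  have fH: "framing H = framing G" unfolding H by (simp add: toggle_def)
  show vH: "verts H = verts G" unfolding H by (simp add: toggle_def)
  show "vsign H = (vsign G)(v := Plus, w := Plus)" unfolding H by (simp add: toggle_def)
  have nbs: "x \<in> nbhd G y \<longleftrightarrow> x \<noteq> y \<and> {x, y} \<in> edges G" for x y by (simp add: nbhd_def)
  have nbV: "nbhd G y \<subseteq> verts G" for y using labeled_edge_verts[OF G] by (auto simp: nbs)
  have SV: "S \<subseteq> verts G" "u \<notin> S" unfolding S_def using uvw nbV by auto
  show "labeled_graph H"
  proof -
    have "\<exists>a\<in>verts G. \<exists>b\<in>verts G. a \<noteq> b \<and> d = {a, b}" if d: "d \<in> edges H" for d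
    proof -
      consider "d \<in> edges G" | t where "t \<in> S" "d = {u, t}" using d eH by auto
      then show ?thesis
      proof cases
        case 1
        then show ?thesis using G unfolding labeled_graph_def by simp
      next
        case 2
        moreover from this have "u \<noteq> t" using SV(2) by blast
        ultimately show ?thesis using SV(1) uvw(1) by blast
      qed
    qed
    then show ?thesis using G unfolding labeled_graph_def vH by blast
  qed
  have m: "label_matrix H i j = label_matrix G i j + of_bool (if i = j then False else {i, j} \<in> {{u, t} | t. t \<in> S})" for i j
    by (rule label_matrix_xor) (use fH eH in auto)
  have Pu: "{u, j} \<in> {{u, t} | t. t \<in> S} \<longleftrightarrow> j \<in> S" for j using SV(2) by (auto simp: doubleton_eq_iff)
  have Pn: "{i, j} \<notin> {{u, t} | t. t \<in> S}" if "i \<noteq> u" "j \<noteq> u" for i j using that by (auto simp: doubleton_eq_iff)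
  have mu: "label_matrix H u j = label_matrix G u j + of_bool (j \<in> S)" if "j \<noteq> u" for j
    using m[of u j] Pu[of j] that by simp
  have mn: "label_matrix H i j = label_matrix G i j" if "i \<noteq> u" "j \<noteq> u" for i j
    using m[of i j] Pn[OF that] by simp
  have Gm: "label_matrix G x y = of_bool (x \<in> nbhd G y)" if "x \<noteq> y" for x y
    using that by (simp add: label_matrix_def nbs)
  show "\<forall>x\<in>{u, v, w}. label_matrix G x x = 1 \<and> label_matrix H x x = 1"
    using lab fH by (simp add: label_matrix_def)
  have "v \<in> nbhd G u" "w \<in> nbhd G u" using nb by auto
  then show G1: "label_matrix G u v = 1" "label_matrix G u w = 1"
    using Gm[of v u] Gm[of w u] uvw label_matrix_commute[of G u] by simp_all
  show G0: "label_matrix G v w = 0" using Gm[of v w] uvw nb by simp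
  have "v \<in> S" "w \<in> S" by (auto simp: S_def)
  then show "label_matrix H u v = 0" "label_matrix H u w = 0" using mu G1 uvw by simp_all
  show "label_matrix H v w = 0" using mn G0 uvw by simp
  show "label_matrix G u x = 0 \<and> label_matrix H u x = label_matrix G v x + label_matrix G w x \<and>
       label_matrix H v x = label_matrix G v x \<and> label_matrix H w x = label_matrix G w x"
    if "x \<in> verts G - {u, v, w}" for x
  proof -
    have x: "x \<noteq> u" "x \<noteq> v" "x \<noteq> w" using that by auto
    have "x \<notin> nbhd G u" using nb x by simp
    then have "label_matrix G u x = 0" using Gm[of x u] x label_matrix_commute[of G u x] by simp
    moreover have "label_matrix G v x = of_bool (x \<in> nbhd G v)" "label_matrix G w x = of_bool (x \<in> nbhd G w)"
      using Gm[of x v] Gm[of x w] x label_matrix_commute[of G _ x] by simp_all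
    moreover have "x \<in> S \<longleftrightarrow> (x \<in> nbhd G v \<longleftrightarrow> x \<notin> nbhd G w)" using x by (simp add: S_def)
    ultimately show ?thesis using mu[OF x(1)] mn[of v x] mn[of w x] x uvw
      by (cases "x \<in> nbhd G v"; cases "x \<in> nbhd G w") simp_all
  qed
  show "label_matrix H x y = label_matrix G x y" if "x \<in> verts G - {u, v, w}" "y \<in> verts G - {u, v, w}" for x y
    using that mn by simp
qed

text \<open>Of the ones that \<open>sinv_triangle\<close> adds to the inverse, those at
  \<open>(v, v)\<close> and \<open>(w, w)\<close> are absorbed by switching the signs of
  \<open>v\<close> and \<open>w\<close> to \<open>Plus\<close>; the others are a third move on the
  looped graph, with \<open>v\<close> and \<open>w\<close> exchanged.\<close>

lemma omega_g3_realizes: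
  assumes G: "labeled_graph G" and uvw: "{u, v, w} \<subseteq> verts G" "u \<noteq> v" "u \<noteq> w" "v \<noteq> w"
    and lab: "\<forall>x\<in>{u, v, w}. framing G x = 0 \<and> vsign G x = Minus"
    and nb: "nbhd G u = {v, w}" "v \<notin> nbhd G w"
    and H: "H = (toggle ({{u, v}, {u, w}} \<union>
                  {{u, t} | t. t \<in> sym_diff (nbhd G v) (nbhd G w) \<and> t \<noteq> u}) G)
           \<lparr>vsign := (vsign G)(v := Plus, w := Plus)\<rparr>"
    and \<rho>: "\<rho> = (\<lambda>i. if i = v then w else if i = w then v else i)"
  shows "realizes G L \<Longrightarrow> realizes H (looped_of (verts G) (\<lambda>i j. toggle3 u v w (loop_matrix L) (\<rho> i) (\<rho> j)))"
    and "realizes H M \<Longrightarrow> \<exists>L. realizes G L"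
proof -
  note m = omega_g3_matrix[OF G uvw lab nb H]
  let ?V = "verts G" and ?M = "label_matrix G" and ?M' = "label_matrix H"
  define V0 where "V0 = ?V - {u, v, w}"
  have V: "?V = insert u (insert v (insert w V0))" "u \<notin> V0" "v \<notin> V0" "w \<notin> V0"
    using uvw by (auto simp: V0_def)
  have fin: "finite ?V" "finite V0" using G by (auto simp: V0_def labeled_graph_def)
  define T where "T i j = (of_bool (i \<in> {u, v, w} \<and> j \<in> {u, v, w} \<and> (i, j) \<noteq> (u, u)) :: bit)" for i j
  have tri: "sinv ?V ?M N \<longleftrightarrow> sinv ?V ?M' N'"
    if "\<And>i j. i \<in> ?V \<Longrightarrow> j \<in> ?V \<Longrightarrow> N' i j = N (\<rho> i) (\<rho> j) + T i j" for N N'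
  proof (rule sinv_triangle[OF V uvw(2-4) fin(2), where p = "?M v" and q = "?M w" and \<rho> = \<rho>])
    show "?M u x = 0 \<and> ?M v x = ?M v x \<and> ?M w x = ?M w x" if "x \<in> V0" for x
      using m(11)[of x] that by (simp add: V0_def)
    show "?M' u x = ?M v x + ?M w x \<and> ?M' v x = ?M v x \<and> ?M' w x = ?M w x" if "x \<in> V0" for x
      using m(11)[of x] that by (simp add: V0_def)
    show "?M' x y = ?M x y" if "x \<in> V0" "y \<in> V0" for x y using m(12) that unfolding V0_def .
  qed (use m(4-10) that \<rho> in \<open>simp_all add: label_matrix_commute T_def\<close>)
  have \<rho>V: "\<rho> i \<in> ?V" if "i \<in> ?V" for i using that uvw(1) \<rho> by auto
  have \<rho>\<rho>: "\<rho> (\<rho> i) = i" for i using uvw(2-4) \<rho> by auto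
  have \<rho>eq: "\<rho> i = \<rho> j \<longleftrightarrow> i = j" for i j using \<rho>\<rho> by metis
  have \<rho>u: "\<rho> i = u \<longleftrightarrow> i = u" and \<rho>3: "\<rho> i \<in> {u, v, w} \<longleftrightarrow> i \<in> {u, v, w}" for i using uvw(2-4) \<rho> by auto
  show "realizes H (looped_of ?V (\<lambda>i j. toggle3 u v w (loop_matrix L) (\<rho> i) (\<rho> j)))" if L: "realizes G L"
  proof -
    note D = realizesD[OF L]
    define n where "n i j = toggle3 u v w (loop_matrix L) (\<rho> i) (\<rho> j)" for i j
    have sn: "sym_mat ?V n"
      unfolding n_def by (rule sym_mat_comp[OF sym_mat_toggle3[OF sym_mat_loop_matrix, of ?V] \<rho>V])
    have ln: "loop_matrix (looped_of ?V n) i j = n i j" if "i \<in> ?V" "j \<in> ?V" for i j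
      by (rule loop_matrix_looped_of[OF sn that])
    define N where "N i j = loop_matrix L i j + of_bool (i = j \<and> vsign G i = Minus)" for i j
    have sN: "sinv ?V ?M' (\<lambda>i j. N (\<rho> i) (\<rho> j) + T i j)"
      by (rule iffD1[OF tri]) (use D(5) in \<open>simp_all add: N_def\<close>)
    have "realizes H (looped_of ?V n)"
    proof (rule realizesI[OF m(1)])
      show "looped_graph (looped_of ?V n)" by (rule looped_graph_looped_of[OF fin(1)])
      show "verts (looped_of ?V n) = verts H" using m(2) by simp
      show "sinv (verts H) ?M' (\<lambda>i j. N (\<rho> i) (\<rho> j) + T i j)" using sN unfolding m(2) .
      fix i j assume "i \<in> verts H" "j \<in> verts H"
      then have ij: "i \<in> ?V" "j \<in> ?V" using m(2) by simp_all
      show "?M' i j = ?M' i j" by simp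
      show "loop_matrix (looped_of ?V n) i j = N (\<rho> i) (\<rho> j) + T i j" if "i \<noteq> j"
        unfolding ln[OF ij] n_def toggle3_def N_def T_def \<rho>3 \<rho>eq using that by auto
    next
      fix i assume "i \<in> verts H"
      then have i: "i \<in> ?V" using m(2) by simp
      consider "i = u" | "i = v" | "i = w" | "i \<notin> {u, v, w}" by blast
      then show "N (\<rho> i) (\<rho> i) + T i i = loop_matrix (looped_of ?V n) i i + of_bool (vsign H i = Minus)"
        unfolding ln[OF i i] m(3) using lab uvw(2-4)
        by cases (simp_all add: n_def toggle3_def N_def T_def \<rho>)
    qed
    then show ?thesis unfolding n_def .
  qed
  show "\<exists>L. realizes G L" if M: "realizes H M"
  proof -
    define N' where "N' i j = loop_matrix M i j + of_bool (i = j \<and> vsign H i = Minus)" for i j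
    have "sinv ?V ?M (\<lambda>i j. N' (\<rho> i) (\<rho> j) + T i j)"
    proof (rule iffD2[OF tri])
      show "sinv ?V ?M' N'" using realizesD(5)[OF M] unfolding N'_def m(2) .
      show "N' i j = N' (\<rho> (\<rho> i)) (\<rho> (\<rho> j)) + T (\<rho> i) (\<rho> j) + T i j" for i j
        unfolding \<rho>\<rho> T_def \<rho>3 by (simp add: \<rho>u add.assoc)
    qed
    then show ?thesis by (rule ex_realizes[OF G])
  qed
qed

lemma compatible_triangle:
  assumes "omega_g3 G H" "labeled_graph G"
  shows "compatible G H"
proof -
  obtain u v w where uvw: "{u, v, w} \<subseteq> verts G" "u \<noteq> v" "u \<noteq> w" "v \<noteq> w"
    and lab: "\<forall>x\<in>{u, v, w}. framing G x = 0 \<and> vsign G x = Minus"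
    and nb: "nbhd G u = {v, w}" "v \<notin> nbhd G w"
    and H: "H = (toggle ({{u, v}, {u, w}} \<union>
                  {{u, t} | t. t \<in> sym_diff (nbhd G v) (nbhd G w) \<and> t \<noteq> u}) G)
           \<lparr>vsign := (vsign G)(v := Plus, w := Plus)\<rparr>"
    using assms(1) unfolding omega_g3_def by (elim exE conjE) (rule that)
  define \<rho> where "\<rho> = (\<lambda>i. if i = v then w else if i = w then v else i)"
  note r = omega_g3_realizes[OF assms(2) uvw lab nb H \<rho>_def]
  note m = omega_g3_matrix[OF assms(2) uvw lab nb H]
  let ?V = "verts G"
  have fwd: "\<exists>M. realizes H M \<and> homotopic L M" if L: "realizes G L" for L
  proof -
    note D = realizesD[OF L]
    let ?n = "loop_matrix L"
    let ?T = "toggle3 u v w ?n"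
    define V0 where "V0 = ?V - {u, v, w}"
    have V: "?V = insert u (insert v (insert w V0))" "u \<notin> V0" "v \<notin> V0" "w \<notin> V0"
      using uvw by (auto simp: V0_def)
    have fV: "finite V0" using D(4) by (simp add: V0_def)
    \<comment> \<open>Row \<open>u\<close> of \<open>A(G) + E\<close> is supported on
      \<open>u, v, w\<close>, and their signs are all \<open>Minus\<close>. Its product with the
      inverse gives the parity condition outside the triangle and, at \<open>u\<close> and
      \<open>v\<close>, the relation that \<open>homotopy_R3\<close> asks for.\<close>
    have row: "?n u j + ?n v j + ?n w j + of_bool (j \<in> {u, v, w}) = of_bool (u = j)" if j: "j \<in> ?V" for j
    proof -
      define N where "N i j = ?n i j + of_bool (i = j \<and> vsign G i = Minus)" for i j
      have "(\<Sum>k\<in>?V. label_matrix G u k * N k j) = of_bool (u = j)"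
        using sinvD(4)[OF D(5) _ j, of u] uvw(1) unfolding N_def by blast
      moreover have "(\<Sum>k\<in>V0. label_matrix G u k * N k j) = 0"
        using m(11) by (intro sum.neutral) (simp add: V0_def)
      ultimately have "N u j + (N v j + N w j) = of_bool (u = j)"
        unfolding V(1) using V(2-4) uvw(2-4) m(4-6) fV by (simp add: sum.insert)
      moreover have "N u j + (N v j + N w j) = ?n u j + ?n v j + ?n w j + of_bool (j \<in> {u, v, w})"
        using lab uvw(2-4) by (auto simp: N_def ac_simps)
      ultimately show ?thesis by simp
    qed
    have uV: "u \<in> ?V" "v \<in> ?V" "w \<in> ?V" using uvw(1) by auto
    have c: "?n v u = ?n u v" "?n w u = ?n u w" "?n w v = ?n v w" by (rule loop_matrix_commute)+
    have "homotopic (looped_of ?V ?n) (looped_of ?V ?T)"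
    proof (rule homotopy.R3D[OF homotopy_R3 D(4) sym_mat_loop_matrix uvw])
      have "?n u u + ?n u v + ?n u w + 1 = 1" "?n u v + ?n v v + ?n v w + 1 = 0"
        using row[OF uV(1)] row[OF uV(2)] uvw(2) unfolding c by simp_all
      then show "?n u w + ?n v w = 1 + ?n u u + ?n v v"
        by (cases "?n u v"; cases "?n u w"; cases "?n v w"; cases "?n v v"; cases "?n u u") simp_all
      show "?n k u + ?n k v + ?n k w = 0" if "k \<in> ?V - {u, v, w}" for k
        using row[of k] that loop_matrix_commute[of L k] by auto
    qed
    moreover have "looped_of ?V ?n = L" using looped_of_loop_matrix[OF D(2)] D(3) by simp
    moreover have "homotopic (looped_of ?V (\<lambda>i j. ?T (\<rho> i) (\<rho> j))) (looped_of ?V ?T)"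
    proof (rule homotopy.iso)
      show "graph_iso (looped_of ?V (\<lambda>i j. ?T (\<rho> i) (\<rho> j))) (looped_of ?V ?T)"
      proof (rule graph_iso_looped_ofI)
        show "bij_betw \<rho> ?V ?V" by (rule bij_betwI[where g = \<rho>]) (use uvw in \<open>auto simp: \<rho>_def\<close>)
      qed (rule refl)
    qed (rule looped_graph_looped_of[OF D(4)])+
    ultimately have "homotopic L (looped_of ?V (\<lambda>i j. ?T (\<rho> i) (\<rho> j)))"
      using homotopy.sym homotopy.trans by metis
    then show ?thesis using r(1)[OF L] by blast
  qed
  show ?thesis
  proof (rule compatibleI)
    show "\<exists>M. realizes H M" if "realizes G L" for L using fwd[OF that] by blast
    fix M assume M: "realizes H M"
    then obtain L where L: "realizes G L" using r(2) by blast
    obtain M' where M': "realizes H M'" "homotopic L M'" using fwd[OF L] by blast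
    have "M' = M" by (rule realizes_unique[OF M'(1) M])
    then show "\<exists>L. realizes G L \<and> homotopic L M" using L M'(2) by blast
  qed
qed

lemma compatible_step:
  assumes "lgraph_step G H"
  shows "compatible G H"
  using assms compatible_iso[of G H] compatible_isolated[of G H] compatible_twins[of G H]
    compatible_triangle[of G H] compatible_pivot[of G H] compatible_local_complement[of G H]
  unfolding lgraph_step_def by blast

lemma linked_to_compatible:
  assumes "linked_to G H"
  shows "compatible G H"
proof -
  have "equivclp lgraph_step G H" using assms by (simp add: graph_link_rel_def)
  then show ?thesis
  proof (induction rule: equivclp_induct)
    case base
    show ?case unfolding compatible_def
      using homotopy.refl[OF realizesD(2)] by (intro conjI allI impI exI)
  next
    case (step H K)
    have HK: "compatible H K" using step.hyps compatible_step compatible_sym by metis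
    show ?case unfolding compatible_def
    proof (intro conjI allI impI)
      fix L assume "realizes G L"
      from compatibleD(1)[OF step.IH this] obtain M where M: "realizes H M" "homotopic L M" by (elim exE conjE)
      from compatibleD(1)[OF HK M(1)] obtain M' where M': "realizes K M'" "homotopic M M'" by (elim exE conjE)
      show "\<exists>M. realizes K M \<and> homotopic L M"
        using M'(1) homotopy.trans[OF M(2) M'(2)] by (intro exI conjI)
    next
      fix M' assume "realizes K M'"
      from compatibleD(2)[OF HK this] obtain M where M: "realizes H M" "homotopic M M'" by (elim exE conjE)
      from compatibleD(2)[OF step.IH M(1)] obtain L where L: "realizes G L" "homotopic L M" by (elim exE conjE)
      show "\<exists>L. realizes G L \<and> homotopic L M'"
        using L(1) homotopy.trans[OF L(2) M(2)] by (intro exI conjI)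
    qed
  qed
qed

section \<open>The bijection\<close>

text \<open>Equality of graph-links transported to looped graphs. By
  \<open>same_looped_graph\<close> the choice of the realizing graphs does not matter, and by
  \<open>ex_realized\<close> the quantifiers are not vacuous.\<close>

definition link_eq :: "nat graph \<Rightarrow> nat graph \<Rightarrow> bool" where
  "link_eq L M \<longleftrightarrow> looped_graph L \<and> looped_graph M \<and>
     (\<forall>G H. realizes G L \<longrightarrow> realizes H M \<longrightarrow> linked_to G H)"

lemma link_eqI:
  assumes "realizes G L" "realizes H M" "linked_to G H"
  shows "link_eq L M"
  unfolding link_eq_def
proof (intro conjI allI impI)
  fix G' H' assume "realizes G' L" "realizes H' M"
  then show "linked_to G' H'"
    using same_looped_graph[of G' L G] same_looped_graph[of H M H'] assms linked_to_trans by metis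
qed (use assms realizesD(2) in auto)

interpretation link: looped_equivalence link_eq
proof
  show "link_eq L L" if L: "looped_graph L" for L
  proof -
    obtain G where "realizes G L" using ex_realized[OF L] by blast
    then show ?thesis using same_looped_graph link_eqI by metis
  qed
  show "link_eq M L" if "link_eq L M" for L M
    using that linked_to_sym unfolding link_eq_def by metis
  show "link_eq L N" if LM: "link_eq L M" and MN: "link_eq M N" for L M N
  proof -
    \<comment> \<open>Transitivity passes through a labeled graph that realizes the middle looped
      graph.\<close>
    obtain H where H: "realizes H M" using ex_realized LM unfolding link_eq_def by metis
    show ?thesis unfolding link_eq_def
    proof (intro conjI allI impI)
      fix G K assume "realizes G L" "realizes K N"
      then show "linked_to G K" using LM MN H linked_to_trans unfolding link_eq_def by metis
    qed (use LM MN in \<open>auto simp: link_eq_def\<close>)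
  qed
  show "link_eq L M" if L: "looped_graph L" and M: "looped_graph M" and i: "graph_iso L M" for L M
  proof -
    obtain G where G: "realizes G L" using ex_realized[OF L] by blast
    obtain H where H: "realizes H M" "lgraph_iso G H" using realized_iso[OF G i] by blast
    show ?thesis using link_eqI[OF G H(1)] linked_to_iso realizesD(1) G H by metis
  qed
  show "link_eq L M" if L: "looped_graph L" and M: "looped_graph M" and o: "omega2 L M" for L M
  proof -
    obtain G where G: "realizes G L" using ex_realized[OF L] by blast
    obtain H where H: "realizes H M" "omega_g2 G H" using realizes_add_twins[OF G o M] by blast
    have "lgraph_step G H" using H realizesD(1)[OF G] realizesD(1)[OF H(1)] by (simp add: lgraph_step_def)
    then show ?thesis by (rule link_eqI[OF G H(1) linked_to_step])
  qed
qed

lemma link_eq_omega1: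
  assumes "looped_graph L" "looped_graph M" "omega1 L M"
  shows "link_eq L M"
proof -
  obtain G where G: "realizes G L" using ex_realized[OF assms(1)] by blast
  obtain H where H: "realizes H M" "omega_g1 G H" using realizes_add_isolated[OF G assms(3,2)] by blast
  have "lgraph_step G H" using H realizesD(1)[OF G] realizesD(1)[OF H(1)] by (simp add: lgraph_step_def)
  then show ?thesis by (rule link_eqI[OF G H(1) linked_to_step])
qed

text \<open>
  If \<open>u, v, w\<close> are the vertices of a move \<open>\<Omega>\<^sub>g3\<close> and \<open>n\<close> is the matrix of the looped graph, then
  the entries of \<open>n\<close> at \<open>u, v, w\<close> are determined by the three bits \<open>A, B, C\<close>, the values of the
  quadratic form given by the inverse on the remaining vertices.
\<close>

definition triangle_type :: "nat set \<Rightarrow> (nat \<Rightarrow> nat \<Rightarrow> bit) \<Rightarrow> nat \<Rightarrow> nat \<Rightarrow> nat \<Rightarrow> bit \<Rightarrow> bit \<Rightarrow> bit \<Rightarrow> bool" where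
  "triangle_type V n u v w A B C \<longleftrightarrow> finite V \<and> sym_mat V n \<and> {u, v, w} \<subseteq> V \<and>
     u \<noteq> v \<and> u \<noteq> w \<and> v \<noteq> w \<and> (\<forall>k\<in>V - {u, v, w}. n k u + n k v + n k w = 0) \<and>
     n u v = A + C \<and> n u w = B + C \<and> n v w = C \<and> n u u = A + B \<and> n v v = A + 1 \<and> n w w = B + 1"

definition attains :: "nat set \<Rightarrow> (nat \<Rightarrow> nat \<Rightarrow> bit) \<Rightarrow> nat \<Rightarrow> nat \<Rightarrow> bit \<Rightarrow> bit \<Rightarrow> bit \<Rightarrow> bool" where
  "attains V0 n v w A B C \<longleftrightarrow> (\<exists>J d. sinv V0 J (\<lambda>i j. if i = j then d i else n i j) \<and>
     A = (\<Sum>i\<in>V0. n i v * (\<Sum>j\<in>V0. J i j * n j v)) \<and>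
     B = (\<Sum>i\<in>V0. n i w * (\<Sum>j\<in>V0. J i j * n j w)) \<and>
     C = (\<Sum>i\<in>V0. n i v * (\<Sum>j\<in>V0. J i j * n j w)))"

text \<open>Block inversion. \<open>M\<close> has an identity block at \<open>u, v, w\<close>, next
  to it the block \<open>R\<close> with rows \<open>p + q\<close>, \<open>p\<close>,
  \<open>q\<close>, and on the rest \<open>J\<close> plus the transpose of \<open>R\<close> times
  \<open>R\<close>, which in characteristic two collapses to the mixed products of \<open>p\<close>
  and \<open>q\<close>. With \<open>K\<close> the inverse of \<open>J\<close>, the block of the
  inverse at \<open>u, v, w\<close> is therefore the identity plus \<open>R\<close> times
  \<open>K\<close> times the transpose of \<open>R\<close>; this is where the entries in
  \<open>triangle_type\<close> come from.\<close>

lemma sinv_bordered_triangle: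
  assumes t: "triangle_type V n u v w A B C" and V0: "V0 = V - {u, v, w}"
    and J: "sinv V0 J (\<lambda>i j. if i = j then d i else n i j)"
    and p: "\<And>i. p i = (\<Sum>j\<in>V0. J i j * n j v)" and q: "\<And>i. q i = (\<Sum>j\<in>V0. J i j * n j w)"
    and A: "A = (\<Sum>i\<in>V0. n i v * p i)" and B: "B = (\<Sum>i\<in>V0. n i w * q i)" and C: "C = (\<Sum>i\<in>V0. n i v * q i)"
    and R: "R = (\<lambda>i j. if i = u then p j + q j else if i = v then p j else q j)"
    and M: "M = (\<lambda>i j. if i \<in> V0 then (if j \<in> V0 then J i j + p i * q j + q i * p j else R j i)
      else if j \<in> V0 then R i j else of_bool (i = j))"
    and N: "N = (\<lambda>i j. if i = j then (if i = u then 1 + A + B else if i = v then 1 + A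
      else if i = w then 1 + B else d i) else n i j)"
  shows "sinv V M N"
proof -
  note t' = t[unfolded triangle_type_def]
  have ne: "u \<noteq> v" "u \<noteq> w" "v \<noteq> w" "v \<noteq> u" "w \<noteq> u" "w \<noteq> v" using t' by auto
  have fin: "finite V" "finite V0" using t' V0 by auto
  have V: "V = insert u (insert v (insert w V0))" and nV: "u \<notin> V0" "v \<notin> V0" "w \<notin> V0"
    using t' V0 by auto
  have sym: "n i j = n j i" if "i \<in> V" "j \<in> V" for i j using t' that sym_matD by metis
  have uvw: "u \<in> V" "v \<in> V" "w \<in> V" and V0V: "\<And>x. x \<in> V0 \<Longrightarrow> x \<in> V" using V by auto
  define K where "K = (\<lambda>i j. if i = j then d i else n i j)"
  have sK: "sinv V0 J K" using J unfolding K_def .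
  have sJ: "J i j = J j i" if "i \<in> V0" "j \<in> V0" for i j using sinvD(2)[OF sK that] .
  have sum3: "(\<Sum>k\<in>V. f k) = f u + (f v + (f w + (\<Sum>k\<in>V0. f k)))" for f :: "nat \<Rightarrow> bit"
    unfolding V using nV ne fin by (simp add: sum.insert)
  have Nn: "N i j = n i j" if "i \<noteq> j" for i j using that by (simp add: N)
  have Nd: "N u u = 1 + A + B" "N v v = 1 + A" "N w w = 1 + B" using ne by (simp_all add: N)
  have NK: "N i j = K i j" if "i \<in> V0" "j \<in> V0" for i j using that nV by (auto simp: N K_def)
  have ent: "n u v = A + C" "n u w = B + C" "n v w = C" "n v u = A + C" "n w u = B + C" "n w v = C"
    using t' sym[of u v] sym[of u w] sym[of v w] uvw by auto
  have even: "n x u = n x v + n x w" if "x \<in> V0" for x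
    using t' that V0 by (metis add.assoc add.commute bit_add_eq_0_iff)
  have x3: "x \<noteq> u" "x \<noteq> v" "x \<noteq> w" if "x \<in> V0" for x using that nV by auto
  have symN: "N i j = N j i" if "i \<in> V" "j \<in> V" for i j using sym[OF that] by (simp add: N)
  define P where "P j = (\<Sum>k\<in>V0. p k * N k j)" for j
  define Q where "Q j = (\<Sum>k\<in>V0. q k * N k j)" for j
  define RJ where "RJ x j = (\<Sum>k\<in>V0. J x k * N k j)" for x j
  have rows: "(\<Sum>k\<in>V. M u k * N k j) = N u j + (P j + Q j)"
    "(\<Sum>k\<in>V. M v k * N k j) = N v j + P j" "(\<Sum>k\<in>V. M w k * N k j) = N w j + Q j" for j
    unfolding sum3 P_def Q_def using nV ne by (simp_all add: M R algebra_simps sum.distrib cong: sum.cong)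
  have rowx: "(\<Sum>k\<in>V. M x k * N k j) = (p x + q x) * N u j + (p x * N v j + (q x * N w j +
      (RJ x j + p x * Q j + q x * P j)))" if "x \<in> V0" for x j
  proof -
    have "(\<Sum>k\<in>V0. M x k * N k j) = (\<Sum>k\<in>V0. J x k * N k j + p x * (q k * N k j) + q x * (p k * N k j))"
      using that by (intro sum.cong) (simp_all add: M algebra_simps)
    also have "\<dots> = RJ x j + p x * Q j + q x * P j"
      by (simp add: sum.distrib sum_distrib_left RJ_def P_def Q_def)
    finally show ?thesis unfolding sum3 using that nV ne by (simp add: M R)
  qed
  have pn: "(\<Sum>k\<in>V0. p k * K k y) = n v y" "(\<Sum>k\<in>V0. q k * K k y) = n w y" if y: "y \<in> V0" for y
  proof -
    have KJ: "sinv V0 K J" using sK by (simp only: sinv_commute[of V0 J])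
    have "(\<Sum>k\<in>V0. p k * K k y) = (\<Sum>k\<in>V0. K y k * (\<Sum>l\<in>V0. J k l * n l v))"
      using sinvD(3)[OF sK _ y] by (intro sum.cong) (simp_all add: p mult.commute)
    then show "(\<Sum>k\<in>V0. p k * K k y) = n v y"
      using sinv_solve[OF KJ y, of "\<lambda>l. n l v"] sym[OF V0V[OF y] uvw(2)] by simp
    have "(\<Sum>k\<in>V0. q k * K k y) = (\<Sum>k\<in>V0. K y k * (\<Sum>l\<in>V0. J k l * n l w))"
      using sinvD(3)[OF sK _ y] by (intro sum.cong) (simp_all add: q mult.commute)
    then show "(\<Sum>k\<in>V0. q k * K k y) = n w y"
      using sinv_solve[OF KJ y, of "\<lambda>l. n l w"] sym[OF V0V[OF y] uvw(3)] by simp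
  qed
  \<comment> \<open>Symmetry of \<open>J\<close> lets \<open>v\<close> and \<open>w\<close> change
    places in the mixed value.\<close>
  have C': "C = (\<Sum>i\<in>V0. n i w * p i)"
  proof -
    have "(\<Sum>i\<in>V0. n i w * p i) = (\<Sum>i\<in>V0. \<Sum>j\<in>V0. n i w * J i j * n j v)"
      by (simp add: p sum_distrib_left mult.assoc)
    also have "\<dots> = (\<Sum>j\<in>V0. \<Sum>i\<in>V0. n j v * (J j i * n i w))"
      by (subst sum.swap) (intro sum.cong refl, simp add: sJ mult_ac)
    also have "\<dots> = C" by (simp add: C q sum_distrib_left)
    finally show ?thesis by simp
  qed
  have colv: "P v = A" "Q v = C" "\<And>x. x \<in> V0 \<Longrightarrow> RJ x v = p x"
    unfolding P_def Q_def RJ_def A C p[symmetric]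
    using x3 by (auto intro!: sum.cong simp: Nn p mult.commute)
  have colw: "P w = C" "Q w = B" "\<And>x. x \<in> V0 \<Longrightarrow> RJ x w = q x"
    unfolding P_def Q_def RJ_def B C' using x3 by (auto intro!: sum.cong simp: Nn q mult.commute)
  \<comment> \<open>Outside the triangle, column \<open>u\<close> is the sum of columns
    \<open>v\<close> and \<open>w\<close> by the parity condition.\<close>
  have colu: "P u = A + C" "Q u = C + B" "\<And>x. x \<in> V0 \<Longrightarrow> RJ x u = p x + q x"
  proof -
    have s: "(\<Sum>k\<in>V0. f k * N k u) = (\<Sum>k\<in>V0. f k * N k v) + (\<Sum>k\<in>V0. f k * N k w)" for f
      unfolding sum.distrib[symmetric] using x3 even by (intro sum.cong) (simp_all add: Nn algebra_simps)
    show "P u = A + C" "Q u = C + B" "\<And>x. x \<in> V0 \<Longrightarrow> RJ x u = p x + q x"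
      using colv colw unfolding P_def Q_def RJ_def s by simp_all
  qed
  have coly: "P y = n v y" "Q y = n w y" "\<And>x. x \<in> V0 \<Longrightarrow> RJ x y = of_bool (x = y)" if y: "y \<in> V0" for y
    using pn[OF y] sinvD(4)[OF sK _ y] NK[OF _ y] unfolding P_def Q_def RJ_def by (simp_all cong: sum.cong)
  show ?thesis
  proof (rule sinvI'[OF fin(1)])
    fix i j assume ij: "i \<in> V" "j \<in> V"
    show "M i j = M j i" using sJ by (auto simp: M mult_ac add_ac)
    consider "i = u" | "i = v" | "i = w" | "i \<in> V0" using ij V by blast
    note i = this
    consider "j = u" | "j = v" | "j = w" | "j \<in> V0" using ij V by blast
    then show "(\<Sum>k\<in>V. M i k * N k j) = of_bool (i = j)"
    proof cases
      case 1
      note j = this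
      from i show ?thesis
      proof cases
        case 1
        show ?thesis unfolding j 1 rows colu(1,2) using ne
          by (simp add: Nd Nn ent ac_simps)
      next
        case 2
        show ?thesis unfolding j 2 rows colu(1,2) using ne
          by (simp add: Nd Nn ent ac_simps)
      next
        case 3
        show ?thesis unfolding j 3 rows colu(1,2) using ne
          by (simp add: Nd Nn ent ac_simps)
      next
        case 4
        show ?thesis unfolding j rowx[OF 4] colu(1,2) colu(3)[OF 4] using ne x3[OF 4]
          by (simp add: Nd Nn ent algebra_simps)
      qed
    next
      case 2
      note j = this
      from i show ?thesis
      proof cases
        case 1
        show ?thesis unfolding j 1 rows colv(1,2) using ne
          by (simp add: Nd Nn ent ac_simps)
      next
        case 2
        show ?thesis unfolding j 2 rows colv(1,2) using ne
          by (simp add: Nd Nn ent ac_simps)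
      next
        case 3
        show ?thesis unfolding j 3 rows colv(1,2) using ne
          by (simp add: Nd Nn ent ac_simps)
      next
        case 4
        show ?thesis unfolding j rowx[OF 4] colv(1,2) colv(3)[OF 4] using ne x3[OF 4]
          by (simp add: Nd Nn ent algebra_simps)
      qed
    next
      case 3
      note j = this
      from i show ?thesis
      proof cases
        case 1
        show ?thesis unfolding j 1 rows colw(1,2) using ne
          by (simp add: Nd Nn ent ac_simps)
      next
        case 2
        show ?thesis unfolding j 2 rows colw(1,2) using ne
          by (simp add: Nd Nn ent ac_simps)
      next
        case 3
        show ?thesis unfolding j 3 rows colw(1,2) using ne
          by (simp add: Nd Nn ent ac_simps)
      next
        case 4
        show ?thesis unfolding j rowx[OF 4] colw(1,2) colw(3)[OF 4] using ne x3[OF 4]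
          by (simp add: Nd Nn ent algebra_simps)
      qed
    next
      case 4
      note y = 4
      have e: "n u j = n v j + n w j" "n v j = n j v" "n w j = n j w"
        using even[OF y] sym[OF uvw(1) V0V[OF y]] sym[OF uvw(2) V0V[OF y]] sym[OF uvw(3) V0V[OF y]] by simp_all
      have ne: "u \<noteq> j" "v \<noteq> j" "w \<noteq> j" using x3[OF y] by simp_all
      from i show ?thesis
      proof cases
        case 1
        show ?thesis unfolding 1 rows coly(1,2)[OF y] using ne by (simp add: Nn e)
      next
        case 2
        show ?thesis unfolding 2 rows coly(1,2)[OF y] using ne by (simp add: Nn)
      next
        case 3
        show ?thesis unfolding 3 rows coly(1,2)[OF y] using ne by (simp add: Nn)
      next
        case 4
        have "N u j = n v j + n w j" "N v j = n v j" "N w j = n w j" using ne e(1) by (simp_all add: Nn)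
        then show ?thesis unfolding rowx[OF 4] coly(1,2)[OF y] coly(3)[OF y 4]
          by (simp add: algebra_simps)
      qed
    qed
  qed
qed

text \<open>\<open>triangle_type\<close> describes the looped graph after the move
  \<open>omega_g3\<close>. So the given graph is realized by the target \<open>H\<close> of such a
  move, and the source \<open>G\<close> is reconstructed by making \<open>u\<close> adjacent to
  \<open>v\<close> and \<open>w\<close> only. The looped graph of \<open>G\<close> is the toggled
  one, up to exchanging \<open>v\<close> and \<open>w\<close>.\<close>

lemma link_eq_triangle:
  assumes t: "triangle_type V n u v w A B C" and a: "attains (V - {u, v, w}) n v w A B C"
  shows "link_eq (looped_of V n) (looped_of V (toggle3 u v w n))"
proof -
  note t' = t[unfolded triangle_type_def]
  define V0 where "V0 = V - {u, v, w}"
  obtain J d where J: "sinv V0 J (\<lambda>i j. if i = j then d i else n i j)"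
    and A': "A = (\<Sum>i\<in>V0. n i v * (\<Sum>j\<in>V0. J i j * n j v))"
    and B': "B = (\<Sum>i\<in>V0. n i w * (\<Sum>j\<in>V0. J i j * n j w))"
    and C': "C = (\<Sum>i\<in>V0. n i v * (\<Sum>j\<in>V0. J i j * n j w))"
    using a unfolding attains_def V0_def[symmetric] by (elim exE conjE) (rule that)
  define p q where "p i = (\<Sum>j\<in>V0. J i j * n j v)" and "q i = (\<Sum>j\<in>V0. J i j * n j w)" for i
  define R where "R = (\<lambda>i j. if i = u then p j + q j else if i = v then p j else q j)"
  define M where "M = (\<lambda>i j. if i \<in> V0 then (if j \<in> V0 then J i j + p i * q j + q i * p j else R j i)
      else if j \<in> V0 then R i j else of_bool (i = j))"
  define N where "N = (\<lambda>i j. if i = j then (if i = u then 1 + A + B else if i = v then 1 + A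
      else if i = w then 1 + B else d i) else n i j)"
  have sMN: "sinv V M N"
    by (rule sinv_bordered_triangle[OF t V0_def J p_def q_def _ _ _ R_def M_def N_def])
      (use A' B' C' in \<open>simp_all add: p_def q_def\<close>)
  have uvw: "{u, v, w} \<subseteq> V" "u \<noteq> v" "u \<noteq> w" "v \<noteq> w" and sn: "sym_mat V n" and fin: "finite V"
    using t' by auto
  have nV: "u \<notin> V0" "v \<notin> V0" "w \<notin> V0" by (auto simp: V0_def)
  \<comment> \<open>Outside the triangle the sign compensates the diagonal \<open>d\<close>; on the
    triangle it is the one that \<open>omega_g3\<close> requires.\<close>
  define s where "s i = (if i \<in> {u, v, w} then Minus else sign_of_bit (d i + n i i))" for i
  define M1 where "M1 = (\<lambda>i j. if i \<in> V0 \<and> j \<in> V0 then M i j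
    else if i \<in> V0 then (if j = u then 0 else R j i) else if j \<in> V0 then (if i = u then 0 else R i j)
    else of_bool (i = j \<or> i = u \<or> j = u))"
  have sM1: "sym_mat V M1"
  proof -
    have "M i j = M j i" if "i \<in> V" "j \<in> V" for i j using sinvD(2)[OF sMN that] .
    then show ?thesis unfolding sym_mat_def M1_def by auto
  qed
  define G where "G = labeled_of V M1 s"
  have lG: "labeled_graph G" unfolding G_def by (rule labeled_graph_labeled_of[OF fin])
  have vG: "verts G = V" "vsign G = s" by (simp_all add: G_def)
  have mG: "label_matrix G i j = M1 i j" if "i \<in> V" "j \<in> V" for i j
    unfolding G_def by (rule label_matrix_labeled_of[OF sM1 that])
  have uV: "u \<in> V" "v \<in> V" "w \<in> V" using uvw by auto
  have nbG: "x \<in> nbhd G y \<longleftrightarrow> x \<in> V \<and> x \<noteq> y \<and> M1 x y = 1" if "y \<in> V" for x y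
  proof (cases "x \<in> V")
    case True
    then show ?thesis using mG[OF True that] by (auto simp: nbhd_def label_matrix_def)
  next
    case False
    then show ?thesis using labeled_edge_verts[OF lG, of x y] vG by (auto simp: nbhd_def)
  qed
  have lab: "\<forall>x\<in>{u, v, w}. framing G x = 0 \<and> vsign G x = Minus"
    using nV by (auto simp: G_def labeled_of_def M1_def s_def)
  have "M1 x u = of_bool (x \<notin> V0)" for x using nV by (simp add: M1_def)
  then have nbu: "nbhd G u = {v, w}" using nbG[OF uV(1)] uV uvw(2-4) by (auto simp: V0_def)
  have nbvw: "v \<notin> nbhd G w" using nbG[OF uV(3)] nV uvw(2-4) by (simp add: M1_def)
  define H where "H = (toggle ({{u, v}, {u, w}} \<union>
                  {{u, t} | t. t \<in> sym_diff (nbhd G v) (nbhd G w) \<and> t \<noteq> u}) G)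
           \<lparr>vsign := (vsign G)(v := Plus, w := Plus)\<rparr>"
  define \<rho> where "\<rho> = (\<lambda>i. if i = v then w else if i = w then v else i)"
  have uvwG: "{u, v, w} \<subseteq> verts G" using uvw vG by simp
  note m = omega_g3_matrix[OF lG uvwG uvw(2-4) lab nbu nbvw H_def]
  note r = omega_g3_realizes[OF lG uvwG uvw(2-4) lab nbu nbvw H_def \<rho>_def]
  have mH: "label_matrix H i j = M i j" if ij: "i \<in> V" "j \<in> V" for i j
  proof -
    have sH: "label_matrix H i j = label_matrix H j i" for i j by (rule label_matrix_commute)
    have hx: "label_matrix H y x = M y x" if x: "x \<in> V0" and y: "y \<in> {u, v, w}" for x y
    proof -
      have "x \<in> verts G - {u, v, w}" "x \<in> V" using x vG by (auto simp: V0_def)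
      then show ?thesis using m(11)[of x] mG[OF uV(2)] mG[OF uV(3)] x y nV uvw(2-4)
        by (auto simp: M1_def M_def R_def)
    qed
    have Ms: "M i j = M j i" using sinvD(2)[OF sMN ij] .
    consider "i \<in> {u, v, w}" "j \<in> {u, v, w}" | "i \<in> {u, v, w}" "j \<in> V0" | "i \<in> V0" "j \<in> {u, v, w}"
      | "i \<in> V0" "j \<in> V0" using ij unfolding V0_def by blast
    then show ?thesis
    proof cases
      case 1
      then show ?thesis using m(4,8-10) sH[of v u] sH[of w u] sH[of w v] nV uvw(2-4) by (auto simp: M_def)
    next
      case 2
      then show ?thesis using hx by simp
    next
      case 3
      then show ?thesis using hx[of i j] Ms sH[of i j] by simp
    next
      case 4
      then show ?thesis using m(12)[of i j] mG[OF ij] vG by (simp add: V0_def M1_def)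
    qed
  qed
  define L where "L = looped_of V n"
  have ln: "loop_matrix L i j = n i j" if "i \<in> V" "j \<in> V" for i j
    unfolding L_def by (rule loop_matrix_looped_of[OF sn that])
  have lL: "looped_graph L" unfolding L_def by (rule looped_graph_looped_of[OF fin])
  have HL: "realizes H L"
  proof (rule realizesI[OF m(1) lL])
    show "verts L = verts H" using m(2) vG by (simp add: L_def)
    show "sinv (verts H) M N" using sMN unfolding m(2) vG(1) .
    fix i j assume "i \<in> verts H" "j \<in> verts H"
    then have ij: "i \<in> V" "j \<in> V" using m(2) vG by simp_all
    show "label_matrix H i j = M i j" by (rule mH[OF ij])
    show "loop_matrix L i j = N i j" if "i \<noteq> j" using ln[OF ij] that by (simp add: N_def)
  next
    fix i assume "i \<in> verts H"
    then have i: "i \<in> V" using m(2) vG by simp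
    show "N i i = loop_matrix L i i + of_bool (vsign H i = Minus)"
      unfolding ln[OF i i] m(3) vG(2) using t' uvw(2-4)
      by (auto simp: N_def s_def ac_simps)
  qed
  obtain L2 where L2: "realizes G L2" using r(2)[OF HL] by blast
  have eqL: "looped_of V (\<lambda>i j. toggle3 u v w (loop_matrix L2) (\<rho> i) (\<rho> j)) = L"
    using realizes_unique[OF r(1)[OF L2] HL] unfolding vG(1) .
  have \<rho>V: "\<rho> i \<in> V" if "i \<in> V" for i using that uvw(1) by (auto simp: \<rho>_def)
  have \<rho>\<rho>: "\<rho> (\<rho> i) = i" for i using uvw(2-4) by (auto simp: \<rho>_def)
  have \<rho>eq: "\<rho> i = \<rho> j \<longleftrightarrow> i = j" for i j using \<rho>\<rho> by metis
  have \<rho>3: "\<rho> i \<in> {u, v, w} \<longleftrightarrow> i \<in> {u, v, w}" for i using uvw(2-4) by (auto simp: \<rho>_def)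
  have L2n: "loop_matrix L2 (\<rho> i) (\<rho> j) = toggle3 u v w n i j" if ij: "i \<in> V" "j \<in> V" for i j
  proof -
    have "n i j = toggle3 u v w (loop_matrix L2) (\<rho> i) (\<rho> j)"
      using ln[OF ij] loop_matrix_looped_of[OF sym_mat_comp[OF sym_mat_toggle3[OF sym_mat_loop_matrix, of V] \<rho>V] ij]
      unfolding eqL[symmetric] by simp
    then show ?thesis unfolding toggle3_def \<rho>3 \<rho>eq by (simp add: add.assoc)
  qed
  have vL2: "looped_graph L2" "verts L2 = V" using realizesD[OF L2] vG by simp_all
  have "graph_iso (looped_of V (toggle3 u v w n)) (looped_of V (loop_matrix L2))"
    using L2n \<rho>V \<rho>\<rho> by (intro graph_iso_looped_ofI[where f = \<rho>] bij_betwI[where g = \<rho>]) auto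
  then have "graph_iso (looped_of V (toggle3 u v w n)) L2" using looped_of_loop_matrix[OF vL2(1)] vL2(2) by simp
  then have "link_eq L2 (looped_of V (toggle3 u v w n))"
    using link.iso[OF looped_graph_looped_of[OF fin] vL2(1)] link.sym by blast
  moreover have "link_eq L2 L"
  proof (rule link_eqI[OF L2 HL linked_to_step])
    have "omega_g3 G H" unfolding omega_g3_def
      using uvwG uvw(2-4) lab nbu nbvw H_def by (intro exI conjI)
    then show "lgraph_step G H" using lG m(1) by (simp add: lgraph_step_def)
  qed
  ultimately show ?thesis using link.sym link.trans unfolding L_def by blast
qed

text \<open>The new vertices are not joined to \<open>V0\<close>, so they contribute a separate
  block with rows (1, 1) and (1, 0), whose inverse has rows (0, 1) and (1, 1). The entries of that
  inverse add up to 1, whence the increments \<alpha>, \<beta> and \<alpha> * \<beta>.\<close>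

lemma attains_pair:
  assumes t: "triangle_type V n u v w A B C" and V0: "V0 = V - {u, v, w}"
    and a: "attains V0 n v w A0 B0 C0" and st: "s \<notin> V" "r \<notin> V" "s \<noteq> r"
    and m: "\<And>i j. i \<in> V \<Longrightarrow> j \<in> V \<Longrightarrow> m i j = n i j"
    and m0: "\<And>i. i \<in> V0 \<Longrightarrow> m s i = 0 \<and> m i s = 0 \<and> m r i = 0 \<and> m i r = 0"
    and m1: "m s r = 1" "m r s = 1" "m s v = \<alpha>" "m r v = \<alpha>" "m s w = \<beta>" "m r w = \<beta>"
  shows "attains (insert s (insert r V0)) m v w (A0 + \<alpha>) (B0 + \<beta>) (C0 + \<alpha> * \<beta>)"
proof -
  obtain J d where J: "sinv V0 J (\<lambda>i j. if i = j then d i else n i j)"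
    and A0: "A0 = (\<Sum>i\<in>V0. n i v * (\<Sum>j\<in>V0. J i j * n j v))"
    and B0: "B0 = (\<Sum>i\<in>V0. n i w * (\<Sum>j\<in>V0. J i j * n j w))"
    and C0: "C0 = (\<Sum>i\<in>V0. n i v * (\<Sum>j\<in>V0. J i j * n j w))"
    using a unfolding attains_def by (elim exE conjE) (rule that)
  have vw: "v \<in> V" "w \<in> V" and fin: "finite V0" and V0V: "V0 \<subseteq> V"
    using t V0 by (auto simp: triangle_type_def)
  have st0: "s \<notin> V0" "r \<notin> V0" using st V0V by auto
  have x0: "x \<noteq> s" "x \<noteq> r" if "x \<in> V0" for x using that st0 by auto
  define J' where "J' i j = (if i \<in> V0 \<and> j \<in> V0 then J i j else if i \<in> V0 \<or> j \<in> V0 then 0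
    else of_bool (i \<noteq> s \<or> j \<noteq> s))" for i j
  define K where "K = (\<lambda>i j. if i = j then (d(s := 1, r := 0)) i else m i j)"
  have K0: "K i j = (if i = j then d i else n i j)" if "i \<in> V0" "j \<in> V0" for i j
    using m[OF subsetD[OF V0V that(1)] subsetD[OF V0V that(2)]] x0[OF that(1)] by (auto simp: K_def)
  have K1: "K s i = 0" "K i s = 0" "K r i = 0" "K i r = 0" if "i \<in> V0" for i
    using m0[OF that] x0[OF that] by (auto simp: K_def)
  have K2: "K s s = 1" "K r r = 0" "K s r = 1" "K r s = 1" using st m1 by (simp_all add: K_def)
  have J1: "J' s i = 0" "J' i s = 0" "J' r i = 0" "J' i r = 0" if "i \<in> V0" for i
    using that st0 by (simp_all add: J'_def)
  have J2: "J' s s = 0" "J' r r = 1" "J' s r = 1" "J' r s = 1" using st st0 by (simp_all add: J'_def)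
  have J0: "J' i j = J i j" if "i \<in> V0" "j \<in> V0" for i j using that by (simp add: J'_def)
  have sum2: "(\<Sum>k\<in>insert s (insert r V0). f k) = f s + (f r + (\<Sum>k\<in>V0. f k))" for f :: "nat \<Rightarrow> bit"
    using st0 st fin by (simp add: sum.insert)
  have "sinv (insert s (insert r V0)) J' K"
  proof (rule sinvI')
    show "finite (insert s (insert r V0))" using fin by simp
    fix i j assume ij: "i \<in> insert s (insert r V0)" "j \<in> insert s (insert r V0)"
    show "J' i j = J' j i" using sinvD(2)[OF J] by (auto simp: J'_def)
    have V: "(\<Sum>k\<in>V0. J' i k * K k j) = of_bool (i = j)" if "i \<in> V0" "j \<in> V0"
      using sinvD(4)[OF J that] that by (simp add: J0 K0 cong: sum.cong)
    have z: "(\<Sum>k\<in>V0. J' i k * K k j) = 0" if "i = s \<or> i = r \<or> j = s \<or> j = r"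
      using that K1 J1 by (intro sum.neutral) auto
    consider "i \<in> V0" "j \<in> V0" | "i \<in> {s, r}" "j \<in> V0" | "i \<in> V0" "j \<in> {s, r}" | "i \<in> {s, r}" "j \<in> {s, r}"
      using ij by blast
    then show "(\<Sum>k\<in>insert s (insert r V0). J' i k * K k j) = of_bool (i = j)"
    proof cases
      case 1
      then show ?thesis unfolding sum2 V[OF 1] using J1 by simp
    next
      case 2
      then have zz: "(\<Sum>k\<in>V0. J' i k * K k j) = 0" using z by blast
      have "i \<noteq> j" using 2 x0[of j] by auto
      then show ?thesis unfolding sum2 zz using K1[OF 2(2)] by simp
    next
      case 3
      then have zz: "(\<Sum>k\<in>V0. J' i k * K k j) = 0" using z by blast
      have "i \<noteq> j" using 3 x0[of i] by auto
      then show ?thesis unfolding sum2 zz using J1[OF 3(1)] by simp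
    next
      case 4
      then have zz: "(\<Sum>k\<in>V0. J' i k * K k j) = 0" using z by blast
      show ?thesis unfolding sum2 zz using 4 J2 K2 st(3) by auto
    qed
  qed
  moreover have q: "(\<Sum>i\<in>insert s (insert r V0). m i x * (\<Sum>j\<in>insert s (insert r V0). J' i j * m j y)) =
      (\<Sum>i\<in>V0. n i x * (\<Sum>j\<in>V0. J i j * n j y)) + a * b"
    if x: "x \<in> V" "m s x = a" "m r x = a" and y: "y \<in> V" "m s y = b" "m r y = b" for x y a b
  proof -
    have 1: "(\<Sum>j\<in>V0. J' i j * m j y) = (\<Sum>j\<in>V0. J i j * n j y)" if "i \<in> V0" for i
      using that V0V y(1) m by (intro sum.cong) (auto simp: J0)
    have 2: "(\<Sum>j\<in>V0. J' i j * m j y) = 0" if "i = s \<or> i = r" for i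
      using that J1 by (intro sum.neutral) auto
    have 3: "(\<Sum>i\<in>V0. m i x * (J' i s * m s y + (J' i r * m r y + (\<Sum>j\<in>V0. J' i j * m j y)))) =
      (\<Sum>i\<in>V0. n i x * (\<Sum>j\<in>V0. J i j * n j y))"
      using V0V x(1) m J1 1 by (intro sum.cong) auto
    show ?thesis unfolding sum2 3 2[OF disjI1[OF refl]] 2[OF disjI2[OF refl]] using J2 x y by (simp add: ac_simps)
  qed
  moreover have "A0 + \<alpha> = (\<Sum>i\<in>insert s (insert r V0). m i v * (\<Sum>j\<in>insert s (insert r V0). J' i j * m j v))"
    unfolding q[OF vw(1) m1(3,4) vw(1) m1(3,4)] A0 by simp
  moreover have "B0 + \<beta> = (\<Sum>i\<in>insert s (insert r V0). m i w * (\<Sum>j\<in>insert s (insert r V0). J' i j * m j w))"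
    unfolding q[OF vw(2) m1(5,6) vw(2) m1(5,6)] B0 by simp
  moreover have "C0 + \<alpha> * \<beta> = (\<Sum>i\<in>insert s (insert r V0). m i v * (\<Sum>j\<in>insert s (insert r V0). J' i j * m j w))"
    unfolding q[OF vw(1) m1(3,4) vw(2) m1(5,6)] C0 by simp
  ultimately show ?thesis unfolding attains_def K_def by (intro exI conjI)
qed

text \<open>Second moves far from the triangle change the attained values, so every triangle can be toggled.\<close>

lemma link_eq_adjust:
  assumes IH: "\<And>V n u v w. triangle_type V n u v w A B C \<Longrightarrow>
      attains (V - {u, v, w}) n v w (A0 + \<alpha>) (B0 + \<beta>) (C0 + \<alpha> * \<beta>) \<Longrightarrow>
      link_eq (looped_of V n) (looped_of V (toggle3 u v w n))"
    and t: "triangle_type V n u v w A B C" and a: "attains (V - {u, v, w}) n v w A0 B0 C0"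
  shows "link_eq (looped_of V n) (looped_of V (toggle3 u v w n))"
proof -
  note t' = t[unfolded triangle_type_def]
  have fin: "finite V" and sn: "sym_mat V n" and uvw: "u \<in> V" "v \<in> V" "w \<in> V" "u \<noteq> v" "u \<noteq> w" "v \<noteq> w"
    using t' by auto
  obtain s where s: "s \<notin> V" using fin ex_new_if_finite[OF infinite_UNIV_nat] by blast
  obtain r where "r \<notin> insert s V" using fin ex_new_if_finite[OF infinite_UNIV_nat, of "insert s V"] by auto
  then have r: "r \<notin> V" "s \<noteq> r" by auto
  \<comment> \<open>The value at \<open>u\<close> is forced by the parity condition at
    \<open>s\<close> and \<open>r\<close>.\<close>
  define c where "c k = (if k = u then \<alpha> + \<beta> else if k = v then \<alpha> else if k = w then \<beta> else 0)" for k
  define m where "m i j = (if i \<in> V \<and> j \<in> V then n i j else if i \<in> V then c i else if j \<in> V then c j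
    else if i = j then of_bool (i = s) else 1)" for i j
  let ?W = "insert s (insert r V)"
  have sm: "sym_mat ?W m" using sn s r by (auto simp: sym_mat_def m_def)
  have mV: "m i j = n i j" if "i \<in> V" "j \<in> V" for i j using that by (simp add: m_def)
  have ms: "m s k = c k" "m r k = c k" "m k s = c k" "m k r = c k" if "k \<in> V" for k
    using that s r by (simp_all add: m_def)
  have W0: "?W - {u, v, w} = insert s (insert r (V - {u, v, w}))" using s r uvw by auto
  have 1: "link_eq (looped_of V n) (looped_of ?W m)"
  proof -
    have "looped_of V n = looped_of V m" by (intro looped_of_cong) (auto simp: m_def)
    moreover have "link_eq (looped_of V m) (looped_of ?W m)"
      by (rule link.twins[OF fin s r(1,2) sm]) (use s r in \<open>simp_all add: m_def\<close>)
    ultimately show ?thesis by simp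
  qed
  have 2: "link_eq (looped_of ?W m) (looped_of ?W (toggle3 u v w m))"
  proof (rule IH)
    have "m k u + m k v + m k w = 0" if "k \<in> ?W - {u, v, w}" for k
    proof -
      consider "k \<in> V - {u, v, w}" | "k = s" | "k = r" using \<open>k \<in> _\<close> by blast
      then show ?thesis
      proof cases
        case 1
        then show ?thesis using t' mV uvw by simp
      qed (use ms uvw in \<open>simp_all add: c_def ac_simps\<close>)
    qed
    then show "triangle_type ?W m u v w A B C"
      using t' mV uvw fin sm unfolding triangle_type_def by simp
    show "attains (?W - {u, v, w}) m v w (A0 + \<alpha>) (B0 + \<beta>) (C0 + \<alpha> * \<beta>)"
      unfolding W0
      by (rule attains_pair[OF t refl a s r(1,2) mV]) (use ms uvw s r in \<open>auto simp: c_def m_def\<close>)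
  qed
  have 3: "link_eq (looped_of V (toggle3 u v w m)) (looped_of ?W (toggle3 u v w m))"
    by (rule link.twins[OF fin s r(1,2) sym_mat_toggle3[OF sm]])
      (use s r uvw in \<open>auto simp: m_def toggle3_def\<close>)
  have "looped_of V (toggle3 u v w m) = looped_of V (toggle3 u v w n)"
    by (intro looped_of_cong) (auto simp: m_def toggle3_def)
  then have "link_eq (looped_of ?W (toggle3 u v w m)) (looped_of V (toggle3 u v w n))"
    using link.sym[OF 3] by simp
  then show ?thesis using link.trans[OF link.trans[OF 1 2]] by blast
qed

text \<open>With \<beta> = 0 an adjustment corrects \<open>A\<close> alone, with \<alpha> = 0 it
  corrects \<open>B\<close> alone. \<open>C\<close> changes only for \<alpha> = \<beta> = 1, which
  disturbs the other two, so it is corrected before them.\<close>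

lemma link_eq_triangle_type:
  assumes "triangle_type V n u v w A B C"
  shows "link_eq (looped_of V n) (looped_of V (toggle3 u v w n))"
proof -
  define P where "P A0 B0 C0 \<longleftrightarrow> (\<forall>V n u v w. triangle_type V n u v w A B C \<longrightarrow>
    attains (V - {u, v, w}) n v w A0 B0 C0 \<longrightarrow> link_eq (looped_of V n) (looped_of V (toggle3 u v w n)))" for A0 B0 C0
  have step: "P A0 B0 C0" if "P (A0 + \<alpha>) (B0 + \<beta>) (C0 + \<alpha> * \<beta>)" for A0 B0 C0 \<alpha> \<beta>
    using link_eq_adjust[of A B C A0 \<alpha> B0 \<beta> C0] that unfolding P_def by blast
  have P0: "P A B C" unfolding P_def using link_eq_triangle by blast
  have P1: "P A0 B C" for A0 using step[of A0 "A0 + A" B 0 C] P0 by simp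
  have P2: "P A0 B0 C" for A0 B0 using step[of A0 0 B0 "B0 + B" C] P1[of A0] by simp
  have P3: "P A0 B0 C0" for A0 B0 C0
  proof (cases "C0 = C")
    case False
    then have "C0 + 1 = C" by (cases C0; cases C) simp_all
    then show ?thesis using step[of A0 1 B0 1 C0] P2[of "A0 + 1" "B0 + 1"] by simp
  qed (use P2 in simp)
  have fin: "finite (V - {u, v, w})" and sn: "sym_mat V n" using assms by (auto simp: triangle_type_def)
  have "\<exists>d J. sinv (V - {u, v, w}) J (\<lambda>i j. if i = j then d i else n i j)"
    by (rule ex_sinv_diagonal[OF fin]) (use sn in \<open>auto dest: sym_matD\<close>)
  then have "\<exists>A0 B0 C0. attains (V - {u, v, w}) n v w A0 B0 C0" unfolding attains_def by blast
  then show ?thesis using P3 assms unfolding P_def by blast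
qed

lemma link_R3_base: "link.R3 0 0 1 l 1 0"
proof (rule link.R3_base)
  show "link.R3 0 0 0 0 1 1"
    unfolding link.R3_def
  proof (intro allI impI, elim conjE)
    fix V :: "nat set" and n x y z
    assume "finite V" "sym_mat V n" "{x, y, z} \<subseteq> V" "x \<noteq> y" "x \<noteq> z" "y \<noteq> z" "n x y = 0" "n x z = 0"
      "n y z = 0" "n x x = 0" "n y y = 1" "n z z = 1" "\<forall>k\<in>V - {x, y, z}. n k x + n k y + n k z = 0"
    then have "triangle_type V n x y z 0 0 0" unfolding triangle_type_def by simp
    then show "link_eq (looped_of V n) (looped_of V (toggle3 x y z n))" by (rule link_eq_triangle_type)
  qed
  show "link.R3 1 0 0 1 0 1"
    unfolding link.R3_def
  proof (intro allI impI, elim conjE)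
    fix V :: "nat set" and n x y z
    assume "finite V" "sym_mat V n" "{x, y, z} \<subseteq> V" "x \<noteq> y" "x \<noteq> z" "y \<noteq> z" "n x y = 1" "n x z = 0"
      "n y z = 0" "n x x = 1" "n y y = 0" "n z z = 1" "\<forall>k\<in>V - {x, y, z}. n k x + n k y + n k z = 0"
    then have "triangle_type V n x y z 1 0 0" unfolding triangle_type_def by simp
    then show "link_eq (looped_of V n) (looped_of V (toggle3 x y z n))" by (rule link_eq_triangle_type)
  qed
qed

lemma link_eq_omega3:
  assumes "omega3 L M" "looped_graph L" "looped_graph M"
  shows "link_eq L M"
proof -
  obtain u v w where uvw: "{u, v, w} \<subseteq> verts L" "u \<noteq> v" "u \<noteq> w" "v \<noteq> w" and vM: "verts M = verts L"
    and l: "loop_matrix L v v = 1" "loop_matrix L w w = 0"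
    "loop_matrix L v w = 1" "loop_matrix L u v = 0" "loop_matrix L u w = 0"
    and ev: "\<And>k. k \<in> verts L - {u, v, w} \<Longrightarrow> loop_matrix L k u + loop_matrix L k v + loop_matrix L k w = 0"
    and M: "\<And>i j. loop_matrix M i j = toggle3 u v w (loop_matrix L) i j"
    by (rule omega3D[OF assms(1,2)]) (rule that)
  have "link.R3 (loop_matrix L u v) (loop_matrix L u w) (loop_matrix L v w)
      (loop_matrix L u u) (loop_matrix L v v) (loop_matrix L w w)"
    unfolding l by (rule link_R3_base)
  moreover have "finite (verts L)" using assms(2) by (simp add: looped_graph_def)
  ultimately have "link_eq (looped_of (verts L) (loop_matrix L)) (looped_of (verts L) (toggle3 u v w (loop_matrix L)))"
    by (rule link.R3D[OF _ _ sym_mat_loop_matrix uvw]) (rule ev)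
  moreover have "looped_of (verts L) (toggle3 u v w (loop_matrix L)) = looped_of (verts M) (loop_matrix M)"
    by (rule looped_of_cong) (simp_all add: M vM)
  ultimately show ?thesis using looped_of_loop_matrix[OF assms(2)] looped_of_loop_matrix[OF assms(3)] by simp
qed

lemma link_eq_step:
  assumes "looped_step L M"
  shows "link_eq L M"
proof -
  have LM: "looped_graph L" "looped_graph M" using assms by (auto simp: looped_step_def)
  from assms consider "graph_iso L M" | "omega1 L M" | "omega2 L M" | "omega3 L M"
    by (auto simp: looped_step_def)
  then show ?thesis
  proof cases
    case 1
    then show ?thesis by (rule link.iso[OF LM])
  next
    case 2
    then show ?thesis by (rule link_eq_omega1[OF LM])
  next
    case 3
    then show ?thesis by (rule link.omega2[OF LM])
  next
    case 4
    then show ?thesis by (rule link_eq_omega3[OF _ LM])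
  qed
qed

lemma homotopic_link_eq:
  assumes "homotopic L M"
  shows "link_eq L M"
proof -
  have "equivclp looped_step L M" and L: "looped_graph L" using assms by (simp_all add: homotopy_rel_def)
  then show ?thesis
  proof (induction rule: equivclp_induct)
    case base
    then show ?case by (rule link.refl)
  next
    case (step M N)
    then have "link_eq M N" using link_eq_step link.sym by blast
    then show ?case using link.trans step by blast
  qed
qed

section \<open>The map from graph-knots to homotopy classes\<close>

definition writhe_class :: "nat lgraph set \<Rightarrow> nat graph set" where
  "writhe_class F = {M. \<exists>G\<in>F. \<exists>L. realizes G L \<and> homotopic L M}"

text \<open>Corank 0 is invertibility, and compatibility carries a realized looped graph from one
  representative to all others.\<close>

lemma graph_knot_iff:
  "F \<in> graph_knots \<longleftrightarrow> (\<exists>G L. realizes G L \<and> F = graph_link_rel `` {G})"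
proof
  assume "F \<in> graph_knots"
  then obtain G where G: "labeled_graph G" "F = graph_link_rel `` {G}"
    and c: "\<forall>H\<in>F. corank (adj_matrix H + 1\<^sub>m (card (verts H))) = 0"
    unfolding graph_knots_def graph_links_def quotient_def by auto
  have "G \<in> F" using equiv_class_self[OF equiv_graph_link_rel, of G] G by simp
  then have "corank (adj_matrix G + 1\<^sub>m (card (verts G))) = 0" using c by simp
  then have "\<exists>N. sinv (verts G) (label_matrix G) N" unfolding corank_0_iff_sinv[OF G(1)] .
  then obtain N where "sinv (verts G) (label_matrix G) N" by (elim exE)
  then obtain L where "realizes G L" using ex_realizes[OF G(1)] by blast
  then show "\<exists>G L. realizes G L \<and> F = graph_link_rel `` {G}" using G(2) by (intro exI conjI)
next
  assume "\<exists>G L. realizes G L \<and> F = graph_link_rel `` {G}"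
  then obtain G L where G: "realizes G L" "F = graph_link_rel `` {G}" by blast
  have "F \<in> graph_links" unfolding graph_links_def using realizesD(1)[OF G(1)] G(2) by (simp add: quotientI)
  moreover have "corank (adj_matrix H + 1\<^sub>m (card (verts H))) = 0" if H: "H \<in> F" for H
  proof -
    have GH: "linked_to G H" using H G(2) by simp
    then have lH: "labeled_graph H" by (simp add: graph_link_rel_def)
    obtain M where "realizes H M" using compatibleD(1)[OF linked_to_compatible[OF GH] G(1)] by (elim exE conjE)
    then have "sinv (verts H) (label_matrix H) (\<lambda>i j. loop_matrix M i j + of_bool (i = j \<and> vsign H i = Minus))"
      by (rule realizesD(5))
    then show ?thesis unfolding corank_0_iff_sinv[OF lH] by (rule exI[of "sinv (verts H) (label_matrix H)"])
  qed
  ultimately show "F \<in> graph_knots" unfolding graph_knots_def by blast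
qed

text \<open>The members of one graph-link have homotopic looped graphs, so the union taken in
  \<open>writhe_class\<close> is a single class.\<close>

lemma writhe_class_eq:
  assumes "realizes G L"
  shows "writhe_class (graph_link_rel `` {G}) = homotopy_rel `` {L}"
proof (rule subset_antisym; rule subsetI)
  fix M assume "M \<in> writhe_class (graph_link_rel `` {G})"
  then obtain H K where H: "linked_to G H" "realizes H K" "homotopic K M" unfolding writhe_class_def by auto
  obtain L' where L': "realizes G L'" "homotopic L' K"
    using compatibleD(2)[OF linked_to_compatible[OF H(1)] H(2)] by blast
  have "L' = L" by (rule realizes_unique[OF L'(1) assms])
  then show "M \<in> homotopy_rel `` {L}" using homotopy.trans[OF L'(2) H(3)] by simp
next
  fix M assume "M \<in> homotopy_rel `` {L}"
  moreover have "linked_to G G"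
    using equiv_class_self[OF equiv_graph_link_rel, of G] realizesD(1)[OF assms] by simp
  ultimately show "M \<in> writhe_class (graph_link_rel `` {G})" unfolding writhe_class_def using assms by auto
qed

lemma homotopy_classesI: "looped_graph L \<Longrightarrow> homotopy_rel `` {L} \<in> homotopy_classes"
  unfolding homotopy_classes_def by (rule quotientI) simp

text \<open>Injectivity rests on \<open>homotopic_link_eq\<close>, surjectivity on
  \<open>ex_realized\<close>.\<close>

lemma bij_betw_writhe_class: "bij_betw writhe_class graph_knots homotopy_classes"
  unfolding bij_betw_def
proof
  show "inj_on writhe_class graph_knots"
  proof (rule inj_onI)
    fix F1 F2 assume F: "F1 \<in> graph_knots" "F2 \<in> graph_knots" "writhe_class F1 = writhe_class F2"
    obtain G1 L1 where 1: "realizes G1 L1" "F1 = graph_link_rel `` {G1}" using F graph_knot_iff by blast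
    obtain G2 L2 where 2: "realizes G2 L2" "F2 = graph_link_rel `` {G2}" using F graph_knot_iff by blast
    have "homotopy_rel `` {L1} = homotopy_rel `` {L2}" using F(3) writhe_class_eq 1 2 by metis
    then have "homotopic L1 L2"
      using eq_equiv_class[OF _ equiv_homotopy_rel] realizesD(2)[OF 2(1)] by blast
    then have "linked_to G1 G2" using homotopic_link_eq 1 2 unfolding link_eq_def by blast
    then show "F1 = F2" unfolding 1 2 by (rule equiv_class_eq[OF equiv_graph_link_rel])
  qed
  show "writhe_class ` graph_knots = homotopy_classes"
  proof (rule subset_antisym; rule subsetI)
    fix X assume "X \<in> writhe_class ` graph_knots"
    then obtain F where F: "F \<in> graph_knots" "X = writhe_class F" by blast
    then obtain G L where G: "realizes G L" "F = graph_link_rel `` {G}" using graph_knot_iff by blast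
    then show "X \<in> homotopy_classes"
      using writhe_class_eq[OF G(1)] F(2) homotopy_classesI[OF realizesD(2)[OF G(1)]] by simp
  next
    fix X assume "X \<in> homotopy_classes"
    then obtain L where L: "looped_graph L" "X = homotopy_rel `` {L}"
      unfolding homotopy_classes_def quotient_def by auto
    obtain G where G: "realizes G L" using ex_realized[OF L(1)] by blast
    have "graph_link_rel `` {G} \<in> graph_knots" using graph_knot_iff G by blast
    then show "X \<in> writhe_class ` graph_knots" using writhe_class_eq[OF G] L(2) by blast
  qed
qed

text \<open>One injection into the naturals copies \<open>G\<close> and \<open>L\<close>
  simultaneously. Any other copy of \<open>G\<close> has an isomorphic looped graph and is therefore
  linked to this one.\<close>

lemma realizes_classes:
  fixes G :: "'v lgraph"
  assumes "realizes G L"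
  shows "graph_link_of G \<in> graph_knots" "homotopy_class_of L \<in> homotopy_classes"
    "writhe_class (graph_link_of G) = homotopy_class_of L"
proof -
  note D = realizesD[OF assms]
  obtain f :: "'v \<Rightarrow> nat" where f: "inj_on f (verts G)" using ex_nat_copy[OF D(4)] by blast
  let ?g = "the_inv_into (verts G) f"
  define L' where "L' = looped_of (f ` verts G) (\<lambda>i j. loop_matrix L (?g i) (?g j))"
  have "graph_iso (looped_of (verts L) (loop_matrix L)) L'"
    unfolding L'_def using f D(3)
    by (intro graph_iso_looped_ofI[where f = f]) (auto simp: bij_betw_def the_inv_into_f_f)
  then have i: "graph_iso L L'" using looped_of_loop_matrix[OF D(2)] by simp
  obtain G' where G': "realizes G' L'" "lgraph_iso G G'" using realized_iso[OF assms i] by blast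
  have "linked_to G' H" if H: "lgraph_iso G G2" "linked_to G2 H" for G2 H
  proof -
    have lG2: "labeled_graph G2" using H(2) by (simp add: graph_link_rel_def)
    obtain L2 where L2: "realizes G2 L2" "graph_iso L L2" using realizes_iso[OF assms H(1) lG2] by blast
    have "graph_iso L' L2" using graph_iso_trans[OF graph_iso_sym[OF i D(2)] L2(2)] .
    then have "link_eq L' L2" using link.iso realizesD(2) G'(1) L2(1) by blast
    then have "linked_to G' G2" using G'(1) L2(1) unfolding link_eq_def by blast
    then show ?thesis using H(2) linked_to_trans by blast
  qed
  then have F: "graph_link_of G = graph_link_rel `` {G'}"
    unfolding graph_link_of_def using G'(2) by blast
  have H: "homotopy_class_of L = homotopy_rel `` {L'}" by (rule homotopy_class_of_eq[OF i D(2)])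
  show "graph_link_of G \<in> graph_knots" using F graph_knot_iff G'(1) by blast
  show "homotopy_class_of L \<in> homotopy_classes"
    unfolding H by (rule homotopy_classesI[OF realizesD(2)[OF G'(1)]])
  show "writhe_class (graph_link_of G) = homotopy_class_of L"
    unfolding F H by (rule writhe_class_eq[OF G'(1)])
qed

section \<open>Crossings of a diagram\<close>

lemma knot_diagramD:
  assumes "knot_diagram D"
  shows "curve D C1_differentiable_on UNIV" "curve D (t + 1) = curve D t" "tangent D t \<noteq> 0"
    "finite {t \<in> {0..<1}. \<exists>s. meets D s t}"
    "meets D s t \<Longrightarrow> cross (tangent D s) (tangent D t) \<noteq> 0"
    "meets D r s \<Longrightarrow> meets D s t \<Longrightarrow> r - t \<in> \<int>"
    "t + 1 \<in> over D \<longleftrightarrow> t \<in> over D" "t \<in> over D \<Longrightarrow> \<exists>s. meets D s t \<and> s \<notin> over D"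
  using assms unfolding knot_diagram_def by blast+

lemma periodic_int:
  fixes f :: "real \<Rightarrow> 'a"
  assumes "\<And>t. f (t + 1) = f t"
  shows "f (t + of_int k) = f t"
proof -
  have n: "f (t + of_nat m) = f t" for t m
  proof (induction m)
    case (Suc m)
    have "f (t + of_nat (Suc m)) = f (t + of_nat m + 1)" by (simp add: add_ac)
    then show ?case using Suc assms by simp
  qed simp
  show ?thesis
  proof (cases "k \<ge> 0")
    case True
    then show ?thesis using n[of t "nat k"] by simp
  next
    case False
    then have "f (t + of_int k + of_nat (nat (- k))) = f (t + of_int k)" by (intro n)
    then show ?thesis using False by simp
  qed
qed

lemma Ints_diffE:
  fixes s t :: real
  assumes "s - t \<in> \<int>"
  obtains k where "s = t + of_int k"
proof -
  obtain k where "s - t = of_int k" using assms by (rule Ints_cases)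
  then show ?thesis by (intro that[of k]) simp
qed

lemma curve_cong: "knot_diagram D \<Longrightarrow> s - t \<in> \<int> \<Longrightarrow> curve D s = curve D t"
  by (elim Ints_diffE) (simp add: periodic_int[of "curve D"] knot_diagramD(2))

lemma over_cong: "knot_diagram D \<Longrightarrow> s - t \<in> \<int> \<Longrightarrow> s \<in> over D \<longleftrightarrow> t \<in> over D"
  by (elim Ints_diffE) (simp add: periodic_int[of "\<lambda>t. t \<in> over D"] knot_diagramD(7))

lemma Ints_diff_cong:
  fixes s t :: real
  assumes "s - s' \<in> \<int>" "t - t' \<in> \<int>"
  shows "s - t \<in> \<int> \<longleftrightarrow> s' - t' \<in> \<int>"
proof -
  have "s - t = (s' - t') + ((s - s') - (t - t'))" "s' - t' = (s - t) - ((s - s') - (t - t'))" by simp_all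
  then show ?thesis using assms by (metis Ints_add Ints_diff)
qed

lemma Ints_diff_commute: "s - t \<in> \<int> \<longleftrightarrow> t - s \<in> (\<int> :: real set)"
  using Ints_minus[of "s - t"] Ints_minus[of "t - s"] by auto

lemma meets_cong:
  assumes "knot_diagram D" "s - s' \<in> \<int>" "t - t' \<in> \<int>"
  shows "meets D s t \<longleftrightarrow> meets D s' t'"
  unfolding meets_def using Ints_diff_cong[OF assms(2,3)] curve_cong[OF assms(1,2)] curve_cong[OF assms(1,3)] by simp

lemma meets_commute: "meets D s t \<longleftrightarrow> meets D t s"
  unfolding meets_def using Ints_diff_commute[of s t] by auto

lemma classical_cong:
  assumes "knot_diagram D" "s - s' \<in> \<int>" "t - t' \<in> \<int>"
  shows "classical D s t \<longleftrightarrow> classical D s' t'"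
  unfolding classical_def using meets_cong[OF assms] over_cong[OF assms(1,2)] over_cong[OF assms(1,3)] by simp

lemma classical_commute: "classical D s t \<longleftrightarrow> classical D t s"
  unfolding classical_def using meets_commute by blast

lemma frac_diff_Ints: "t - frac t \<in> \<int>" "frac t - t \<in> \<int>"
  by (simp_all add: frac_def)

lemma frac_unit: "frac t \<in> {0..<1}"
  by (simp add: frac_lt_1)

lemma unit_eqI:
  fixes s t :: real
  assumes "s - t \<in> \<int>" "s \<in> {0..<1}" "t \<in> {0..<1}"
  shows "s = t"
proof -
  obtain k where k: "s = t + of_int k" using assms(1) by (rule Ints_diffE)
  then have "- 1 < real_of_int k" "real_of_int k < 1" using assms(2,3) by auto
  then have "k = 0" by linarith
  then show ?thesis using k by simp
qed

lemma classical_unique: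
  assumes "knot_diagram D" "classical D s t" "classical D s t'"
  shows "t - t' \<in> \<int>"
  using assms knot_diagramD(6)[OF assms(1), of t s t'] meets_commute[of D t s] unfolding classical_def by blast

text \<open>A time in \<open>over\<close> has a partner outside \<open>over\<close>, and the absence
  of triple points identifies every partner with it modulo integers.\<close>

lemma classical_over:
  assumes "knot_diagram D" "classical D s t"
  shows "s \<in> over D \<longleftrightarrow> t \<notin> over D"
proof -
  have *: "t \<notin> over D" if st: "meets D s t" and s: "s \<in> over D" for s t
  proof -
    obtain r where r: "meets D r s" "r \<notin> over D" using knot_diagramD(8)[OF assms(1) s] by blast
    then have "r - t \<in> \<int>" using knot_diagramD(6)[OF assms(1) r(1) st] by blast
    then show ?thesis using over_cong[OF assms(1)] r(2) by blast
  qed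
  show ?thesis using *[of s t] *[of t s] assms(2) meets_commute[of D s t] unfolding classical_def by blast
qed

lemma finite_classical_times: "knot_diagram D \<Longrightarrow> finite (classical_times D)"
  unfolding classical_times_def classical_def
  by (rule finite_subset[OF _ knot_diagramD(4)[of D]]) auto

lemma crossingI:
  assumes "knot_diagram D" "classical D s t"
  shows "{frac s, frac t} \<in> crossings D"
  using classical_cong[OF assms(1) frac_diff_Ints(2) frac_diff_Ints(2), of s t] assms(2) frac_unit
  unfolding crossings_def by blast

lemma crossingE:
  assumes "c \<in> crossings D"
  obtains s t where "c = {s, t}" "s < t" "classical D s t" "s \<in> {0..<1}" "t \<in> {0..<1}"
    "s \<in> classical_times D" "t \<in> classical_times D"
proof -
  obtain s t where st: "c = {s, t}" "s \<in> {0..<1}" "t \<in> {0..<1}" "classical D s t"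
    using assms unfolding crossings_def by auto
  then have T: "s \<in> classical_times D" "t \<in> classical_times D"
    using classical_commute unfolding classical_times_def by blast+
  have "s \<noteq> t" using st(4) by (auto simp: classical_def meets_def)
  then consider "s < t" | "t < s" by linarith
  then show ?thesis
  proof cases
    case 1
    then show ?thesis using st T by (intro that[of s t])
  next
    case 2
    then show ?thesis using st T classical_commute[of D s t] by (intro that[of t s]) auto
  qed
qed

lemma crossing_subset: "c \<in> crossings D \<Longrightarrow> c \<subseteq> classical_times D"
  by (elim crossingE) simp

lemma finite_crossings: "knot_diagram D \<Longrightarrow> finite (crossings D)"
  using finite_subset[of "crossings D" "Pow (classical_times D)"] crossing_subset finite_classical_times by blast

lemma ex_crossing:
  assumes "knot_diagram D" "t \<in> classical_times D"
  shows "\<exists>c\<in>crossings D. t \<in> c"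
proof -
  obtain s where s: "classical D s t" "t \<in> {0..<1}" using assms(2) unfolding classical_times_def by auto
  have "frac t = t" using s(2) by (simp add: frac_eq)
  then show ?thesis using crossingI[OF assms(1) s(1)] by (intro bexI[of _ "{frac s, frac t}"]) auto
qed

lemma crossing_unique:
  assumes D: "knot_diagram D" and c: "c \<in> crossings D" and d: "d \<in> crossings D" and t: "t \<in> c" "t \<in> d"
  shows "c = d"
proof -
  have *: "\<exists>s. c = {s, t} \<and> classical D t s \<and> s \<in> {0..<1}" if c: "c \<in> crossings D" and t: "t \<in> c" for c
  proof -
    obtain p q where pq: "c = {p, q}" "classical D p q" "p \<in> {0..<1}" "q \<in> {0..<1}" using c by (elim crossingE)
    from t pq(1) consider "t = p" | "t = q" by blast
    then show ?thesis
    proof cases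
      case 1
      then show ?thesis using pq by (intro exI[of _ q]) auto
    next
      case 2
      then show ?thesis using pq classical_commute[of D p q] by (intro exI[of _ p]) auto
    qed
  qed
  obtain s where s: "c = {s, t}" "classical D t s" "s \<in> {0..<1}" using *[OF c t(1)] by (elim exE conjE)
  obtain s' where s': "d = {s', t}" "classical D t s'" "s' \<in> {0..<1}" using *[OF d t(2)] by (elim exE conjE)
  have "s = s'" using unit_eqI[OF classical_unique[OF D s(2) s'(2)] s(3) s'(3)] .
  then show ?thesis using s s' by simp
qed

lemma linked_commute: "linked c d \<longleftrightarrow> linked d c"
  unfolding linked_def by blast

lemma linked_irrefl: "\<not> linked c c"
  unfolding linked_def by (auto simp: doubleton_eq_iff)

text \<open>The parity form of interleaving, which turns linking into a sum of two bits.\<close>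

lemma linked_iff:
  fixes p q x y :: "'a :: linorder"
  assumes "p < q" "x \<noteq> y" "x \<notin> {p, q}" "y \<notin> {p, q}"
  shows "linked {p, q} {x, y} \<longleftrightarrow> (p < x \<and> x < q) \<noteq> (p < y \<and> y < q)"
proof
  assume "linked {p, q} {x, y}"
  then obtain p' q' x' y' where *: "{p, q} = {p', q'}" "{x, y} = {x', y'}"
    "p' < x' \<and> x' < q' \<and> q' < y' \<or> x' < p' \<and> p' < y' \<and> y' < q'" unfolding linked_def by blast
  then have "p' = p \<and> q' = q \<or> p' = q \<and> q' = p" "x' = x \<and> y' = y \<or> x' = y \<and> y' = x"
    by (auto simp: doubleton_eq_iff)
  then show "(p < x \<and> x < q) \<noteq> (p < y \<and> y < q)" using *(3) assms(1) by auto
next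
  assume *: "(p < x \<and> x < q) \<noteq> (p < y \<and> y < q)"
  have l: "linked {p, q} {a, b}" if "p < a" "a < q" "\<not> (p < b \<and> b < q)" "b \<notin> {p, q}" for a b
  proof -
    from that consider "b < p" | "q < b" by fastforce
    then show ?thesis
    proof cases
      case 1
      have "{a, b} = {b, a}" by (rule insert_commute)
      then show ?thesis unfolding linked_def using that 1 by blast
    next
      case 2
      then show ?thesis unfolding linked_def using that by blast
    qed
  qed
  show "linked {p, q} {x, y}"
    using * l[of x y] l[of y x] assms by (auto simp: insert_commute)
qed

lemma negative_crossing_iff:
  assumes "knot_diagram D" "classical D s t" "s \<in> over D"
  shows "negative_crossing D {s, t} \<longleftrightarrow> cross (tangent D s) (tangent D t) < 0"
  using classical_over[OF assms(1,2)] assms(3) unfolding negative_crossing_def by (auto simp: doubleton_eq_iff)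

lemma looped_gauss_graph: "knot_diagram D \<Longrightarrow> looped_graph (gauss_graph D)"
  unfolding looped_graph_def gauss_graph_def using finite_crossings by auto

lemma loop_matrix_gauss:
  assumes "c \<in> crossings D" "d \<in> crossings D"
  shows "loop_matrix (gauss_graph D) c d = of_bool (if c = d then negative_crossing D c else linked c d)"
proof -
  have "{c, d} \<in> edges (gauss_graph D) \<longleftrightarrow> linked c d \<or> c = d \<and> negative_crossing D c"
    unfolding gauss_graph_def using assms linked_commute[of c d]
    by (auto simp: doubleton_eq_iff singleton_insert_inj_eq singleton_insert_inj_eq')
  then show ?thesis using linked_irrefl[of c] by (auto simp: loop_matrix_def)
qed

section \<open>Rotating circuits\<close>

lemma next_prev:
  fixes T :: "real set"
  assumes T: "T = classical_times D" "finite T" and t: "t \<in> T"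
  shows "prev_time D t \<in> T" "next_time D t \<in> T" "next_time D (prev_time D t) = t" "prev_time D (next_time D t) = t"
proof -
  have p: "prev_time D x = (if {s \<in> T. s < x} = {} then Max T else Max {s \<in> T. s < x})" for x
    unfolding prev_time_def Let_def T(1) ..
  have n: "next_time D x = (if {s \<in> T. x < s} = {} then Min T else Min {s \<in> T. x < s})" for x
    unfolding next_time_def Let_def T(1) ..
  have ne: "T \<noteq> {}" using t by auto
  have MT: "Max T \<in> T" "Min T \<in> T" using T(2) ne by auto
  have f: "finite {s \<in> T. P s}" for P using T(2) by simp
  show "prev_time D t \<in> T" unfolding p using MT Max_in[OF f[of "\<lambda>s. s < t"]] by auto
  show "next_time D t \<in> T" unfolding n using MT Min_in[OF f[of "\<lambda>s. t < s"]] by auto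
  show "next_time D (prev_time D t) = t"
  proof (cases "{s \<in> T. s < t} = {}")
    case True
    then have 1: "prev_time D t = Max T" by (simp add: p)
    have "{s \<in> T. Max T < s} = {}" using T(2) by (auto simp: not_less)
    moreover have "Min T = t" using True t T(2) by (intro Min_eqI) (auto simp: not_less)
    ultimately show ?thesis unfolding 1 n by simp
  next
    case False
    define r where "r = Max {s \<in> T. s < t}"
    have r: "r \<in> T" "r < t" using Max_in[OF f False] by (auto simp: r_def)
    have rm: "s \<le> r" if "s \<in> T" "s < t" for s unfolding r_def using that f by (intro Max_ge) auto
    have "Min {s \<in> T. r < s} = t" using t r rm f by (intro Min_eqI) force+
    moreover have n0: "{s \<in> T. r < s} \<noteq> {}" using t r by auto
    moreover have "prev_time D t = r" by (simp only: p r_def False if_False)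
    ultimately show ?thesis by (simp only: n[of r] n0 if_False)
  qed
  show "prev_time D (next_time D t) = t"
  proof (cases "{s \<in> T. t < s} = {}")
    case True
    then have 1: "next_time D t = Min T" by (simp add: n)
    have "{s \<in> T. s < Min T} = {}" using T(2) by (auto simp: not_less)
    moreover have "Max T = t" using True t T(2) by (intro Max_eqI) (auto simp: not_less)
    ultimately show ?thesis unfolding 1 p by simp
  next
    case False
    define r where "r = Min {s \<in> T. t < s}"
    have r: "r \<in> T" "t < r" using Min_in[OF f False] by (auto simp: r_def)
    have rm: "r \<le> s" if "s \<in> T" "t < s" for s unfolding r_def using that f by (intro Min_le) auto
    have "Max {s \<in> T. s < r} = t" using t r rm f by (intro Max_eqI) force+
    moreover have n0: "{s \<in> T. s < r} \<noteq> {}" using t r by auto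
    moreover have "next_time D t = r" by (simp only: n r_def False if_False)
    ultimately show ?thesis by (simp only: p[of r] n0 if_False)
  qed
qed

text \<open>Naming the edge before a time by its start moves the closed end of the half-open
  interval. If \<open>x\<close> is the first time, the predecessor wraps around to the last one, and
  both sides are false.\<close>

lemma prev_time_between:
  assumes T: "finite (classical_times D)" and st: "s \<in> classical_times D" "t \<in> classical_times D" "x \<in> classical_times D"
  shows "s \<le> prev_time D x \<and> prev_time D x < t \<longleftrightarrow> s < x \<and> x \<le> t"
proof -
  let ?E = "{s \<in> classical_times D. s < x}"
  show ?thesis
  proof (cases "?E = {}")
    case True
    then have "prev_time D x = Max (classical_times D)" by (simp add: prev_time_def)
    then have "t \<le> prev_time D x" using T st by simp
    moreover have "\<not> s < x" using True st by blast
    ultimately show ?thesis by auto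
  next
    case False
    have p: "prev_time D x = Max ?E" by (simp only: prev_time_def Let_def False if_False)
    have f: "finite ?E" using T by simp
    have "prev_time D x < x" using Max_in[OF f False] p by simp
    moreover have "r \<le> prev_time D x" if "r \<in> classical_times D" "r < x" for r
      unfolding p using that f by (intro Max_ge) auto
    ultimately show ?thesis using st by (metis leD le_less_trans less_le_trans not_le)
  qed
qed

section \<open>Half-edges and visits of a rotating circuit\<close>

locale circuit =
  fixes D :: vdiagram and C :: "half_edge list"
  assumes D: "knot_diagram D" and rot: "rotating_circuit D C" and ne: "crossings D \<noteq> {}"
begin

lemma finite_times: "finite (classical_times D)"
  using finite_classical_times[OF D] .

lemma bij_edges: "bij_betw (\<lambda>i. edge_of D (C ! i)) {..<length C} (classical_times D)"
  using rot unfolding rotating_circuit_def by blast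

lemma fst_nth: "k < length C \<Longrightarrow> fst (C ! k) \<in> classical_times D"
  using rot unfolding rotating_circuit_def by simp

lemma nonempty: "0 < length C"
proof -
  obtain c where "c \<in> crossings D" using ne by blast
  then have "classical_times D \<noteq> {}" by (elim crossingE) auto
  then show ?thesis using bij_edges by (cases "length C") (auto simp: bij_betw_def)
qed

lemma transition: "k < length C \<Longrightarrow> {fst (other_end D (C ! k)), fst (C ! (Suc k mod length C))} \<in> crossings D"
  using rot unfolding rotating_circuit_def adjacent_half_edges_def by blast

lemma other_end:
  assumes "fst h \<in> classical_times D"
  shows "fst (other_end D h) \<in> classical_times D" "other_end D (other_end D h) = h"
    "edge_of D (other_end D h) = edge_of D h" "edge_of D h \<in> classical_times D"
    "snd (other_end D h) \<noteq> snd h"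
proof -
  obtain t b where h: "h = (t, b)" by (cases h)
  note np = next_prev[OF refl finite_times assms]
  show "fst (other_end D h) \<in> classical_times D" "other_end D (other_end D h) = h"
    "edge_of D (other_end D h) = edge_of D h" "edge_of D h \<in> classical_times D"
    "snd (other_end D h) \<noteq> snd h"
    using np assms unfolding h by (cases b; simp)+
qed

lemma edge_of_eqD:
  assumes "fst h \<in> classical_times D" "fst h' \<in> classical_times D" "edge_of D h = edge_of D h'"
  shows "h' = h \<or> h' = other_end D h"
proof -
  obtain t b t' b' where h: "h = (t, b)" "h' = (t', b')" by (cases h; cases h')
  have np: "next_time D (prev_time D t) = t" "next_time D (prev_time D t') = t'"
    using next_prev(3)[OF refl finite_times assms(1)] next_prev(3)[OF refl finite_times assms(2)] h by simp_all
  consider "b" "b'" | "b" "\<not> b'" | "\<not> b" "b'" | "\<not> b" "\<not> b'" by blast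
  then show ?thesis
  proof cases
    case 2
    then have "t = prev_time D t'" using assms(3) h by simp
    then have "next_time D t = t'" using np(2) by simp
    then show ?thesis using 2 h by simp
  next
    case 4
    then have "prev_time D t = prev_time D t'" using assms(3) h by simp
    then have "t = t'" using np by metis
    then show ?thesis using 4 h by simp
  qed (use assms(3) h in auto)
qed

text \<open>Well defined on half-edges at classical times, since the tour traverses every edge once,
  in one of its two directions.\<close>

definition idx :: "half_edge \<Rightarrow> nat" where
  "idx h = (THE k. k < length C \<and> edge_of D (C ! k) = edge_of D h)"

lemma edge_inj:
  assumes "k < length C" "l < length C" "edge_of D (C ! k) = edge_of D (C ! l)"
  shows "k = l"
  using bij_edges assms unfolding bij_betw_def by (auto dest: inj_onD)

lemma idx_eqI:
  assumes "k < length C" "edge_of D (C ! k) = edge_of D h"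
  shows "idx h = k"
  unfolding idx_def
proof (rule the_equality)
  show "l = k" if "l < length C \<and> edge_of D (C ! l) = edge_of D h" for l
    using that assms by (intro edge_inj) auto
qed (use assms in blast)

lemma idx:
  assumes "fst h \<in> classical_times D"
  shows "idx h < length C" "edge_of D (C ! idx h) = edge_of D h" "C ! idx h = h \<or> C ! idx h = other_end D h"
proof -
  have "edge_of D h \<in> (\<lambda>i. edge_of D (C ! i)) ` {..<length C}"
    using bij_edges other_end(4)[OF assms] unfolding bij_betw_def by simp
  then obtain k where k: "k < length C" "edge_of D (C ! k) = edge_of D h" by auto
  then have "idx h = k" by (rule idx_eqI)
  then show "idx h < length C" "edge_of D (C ! idx h) = edge_of D h" using k by simp_all
  then show "C ! idx h = h \<or> C ! idx h = other_end D h"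
    using edge_of_eqD[OF assms fst_nth[OF \<open>idx h < length C\<close>]] by simp
qed

lemma idx_nth: "k < length C \<Longrightarrow> idx (C ! k) = k"
  by (rule idx_eqI) simp_all

lemma idx_other_end_nth: "k < length C \<Longrightarrow> idx (other_end D (C ! k)) = k"
  by (rule idx_eqI) (simp_all add: other_end(3)[OF fst_nth])

lemma departure_iff:
  assumes "fst h \<in> classical_times D"
  shows "h \<in> set C \<longleftrightarrow> C ! idx h = h" "h \<notin> set C \<longleftrightarrow> C ! idx h = other_end D h"
proof -
  have ne: "other_end D h \<noteq> h" using other_end(5)[OF assms] by auto
  have 1: "C ! idx h = h" if h: "h \<in> set C"
  proof -
    obtain k where k: "k < length C" "C ! k = h" using h unfolding in_set_conv_nth by blast
    then have "idx h = k" using idx_nth by auto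
    then show ?thesis using k by simp
  qed
  have 2: "h \<in> set C" if "C ! idx h = h" using nth_mem[OF idx(1)[OF assms]] that by simp
  show "h \<in> set C \<longleftrightarrow> C ! idx h = h" using 1 2 by blast
  show "h \<notin> set C \<longleftrightarrow> C ! idx h = other_end D h" using 1 2 ne idx(3)[OF assms] by auto
qed

lemma arrival:
  assumes "fst h \<in> classical_times D" "h \<notin> set C"
  shows "h = other_end D (C ! idx h)"
  using departure_iff(2)[OF assms(1)] assms(2) other_end(2)[OF assms(1)] by simp

lemma other_end_nth_notin:
  assumes "k < length C"
  shows "other_end D (C ! k) \<notin> set C"
proof -
  have f: "fst (other_end D (C ! k)) \<in> classical_times D" using other_end(1)[OF fst_nth[OF assms]] .
  show ?thesis
    using departure_iff(2)[OF f] idx_other_end_nth[OF assms] other_end(2)[OF fst_nth[OF assms]] by simp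
qed

text \<open>The position of the visit of the circuit to which a half-edge belongs.\<close>

definition pos :: "half_edge \<Rightarrow> nat" where
  "pos h = (if h \<in> set C then idx h else Suc (idx h) mod length C)"

lemma pos_less: "fst h \<in> classical_times D \<Longrightarrow> pos h < length C"
  using idx(1) nonempty by (simp add: pos_def)

lemma pos_nth: "k < length C \<Longrightarrow> pos (C ! k) = k"
  by (simp add: pos_def idx_nth)

lemma pos_other_end_nth: "k < length C \<Longrightarrow> pos (other_end D (C ! k)) = Suc k mod length C"
  by (simp add: pos_def other_end_nth_notin idx_other_end_nth)

lemma nth_pos_departure: "h \<in> set C \<Longrightarrow> fst h \<in> classical_times D \<Longrightarrow> C ! pos h = h"
  using departure_iff(1) by (simp add: pos_def)

lemma arrival_transition:
  assumes "fst h \<in> classical_times D" "h \<notin> set C"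
  shows "{fst h, fst (C ! pos h)} \<in> crossings D"
  using transition[OF idx(1)[OF assms(1)]] arrival[OF assms] assms(2) by (simp add: pos_def)

text \<open>A visit consists of one arrival and one departure, so distinct half-edges at one
  position are of different kinds, and the tour turns from one to the other.\<close>

lemma same_position:
  assumes "fst h \<in> classical_times D" "fst h' \<in> classical_times D" "pos h = pos h'" "h \<noteq> h'"
  shows "h \<in> set C \<longleftrightarrow> h' \<notin> set C" "{fst h, fst h'} \<in> crossings D"
proof -
  have dd: False if "h \<in> set C" "h' \<in> set C"
    using nth_pos_departure[OF that(1) assms(1)] nth_pos_departure[OF that(2) assms(2)] assms(3,4) by simp
  have aa: False if "h \<notin> set C" "h' \<notin> set C"
  proof -
    have "Suc (idx h) mod length C = Suc (idx h') mod length C" using assms(3) that by (simp add: pos_def)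
    then have "idx h = idx h'" using idx(1)[OF assms(1)] idx(1)[OF assms(2)]
      by (metis Suc_lessI mod_less mod_self nat.inject zero_less_Suc less_irrefl)
    then show False using arrival[OF assms(1) that(1)] arrival[OF assms(2) that(2)] assms(4) by simp
  qed
  show x: "h \<in> set C \<longleftrightarrow> h' \<notin> set C" using dd aa by blast
  show "{fst h, fst h'} \<in> crossings D"
  proof (cases "h \<in> set C")
    case True
    then show ?thesis using arrival_transition[OF assms(2)] x nth_pos_departure[OF True assms(1)] assms(3)
      by (simp add: insert_commute)
  next
    case False
    then have "h' \<in> set C" using x by simp
    then show ?thesis using arrival_transition[OF assms(1) False] nth_pos_departure[OF _ assms(2)] assms(3) by simp
  qed
qed

lemma crossing_two_times: "{t, t'} \<in> crossings D \<Longrightarrow> t \<noteq> t'"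
  by (elim crossingE) auto

text \<open>\<open>adjacent_half_edges\<close> forbids going straight on, because the two times of a
  crossing are different.\<close>

lemma pos_straight: "t \<in> classical_times D \<Longrightarrow> pos (t, True) \<noteq> pos (t, False)"
  using same_position(2)[of "(t, True)" "(t, False)"] crossing_two_times[of t t] by auto

lemma ex_arrival:
  assumes "k < length C"
  obtains h where "fst h \<in> classical_times D" "h \<notin> set C" "pos h = k"
proof -
  let ?l = "if k = 0 then length C - 1 else k - 1"
  have l: "?l < length C" "Suc ?l mod length C = k" using assms by (auto simp: less_imp_diff_less)
  show ?thesis
    using other_end(1)[OF fst_nth[OF l(1)]] other_end_nth_notin[OF l(1)] pos_other_end_nth[OF l(1)] l(2)
    by (intro that) auto
qed

lemma pos_mem_chord:
  assumes "c \<in> crossings D" "fst h \<in> c"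
  shows "pos h \<in> circuit_chord C c"
proof -
  have h: "fst h \<in> classical_times D" using assms crossing_subset by blast
  show ?thesis
  proof (cases "h \<in> set C")
    case True
    then show ?thesis using nth_pos_departure[OF True h] pos_less[OF h] assms by (simp add: circuit_chord_def)
  next
    case False
    have "c = {fst h, fst (C ! pos h)}"
      using crossing_unique[OF D assms(1) arrival_transition[OF h False] assms(2)] by simp
    then show ?thesis using pos_less[OF h] by (auto simp: circuit_chord_def)
  qed
qed

text \<open>Each of the two visits to a crossing uses one half-edge of either strand, so the
  half-edges of a single strand already show both positions.\<close>

lemma circuit_chord_eq:
  assumes c: "c \<in> crossings D" and t: "t \<in> c"
  shows "circuit_chord C c = {pos (t, True), pos (t, False)}"
proof
  show "{pos (t, True), pos (t, False)} \<subseteq> circuit_chord C c"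
    using pos_mem_chord[OF c, of "(t, True)"] pos_mem_chord[OF c, of "(t, False)"] t by simp
  show "circuit_chord C c \<subseteq> {pos (t, True), pos (t, False)}"
  proof
    fix k assume "k \<in> circuit_chord C c"
    then have k: "k < length C" "fst (C ! k) \<in> c" by (auto simp: circuit_chord_def)
    obtain h where h: "fst h \<in> classical_times D" "h \<notin> set C" "pos h = k" using ex_arrival[OF k(1)] .
    have e: "{fst h, fst (C ! k)} \<in> crossings D" using arrival_transition[OF h(1,2)] h(3) by simp
    have "c = {fst h, fst (C ! k)}" using crossing_unique[OF D c e k(2)] by simp
    then have "\<exists>g. fst g = t \<and> pos g = k" using t h(3) pos_nth[OF k(1)] by blast
    then obtain b where "pos (t, b) = k" by (metis prod.collapse)
    then show "k \<in> {pos (t, True), pos (t, False)}" by (cases b) auto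
  qed
qed

lemma circuit_chordE:
  assumes "c \<in> crossings D"
  obtains i j where "circuit_chord C c = {i, j}" "i < j" "j < length C"
proof -
  obtain t where t: "t \<in> c" "t \<in> classical_times D" using assms by (elim crossingE) auto
  let ?i = "pos (t, True)" and ?j = "pos (t, False)"
  have e: "circuit_chord C c = {?i, ?j}" by (rule circuit_chord_eq[OF assms t(1)])
  have l: "?i < length C" "?j < length C" using pos_less t(2) by simp_all
  consider "?i < ?j" | "?j < ?i" using pos_straight[OF t(2)] by linarith
  then show ?thesis
  proof cases
    case 1
    then show ?thesis using e l by (intro that[of ?i ?j])
  next
    case 2
    then show ?thesis using e l by (intro that[of ?j ?i]) auto
  qed
qed

lemma circuit_chord_disjoint:
  assumes "c \<in> crossings D" "d \<in> crossings D" "c \<noteq> d"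
  shows "circuit_chord C c \<inter> circuit_chord C d = {}"
  using crossing_unique[OF D assms(1,2)] assms(3) unfolding circuit_chord_def by blast

text \<open>
  \<open>X u\<close> marks the edges of one of the two halves into which the rotating circuit is cut at \<open>u\<close>,
  and \<open>Y v\<close> the edges of one half of the straight circuit. Both are cycles of the 4-graph, and so
  is \<open>Y v\<close> plus the sum of \<open>X u\<close> weighted by the Gauss diagram matrix \<open>N\<close>. This
  combination does not jump along the circuit \<open>C\<close>; hence it is constant, and the fact that it
  does not jump along the straight circuit either says that \<open>N\<close> is the inverse matrix.
\<close>

definition X :: "real set \<Rightarrow> half_edge \<Rightarrow> bit" where
  "X u h = of_bool (Min (circuit_chord C u) \<le> idx h \<and> idx h < Max (circuit_chord C u))"

definition Y :: "real set \<Rightarrow> half_edge \<Rightarrow> bit" where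
  "Y v h = of_bool (Min v \<le> edge_of D h \<and> edge_of D h < Max v)"

text \<open>An edge departs at its own index and arrives one later, so the half-open interval is
  closed on the left for departures and on the right for arrivals. The edge that returns to position
  0 lies outside because \<open>j < length C\<close>.\<close>

lemma X_eq:
  assumes "circuit_chord C u = {i, j}" "i < j" "j < length C" "fst h \<in> classical_times D"
  shows "X u h = of_bool (if h \<in> set C then i \<le> pos h \<and> pos h < j else i < pos h \<and> pos h \<le> j)"
proof -
  have m: "Min (circuit_chord C u) = i" "Max (circuit_chord C u) = j" using assms(1,2) by (auto simp: min_def max_def)
  show ?thesis
  proof (cases "h \<in> set C")
    case True
    then show ?thesis by (simp add: X_def m pos_def)
  next
    case False
    have k: "idx h < length C" by (rule idx(1)[OF assms(4)])
    have "i \<le> idx h \<and> idx h < j \<longleftrightarrow> i < Suc (idx h) mod length C \<and> Suc (idx h) mod length C \<le> j"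
    proof (cases "Suc (idx h) = length C")
      case True
      then show ?thesis using assms(2,3) by auto
    next
      case False
      then have "Suc (idx h) mod length C = Suc (idx h)" using k by simp
      then show ?thesis by auto
    qed
    then show ?thesis using False by (simp add: X_def m pos_def)
  qed
qed

lemma label_matrix_circuit:
  assumes "u \<in> crossings D" "w \<in> crossings D"
  shows "label_matrix (circuit_graph D C) u w = (if u = w then circuit_framing C u + 1
    else of_bool (linked (circuit_chord C u) (circuit_chord C w)))"
proof -
  have "{u, w} \<in> edges (circuit_graph D C) \<longleftrightarrow> linked (circuit_chord C u) (circuit_chord C w)"
    unfolding circuit_graph_def using assms linked_commute[of "circuit_chord C u" "circuit_chord C w"]
    by (auto simp: doubleton_eq_iff)
  then show ?thesis by (simp add: label_matrix_def circuit_graph_def)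
qed

text \<open>At each visit a half-edge of one strand is paired with one of the other, one arriving
  and one departing; so both strands determine the same framing.\<close>

lemma mixed_iff:
  assumes w: "{t, t'} \<in> crossings D"
  shows "((t, True) \<in> set C \<longleftrightarrow> (t, False) \<in> set C) \<longleftrightarrow> ((t', True) \<in> set C \<longleftrightarrow> (t', False) \<in> set C)"
proof -
  let ?w = "{t, t'}"
  have T: "t \<in> classical_times D" "t' \<in> classical_times D" using crossing_subset[OF w] by auto
  have ne: "t \<noteq> t'" by (rule crossing_two_times[OF w])
  have e: "{pos (t, True), pos (t, False)} = {pos (t', True), pos (t', False)}"
    using circuit_chord_eq[OF w, of t] circuit_chord_eq[OF w, of t'] by simp
  have x: "(t, b) \<in> set C \<longleftrightarrow> (t', b') \<notin> set C" if "pos (t, b) = pos (t', b')" for b b'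
    using same_position(1)[of "(t, b)" "(t', b')"] that T ne by simp
  have "pos (t, True) = pos (t', True) \<and> pos (t, False) = pos (t', False) \<or>
    pos (t, True) = pos (t', False) \<and> pos (t, False) = pos (t', True)"
    using e by (auto simp: doubleton_eq_iff)
  then show ?thesis using x[of True True] x[of False False] x[of True False] x[of False True] by blast
qed

lemma circuit_framing_eq:
  assumes w: "w \<in> crossings D" and t: "t \<in> w"
  shows "circuit_framing C w = of_bool (((t, True) \<in> set C) \<noteq> ((t, False) \<in> set C))"
proof -
  have "((s, True) \<in> set C \<longleftrightarrow> (s, False) \<in> set C) \<longleftrightarrow> ((t, True) \<in> set C \<longleftrightarrow> (t, False) \<in> set C)" if "s \<in> w" for s
  proof (cases "s = t")
    case False
    obtain p q where "w = {p, q}" using w by (elim crossingE)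
    then have "w = {s, t}" using \<open>s \<in> w\<close> t False by auto
    then show ?thesis using mixed_iff[of s t] w by simp
  qed simp
  then show ?thesis unfolding circuit_framing_def using t by (intro arg_cong[where f = of_bool]) blast
qed

text \<open>Going straight through \<open>w\<close> leads from one visit of \<open>w\<close> to the
  other. For \<open>w\<close> different from \<open>u\<close> this changes the half of the circuit
  iff the chords are linked; at \<open>u\<close> itself both half-edges lie in the same half iff the
  framing is 1.\<close>

lemma X_straight:
  assumes u: "u \<in> crossings D" and w: "w \<in> crossings D" and t: "t \<in> w"
  shows "X u (t, True) + X u (t, False) = label_matrix (circuit_graph D C) u w"
proof -
  obtain i j where ij: "circuit_chord C u = {i, j}" "i < j" "j < length C" using circuit_chordE[OF u] .
  have T: "t \<in> classical_times D" using crossing_subset[OF w] t by blast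
  let ?a = "pos (t, True)" and ?b = "pos (t, False)"
  have ab: "circuit_chord C w = {?a, ?b}" "?a \<noteq> ?b" using circuit_chord_eq[OF w t] pos_straight[OF T] by auto
  have x: "X u (t, b) = of_bool (if (t, b) \<in> set C then i \<le> pos (t, b) \<and> pos (t, b) < j
      else i < pos (t, b) \<and> pos (t, b) \<le> j)" for b
    using X_eq[OF ij, of "(t, b)"] T by simp
  show ?thesis
  proof (cases "u = w")
    case True
    then have e: "?a = i \<and> ?b = j \<or> ?a = j \<and> ?b = i" using ab ij by (auto simp: doubleton_eq_iff)
    show ?thesis unfolding label_matrix_circuit[OF u w] x circuit_framing_eq[OF u t[folded True]]
      using e ij(2) True by auto
  next
    case False
    then have "{i, j} \<inter> {?a, ?b} = {}" using circuit_chord_disjoint[OF u w] ab ij by simp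
    then have n: "?a \<notin> {i, j}" "?b \<notin> {i, j}" by auto
    have y: "X u (t, b) = of_bool (i < pos (t, b) \<and> pos (t, b) < j)" if "pos (t, b) \<notin> {i, j}" for b
      unfolding x using that by (auto simp: le_less)
    have "linked {i, j} {?a, ?b} \<longleftrightarrow> (i < ?a \<and> ?a < j) \<noteq> (i < ?b \<and> ?b < j)"
      by (rule linked_iff[OF ij(2) ab(2) n])
    then show ?thesis unfolding label_matrix_circuit[OF u w] y[OF n(1)] y[OF n(2)] ab(1) ij(1)
      using False by (simp only: if_False of_bool_xor)
  qed
qed

lemma X_jump:
  assumes u: "u \<in> crossings D" and k: "k < length C"
  shows "X u (C ! k) + X u (C ! (Suc k mod length C)) = of_bool (fst (C ! (Suc k mod length C)) \<in> u)"
proof -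
  obtain i j where ij: "circuit_chord C u = {i, j}" "i < j" "j < length C" using circuit_chordE[OF u] .
  let ?l = "Suc k mod length C"
  have l: "?l < length C" using nonempty by simp
  have "fst (C ! ?l) \<in> u \<longleftrightarrow> ?l \<in> circuit_chord C u" using l by (simp add: circuit_chord_def)
  then have m: "fst (C ! ?l) \<in> u \<longleftrightarrow> ?l = i \<or> ?l = j" using ij by simp
  have x: "X u (C ! m) = of_bool (i \<le> m \<and> m < j)" if "m < length C" for m
    using X_eq[OF ij fst_nth[OF that]] that by (simp add: pos_nth)
  show ?thesis
  proof (cases "Suc k = length C")
    case True
    then show ?thesis unfolding x[OF k] x[OF l] m using ij(2,3) by auto
  next
    case False
    then have "?l = Suc k" using k by simp
    then show ?thesis unfolding x[OF k] x[OF l] m using ij(2) by auto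
  qed
qed

lemma Y_eq:
  assumes v: "v = {s, t}" "s < t" "v \<in> crossings D" and x: "x \<in> classical_times D"
  shows "Y v (x, True) = of_bool (s \<le> x \<and> x < t)" "Y v (x, False) = of_bool (s < x \<and> x \<le> t)"
proof -
  have m: "Min v = s" "Max v = t" using v(1,2) by (auto simp: min_def max_def)
  have T: "s \<in> classical_times D" "t \<in> classical_times D" using crossing_subset[OF v(3)] v(1) by auto
  show "Y v (x, True) = of_bool (s \<le> x \<and> x < t)" by (simp add: Y_def m)
  show "Y v (x, False) = of_bool (s < x \<and> x \<le> t)"
    using prev_time_between[OF finite_times T x] by (simp add: Y_def m)
qed

lemma Y_straight:
  assumes v: "v \<in> crossings D" and w: "w \<in> crossings D" and t: "t \<in> w"
  shows "Y v (t, True) + Y v (t, False) = of_bool (v = w)"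
proof -
  obtain p q where pq: "v = {p, q}" "p < q" using v by (elim crossingE)
  have T: "t \<in> classical_times D" using crossing_subset[OF w] t by blast
  have "t \<in> v \<longleftrightarrow> v = w" using crossing_unique[OF D v w _ t] t by auto
  moreover have "t \<in> v \<longleftrightarrow> t = p \<or> t = q" using pq(1) by simp
  ultimately have "v = w \<longleftrightarrow> t = p \<or> t = q" by simp
  then show ?thesis unfolding Y_eq[OF pq v T] using pq(2) by auto
qed

lemma transition_crossing:
  assumes "w \<in> crossings D" "k < length C" "fst (C ! (Suc k mod length C)) \<in> w"
  shows "w = {fst (other_end D (C ! k)), fst (C ! (Suc k mod length C))}"
  by (rule crossing_unique[OF D assms(1) transition[OF assms(2)] assms(3)]) simp

text \<open>The two visits use complementary half-edges, and passing to the complement reverses both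
  directions.\<close>

lemma same_direction_unique:
  assumes w: "w \<in> crossings D" and k: "k < length C" "l < length C"
    "fst (C ! (Suc k mod length C)) \<in> w" "fst (C ! (Suc l mod length C)) \<in> w"
  shows "snd (other_end D (C ! k)) = snd (C ! (Suc k mod length C)) \<longleftrightarrow>
    snd (other_end D (C ! l)) = snd (C ! (Suc l mod length C))"
proof (cases "k = l")
  case False
  let ?h = "other_end D (C ! k)" and ?h' = "C ! (Suc k mod length C)"
  let ?g = "other_end D (C ! l)" and ?g' = "C ! (Suc l mod length C)"
  have m: "Suc k mod length C < length C" "Suc l mod length C < length C" using nonempty by simp_all
  have ne: "Suc k mod length C \<noteq> Suc l mod length C"
    using False k(1,2) by (metis Suc_lessI mod_less mod_self nat.inject zero_less_Suc less_irrefl)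
  have P: "pos ?h = Suc k mod length C" "pos ?h' = Suc k mod length C"
    "pos ?g = Suc l mod length C" "pos ?g' = Suc l mod length C"
    using pos_other_end_nth k pos_nth m by simp_all
  have dis: "?h \<noteq> ?g" "?h \<noteq> ?g'" "?h' \<noteq> ?g" "?h' \<noteq> ?g'" using P ne by metis+
  have W: "w = {fst ?h, fst ?h'}" "w = {fst ?g, fst ?g'}"
    by (rule transition_crossing[OF w k(1,3)], rule transition_crossing[OF w k(2,4)])
  then have "{fst ?h, fst ?h'} = {fst ?g, fst ?g'}" by simp
  then consider "fst ?h = fst ?g" "fst ?h' = fst ?g'" | "fst ?h = fst ?g'" "fst ?h' = fst ?g"
    unfolding doubleton_eq_iff by blast
  then show ?thesis
  proof cases
    case 1
    then have "snd ?h \<noteq> snd ?g" "snd ?h' \<noteq> snd ?g'" using dis by (simp_all only: prod_eq_iff simp_thms)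
    then show ?thesis by blast
  next
    case 2
    then have "snd ?h \<noteq> snd ?g'" "snd ?h' \<noteq> snd ?g" using dis by (simp_all only: prod_eq_iff simp_thms)
    then show ?thesis by blast
  qed
qed simp

text \<open>Reversing a half-edge changes the sign of the cross product, so the counterclockwise
  test depends only on the writhe and on whether the time directions agree. At a positive crossing
  the A-smoothing is the one that respects the orientation.\<close>

lemma A_joined_iff:
  assumes "classical D s t" "s \<in> over D" and h: "{fst h, fst h'} = {s, t}"
  shows "A_joined D h h' \<longleftrightarrow> (cross (tangent D s) (tangent D t) < 0 \<longleftrightarrow> snd h = snd h')"
proof -
  let ?x = "cross (tangent D s) (tangent D t)"
  have t: "t \<notin> over D" using classical_over[OF D assms(1)] assms(2) by simp
  have "?x \<noteq> 0" using knot_diagramD(5)[OF D] assms(1) unfolding classical_def by blast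
  moreover have "cross (half_edge_dir D (t, b')) (half_edge_dir D (s, b)) = (if b = b' then - ?x else ?x)" for b b'
    by (cases b; cases b') (simp_all add: cross_def half_edge_dir_def algebra_simps)
  ultimately have c: "cross (half_edge_dir D (t, b')) (half_edge_dir D (s, b)) > 0 \<longleftrightarrow> (?x < 0 \<longleftrightarrow> b = b')" for b b'
    by (cases "b = b'") auto
  obtain x b x' b' where e: "h = (x, b)" "h' = (x', b')" by (cases h; cases h')
  then have "x = s \<and> x' = t \<or> x = t \<and> x' = s" using h by (auto simp: doubleton_eq_iff)
  then show ?thesis
  proof
    assume "x = s \<and> x' = t"
    then show ?thesis unfolding A_joined_def e using t assms(2) c[of b' b] by simp
  next
    assume "x = t \<and> x' = s"
    then show ?thesis unfolding A_joined_def e using t assms(2) c[of b b'] by auto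
  qed
qed

abbreviation N :: "real set \<Rightarrow> real set \<Rightarrow> bit" where
  "N v w \<equiv> loop_matrix (gauss_graph D) v w + of_bool (v = w \<and> vsign (circuit_graph D C) v = Minus)"

text \<open>Correcting the writhe by the sign removes the over/under information: what remains is
  whether the circuit turns against the orientation, joining two half-edges of equal time
  direction.\<close>

lemma N_diagonal:
  assumes w: "w \<in> crossings D" and k: "k < length C" "fst (C ! (Suc k mod length C)) \<in> w"
  shows "N w w = of_bool (snd (other_end D (C ! k)) = snd (C ! (Suc k mod length C)))"
proof -
  obtain s t where st: "w = {s, t}" "classical D s t" "s \<in> over D"
  proof -
    obtain p q where pq: "w = {p, q}" "classical D p q" using w by (elim crossingE)
    show ?thesis
    proof (cases "p \<in> over D")
      case True
      then show ?thesis using pq that by blast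
    next
      case False
      then have "q \<in> over D" using pq(2) unfolding classical_def by blast
      then show ?thesis using pq that[of q p] classical_commute by auto
    qed
  qed
  let ?neg = "cross (tangent D s) (tangent D t) < 0"
  let ?P = "snd (other_end D (C ! k)) = snd (C ! (Suc k mod length C))"
  have A: "A_joined D (other_end D (C ! i)) (C ! (Suc i mod length C)) \<longleftrightarrow> (?neg \<longleftrightarrow> ?P)"
    if "i < length C" "fst (C ! (Suc i mod length C)) \<in> w" for i
  proof -
    have "{fst (other_end D (C ! i)), fst (C ! (Suc i mod length C))} = {s, t}"
      using transition_crossing[OF w that] st(1) by simp
    then show ?thesis using A_joined_iff[OF st(2,3)] same_direction_unique[OF w that(1) k(1) that(2) k(2)] by simp
  qed
  have "circuit_sign D C w = Plus \<longleftrightarrow> (?neg \<longleftrightarrow> ?P)"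
    unfolding circuit_sign_def Let_def using A k by auto
  then have "circuit_sign D C w = Minus \<longleftrightarrow> \<not> (?neg \<longleftrightarrow> ?P)" by (cases "circuit_sign D C w") auto
  moreover have "loop_matrix (gauss_graph D) w w = of_bool ?neg"
    using loop_matrix_gauss[OF w w] negative_crossing_iff[OF D st(2,3)] st(1) by simp
  ultimately show ?thesis by (auto simp: circuit_graph_def)
qed

text \<open>A turn at \<open>w\<close> passes from one strand to the other, hence between the halves
  of the straight circuit iff the chords are linked. At \<open>v\<close> itself the jump depends on
  the time directions, as described by \<open>N_diagonal\<close>.\<close>

lemma Y_jump:
  assumes v: "v \<in> crossings D" and w: "w \<in> crossings D" and k: "k < length C" "fst (C ! (Suc k mod length C)) \<in> w"
  shows "Y v (C ! k) + Y v (C ! (Suc k mod length C)) = N v w"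
proof -
  let ?h = "other_end D (C ! k)" and ?h' = "C ! (Suc k mod length C)"
  have Yh: "Y v (C ! k) = Y v ?h" using other_end(3)[OF fst_nth[OF k(1)]] by (simp add: Y_def)
  have W: "w = {fst ?h, fst ?h'}" by (rule transition_crossing[OF w k])
  obtain x b x' b' where e: "?h = (x, b)" "?h' = (x', b')" by (cases ?h; cases ?h')
  have xx: "w = {x, x'}" using W e by simp
  have ne: "x \<noteq> x'" using crossing_two_times[of x x'] w xx by simp
  have T: "x \<in> classical_times D" "x' \<in> classical_times D" using crossing_subset[OF w] xx by auto
  obtain p q where pq: "v = {p, q}" "p < q" using v by (elim crossingE)
  have Yb: "Y v (y, b) = (if b then of_bool (p \<le> y \<and> y < q) else of_bool (p < y \<and> y \<le> q))"
    if "y \<in> classical_times D" for y b using Y_eq[OF pq v that] by simp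
  show ?thesis
  proof (cases "v = w")
    case True
    then have "x = p \<and> x' = q \<or> x = q \<and> x' = p" using xx pq by (auto simp: doubleton_eq_iff)
    then have "Y v ?h + Y v ?h' = of_bool (b = b')"
      unfolding e Yb[OF T(1)] Yb[OF T(2)] using pq(2) by auto
    then show ?thesis using N_diagonal[OF w k] True Yh e by simp
  next
    case False
    then have n: "x \<notin> {p, q}" "x' \<notin> {p, q}" using crossing_unique[OF D v w] pq xx by auto
    have y: "Y v (y, b) = of_bool (p < y \<and> y < q)" if "y \<in> classical_times D" "y \<notin> {p, q}" for y b
      unfolding Yb[OF that(1)] using that(2) by (auto simp: le_less)
    have "N v w = of_bool (linked {p, q} {x, x'})" using loop_matrix_gauss[OF v w] False pq xx by simp
    also have "linked {p, q} {x, x'} \<longleftrightarrow> (p < x \<and> x < q) \<noteq> (p < x' \<and> x' < q)" by (rule linked_iff[OF pq(2) ne n])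
    also have "of_bool \<dots> = Y v ?h + Y v ?h'" unfolding e y[OF T(1) n(1)] y[OF T(2) n(2)] by (rule of_bool_xor)
    finally show ?thesis using Yh by simp
  qed
qed

theorem realizes_circuit_graph: "realizes (circuit_graph D C) (gauss_graph D)"
proof -
  let ?V = "crossings D" and ?M = "label_matrix (circuit_graph D C)"
  have fin: "finite ?V" by (rule finite_crossings[OF D])
  have lG: "labeled_graph (circuit_graph D C)"
  proof -
    have "\<exists>u\<in>?V. \<exists>v\<in>?V. u \<noteq> v \<and> e = {u, v}" if e: "e \<in> edges (circuit_graph D C)" for e
    proof -
      obtain c d where cd: "c \<in> ?V" "d \<in> ?V" "linked (circuit_chord C c) (circuit_chord C d)" "e = {c, d}"
        using e unfolding circuit_graph_def by auto
      then have "c \<noteq> d" using linked_irrefl by auto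
      then show ?thesis using cd by (intro bexI conjI)
    qed
    then show ?thesis using fin unfolding labeled_graph_def by (simp add: circuit_graph_def)
  qed
  define z where "z v h = Y v h + (\<Sum>u\<in>?V. N v u * X u h)" for v h
  have jump: "z v (C ! k) = z v (C ! (Suc k mod length C))" if v: "v \<in> ?V" and k: "k < length C" for v k
  proof -
    let ?l = "Suc k mod length C"
    have "?l < length C" using nonempty by simp
    then obtain w where w: "w \<in> ?V" "fst (C ! ?l) \<in> w" using ex_crossing[OF D fst_nth] by blast
    have "(\<Sum>u\<in>?V. N v u * X u (C ! k)) + (\<Sum>u\<in>?V. N v u * X u (C ! ?l)) = (\<Sum>u\<in>?V. if u = w then N v u else 0)"
      unfolding sum.distrib[symmetric]
    proof (rule sum.cong[OF refl])
      fix u assume u: "u \<in> ?V"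
      have "fst (C ! ?l) \<in> u \<longleftrightarrow> u = w" using crossing_unique[OF D u w(1) _ w(2)] w(2) by blast
      then have "N v u * (X u (C ! k) + X u (C ! ?l)) = (if u = w then N v u else 0)"
        unfolding X_jump[OF u k] by simp
      then show "N v u * X u (C ! k) + N v u * X u (C ! ?l) = (if u = w then N v u else 0)"
        by (simp only: distrib_left)
    qed
    also have "\<dots> = N v w" using fin w(1) by simp
    also have "\<dots> = Y v (C ! k) + Y v (C ! ?l)" using Y_jump[OF v w(1) k w(2)] by simp
    finally have "z v (C ! k) + z v (C ! ?l) = 0" unfolding z_def by (simp only: add_ac) simp
    then show ?thesis by simp
  qed
  have const: "z v (C ! k) = z v (C ! 0)" if v: "v \<in> ?V" and k: "k < length C" for v k
    using k
  proof (induction k)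
    case (Suc k)
    then show ?case using jump[OF v, of k] by simp
  qed simp
  have zh: "z v h = z v (C ! 0)" if v: "v \<in> ?V" and h: "fst h \<in> classical_times D" for v h
  proof -
    have "idx (C ! idx h) = idx h" by (rule idx_nth[OF idx(1)[OF h]])
    then have "z v h = z v (C ! idx h)" unfolding z_def X_def Y_def idx(2)[OF h] by simp
    then show ?thesis using const[OF v idx(1)[OF h]] by simp
  qed
  have NM: "(\<Sum>u\<in>?V. N v u * ?M u w) = of_bool (v = w)" if v: "v \<in> ?V" and w: "w \<in> ?V" for v w
  proof -
    obtain t where t: "t \<in> w" "t \<in> classical_times D" using w by (elim crossingE) auto
    \<comment> \<open>Constancy across the straight passage through \<open>w\<close> is the product
      equation for the entry \<open>(v, w)\<close>.\<close>
    have "z v (t, True) + z v (t, False) = 0" using zh[OF v, of "(t, True)"] zh[OF v, of "(t, False)"] t by simp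
    then have "(Y v (t, True) + Y v (t, False)) +
        ((\<Sum>u\<in>?V. N v u * X u (t, True)) + (\<Sum>u\<in>?V. N v u * X u (t, False))) = 0"
      unfolding z_def by (simp only: add_ac)
    moreover have "(\<Sum>u\<in>?V. N v u * X u (t, True)) + (\<Sum>u\<in>?V. N v u * X u (t, False)) = (\<Sum>u\<in>?V. N v u * ?M u w)"
      unfolding sum.distrib[symmetric] distrib_left[symmetric]
      by (rule sum.cong[OF refl]) (simp only: X_straight[OF _ w t(1)])
    ultimately show ?thesis unfolding Y_straight[OF v w t(1)] by simp
  qed
  have "sinv ?V N ?M"
  proof (rule sinvI'[OF fin _ NM])
    show "N i j = N j i" for i j using loop_matrix_commute[of _ i j] by auto
  qed
  then have "sinv ?V ?M N" by (simp only: sinv_commute[of _ ?M])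
  then show ?thesis unfolding realizes_def using lG looped_gauss_graph[OF D]
    by (simp add: circuit_graph_def gauss_graph_def)
qed

end

section \<open>The circular order of times\<close>

text \<open>\<open>x\<close> lies on the half-open arc that runs forward from \<open>p\<close> to
  \<open>q\<close> on the circle of reals modulo 1.\<close>

definition circ :: "real \<Rightarrow> real \<Rightarrow> real \<Rightarrow> bool" where
  "circ p q x \<longleftrightarrow> frac (x - p) < frac (q - p)"

definition alternate :: "real \<Rightarrow> real \<Rightarrow> real \<Rightarrow> real \<Rightarrow> bool" where
  "alternate p q x y \<longleftrightarrow> circ p q x \<noteq> circ p q y"

lemma frac_cong:
  fixes x y :: real
  assumes "x - y \<in> \<int>"
  shows "frac x = frac y"
proof -
  have "frac x - frac y \<in> \<int>"
    using Ints_diff_cong[of "frac x" x "frac y" y] frac_diff_Ints assms by blast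
  then show ?thesis using unit_eqI frac_unit by blast
qed

lemma frac_eqI: "0 \<le> y \<Longrightarrow> y < 1 \<Longrightarrow> x - y \<in> \<int> \<Longrightarrow> frac x = y" for x y :: real
  using frac_cong[of x y] by (simp add: frac_eq)

lemma circ_cong:
  assumes "p - p' \<in> \<int>" "q - q' \<in> \<int>" "x - x' \<in> \<int>"
  shows "circ p q x \<longleftrightarrow> circ p' q' x'"
proof -
  have "(x - p) - (x' - p') \<in> \<int>" "(q - p) - (q' - p') \<in> \<int>"
    using Ints_diff[OF assms(3,1)] Ints_diff[OF assms(2,1)] by (simp_all add: algebra_simps)
  then show ?thesis using frac_cong unfolding circ_def by metis
qed

lemma alternate_cong:
  assumes "p - p' \<in> \<int>" "q - q' \<in> \<int>" "x - x' \<in> \<int>" "y - y' \<in> \<int>"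
  shows "alternate p q x y \<longleftrightarrow> alternate p' q' x' y'"
  unfolding alternate_def using circ_cong[OF assms(1,2,3)] circ_cong[OF assms(1,2,4)] by simp

text \<open>Change of base point: with it, statements on circular order reduce to comparing
  positions measured from \<open>p\<close>.\<close>

lemma frac_diff_eq:
  "frac (x - q) = (if frac (q - p) \<le> frac (x - p) then frac (x - p) - frac (q - p)
     else frac (x - p) - frac (q - p) + 1)" for x p q :: real
proof (rule frac_eqI)
  let ?a = "frac (x - p)" and ?b = "frac (q - p)"
  have ab: "0 \<le> ?a" "?a < 1" "0 \<le> ?b" "?b < 1" by (simp_all add: frac_lt_1)
  then show "0 \<le> (if ?b \<le> ?a then ?a - ?b else ?a - ?b + 1)" "(if ?b \<le> ?a then ?a - ?b else ?a - ?b + 1) < 1"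
    unfolding if_split[of "\<lambda>z. 0 \<le> z"] if_split[of "\<lambda>z. z < 1"] by linarith+
  have "x - q - (?a - ?b) = (x - p - ?a) - (q - p - ?b)" by simp
  then have i: "x - q - (?a - ?b) \<in> \<int>" using Ints_diff[OF frac_diff_Ints(1) frac_diff_Ints(1)] by metis
  have "x - q - (?a - ?b + 1) = x - q - (?a - ?b) - 1" by simp
  then have "x - q - (?a - ?b + 1) \<in> \<int>" using Ints_diff[OF i Ints_1] by metis
  with i show "x - q - (if ?b \<le> ?a then ?a - ?b else ?a - ?b + 1) \<in> \<int>"
    by (cases "?b \<le> ?a") (simp_all only: if_True if_False)
qed

lemma frac_eq_iff: "frac x = frac y \<longleftrightarrow> x - y \<in> \<int>" for x y :: real
proof
  assume "frac x = frac y"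
  then have "x - y = (x - frac x) - (y - frac y)" by simp
  then show "x - y \<in> \<int>" using Ints_diff[OF frac_diff_Ints(1) frac_diff_Ints(1)] by metis
qed (rule frac_cong)

lemma relative_positions:
  fixes p q x :: real
  assumes "p - q \<notin> \<int>" "p - x \<notin> \<int>" "q - x \<notin> \<int>"
  shows "0 < frac (x - p)" "0 < frac (q - p)" "frac (x - p) \<noteq> frac (q - p)" "frac (x - p) < 1" "frac (q - p) < 1"
  using frac_gt_0_iff[of "x - p"] frac_gt_0_iff[of "q - p"] frac_eq_iff[of "x - p" "q - p"]
    Ints_diff_commute[of x p] Ints_diff_commute[of q p] Ints_diff_commute[of q x] assms
    frac_lt_1[of "x - p"] frac_lt_1[of "q - p"] by simp_all

lemma circ_swap:
  assumes "p - q \<notin> \<int>" "p - x \<notin> \<int>" "q - x \<notin> \<int>"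
  shows "circ q p x \<longleftrightarrow> \<not> circ p q x"
proof -
  define a b where "a = frac (x - p)" and "b = frac (q - p)"
  have "0 < a" "0 < b" "a \<noteq> b" "a < 1" "b < 1" using relative_positions[OF assms] unfolding a_def b_def by blast+
  then show ?thesis
    unfolding circ_def frac_diff_eq[of x q p] frac_diff_eq[of p q p] a_def[symmetric] b_def[symmetric] by auto
qed

lemma circ_rotate:
  assumes "p - q \<notin> \<int>" "p - x \<notin> \<int>" "q - x \<notin> \<int>"
  shows "circ x p q \<longleftrightarrow> circ p q x"
proof -
  define a b where "a = frac (x - p)" and "b = frac (q - p)"
  have "0 < a" "0 < b" "a \<noteq> b" "a < 1" "b < 1" using relative_positions[OF assms] unfolding a_def b_def by blast+
  then show ?thesis
    unfolding circ_def frac_diff_eq[of q x p] frac_diff_eq[of p x p] a_def[symmetric] b_def[symmetric] by auto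
qed

lemma alternate_commute:
  assumes "p - q \<notin> \<int>" "p - x \<notin> \<int>" "q - x \<notin> \<int>" "p - y \<notin> \<int>" "q - y \<notin> \<int>" "x - y \<notin> \<int>"
  shows "alternate p q x y \<longleftrightarrow> alternate x y p q"
proof -
  define a b c where "a = frac (x - p)" and "b = frac (q - p)" and "c = frac (y - p)"
  have "0 < a" "0 < b" "a \<noteq> b" "a < 1" "b < 1" "0 < c" "c \<noteq> b" "c < 1" "c \<noteq> a"
    using relative_positions[OF assms(1,2,3)] relative_positions[OF assms(1,4,5)]
      relative_positions(3)[OF assms(2,4,6)] unfolding a_def b_def c_def by blast+
  then show ?thesis
    unfolding alternate_def circ_def frac_diff_eq[of p x p] frac_diff_eq[of q x p] frac_diff_eq[of y x p]
      a_def[symmetric] b_def[symmetric] c_def[symmetric] by auto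
qed

lemma alternate_swap:
  assumes "p - q \<notin> \<int>" "p - x \<notin> \<int>" "q - x \<notin> \<int>" "p - y \<notin> \<int>" "q - y \<notin> \<int>"
  shows "alternate q p x y \<longleftrightarrow> alternate p q x y"
  unfolding alternate_def circ_swap[OF assms(1,2,3)] circ_swap[OF assms(1,4,5)] by auto

lemma linked_iff_alternate:
  assumes u: "p \<in> {0..<1}" "q \<in> {0..<1}" "x \<in> {0..<1}" "y \<in> {0..<1}"
    and ne: "p \<noteq> q" "p \<noteq> x" "p \<noteq> y" "q \<noteq> x" "q \<noteq> y" "x \<noteq> y"
  shows "linked {p, q} {x, y} \<longleftrightarrow> alternate p q x y"
proof -
  have nI: "s - t \<notin> \<int>" if "s \<in> {0..<1}" "t \<in> {0..<1}" "s \<noteq> t" for s t :: real using unit_eqI that by blast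
  have f: "frac (s - t) = (if t \<le> s then s - t else s - t + 1)" if "s \<in> {0..<1}" "t \<in> {0..<1}" for s t :: real
    using that by (intro frac_eqI) auto
  have *: "linked {p, q} {x, y} \<longleftrightarrow> alternate p q x y"
    if "p < q" and u: "p \<in> {0..<1}" "q \<in> {0..<1}" "p \<noteq> x" "p \<noteq> y" "q \<noteq> x" "q \<noteq> y" for p q
  proof -
    have "circ p q z \<longleftrightarrow> p < z \<and> z < q" if "z \<in> {0..<1}" "p \<noteq> z" for z
      unfolding circ_def f[OF that(1) u(1)] f[OF u(2,1)] using that u \<open>p < q\<close> by auto
    then show ?thesis unfolding alternate_def
      using linked_iff[OF \<open>p < q\<close> ne(6), of] u assms(3,4) by auto
  qed
  show ?thesis
  proof (cases "p < q")
    case True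
    then show ?thesis using * u ne by blast
  next
    case False
    then have "linked {q, p} {x, y} \<longleftrightarrow> alternate q p x y" using * u ne by auto
    then show ?thesis
      using alternate_swap[OF nI[OF u(1,2) ne(1)] nI[OF u(1,3) ne(2)] nI[OF u(2,3) ne(4)] nI[OF u(1,4) ne(3)] nI[OF u(2,4) ne(5)]]
      by (simp add: insert_commute)
  qed
qed

section \<open>Arcs of the circle of times\<close>

lemma mem_arc: "a < t \<Longrightarrow> t < b \<Longrightarrow> t \<in> arc a b"
  unfolding arc_def by (auto intro!: exI[of _ 0])

lemma arcE:
  assumes "t \<in> arc a b"
  obtains t' where "a < t'" "t' < b" "t - t' \<in> \<int>"
proof -
  obtain k :: int where "a < t + of_int k" "t + of_int k < b" using assms unfolding arc_def by auto
  then show ?thesis by (intro that[of "t + of_int k"]) simp_all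
qed

lemma arc_cong: "s - t \<in> \<int> \<Longrightarrow> s \<in> arc a b \<longleftrightarrow> t \<in> arc a b"
proof -
  have *: "s \<in> arc a b" if i: "s - t \<in> \<int>" and t: "t \<in> arc a b" for s t
  proof -
    obtain t' where t': "a < t'" "t' < b" "t - t' \<in> \<int>" using t by (rule arcE)
    have "t' - s \<in> \<int>" using Ints_add[OF i t'(3)] Ints_diff_commute[of s t'] by simp
    then obtain k where "t' = s + of_int k" by (rule Ints_diffE)
    then show ?thesis using t' unfolding arc_def by auto
  qed
  assume "s - t \<in> \<int>"
  then show ?thesis using *[of s t] *[of t s] Ints_diff_commute[of s t] by blast
qed

text \<open>The representative is the last one not after \<open>a\<close>; its next copy is not
  before \<open>b\<close>, since otherwise it would fall into the arc.\<close>

lemma not_arcE: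
  assumes "x \<notin> arc a b" "a < b"
  obtains x' where "x - x' \<in> \<int>" "x' \<le> a" "b \<le> x' + 1"
proof -
  define x' where "x' = a - frac (a - x)"
  have x: "x' \<le> a" "a < x' + 1" using frac_lt_1[of "a - x"] by (simp_all add: x'_def)
  have "x - x' = - ((a - x) - frac (a - x))" by (simp add: x'_def)
  then have i: "x - x' \<in> \<int>" using Ints_minus[OF frac_diff_Ints(1)] by metis
  have "x' + 1 \<notin> arc a b"
  proof -
    have "x - (x' + 1) = (x - x') - 1" by simp
    then have "x - (x' + 1) \<in> \<int>" using Ints_diff[OF i Ints_1] by metis
    then show ?thesis using arc_cong assms(1) by blast
  qed
  then have "b \<le> x' + 1" using x mem_arc[of a "x' + 1" b] by force
  then show ?thesis using that i x(1) by blast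
qed

text \<open>Seen from two points outside the arc, the whole arc is in the same place.\<close>

lemma circ_arc_third:
  assumes ab: "a < b" and x: "x \<notin> arc a b" and y: "y \<notin> arc a b" and s: "s \<in> arc a b" and t: "t \<in> arc a b"
  shows "circ x y s \<longleftrightarrow> circ x y t"
proof -
  obtain x' where x': "x - x' \<in> \<int>" "x' \<le> a" "b \<le> x' + 1" using x ab by (rule not_arcE)
  obtain y' where y': "y - y' \<in> \<int>" "y' \<le> a" "b \<le> y' + 1" using y ab by (rule not_arcE)
  have f: "frac (y' - x') = (if x' \<le> y' then y' - x' else y' - x' + 1)"
    using x' y' ab by (intro frac_eqI) auto
  have *: "circ x y s \<longleftrightarrow> y' < x'" if s: "s \<in> arc a b" for s
  proof -
    obtain s' where s': "a < s'" "s' < b" "s - s' \<in> \<int>" using s by (rule arcE)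
    have "frac (s' - x') = s' - x'" using s' x' by (intro frac_eqI) auto
    then have "circ x' y' s' \<longleftrightarrow> y' < x'" unfolding circ_def f using s' x' y' by auto
    then show ?thesis using circ_cong[OF x'(1) y'(1) s'(3)] by simp
  qed
  show ?thesis using *[OF s] *[OF t] by simp
qed

lemma circ_within_arc:
  assumes ab: "a < b" and y: "y \<notin> arc a b" and s: "a < s" "s < b" and t: "a < t" "t < b" "s \<noteq> t"
  shows "circ s y t \<longleftrightarrow> s < t"
proof -
  obtain y' where y': "y - y' \<in> \<int>" "y' \<le> a" "b \<le> y' + 1" using y ab by (rule not_arcE)
  have "frac (y' - s) = y' + 1 - s" using y' s by (intro frac_eqI) auto
  moreover have "frac (t - s) = (if s \<le> t then t - s else t - s + 1)"
    using s t y' by (intro frac_eqI) auto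
  ultimately have "circ s y' t \<longleftrightarrow> s < t" unfolding circ_def using s t y' by auto
  then show ?thesis using circ_cong[OF _ y'(1), of s s t t] by simp
qed

lemma arc_diff_notin_Ints:
  assumes "s \<in> arc a b" "t \<notin> arc a b"
  shows "s - t \<notin> \<int>"
  using arc_cong assms by blast

lemma arc_inner_notin_Ints:
  assumes "b < a + 1" "a < s" "s < b" "a < t" "t < b" "s \<noteq> t"
  shows "s - t \<notin> (\<int> :: real set)"
proof
  assume "s - t \<in> \<int>"
  then obtain k where "s = t + of_int k" by (rule Ints_diffE)
  then have "- 1 < real_of_int k" "real_of_int k < 1" "k \<noteq> 0" using assms by auto
  then show False by linarith
qed

section \<open>The Gauss diagram in terms of arbitrary times\<close>

lemma curve_has_derivative:
  assumes "knot_diagram D"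
  shows "(curve D has_vector_derivative tangent D t) (at t)"
proof -
  obtain d where "\<And>x. (curve D has_vector_derivative d x) (at x)"
    using knot_diagramD(1)[OF assms] unfolding C1_differentiable_on_def by auto
  then show ?thesis using vector_derivative_at by metis
qed

lemma continuous_tangent:
  assumes "knot_diagram D"
  shows "continuous_on UNIV (tangent D)"
proof -
  obtain d where d: "\<And>x. (curve D has_vector_derivative d x) (at x)" "continuous_on UNIV d"
    using knot_diagramD(1)[OF assms] unfolding C1_differentiable_on_def by auto
  show ?thesis unfolding vector_derivative_at[OF d(1)] using d(2) by simp
qed

lemma continuous_curve:
  assumes "knot_diagram D"
  shows "continuous_on S (curve D)"
proof (rule continuous_at_imp_continuous_on, rule ballI)
  fix x
  show "isCont (curve D) x"
    using has_vector_derivative_continuous[OF curve_has_derivative[OF assms]] .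
qed

lemma tangent_cong:
  assumes D: "knot_diagram D" and st: "s - t \<in> \<int>"
  shows "tangent D s = tangent D t"
proof -
  have "((\<lambda>x. x + (t - s)) has_vector_derivative 1) (at s)" by (auto intro!: derivative_eq_intros)
  moreover have "(curve D has_vector_derivative tangent D t) (at (s + (t - s)))" using curve_has_derivative[OF D] by simp
  ultimately have "((curve D \<circ> (\<lambda>x. x + (t - s))) has_vector_derivative 1 *\<^sub>R tangent D t) (at s)"
    by (rule vector_diff_chain_at)
  moreover have "curve D \<circ> (\<lambda>x. x + (t - s)) = curve D"
  proof
    fix x
    have "x + (t - s) - x \<in> \<int>" using st Ints_diff_commute[of s t] by simp
    then show "(curve D \<circ> (\<lambda>x. x + (t - s))) x = curve D x" using curve_cong[OF D] by simp
  qed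
  ultimately have "(curve D has_vector_derivative tangent D t) (at s)" by simp
  then show ?thesis by (rule vector_derivative_at)
qed

abbreviation gauss_matrix :: "vdiagram \<Rightarrow> real set \<Rightarrow> real set \<Rightarrow> bit" where
  "gauss_matrix D \<equiv> loop_matrix (gauss_graph D)"

text \<open>The vertex of the Gauss diagram graph named by arbitrary real representatives of its two
  times.\<close>

definition chord :: "real \<Rightarrow> real \<Rightarrow> real set" where
  "chord s t = {frac s, frac t}"

lemma chord_commute: "chord s t = chord t s"
  by (simp add: chord_def insert_commute)

lemma chord_cong: "s - s' \<in> \<int> \<Longrightarrow> t - t' \<in> \<int> \<Longrightarrow> chord s t = chord s' t'"
  by (simp add: chord_def frac_cong)

lemma chord_mem: "knot_diagram D \<Longrightarrow> classical D s t \<Longrightarrow> chord s t \<in> crossings D"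
  unfolding chord_def by (rule crossingI)

lemma crossing_chordE:
  assumes "c \<in> crossings D"
  obtains s t where "c = chord s t" "classical D s t"
proof -
  obtain s t where "c = {s, t}" "classical D s t" "s \<in> {0..<1}" "t \<in> {0..<1}" using assms by (rule crossingE)
  then show ?thesis by (intro that[of s t]) (simp_all add: chord_def frac_eq)
qed

lemma chord_eqD:
  assumes "chord s t = chord x y"
  shows "s - x \<in> \<int> \<and> t - y \<in> \<int> \<or> s - y \<in> \<int> \<and> t - x \<in> \<int>"
  using assms unfolding chord_def doubleton_eq_iff frac_eq_iff .

lemma classical_notin_Ints: "classical D s t \<Longrightarrow> s - t \<notin> \<int>"
  by (simp add: classical_def meets_def)

lemma distinct_chords:
  assumes D: "knot_diagram D" and c: "classical D s t" "classical D x y" "chord s t \<noteq> chord x y"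
  shows "s - x \<notin> \<int>" "s - y \<notin> \<int>" "t - x \<notin> \<int>" "t - y \<notin> \<int>"
proof -
  have *: "chord s t = chord x y" if "classical D s t" "classical D x y" "s - x \<in> \<int>" for s t x y
  proof -
    have "classical D x t" using classical_cong[OF D that(3), of t t] that(1) by simp
    then have "t - y \<in> \<int>" using classical_unique[OF D _ that(2)] by blast
    then show ?thesis using chord_cong that(3) by blast
  qed
  have c': "classical D t s" "classical D y x" using c classical_commute by blast+
  show "s - x \<notin> \<int>" using *[OF c(1,2)] c(3) by blast
  show "s - y \<notin> \<int>" using *[OF c(1) c'(2)] c(3) chord_commute by metis
  show "t - x \<notin> \<int>" using *[OF c'(1) c(2)] c(3) chord_commute by metis
  show "t - y \<notin> \<int>" using *[OF c'] c(3) chord_commute by metis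
qed

lemma gauss_matrix_chords:
  assumes D: "knot_diagram D" and c: "classical D s t" "classical D x y" "chord s t \<noteq> chord x y"
  shows "gauss_matrix D (chord s t) (chord x y) = of_bool (alternate s t x y)"
proof -
  note d = distinct_chords[OF D c]
  have f: "frac u \<noteq> frac w" if "u - w \<notin> \<int>" for u w :: real using that frac_eq_iff by blast
  have "linked (chord s t) (chord x y) \<longleftrightarrow> alternate (frac s) (frac t) (frac x) (frac y)"
    unfolding chord_def
    using f classical_notin_Ints[OF c(1)] classical_notin_Ints[OF c(2)] d
    by (intro linked_iff_alternate frac_unit) auto
  also have "\<dots> \<longleftrightarrow> alternate s t x y" by (rule alternate_cong; rule frac_diff_Ints(2))
  finally show ?thesis using loop_matrix_gauss[OF chord_mem[OF D c(1)] chord_mem[OF D c(2)]] c(3) by simp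
qed

lemma gauss_matrix_diagonal:
  assumes D: "knot_diagram D" and c: "classical D s t" "s \<in> over D"
  shows "gauss_matrix D (chord s t) (chord s t) = of_bool (cross (tangent D s) (tangent D t) < 0)"
proof -
  have "classical D (frac s) (frac t)" using classical_cong[OF D frac_diff_Ints(2) frac_diff_Ints(2)] c(1) by blast
  moreover have "frac s \<in> over D" using over_cong[OF D frac_diff_Ints(2)] c(2) by blast
  ultimately show ?thesis
    using negative_crossing_iff[OF D] loop_matrix_gauss[OF chord_mem[OF D c(1)] chord_mem[OF D c(1)]]
      tangent_cong[OF D frac_diff_Ints(2), of s] tangent_cong[OF D frac_diff_Ints(2), of t]
    by (simp add: chord_def)
qed

lemma gauss_graph_looped_of:
  "knot_diagram D \<Longrightarrow> gauss_graph D = looped_of (crossings D) (gauss_matrix D)"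
  using looped_of_loop_matrix[OF looped_gauss_graph] by (simp add: gauss_graph_def)

lemma over_underE:
  assumes "knot_diagram D" "c \<in> crossings D"
  obtains s t where "c = chord s t" "classical D s t" "s \<in> over D"
proof -
  obtain s t where st: "c = chord s t" "classical D s t" using assms(2) by (rule crossing_chordE)
  show ?thesis
  proof (cases "s \<in> over D")
    case True
    then show ?thesis using st by (intro that)
  next
    case False
    then have "t \<in> over D" using st(2) by (auto simp: classical_def)
    then show ?thesis using st classical_commute[of D s t] chord_commute[of s t] by (intro that[of t s]) auto
  qed
qed

section \<open>Changes of a diagram on an arc\<close>

locale arc_change =
  fixes a b :: real and D D' :: vdiagram
  assumes D: "knot_diagram D" and D': "knot_diagram D'" and change: "differ_on_arc a b D D'"
begin

lemma ab: "a < b" "b < a + 1"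
  using change by (auto simp: differ_on_arc_def)

lemma outside: "t \<notin> arc a b \<Longrightarrow> curve D' t = curve D t" "t \<notin> arc a b \<Longrightarrow> t \<in> over D' \<longleftrightarrow> t \<in> over D"
  using change by (auto simp: differ_on_arc_def)

lemma meets_outside: "s \<notin> arc a b \<Longrightarrow> t \<notin> arc a b \<Longrightarrow> meets D' s t \<longleftrightarrow> meets D s t"
  using outside by (simp add: meets_def)

lemma classical_outside: "s \<notin> arc a b \<Longrightarrow> t \<notin> arc a b \<Longrightarrow> classical D' s t \<longleftrightarrow> classical D s t"
  using outside meets_outside by (simp add: classical_def)

text \<open>The curves agree on the closed interval from \<open>b - 1\<close> to \<open>a\<close>,
  which contains every time outside the open arc modulo 1. One-sided derivatives determine the
  tangents also at its ends.\<close>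

lemma tangent_outside:
  assumes "t \<notin> arc a b"
  shows "tangent D' t = tangent D t"
proof -
  obtain t' where t': "t - t' \<in> \<int>" "t' \<le> a" "b \<le> t' + 1" using assms ab(1) by (rule not_arcE)
  let ?I = "cbox (b - 1) a"
  have I: "x \<notin> arc a b" if "x \<in> ?I" for x
  proof
    assume "x \<in> arc a b"
    then obtain y where y: "a < y" "y < b" "x - y \<in> \<int>" by (rule arcE)
    obtain k where "x = y + of_int k" using y(3) by (rule Ints_diffE)
    moreover have "b - 1 \<le> x" "x \<le> a" using that by auto
    ultimately have "- 1 < real_of_int k" "real_of_int k < 0" using y by auto
    then have "real_of_int (- 1) < real_of_int k" "real_of_int k < real_of_int 0" by simp_all
    then have "- 1 < k" "k < 0" by (simp_all only: of_int_less_iff)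
    then show False by linarith
  qed
  have t'I: "t' \<in> ?I" using t' by simp
  have "(curve D has_vector_derivative tangent D t') (at t' within ?I)"
    using curve_has_derivative[OF D] by (rule has_vector_derivative_at_within)
  moreover have "(curve D has_vector_derivative tangent D' t') (at t' within ?I)"
  proof (rule has_vector_derivative_transform[OF t'I])
    show "(curve D' has_vector_derivative tangent D' t') (at t' within ?I)"
      using curve_has_derivative[OF D'] by (rule has_vector_derivative_at_within)
  qed (use I outside(1) in simp)
  moreover have "b - 1 < a" using ab by simp
  ultimately have "tangent D t' = tangent D' t'"
    using vector_derivative_unique_within_closed_interval t'I by blast
  then show ?thesis using tangent_cong[OF D t'(1)] tangent_cong[OF D' t'(1)] by simp
qed

definition old_crossings :: "real set set" where
  "old_crossings = {c \<in> crossings D. \<forall>t\<in>c. t \<notin> arc a b}"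

lemma old_crossing_chord:
  assumes "classical D s t"
  shows "chord s t \<in> old_crossings \<longleftrightarrow> s \<notin> arc a b \<and> t \<notin> arc a b"
  using chord_mem[OF D assms] arc_cong[OF frac_diff_Ints(2)] unfolding old_crossings_def chord_def by auto

lemma old_crossing_chord':
  assumes "classical D' s t"
  shows "chord s t \<in> old_crossings \<longleftrightarrow> s \<notin> arc a b \<and> t \<notin> arc a b"
proof
  assume "chord s t \<in> old_crossings"
  then show "s \<notin> arc a b \<and> t \<notin> arc a b" using arc_cong[OF frac_diff_Ints(2)] unfolding old_crossings_def chord_def by auto
next
  assume "s \<notin> arc a b \<and> t \<notin> arc a b"
  then show "chord s t \<in> old_crossings" using classical_outside assms old_crossing_chord by blast
qed

lemma old_crossingE:
  assumes "c \<in> old_crossings"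
  obtains s t where "c = chord s t" "classical D s t" "classical D' s t" "s \<in> over D" "s \<in> over D'"
    "s \<notin> arc a b" "t \<notin> arc a b"
proof -
  have c: "c \<in> crossings D" using assms by (simp add: old_crossings_def)
  obtain s t where st: "c = chord s t" "classical D s t" "s \<in> over D" using D c by (rule over_underE)
  then have "s \<notin> arc a b" "t \<notin> arc a b" using assms old_crossing_chord by blast+
  then show ?thesis using st classical_outside outside(2) by (intro that[of s t]) auto
qed

lemma old_crossings_subset: "old_crossings \<subseteq> crossings D" "old_crossings \<subseteq> crossings D'"
proof -
  show "old_crossings \<subseteq> crossings D" by (auto simp: old_crossings_def)
  show "old_crossings \<subseteq> crossings D'"
  proof
    fix c assume "c \<in> old_crossings"
    then obtain s t where "c = chord s t" "classical D' s t" by (rule old_crossingE)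
    then show "c \<in> crossings D'" using chord_mem[OF D'] by simp
  qed
qed

lemma gauss_matrix_old:
  assumes "c \<in> old_crossings" "d \<in> old_crossings"
  shows "gauss_matrix D' c d = gauss_matrix D c d"
proof -
  obtain s t where st: "c = chord s t" "classical D s t" "classical D' s t" "s \<in> over D" "s \<in> over D'"
    "s \<notin> arc a b" "t \<notin> arc a b" using assms(1) by (rule old_crossingE)
  obtain x y where xy: "d = chord x y" "classical D x y" "classical D' x y" using assms(2) by (rule old_crossingE)
  show ?thesis
  proof (cases "c = d")
    case True
    then show ?thesis
      using gauss_matrix_diagonal[OF D st(2,4)] gauss_matrix_diagonal[OF D' st(3,5)] tangent_outside[OF st(6)]
        tangent_outside[OF st(7)] st(1) by simp
  next
    case False
    then show ?thesis
      using gauss_matrix_chords[OF D st(2) xy(2)] gauss_matrix_chords[OF D' st(3) xy(3)] st(1) xy(1) by simp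
  qed
qed

lemma old_crossing_alternate:
  assumes "classical E s t" "c = chord x y" "classical E x y" "chord s t \<noteq> c" "knot_diagram E"
  shows "gauss_matrix E (chord s t) c = of_bool (circ x y s \<noteq> circ x y t)"
proof -
  note d = distinct_chords[OF assms(5,1,3)]
  have "alternate s t x y \<longleftrightarrow> alternate x y s t"
    using alternate_commute[of s t x y] d assms classical_notin_Ints by metis
  then show ?thesis
    using gauss_matrix_chords[OF assms(5,1,3)] assms(2,4) unfolding alternate_def[of x y] by simp
qed

end

section \<open>Detours and the first Reidemeister move\<close>

lemma homotopy_class_detour:
  assumes D: "knot_diagram D" and D': "knot_diagram D'" and det: "detour D D'"
  shows "homotopy_class_of (gauss_graph D) = homotopy_class_of (gauss_graph D')"
proof -
  obtain a b where ch: "differ_on_arc a b D D'"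
    and no: "\<forall>t\<in>arc a b. \<forall>s. \<not> classical D s t \<and> \<not> classical D' s t"
    using det unfolding detour_def by blast
  interpret arc_change a b D D' using D D' ch by unfold_locales
  have no': "s \<notin> arc a b" "t \<notin> arc a b" if "classical D s t \<or> classical D' s t" for s t
    using no that classical_commute by blast+
  have "crossings D \<subseteq> old_crossings"
  proof
    fix c assume "c \<in> crossings D"
    then obtain s t where "c = chord s t" "classical D s t" by (rule crossing_chordE)
    then show "c \<in> old_crossings" using old_crossing_chord no' by blast
  qed
  moreover have "crossings D' \<subseteq> old_crossings"
  proof
    fix c assume "c \<in> crossings D'"
    then obtain s t where "c = chord s t" "classical D' s t" by (rule crossing_chordE)
    then show "c \<in> old_crossings" using old_crossing_chord' no' by blast
  qed
  ultimately have e: "crossings D = old_crossings" "crossings D' = old_crossings" using old_crossings_subset by blast+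
  have "looped_of (crossings D) (gauss_matrix D) = looped_of (crossings D') (gauss_matrix D')"
    using gauss_matrix_old e by (intro looped_of_cong) simp_all
  then show ?thesis using gauss_graph_looped_of[OF D] gauss_graph_looped_of[OF D'] by simp
qed

lemma crossing_timesE:
  assumes "crossing_times a b D = S" "knot_diagram D" "x \<in> arc a b" "meets D y x"
  obtains x' where "x' \<in> S" "x - x' \<in> \<int>"
proof -
  obtain x' where x': "a < x'" "x' < b" "x - x' \<in> \<int>" using assms(3) by (rule arcE)
  have "y - y \<in> \<int>" by simp
  from meets_cong[OF assms(2) this x'(3)] have "meets D y x'" using assms(4) by blast
  then have "x' \<in> S" using x' assms(1) unfolding crossing_times_def by blast
  then show ?thesis using x'(3) that by blast
qed

lemma crossing_timesD: "x \<in> crossing_times a b D \<Longrightarrow> a < x \<and> x < b"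
  by (simp add: crossing_times_def)

lemma homotopy_class_reidemeister1:
  assumes D: "knot_diagram D" and D': "knot_diagram D'" and R: "reidemeister1 D D'"
  shows "homotopy_class_of (gauss_graph D) = homotopy_class_of (gauss_graph D')"
proof -
  obtain a b z r s t where ch: "changes_in_disc a b z r D D'"
    and T: "crossing_times a b D = {}" and T': "crossing_times a b D' = {s, t}" and cl: "classical D' s t"
    using R unfolding reidemeister1_def by blast
  interpret arc_change a b D D' using D D' ch unfolding changes_in_disc_def by unfold_locales auto
  have st: "s \<in> arc a b" "t \<in> arc a b"
    using crossing_timesD[of s a b D'] crossing_timesD[of t a b D'] T' mem_arc by auto
  have "crossings D \<subseteq> old_crossings"
  proof
    fix c assume "c \<in> crossings D"
    then obtain p q where pq: "c = chord p q" "classical D p q" by (rule crossing_chordE)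
    then have "meets D p q" "meets D q p" using meets_commute unfolding classical_def by blast+
    then have "p \<notin> arc a b" "q \<notin> arc a b" using crossing_timesE[OF T D] by blast+
    then show "c \<in> old_crossings" using old_crossing_chord pq by blast
  qed
  then have e: "crossings D = old_crossings" using old_crossings_subset by blast
  have e': "crossings D' = insert (chord s t) old_crossings"
  proof
    show "insert (chord s t) old_crossings \<subseteq> crossings D'" using old_crossings_subset chord_mem[OF D' cl] by blast
    show "crossings D' \<subseteq> insert (chord s t) old_crossings"
    proof
      fix c assume "c \<in> crossings D'"
      then obtain p q where pq: "c = chord p q" "classical D' p q" by (rule crossing_chordE)
      have *: "chord p q = chord s t" if p: "p \<in> arc a b" and cpq: "classical D' p q" for p q
      proof (rule ccontr)
        assume ne: "chord p q \<noteq> chord s t"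
        have "meets D' q p" using cpq meets_commute unfolding classical_def by blast
        then obtain x where "x \<in> {s, t}" "p - x \<in> \<int>" using crossing_timesE[OF T' D' p] by blast
        then show False using distinct_chords[OF D' cpq cl ne] by blast
      qed
      show "c \<in> insert (chord s t) old_crossings"
      proof (cases "p \<notin> arc a b \<and> q \<notin> arc a b")
        case True
        then show ?thesis using old_crossing_chord' pq by blast
      next
        case False
        then have "chord p q = chord s t \<or> chord q p = chord s t"
          using *[of p q] *[of q p] pq(2) classical_commute by blast
        then show ?thesis using pq(1) chord_commute by blast
      qed
    qed
  qed
  have n: "chord s t \<notin> old_crossings" using old_crossing_chord'[OF cl] st by blast
  have fin: "finite old_crossings" using finite_crossings[OF D] e by simp
  \<comment> \<open>Both ends of the new chord lie on the changed arc and both ends of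
    \<open>c\<close> outside it, so the chords do not alternate.\<close>
  have "gauss_matrix D' (chord s t) c = 0" if c: "c \<in> old_crossings" for c
  proof -
    obtain x y where xy: "c = chord x y" "classical D' x y" "x \<notin> arc a b" "y \<notin> arc a b"
      using c by (rule old_crossingE)
    have "chord s t \<noteq> c" using n c by blast
    then show ?thesis
      using old_crossing_alternate[OF cl xy(1,2) _ D'] circ_arc_third[OF ab(1) xy(3,4) st] by simp
  qed
  then have "homotopy_class_of (looped_of old_crossings (gauss_matrix D')) =
      homotopy_class_of (looped_of (insert (chord s t) old_crossings) (gauss_matrix D'))"
    by (intro homotopy_class_of_isolated fin n sym_mat_loop_matrix)
  moreover have "looped_of old_crossings (gauss_matrix D') = looped_of (crossings D) (gauss_matrix D)"
    using gauss_matrix_old e by (intro looped_of_cong) simp_all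
  ultimately show ?thesis using gauss_graph_looped_of[OF D] gauss_graph_looped_of[OF D'] e' by simp
qed

section \<open>Isotopies\<close>

lemma circ_increasing:
  assumes mono: "strict_mono p" and per: "\<And>t. p (t + 1) = p t + (1::real)"
  shows "circ (p s) (p t) (p x) \<longleftrightarrow> circ s t x"
proof -
  have shift: "p (u + of_int k) = p u + of_int k" for u k
    using periodic_int[of "\<lambda>t. p t - t" u k] per by simp
  have f: "frac (p u - p s) = p (s + frac (u - s)) - p s" for u
  proof (rule frac_eqI)
    show "0 \<le> p (s + frac (u - s)) - p s" using strict_mono_less_eq[OF mono, of s "s + frac (u - s)"] by simp
    have "p (s + frac (u - s)) < p (s + 1)" using strict_mono_less[OF mono] frac_lt_1 by simp
    then show "p (s + frac (u - s)) - p s < 1" using per by simp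
    have "u = s + frac (u - s) + of_int \<lfloor>u - s\<rfloor>" by (simp add: frac_def)
    then have "p u = p (s + frac (u - s)) + of_int \<lfloor>u - s\<rfloor>" using shift by metis
    then show "p u - p s - (p (s + frac (u - s)) - p s) \<in> \<int>" by simp
  qed
  show ?thesis unfolding circ_def f using strict_mono_less[OF mono] by simp
qed

text \<open>Reversing the circle replaces the arc from \<open>p\<close> to \<open>q\<close> by its
  complement, which does not affect whether \<open>x\<close> and \<open>y\<close> are
  separated.\<close>

lemma alternate_minus:
  assumes "p - q \<notin> \<int>" "p - x \<notin> \<int>" "q - x \<notin> \<int>" "p - y \<notin> \<int>" "q - y \<notin> \<int>"
  shows "alternate (- p) (- q) (- x) (- y) \<longleftrightarrow> alternate p q x y"
proof -
  have f: "frac (- u - - v) = 1 - frac (u - v)" if "v - u \<notin> \<int>" for u v :: real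
  proof -
    have "u - v \<notin> \<int>" using that Ints_diff_commute by blast
    then show ?thesis using frac_neg[of "u - v"] by (simp add: algebra_simps)
  qed
  have c: "circ (- p) (- q) (- z) \<longleftrightarrow> \<not> circ p q z" if "p - z \<notin> \<int>" "q - z \<notin> \<int>" for z
    using relative_positions(3)[OF assms(1) that] unfolding circ_def f[OF that(1)] f[OF assms(1)] by auto
  show ?thesis unfolding alternate_def c[OF assms(2,3)] c[OF assms(4,5)] by blast
qed

text \<open>The derivative is continuous without zeros, hence of constant sign; up to the sign
  \<open>e\<close>, the map \<open>p\<close> is strictly increasing and commutes with the shift by
  1.\<close>

lemma reparametrization:
  fixes p p' :: "real \<Rightarrow> real"
  assumes d: "\<And>t. (p has_real_derivative p' t) (at t)" and cont: "continuous_on UNIV p'" and nz: "\<And>t. p' t \<noteq> 0"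
    and per: "(\<forall>t. p (t + 1) = p t + 1) \<or> (\<forall>t. p (t + 1) = p t - 1)"
  shows "p' s * p' t > 0" "p s - p t \<in> \<int> \<longleftrightarrow> s - t \<in> \<int>" "surj p"
    "s - t \<notin> \<int> \<Longrightarrow> s - x \<notin> \<int> \<Longrightarrow> t - x \<notin> \<int> \<Longrightarrow> s - y \<notin> \<int> \<Longrightarrow> t - y \<notin> \<int> \<Longrightarrow>
      alternate (p s) (p t) (p x) (p y) \<longleftrightarrow> alternate s t x y"
proof -
  have sg: "p' s * p' t > 0" for s t
  proof (rule ccontr)
    assume "\<not> p' s * p' t > 0"
    then have "p' s < 0 \<and> 0 < p' t \<or> p' t < 0 \<and> 0 < p' s"
      using nz[of s] nz[of t] by (meson linorder_neqE_linordered_idom mult_neg_neg mult_pos_pos)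
    moreover have "connected (range p')" using connected_continuous_image[OF cont] by simp
    ultimately have "0 \<in> range p'" using connected_contains_Icc[of "range p'"] by (meson atLeastAtMost_iff less_imp_le rangeI subsetD)
    then show False using nz by auto
  qed
  then show "p' s * p' t > 0" .
  define e :: real where "e = (if p' 0 > 0 then 1 else - 1)"
  define P where "P t = e * p t" for t
  have e: "e = 1 \<or> e = - 1" by (simp add: e_def)
  have dP: "(P has_real_derivative e * p' t) (at t)" for t
    unfolding P_def by (intro DERIV_cmult d)
  have pos: "e * p' t > 0" for t
  proof (cases "p' 0 > 0")
    case True
    have "p' t > 0" by (rule zero_less_mult_pos[OF sg True])
    then show ?thesis using True by (simp add: e_def)
  next
    case False
    then have "p' 0 < 0" using nz[of 0] by linarith
    then have n: "0 < - p' 0" by simp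
    have m: "0 < (- p' 0) * (- p' t)" using sg[of 0 t] by simp
    have "0 < - p' t" by (rule zero_less_mult_pos[OF m n])
    then show ?thesis using False by (simp add: e_def)
  qed
  have mono: "strict_mono P"
  proof (rule strict_monoI)
    fix x y :: real assume xy: "x < y"
    show "P x < P y" by (rule DERIV_pos_imp_increasing[OF xy], rule exI, rule conjI, rule dP, rule pos)
  qed
  have perP: "P (t + 1) = P t + 1" for t
  proof -
    have "P t < P (t + 1)" using strict_mono_less[OF mono] by simp
    then show ?thesis using per e unfolding P_def by auto
  qed
  have shift: "P (u + of_int k) = P u + of_int k" for u k
    using periodic_int[of "\<lambda>t. P t - t" u k] perP by simp
  have PZ: "P s - P t \<in> \<int> \<longleftrightarrow> s - t \<in> \<int>" for s t
  proof
    assume "P s - P t \<in> \<int>"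
    then obtain k where "P s = P t + of_int k" by (rule Ints_diffE)
    then have "P s = P (t + of_int k)" using shift by simp
    then have "s = t + of_int k" using strict_mono_eq[OF mono] by simp
    then show "s - t \<in> \<int>" by simp
  next
    assume "s - t \<in> \<int>"
    then obtain k where "s = t + of_int k" by (rule Ints_diffE)
    then show "P s - P t \<in> \<int>" using shift by simp
  qed
  have pe: "p t = e * P t" for t using e unfolding P_def by auto
  have "p s - p t \<in> \<int> \<longleftrightarrow> P s - P t \<in> \<int>" for s t
    using e Ints_minus[of "P s - P t"] Ints_minus[of "P t - P s"] unfolding pe by auto
  then show pZ: "p s - p t \<in> \<int> \<longleftrightarrow> s - t \<in> \<int>" using PZ by simp
  have "surj P"
  proof (rule surjI[of P "\<lambda>y. SOME x. P x = y"])
    fix y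
    let ?k = "\<lfloor>y - P 0\<rfloor>"
    have "P (of_int ?k) \<le> y" "y \<le> P (of_int ?k + 1)"
      using shift[of 0 ?k] perP[of "of_int ?k"] by (simp, linarith, simp, linarith)
    moreover have "continuous_on {of_int ?k..of_int ?k + 1} P"
      using dP DERIV_isCont by (intro continuous_at_imp_continuous_on) blast
    ultimately have "\<exists>x. of_int ?k \<le> x \<and> x \<le> of_int ?k + 1 \<and> P x = y" by (intro IVT') auto
    then show "P (SOME x. P x = y) = y" by (metis (mono_tags, lifting) someI_ex)
  qed
  then show "surj p"
    unfolding surj_def pe by (metis (no_types, opaque_lifting) e minus_minus mult_1 mult_minus1)
  assume ne: "s - t \<notin> \<int>" "s - x \<notin> \<int>" "t - x \<notin> \<int>" "s - y \<notin> \<int>" "t - y \<notin> \<int>"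
  have P: "alternate (P s) (P t) (P x) (P y) \<longleftrightarrow> alternate s t x y"
    unfolding alternate_def using circ_increasing[OF mono perP] by simp
  show "alternate (p s) (p t) (p x) (p y) \<longleftrightarrow> alternate s t x y"
    using e
  proof
    assume "e = 1"
    then show ?thesis using P unfolding pe by simp
  next
    assume "e = - 1"
    then have "alternate (p s) (p t) (p x) (p y) \<longleftrightarrow> alternate (- P s) (- P t) (- P x) (- P y)" unfolding pe by simp
    then show ?thesis using alternate_minus[of "P s" "P t" "P x" "P y"] ne PZ P by simp
  qed
qed

text \<open>The factor is the determinant of \<open>f\<close>.\<close>

lemma cross_linear:
  assumes "bounded_linear f"
  shows "cross (f w) (f z) = cross (f 1) (f \<i>) * cross w z"
proof -
  interpret bounded_linear f by fact
  have lin: "f u = Re u *\<^sub>R f 1 + Im u *\<^sub>R f \<i>" for u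
  proof -
    have "u = Re u *\<^sub>R 1 + Im u *\<^sub>R \<i>" by (simp add: complex_eq_iff)
    then have "f u = f (Re u *\<^sub>R 1 + Im u *\<^sub>R \<i>)" by simp
    then show ?thesis by (simp only: add scaleR)
  qed
  have "Re (f u) = Re u * Re (f 1) + Im u * Re (f \<i>)" "Im (f u) = Re u * Im (f 1) + Im u * Im (f \<i>)" for u
    using arg_cong[OF lin[of u], of Re] arg_cong[OF lin[of u], of Im] by simp_all
  note this[of w] this[of z]
  then show ?thesis unfolding cross_def by (simp add: algebra_simps)
qed

lemma homotopy_class_isotopic:
  assumes D: "knot_diagram D" and D': "knot_diagram D'" and iso: "isotopic D D'"
  shows "homotopy_class_of (gauss_graph D) = homotopy_class_of (gauss_graph D')"
proof -
  obtain h h' p p' where h: "bij h" "\<forall>z. (h has_derivative h' z) (at z)" "\<forall>z. cross (h' z 1) (h' z \<i>) > 0"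
    and p: "\<forall>t. (p has_real_derivative p' t) (at t)" "continuous_on UNIV p'" "\<forall>t. p' t \<noteq> 0"
      "(\<forall>t. p (t + 1) = p t + 1) \<or> (\<forall>t. p (t + 1) = p t - 1)"
    and c: "curve D' = h \<circ> curve D \<circ> p" and o: "over D' = p -` over D"
    using iso unfolding isotopic_def by blast
  note P = reparametrization[OF spec[OF p(1)] p(2) spec[OF p(3)] p(4)]
  have m: "meets D' s t \<longleftrightarrow> meets D (p s) (p t)" for s t
    unfolding meets_def P(2) c using h(1) by (simp add: bij_def inj_eq)
  have cl: "classical D' s t \<longleftrightarrow> classical D (p s) (p t)" for s t
    unfolding classical_def m o by simp
  have tan: "tangent D' t = h' (curve D (p t)) (p' t *\<^sub>R tangent D (p t))" for t
  proof -
    have "(p has_vector_derivative p' t) (at t)"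
      using p(1) by (simp add: has_real_derivative_iff_has_vector_derivative)
    then have 1: "(curve D \<circ> p has_vector_derivative p' t *\<^sub>R tangent D (p t)) (at t)"
      by (rule vector_diff_chain_at[OF _ curve_has_derivative[OF D]])
    have 2: "(h has_derivative h' (curve D (p t))) (at ((curve D \<circ> p) t) within (curve D \<circ> p) ` UNIV)"
      using h(2) by (simp add: has_derivative_at_withinI)
    from vector_derivative_diff_chain_within[OF 1 2]
    have "(h \<circ> (curve D \<circ> p) has_vector_derivative h' (curve D (p t)) (p' t *\<^sub>R tangent D (p t))) (at t)" .
    then show ?thesis unfolding c comp_assoc by (rule vector_derivative_at)
  qed
  \<comment> \<open>The Jacobian of \<open>h\<close> is positive, and so is the product of the two
    speeds even when the direction is reversed; hence writhes are preserved.\<close>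
  have sgn: "cross (tangent D' s) (tangent D' t) < 0 \<longleftrightarrow> cross (tangent D (p s)) (tangent D (p t)) < 0"
    if "classical D' s t" for s t
  proof -
    have z: "curve D (p s) = curve D (p t)" using that unfolding cl by (simp add: classical_def meets_def)
    let ?z = "curve D (p t)"
    have "bounded_linear (h' ?z)" using h(2) has_derivative_bounded_linear by blast
    then have "cross (tangent D' s) (tangent D' t) =
        cross (h' ?z 1) (h' ?z \<i>) * cross (p' s *\<^sub>R tangent D (p s)) (p' t *\<^sub>R tangent D (p t))"
      unfolding tan z by (rule cross_linear)
    also have "cross (p' s *\<^sub>R tangent D (p s)) (p' t *\<^sub>R tangent D (p t)) =
        (p' s * p' t) * cross (tangent D (p s)) (tangent D (p t))"
      by (simp add: cross_def algebra_simps)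
    finally have e: "cross (tangent D' s) (tangent D' t) =
        (cross (h' ?z 1) (h' ?z \<i>) * (p' s * p' t)) * cross (tangent D (p s)) (tangent D (p t))"
      by (simp only: mult.assoc)
    have "0 < cross (h' ?z 1) (h' ?z \<i>) * (p' s * p' t)" by (rule mult_pos_pos[OF spec[OF h(3)] P(1)])
    from mult_less_cancel_left_pos[OF this, of "cross (tangent D (p s)) (tangent D (p t))" 0]
    show ?thesis unfolding e by (simp only: mult_zero_right)
  qed
  define f where "f c = (\<lambda>t. frac (p t)) ` c" for c
  have fr: "frac (p (frac t)) = frac (p t)" for t using P(2)[of "frac t" t] frac_diff_Ints frac_eq_iff by blast
  have f: "f (chord s t) = chord (p s) (p t)" for s t by (simp add: f_def chord_def fr)
  have fi: "f (chord s t) = f (chord x y) \<longleftrightarrow> chord s t = chord x y" for s t x y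
    unfolding f unfolding chord_def doubleton_eq_iff frac_eq_iff P(2) by blast
  have "bij_betw f (crossings D') (crossings D)"
    unfolding bij_betw_def
  proof
    show "inj_on f (crossings D')"
    proof (rule inj_onI)
      fix c d assume "c \<in> crossings D'" "d \<in> crossings D'" "f c = f d"
      then show "c = d" by (elim crossing_chordE) (simp add: fi)
    qed
    show "f ` crossings D' = crossings D"
    proof (rule subset_antisym; rule subsetI)
      fix c assume "c \<in> f ` crossings D'"
      then obtain d where d: "d \<in> crossings D'" "c = f d" by blast
      obtain s t where "d = chord s t" "classical D' s t" using d(1) by (rule crossing_chordE)
      then show "c \<in> crossings D" using d(2) f chord_mem[OF D] cl by simp
    next
      fix c assume "c \<in> crossings D"
      then obtain u w where uw: "c = chord u w" "classical D u w" by (rule crossing_chordE)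
      obtain s t where "u = p s" "w = p t" using P(3) by (metis surjD)
      then have "c = f (chord s t)" "chord s t \<in> crossings D'" using uw f cl chord_mem[OF D'] by simp_all
      then show "c \<in> f ` crossings D'" by blast
    qed
  qed
  moreover have "gauss_matrix D (f c) (f d) = gauss_matrix D' c d" if c: "c \<in> crossings D'" and d: "d \<in> crossings D'" for c d
  proof -
    obtain s t where st: "c = chord s t" "classical D' s t" "s \<in> over D'" using D' c by (rule over_underE)
    obtain x y where xy: "d = chord x y" "classical D' x y" using d by (rule crossing_chordE)
    have st': "classical D (p s) (p t)" "p s \<in> over D" and xy': "classical D (p x) (p y)"
      using st xy cl o by auto
    show ?thesis
    proof (cases "c = d")
      case True
      show ?thesis unfolding True[symmetric] st(1) f
        using gauss_matrix_diagonal[OF D st'] gauss_matrix_diagonal[OF D' st(2,3)] sgn[OF st(2)] by simp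
    next
      case False
      then have ne: "chord s t \<noteq> chord x y" "chord (p s) (p t) \<noteq> chord (p x) (p y)"
        using st(1) xy(1) fi f by metis+
      note d = distinct_chords[OF D' st(2) xy(2) ne(1)]
      have "alternate (p s) (p t) (p x) (p y) \<longleftrightarrow> alternate s t x y"
        using P(4) classical_notin_Ints[OF st(2)] d by blast
      then show ?thesis unfolding st(1) xy(1) f
        using gauss_matrix_chords[OF D st'(1) xy' ne(2)] gauss_matrix_chords[OF D' st(2) xy(2) ne(1)] by simp
    qed
  qed
  ultimately have "graph_iso (looped_of (crossings D') (gauss_matrix D')) (looped_of (crossings D) (gauss_matrix D))"
    by (rule graph_iso_looped_ofI)
  then have "graph_iso (gauss_graph D') (gauss_graph D)"
    using gauss_graph_looped_of[OF D] gauss_graph_looped_of[OF D'] by simp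
  then show ?thesis using homotopy_class_of_iso looped_gauss_graph[OF D'] by metis
qed

section \<open>Simple zeros of real functions\<close>

lemma sign_const:
  fixes g :: "real \<Rightarrow> real"
  assumes "continuous_on {l..u} g" "l \<le> u" "\<And>t. l \<le> t \<Longrightarrow> t \<le> u \<Longrightarrow> g t \<noteq> 0"
  shows "g l > 0 \<longleftrightarrow> g u > 0"
proof -
  have "g l \<noteq> 0" "g u \<noteq> 0" using assms(2,3) by simp_all
  moreover have "\<not> (g l < 0 \<and> 0 < g u)" using IVT'[of g l 0 u] assms by force
  moreover have "\<not> (0 < g l \<and> g u < 0)" using IVT2'[of g u 0 l] assms by force
  ultimately show ?thesis by linarith
qed

text \<open>Before the zero the function keeps its sign from \<open>a\<close>. A positive derivative
  at \<open>s\<close> would make it negative just before \<open>s\<close>; so the derivative is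
  negative, and the function stays negative afterwards.\<close>

lemma simple_zero_positive:
  fixes g :: "real \<Rightarrow> real"
  assumes c: "continuous_on {a..b} g" and s: "a < s" "s < b" and ga: "g a > 0"
    and z: "\<And>t. a < t \<Longrightarrow> t < b \<Longrightarrow> g t = 0 \<longleftrightarrow> t = s" and d: "(g has_real_derivative g') (at s)" "g' \<noteq> 0"
  shows "g' < 0 \<and> (\<forall>t. a < t \<and> t < s \<longrightarrow> g t > 0) \<and> (\<forall>t. s < t \<and> t < b \<longrightarrow> g t < 0)"
proof -
  have gs: "g s = 0" using z s by simp
  have left: "g t > 0" if t: "a < t" "t < s" for t
  proof -
    have "g x \<noteq> 0" if "a \<le> x" "x \<le> t" for x
      using z[of x] that t s ga by (cases "x = a") auto
    moreover have "continuous_on {a..t} g" using t s by (intro continuous_on_subset[OF c]) auto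
    ultimately show ?thesis using sign_const[of a t g] t ga by simp
  qed
  have neg: "g' < 0"
  proof (rule ccontr)
    assume "\<not> g' < 0"
    then have "g' > 0" using d(2) by simp
    from DERIV_pos_inc_left[OF d(1) this] obtain e where e: "e > 0" "\<And>h. 0 < h \<Longrightarrow> h < e \<Longrightarrow> g (s - h) < g s" by blast
    define h where "h = min (e / 2) ((s - a) / 2)"
    have h: "0 < h" "h < e" "a < s - h" "s - h < s" using e(1) s(1) by (auto simp: h_def min_def field_simps)
    show False using e(2)[OF h(1,2)] left[OF h(3,4)] gs by simp
  qed
  have "g t < 0" if t: "s < t" "t < b" for t
  proof -
    from DERIV_neg_dec_right[OF d(1) neg] obtain e where e: "e > 0" "\<And>h. 0 < h \<Longrightarrow> h < e \<Longrightarrow> g s > g (s + h)" by blast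
    define h where "h = min (e / 2) ((t - s) / 2)"
    have h: "0 < h" "h < e" "s + h \<le> t" using e(1) t(1) by (auto simp: h_def min_def field_simps)
    have nz: "g x \<noteq> 0" if "s + h \<le> x" "x \<le> t" for x using z[of x] that t s h by auto
    moreover have "continuous_on {s + h..t} g" using t s h by (intro continuous_on_subset[OF c]) auto
    ultimately have "g (s + h) > 0 \<longleftrightarrow> g t > 0" using sign_const[of "s + h" t g] h(3) by blast
    then show ?thesis using e(2)[OF h(1,2)] gs nz[of t] h(3) by force
  qed
  then show ?thesis using neg left by blast
qed

text \<open>Everything is read off the sign at \<open>a\<close>, a point that a Reidemeister move
  leaves in place; this allows crossings before and after the move to be compared.\<close>

lemma simple_zero:
  fixes g :: "real \<Rightarrow> real"
  assumes c: "continuous_on {a..b} g" and s: "a < s" "s < b" and ga: "g a \<noteq> 0"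
    and z: "\<And>t. a < t \<Longrightarrow> t < b \<Longrightarrow> g t = 0 \<longleftrightarrow> t = s" and d: "(g has_real_derivative g') (at s)" "g' \<noteq> 0"
  shows "g' < 0 \<longleftrightarrow> g a > 0" "a < t \<Longrightarrow> t < s \<Longrightarrow> g t > 0 \<longleftrightarrow> g a > 0" "s < t \<Longrightarrow> t < b \<Longrightarrow> g t > 0 \<longleftrightarrow> g a < 0"
proof -
  have "(g' < 0 \<longleftrightarrow> g a > 0) \<and> (\<forall>t. a < t \<and> t < s \<longrightarrow> (g t > 0 \<longleftrightarrow> g a > 0)) \<and>
    (\<forall>t. s < t \<and> t < b \<longrightarrow> (g t > 0 \<longleftrightarrow> g a < 0))"
  proof (cases "g a > 0")
    case True
    then show ?thesis using simple_zero_positive[OF c s True z d] by (auto simp: not_less_iff_gr_or_eq)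
  next
    case False
    then have "- g a > 0" using ga by simp
    from simple_zero_positive[OF continuous_on_minus[OF c] s this _ DERIV_minus[OF d(1)]] z d(2)
    have "- g' < 0 \<and> (\<forall>t. a < t \<and> t < s \<longrightarrow> - g t > 0) \<and> (\<forall>t. s < t \<and> t < b \<longrightarrow> - g t < 0)" by simp
    then show ?thesis using False ga by (auto simp: not_less_iff_gr_or_eq)
  qed
  then show "g' < 0 \<longleftrightarrow> g a > 0" "a < t \<Longrightarrow> t < s \<Longrightarrow> g t > 0 \<longleftrightarrow> g a > 0"
    "s < t \<Longrightarrow> t < b \<Longrightarrow> g t > 0 \<longleftrightarrow> g a < 0" by blast+
qed

lemma consecutive_zeros_positive:
  fixes g :: "real \<Rightarrow> real"
  assumes c: "continuous_on {s..t} g" and st: "s < t" and z: "g s = 0" "g t = 0"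
    "\<And>x. s < x \<Longrightarrow> x < t \<Longrightarrow> g x \<noteq> 0"
    and d: "(g has_real_derivative g1) (at s)" "(g has_real_derivative g2) (at t)" and p: "g1 > 0" "g2 > 0"
  shows False
proof -
  from DERIV_pos_inc_right[OF d(1) p(1)] obtain e where e: "e > 0" "\<And>h. 0 < h \<Longrightarrow> h < e \<Longrightarrow> g s < g (s + h)" by blast
  from DERIV_pos_inc_left[OF d(2) p(2)] obtain f where f: "f > 0" "\<And>h. 0 < h \<Longrightarrow> h < f \<Longrightarrow> g (t - h) < g t" by blast
  define h where "h = min (min (e / 2) (f / 2)) ((t - s) / 3)"
  have h: "0 < h" "h < e" "h < f" "s + h \<le> t - h" using e(1) f(1) st by (auto simp: h_def min_def field_simps)
  have "continuous_on {s + h..t - h} g" using h by (intro continuous_on_subset[OF c]) auto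
  then have "g (s + h) > 0 \<longleftrightarrow> g (t - h) > 0" using sign_const[of "s + h" "t - h" g] h z(3) by simp
  then show False using e(2)[OF h(1,2)] f(2)[OF h(1,3)] z(1,2) by simp
qed

text \<open>Derivatives of equal sign would give \<open>g\<close> opposite signs just after
  \<open>s\<close> and just before \<open>t\<close>, with no zero in between.\<close>

lemma consecutive_zeros:
  fixes g :: "real \<Rightarrow> real"
  assumes c: "continuous_on {s..t} g" and st: "s < t" and z: "g s = 0" "g t = 0"
    "\<And>x. s < x \<Longrightarrow> x < t \<Longrightarrow> g x \<noteq> 0"
    and d: "(g has_real_derivative g1) (at s)" "(g has_real_derivative g2) (at t)" and nz: "g1 \<noteq> 0" "g2 \<noteq> 0"
  shows "g1 < 0 \<longleftrightarrow> \<not> g2 < 0"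
proof -
  have "\<not> (g1 > 0 \<and> g2 > 0)" using consecutive_zeros_positive[OF c st z d] by blast
  moreover have "\<not> (- g1 > 0 \<and> - g2 > 0)"
  proof
    assume h: "- g1 > 0 \<and> - g2 > 0"
    show False
      by (rule consecutive_zeros_positive[OF continuous_on_minus[OF c] st _ _ _ DERIV_minus[OF d(1)] DERIV_minus[OF d(2)]])
        (use z h in auto)
  qed
  ultimately show ?thesis using nz by linarith
qed

section \<open>Straight strands\<close>

lemma bounded_linear_cross: "bounded_linear (cross v)"
  unfolding cross_def
  by (intro bounded_linear_sub bounded_linear_compose[OF bounded_linear_mult_right bounded_linear_Im]
      bounded_linear_compose[OF bounded_linear_mult_right bounded_linear_Re])

text \<open>For nonzero \<open>v\<close>, the function is up to a positive factor the signed
  distance from the line through \<open>x\<close> in direction \<open>v\<close>.\<close>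

lemma side_has_derivative:
  assumes "knot_diagram D"
  shows "((\<lambda>t. cross v (curve D t - x)) has_real_derivative cross v (tangent D t)) (at t)"
proof -
  have "((\<lambda>t. curve D t - x) has_vector_derivative tangent D t - 0) (at t)"
    by (intro has_vector_derivative_diff curve_has_derivative[OF assms] has_vector_derivative_const)
  from bounded_linear.has_vector_derivative[OF bounded_linear_cross this]
  show ?thesis by (simp add: has_real_derivative_iff_has_vector_derivative)
qed

lemma continuous_side: "knot_diagram D \<Longrightarrow> continuous_on S (\<lambda>t. cross v (curve D t - x))"
  using side_has_derivative DERIV_isCont by (intro continuous_at_imp_continuous_on) blast

lemma cross_scaleR_self [simp]: "cross v (t *\<^sub>R v) = 0"
  by (simp add: cross_def)

lemma cross_commute: "cross w z = - cross z w"
  by (simp add: cross_def)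

lemma open_arc: "open (arc a b)"
proof -
  have "arc a b = (\<Union>k::int. {a - of_int k<..<b - of_int k})"
    unfolding arc_def set_eq_iff by (simp add: diff_less_eq less_diff_eq)
  then show ?thesis by (simp add: open_UN)
qed

lemma arc_end_notin: "c < d \<Longrightarrow> d < c + 1 \<Longrightarrow> c \<notin> arc c d \<and> d \<notin> arc c d"
proof -
  assume cd: "c < d" "d < c + 1"
  have "\<not> (c < c + real_of_int k \<and> c + real_of_int k < d)" "\<not> (c < d + real_of_int k \<and> d + real_of_int k < d)" for k
  proof -
    have "k \<le> 0 \<or> k \<ge> 1" "k \<ge> 0 \<or> k \<le> - 1" by linarith+
    then have "real_of_int k \<le> 0 \<or> real_of_int k \<ge> 1" "real_of_int k \<ge> 0 \<or> real_of_int k \<le> - 1" by linarith+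
    then show "\<not> (c < c + real_of_int k \<and> c + real_of_int k < d)" "\<not> (c < d + real_of_int k \<and> d + real_of_int k < d)"
      using cd by linarith+
  qed
  then show ?thesis unfolding arc_def by blast
qed

text \<open>Every neighbourhood of an end of an arc meets the arc.\<close>

lemma open_disjoint_arc_ends:
  assumes "open U" "U \<inter> arc c d = {}" "c < d"
  shows "c \<notin> U" "d \<notin> U"
proof -
  have *: False if x: "x \<in> U" "x \<in> {c..d}" for x
  proof -
    obtain e where e: "e > 0" "ball x e \<subseteq> U" using assms(1) x(1) openE by blast
    define y where "y = (if x < (c + d) / 2 then x + min (e / 2) ((d - c) / 4) else x - min (e / 2) ((d - c) / 4))"
    have "\<bar>y - x\<bar> < e" using e(1) assms(3) by (auto simp: y_def min_def)
    then have "y \<in> U" using e(2) by (auto simp: dist_real_def abs_minus_commute)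
    moreover have "c < y" "y < d" using x(2) e(1) assms(3) by (auto simp: y_def min_def field_simps)
    ultimately show False using assms(2) mem_arc by blast
  qed
  show "c \<notin> U" "d \<notin> U" using *[of c] *[of d] assms(3) by auto
qed

lemma strand_ends_outside:
  assumes D: "knot_diagram D" and U: "open U" "U \<inter> arc c d = {}" and cd: "c < d" "d < c + 1"
    and cover: "\<And>t. curve D t \<in> ball z r \<Longrightarrow> t \<in> U \<or> t \<in> arc c d"
  shows "curve D c \<notin> ball z r" "curve D d \<notin> ball z r"
  using open_disjoint_arc_ends[OF U cd(1)] arc_end_notin[OF cd] cover by blast+

text \<open>A chord of the disc, traversed at constant velocity. The ends lie outside the open disc,
  so that the strand is everything the disc contains of its line.\<close>

locale strand =
  fixes D :: vdiagram and z :: complex and r c d :: real and x v :: complex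
  assumes D: "knot_diagram D" and cd: "c < d" "d < c + 1"
    and straight: "\<And>t. c < t \<Longrightarrow> t < d \<Longrightarrow> curve D t = x + t *\<^sub>R v"
    and inside: "\<And>t. t \<in> arc c d \<Longrightarrow> curve D t \<in> ball z r"
    and ends: "curve D c \<notin> ball z r" "curve D d \<notin> ball z r"
begin

lemma tangent_strand:
  assumes "c < t" "t < d"
  shows "tangent D t = v"
proof -
  have "((\<lambda>t. x + t *\<^sub>R v) has_vector_derivative v) (at t)" by (auto intro!: derivative_eq_intros)
  then have "(curve D has_vector_derivative v) (at t)"
    by (rule has_vector_derivative_transform_within_open[where S = "{c<..<d}"]) (use assms straight in auto)
  then show ?thesis by (rule vector_derivative_at)
qed

lemma closure_strand: "closure {c<..<d} = {c..d}"
  using cd(1) by (rule closure_greaterThanLessThan)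

lemma tangent_strand_closed:
  assumes "c \<le> t" "t \<le> d"
  shows "tangent D t = v" "curve D t = x + t *\<^sub>R v"
proof -
  have t: "t \<in> closure {c<..<d}" using assms closure_strand by simp
  have "continuous_on (closure {c<..<d}) (\<lambda>t. tangent D t)"
    using continuous_tangent[OF D] by (rule continuous_on_subset) simp
  then show "tangent D t = v"
    by (rule continuous_constant_on_closure[OF _ _ t]) (simp add: tangent_strand)
  have "continuous_on (closure {c<..<d}) (\<lambda>t. curve D t - (x + t *\<^sub>R v))"
    by (intro continuous_intros continuous_curve[OF D])
  then have "curve D t - (x + t *\<^sub>R v) = 0"
    by (rule continuous_constant_on_closure[OF _ _ t]) (simp add: straight)
  then show "curve D t = x + t *\<^sub>R v" by simp
qed

lemma v_nz: "v \<noteq> 0"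
  using tangent_strand_closed(1)[of c] knot_diagramD(3)[OF D, of c] cd(1) by simp

lemma norm_ends: "norm (x + c *\<^sub>R v - z) = r" "norm (x + d *\<^sub>R v - z) = r"
proof -
  have le: "norm (curve D t - z) \<le> r" if "c \<le> t" "t \<le> d" for t
  proof (rule continuous_le_on_closure[where S = "{c<..<d}" and f = "\<lambda>t. norm (curve D t - z)"])
    show "continuous_on (closure {c<..<d}) (\<lambda>t. norm (curve D t - z))"
      by (intro continuous_intros continuous_curve[OF D])
    show "t \<in> closure {c<..<d}" using that closure_strand by simp
    show "norm (curve D y - z) \<le> r" if "y \<in> {c<..<d}" for y
      using inside[OF mem_arc[of c y d]] that by (simp add: dist_norm norm_minus_commute)
  qed
  show "norm (x + c *\<^sub>R v - z) = r" "norm (x + d *\<^sub>R v - z) = r"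
    using le[of c] le[of d] ends tangent_strand_closed(2)[of c] tangent_strand_closed(2)[of d] cd(1)
    by (simp_all add: dist_norm norm_minus_commute)
qed

text \<open>The power of a point: the left side is a quadratic polynomial in \<open>t\<close> that
  vanishes at \<open>c\<close> and \<open>d\<close>, as the ends of the strand lie on the
  circle.\<close>

lemma norm_line: "(norm (x + t *\<^sub>R v - z))\<^sup>2 - r\<^sup>2 = (norm v)\<^sup>2 * ((t - c) * (t - d))"
proof -
  define A B C where "A = (norm v)\<^sup>2" and "B = 2 * inner (x - z) v" and "C = (norm (x - z))\<^sup>2 - r\<^sup>2"
  have q: "(norm (x + t *\<^sub>R v - z))\<^sup>2 - r\<^sup>2 = A * t\<^sup>2 + B * t + C" for t
  proof -
    have "x + t *\<^sub>R v - z = (x - z) + t *\<^sub>R v" by simp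
    then have "(norm (x + t *\<^sub>R v - z))\<^sup>2 = inner ((x - z) + t *\<^sub>R v) ((x - z) + t *\<^sub>R v)"
      by (simp only: power2_norm_eq_inner)
    also have "\<dots> = inner (x - z) (x - z) + 2 * t * inner (x - z) v + t\<^sup>2 * inner v v"
      by (simp only: inner_add_left inner_add_right inner_scaleR_left inner_scaleR_right inner_commute[of v "x - z"])
        (simp add: algebra_simps power2_eq_square)
    finally show ?thesis by (simp add: A_def B_def C_def power2_norm_eq_inner algebra_simps)
  qed
  have 1: "A * c\<^sup>2 + B * c + C = 0" "A * d\<^sup>2 + B * d + C = 0" using q[of c] q[of d] norm_ends by simp_all
  then have "(c - d) * (A * (c + d) + B) = 0" by (simp add: algebra_simps power2_eq_square)
  then have B: "B = - A * (c + d)" using cd(1) by simp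
  have C: "C = A * c * d" using 1(1) unfolding B by (simp add: algebra_simps power2_eq_square)
  show ?thesis unfolding q B C A_def[symmetric] by (simp add: algebra_simps power2_eq_square)
qed

lemma line_inside:
  assumes "x + t *\<^sub>R v \<in> ball z r"
  shows "c < t" "t < d"
proof -
  have "norm (x + t *\<^sub>R v - z) < r" using assms by (simp add: dist_norm norm_minus_commute)
  then have "(norm (x + t *\<^sub>R v - z))\<^sup>2 < r\<^sup>2" by (intro power_strict_mono) simp_all
  then have "(norm v)\<^sup>2 * ((t - c) * (t - d)) < 0" using norm_line[of t] by simp
  then have "(t - c) * (t - d) < 0" using v_nz by (simp add: mult_less_0_iff)
  then show "c < t" "t < d" using cd(1) by (auto simp: mult_less_0_iff)
qed

lemma line_on_sphere:
  assumes "norm (x + t *\<^sub>R v - z) = r"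
  shows "t = c \<or> t = d"
  using norm_line[of t] assms v_nz by simp

lemma on_line:
  assumes "cross v (w - x) = 0"
  obtains t where "w = x + t *\<^sub>R v"
proof -
  have eq: "Re v * Im (w - x) = Im v * Re (w - x)" using assms by (simp add: cross_def)
  have "Re v \<noteq> 0 \<or> Im v \<noteq> 0" using v_nz complex_eq_iff by auto
  then have "\<exists>t. w - x = t *\<^sub>R v"
  proof
    assume "Re v \<noteq> 0"
    then show ?thesis using eq by (intro exI[of _ "Re (w - x) / Re v"]) (simp add: complex_eq_iff field_simps)
  next
    assume "Im v \<noteq> 0"
    then show ?thesis using eq by (intro exI[of _ "Im (w - x) / Im v"]) (simp add: complex_eq_iff field_simps)
  qed
  then obtain t where "w - x = t *\<^sub>R v" by blast
  then have "w = x + t *\<^sub>R v" by (simp add: algebra_simps)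
  then show ?thesis by (rule that)
qed

text \<open>Within the disc the line coincides with the strand, so a zero of the side function is a
  point of the curve.\<close>

lemma meets_strand:
  assumes "w \<in> ball z r" "cross v (w - x) = 0"
  obtains t where "c < t" "t < d" "w = curve D t"
proof -
  obtain t where t: "w = x + t *\<^sub>R v" using assms(2) by (rule on_line)
  then have "c < t" "t < d" using line_inside assms(1) by simp_all
  then show ?thesis using t straight by (intro that[of t]) simp_all
qed

lemma side_strand: "c < t \<Longrightarrow> t < d \<Longrightarrow> cross v (curve D t - x) = 0"
  using straight by simp

lemma inj_strand:
  assumes "s \<in> arc c d" "t \<in> arc c d" "curve D s = curve D t"
  shows "s - t \<in> \<int>"
proof -
  obtain s' where s': "c < s'" "s' < d" "s - s' \<in> \<int>" using assms(1) by (rule arcE)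
  obtain t' where t': "c < t'" "t' < d" "t - t' \<in> \<int>" using assms(2) by (rule arcE)
  have "curve D s' = curve D t'" using curve_cong[OF D s'(3)] curve_cong[OF D t'(3)] assms(3) by simp
  then have "(s' - t') *\<^sub>R v = 0" using straight s' t' by (simp add: algebra_simps)
  then have "s' = t'" using v_nz by simp
  then show ?thesis using Ints_diff_cong[OF s'(3) t'(3)] by simp
qed

end

section \<open>The second Reidemeister move\<close>

locale disc_change =
  fixes a b :: real and D D' :: vdiagram and z :: complex and r :: real
  assumes D: "knot_diagram D" and D': "knot_diagram D'" and disc: "changes_in_disc a b z r D D'"
begin

sublocale arc_change a b D D'
  using D D' disc unfolding changes_in_disc_def by unfold_locales auto

lemma in_disc: "t \<in> arc a b \<Longrightarrow> curve D t \<in> ball z r" "t \<in> arc a b \<Longrightarrow> curve D' t \<in> ball z r"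
  using disc unfolding changes_in_disc_def by auto

lemma not_on_sphere: "meets D s t \<Longrightarrow> curve D s \<notin> sphere z r"
  using disc unfolding changes_in_disc_def by auto

text \<open>\<open>V\<close> stands for the times of the other unchanged strand. Since it and the
  changed arc are open and disjoint from the strand, the ends of the strand are not in the disc;
  being away from the changed arc, the strand is common to both diagrams.\<close>

lemma strands:
  assumes S: "{t. t \<notin> arc a b \<and> curve D t \<in> ball z r} = arc c d \<union> V" and V: "open V" "V \<inter> arc c d = {}"
    and str: "straight_strand c d D"
  obtains x v where "strand D z r c d x v" "strand D' z r c d x v"
proof -
  obtain x v where cd: "c < d" "d < c + 1" and xv: "\<And>t. c < t \<Longrightarrow> t < d \<Longrightarrow> curve D t = x + t *\<^sub>R v"
    using str unfolding straight_strand_def by blast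
  have n: "t \<notin> arc a b" if "t \<in> arc c d" for t using S that by blast
  have ends: "curve D c \<notin> ball z r" "curve D d \<notin> ball z r"
  proof -
    have "open (arc a b \<union> V)" "(arc a b \<union> V) \<inter> arc c d = {}" using open_arc V n by auto
    moreover have "t \<in> arc a b \<union> V \<or> t \<in> arc c d" if "curve D t \<in> ball z r" for t using S that by blast
    ultimately show "curve D c \<notin> ball z r" "curve D d \<notin> ball z r" using strand_ends_outside[OF D _ _ cd] by blast+
  qed
  have "arc a b \<inter> arc c d = {}" using n by blast
  then have "c \<notin> arc a b" "d \<notin> arc a b" using open_disjoint_arc_ends[OF open_arc _ cd(1)] by blast+
  then have ends': "curve D' c = curve D c" "curve D' d = curve D d" using outside(1) by simp_all
  have same: "curve D' t = curve D t" if "t \<in> arc c d" for t using n[OF that] outside(1) by simp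
  have ball: "curve D t \<in> ball z r" if "t \<in> arc c d" for t using S that by blast
  have "strand D z r c d x v" using D cd xv ball ends by unfold_locales
  moreover have "strand D' z r c d x v"
    using D' cd xv ball ends ends' same mem_arc by unfold_locales simp_all
  ultimately show ?thesis by (rule that)
qed

end

lemma over_strandE:
  assumes "knot_diagram D" "over_strand D s c d"
  obtains s' where "c < s'" "s' < d" "classical D s s'" "s \<in> over D"
proof -
  obtain w where w: "w \<in> arc c d" "meets D w s" "s \<in> over D" using assms(2) unfolding over_strand_def by blast
  obtain s' where s': "c < s'" "s' < d" "w - s' \<in> \<int>" using w(1) by (rule arcE)
  have "meets D s' s" using meets_cong[OF assms(1) s'(3), of s s] w(2) by simp
  then have "classical D s s'" using w(3) meets_commute unfolding classical_def by blast
  then show ?thesis using s'(1,2) w(3) by (intro that[of s'])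
qed

lemma crossing_of_times:
  assumes D: "knot_diagram D" and T: "crossing_times a b D = {s, t}"
    and s: "classical D s s'" and t: "classical D t t'"
    and pq: "classical D p q" "p \<in> arc a b \<or> q \<in> arc a b"
  shows "chord p q = chord s s' \<or> chord p q = chord t t'"
proof -
  have *: "chord p q = chord s s' \<or> chord p q = chord t t'" if p: "p \<in> arc a b" and c: "classical D p q" for p q
  proof (rule ccontr)
    assume ne: "\<not> (chord p q = chord s s' \<or> chord p q = chord t t')"
    have "meets D q p" using c meets_commute unfolding classical_def by blast
    then obtain x where "x \<in> {s, t}" "p - x \<in> \<int>" using crossing_timesE[OF T D p] by blast
    then show False using distinct_chords(1)[OF D c s] distinct_chords(1)[OF D c t] ne by blast
  qed
  show ?thesis
  proof (cases "p \<in> arc a b")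
    case True
    then show ?thesis using * pq(1) by blast
  next
    case False
    then have "q \<in> arc a b" "classical D q p" using pq classical_commute by blast+
    then show ?thesis using *[of q p] chord_commute[of p q] by simp
  qed
qed

lemma homotopy_class_reidemeister2:
  assumes D: "knot_diagram D" and D': "knot_diagram D'" and R: "reidemeister2 D D'"
  shows "homotopy_class_of (gauss_graph D) = homotopy_class_of (gauss_graph D')"
proof -
  obtain a b c d z r s t where ch: "changes_in_disc a b z r D D'"
    and S: "{x. x \<notin> arc a b \<and> curve D x \<in> ball z r} = arc c d" and str: "straight_strand c d D"
    and T: "crossing_times a b D = {}" and st: "s \<noteq> t" and T': "crossing_times a b D' = {s, t}"
    and ov: "over_strand D' s c d" "over_strand D' t c d"
    using R unfolding reidemeister2_def by (elim exE conjE) (rule that)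
  interpret disc_change a b D D' z r using D D' ch by unfold_locales
  obtain x v where "strand D z r c d x v" and strand': "strand D' z r c d x v"
    by (rule strands[of c d "{}"]) (use S str that in auto)
  interpret S: strand D' z r c d x v by (rule strand')
  have cd: "u \<notin> arc a b" if "u \<in> arc c d" for u using S that by blast
  have stab: "a < s" "s < b" "a < t" "t < b"
    using crossing_timesD[of s a b D'] crossing_timesD[of t a b D'] T' by auto
  then have sta: "s \<in> arc a b" "t \<in> arc a b" using mem_arc by blast+
  define g where "g u = cross v (curve D' u - x)" for u
  have gd: "(g has_real_derivative cross v (tangent D' u)) (at u)" for u
    unfolding g_def by (rule side_has_derivative[OF D'])
  have gc: "continuous_on A g" for A unfolding g_def by (rule continuous_side[OF D'])
  \<comment> \<open>On the changed arc, a zero of the side function is a crossing with the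
    strand.\<close>
  have gz: "u \<in> {s, t}" if u: "a < u" "u < b" "g u = 0" for u
  proof -
    have "curve D' u \<in> ball z r" using in_disc(2) mem_arc[OF u(1,2)] by blast
    then obtain w where w: "c < w" "w < d" "curve D' u = curve D' w" using S.meets_strand u(3) unfolding g_def by blast
    have "w \<in> arc c d" using w mem_arc by blast
    then have "w - u \<notin> \<int>" using arc_cong cd mem_arc[OF u(1,2)] by blast
    then have "meets D' w u" using w(3) by (simp add: meets_def)
    then have "u \<in> crossing_times a b D'" using u unfolding crossing_times_def by blast
    then show ?thesis using T' by simp
  qed
  have new: "\<exists>w. c < w \<and> w < d \<and> classical D' u w \<and> u \<in> over D' \<and> g u = 0 \<and>
      cross v (tangent D' u) \<noteq> 0 \<and> cross (tangent D' u) (tangent D' w) = - cross v (tangent D' u)"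
    if u: "over_strand D' u c d" for u
  proof -
    obtain w where w: "c < w" "w < d" "classical D' u w" "u \<in> over D'" using D' u by (rule over_strandE)
    have m: "meets D' w u" using w(3) meets_commute unfolding classical_def by blast
    have "cross (tangent D' w) (tangent D' u) \<noteq> 0" by (rule knot_diagramD(5)[OF D' m])
    moreover have "tangent D' w = v" using S.tangent_strand w by blast
    moreover have "g u = 0" using m S.side_strand[OF w(1,2)] unfolding g_def meets_def by simp
    ultimately show ?thesis using w cross_commute[of "tangent D' u" v] by (intro exI[of _ w]) simp
  qed
  obtain s' where s': "c < s'" "s' < d" "classical D' s s'" "s \<in> over D'" "g s = 0"
    "cross v (tangent D' s) \<noteq> 0" "cross (tangent D' s) (tangent D' s') = - cross v (tangent D' s)"
    using new[OF ov(1)] by (elim exE conjE)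
  obtain t' where t': "c < t'" "t' < d" "classical D' t t'" "t \<in> over D'" "g t = 0"
    "cross v (tangent D' t) \<noteq> 0" "cross (tangent D' t) (tangent D' t') = - cross v (tangent D' t)"
    using new[OF ov(2)] by (elim exE conjE)
  have s'c: "s' \<in> arc c d" and t'c: "t' \<in> arc c d" using s' t' mem_arc by blast+
  \<comment> \<open>\<open>s\<close> and \<open>t\<close> are consecutive zeros of the side
    function, so the two crossings go in opposite directions and their writhes differ.\<close>
  have sgn: "cross v (tangent D' s) < 0 \<longleftrightarrow> \<not> cross v (tangent D' t) < 0"
  proof (cases "s < t")
    case True
    have "g u \<noteq> 0" if "s < u" "u < t" for u using gz[of u] stab that by auto
    then show ?thesis using consecutive_zeros[OF gc True s'(5) t'(5) _ gd gd s'(6) t'(6)] by blast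
  next
    case False
    then have ts: "t < s" using st by simp
    have "g u \<noteq> 0" if "t < u" "u < s" for u using gz[of u] stab that by auto
    then show ?thesis using consecutive_zeros[OF gc ts t'(5) s'(5) _ gd gd t'(6) s'(6)] by blast
  qed
  let ?c1 = "chord s s'" and ?c2 = "chord t t'"
  have no: "p \<notin> arc c d" if pq: "classical D' p q" "p \<notin> arc a b" "q \<notin> arc a b" for p q
  proof
    assume p: "p \<in> arc c d"
    have e: "curve D' p = curve D' q" using pq(1) by (simp add: classical_def meets_def)
    then have "curve D q \<in> ball z r" using S.inside[OF p] outside(1)[OF pq(3)] by simp
    then have "q \<in> arc c d" using S pq(3) by blast
    then show False using S.inj_strand[OF p _ e] classical_notin_Ints[OF pq(1)] by blast
  qed
  have "crossings D \<subseteq> old_crossings"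
  proof
    fix c assume "c \<in> crossings D"
    then obtain p q where pq: "c = chord p q" "classical D p q" by (rule crossing_chordE)
    then have "meets D p q" "meets D q p" using meets_commute unfolding classical_def by blast+
    then have "p \<notin> arc a b" "q \<notin> arc a b" using crossing_timesE[OF T D] by blast+
    then show "c \<in> old_crossings" using old_crossing_chord pq by blast
  qed
  then have e: "crossings D = old_crossings" using old_crossings_subset by blast
  have e': "crossings D' = insert ?c1 (insert ?c2 old_crossings)"
  proof
    show "insert ?c1 (insert ?c2 old_crossings) \<subseteq> crossings D'"
      using old_crossings_subset chord_mem[OF D' s'(3)] chord_mem[OF D' t'(3)] by blast
    show "crossings D' \<subseteq> insert ?c1 (insert ?c2 old_crossings)"
    proof
      fix k assume "k \<in> crossings D'"
      then obtain p q where pq: "k = chord p q" "classical D' p q" by (rule crossing_chordE)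
      show "k \<in> insert ?c1 (insert ?c2 old_crossings)"
      proof (cases "p \<notin> arc a b \<and> q \<notin> arc a b")
        case True
        then show ?thesis using old_crossing_chord' pq by blast
      next
        case False
        then show ?thesis using crossing_of_times[OF D' T' s'(3) t'(3) pq(2)] pq(1) by blast
      qed
    qed
  qed
  have n: "?c1 \<notin> old_crossings" "?c2 \<notin> old_crossings" using old_crossing_chord' s'(3) t'(3) sta by blast+
  have ne: "?c1 \<noteq> ?c2"
  proof
    assume "?c1 = ?c2"
    then have "s - t \<in> \<int> \<or> s - t' \<in> \<int>" using chord_eqD by blast
    then show False using arc_inner_notin_Ints[OF ab(2) stab st] arc_cong cd[OF t'c] sta by blast
  qed
  have fin: "finite old_crossings" using finite_crossings[OF D] e by simp
  \<comment> \<open>Both new chords run between the same two arcs, and no end of another chord lies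
    on either arc.\<close>
  have "gauss_matrix D' ?c1 k = gauss_matrix D' ?c2 k" if k: "k \<in> old_crossings" for k
  proof -
    obtain p q where pq: "k = chord p q" "classical D p q" "classical D' p q" "p \<in> over D" "p \<in> over D'"
      "p \<notin> arc a b" "q \<notin> arc a b"
      using k by (rule old_crossingE)
    have "?c1 \<noteq> k" "?c2 \<noteq> k" using n k by blast+
    moreover have "p \<notin> arc c d" "q \<notin> arc c d"
      using no[OF pq(3,6,7)] no[OF _ pq(7,6)] pq(3) classical_commute by blast+
    ultimately show ?thesis
      using old_crossing_alternate[OF s'(3) pq(1,3) _ D'] old_crossing_alternate[OF t'(3) pq(1,3) _ D']
        circ_arc_third[OF ab(1) pq(6,7) sta] circ_arc_third[OF S.cd(1) _ _ s'c t'c, of p q] by simp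
  qed
  moreover have "gauss_matrix D' ?c1 ?c1 \<noteq> gauss_matrix D' ?c2 ?c2"
    unfolding gauss_matrix_diagonal[OF D' s'(3,4)] gauss_matrix_diagonal[OF D' t'(3,4)] s'(7) t'(7)
    using sgn s'(6) t'(6) by auto
  ultimately have "homotopy_class_of (looped_of old_crossings (gauss_matrix D')) =
      homotopy_class_of (looped_of (insert ?c1 (insert ?c2 old_crossings)) (gauss_matrix D'))"
    by (intro homotopy_class_of_twins fin n ne sym_mat_loop_matrix)
  moreover have "looped_of old_crossings (gauss_matrix D') = looped_of (crossings D) (gauss_matrix D)"
    using gauss_matrix_old e by (intro looped_of_cong) simp_all
  ultimately show ?thesis using gauss_graph_looped_of[OF D] gauss_graph_looped_of[OF D'] e' by simp
qed

section \<open>The third Reidemeister move\<close>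

text \<open>Each of three disjoint arcs looks like a point from the others. The points are replaced
  one at a time, after rotating the triple so that the moving point comes last.\<close>

lemma circ_three_arcs:
  assumes l: "a1 < b1" "a2 < b2" "a3 < b3"
    and disj: "arc a1 b1 \<inter> arc a2 b2 = {}" "arc a1 b1 \<inter> arc a3 b3 = {}" "arc a2 b2 \<inter> arc a3 b3 = {}"
    and p: "p \<in> arc a1 b1" "p' \<in> arc a1 b1" and q: "q \<in> arc a2 b2" "q' \<in> arc a2 b2"
    and x: "x \<in> arc a3 b3" "x' \<in> arc a3 b3"
  shows "circ p q x \<longleftrightarrow> circ p' q' x'"
proof -
  have n: "u - w \<notin> \<int>" "u - y \<notin> \<int>" "w - y \<notin> \<int>"
    if "u \<in> arc a1 b1" "w \<in> arc a2 b2" "y \<in> arc a3 b3" for u w y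
  proof -
    have "w \<notin> arc a1 b1" "y \<notin> arc a1 b1" "y \<notin> arc a2 b2" using disj that by blast+
    then show "u - w \<notin> \<int>" "u - y \<notin> \<int>" "w - y \<notin> \<int>" using arc_diff_notin_Ints that by blast+
  qed
  have o: "p \<notin> arc a3 b3" "q \<notin> arc a3 b3" "x' \<notin> arc a2 b2" "p \<notin> arc a2 b2" "q' \<notin> arc a1 b1" "x' \<notin> arc a1 b1"
    using disj p q x by blast+
  have "circ p q x \<longleftrightarrow> circ p q x'" by (rule circ_arc_third[OF l(3) o(1,2) x])
  also have "\<dots> \<longleftrightarrow> circ x' p q" using circ_rotate[OF n[OF p(1) q(1) x(2)]] by simp
  also have "\<dots> \<longleftrightarrow> circ x' p q'" by (rule circ_arc_third[OF l(2) o(3,4) q])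
  also have "\<dots> \<longleftrightarrow> circ p q' x'" by (rule circ_rotate[OF n[OF p(1) q(2) x(2)]])
  also have "\<dots> \<longleftrightarrow> circ q' x' p"
  proof (rule circ_rotate)
    show "q' - x' \<notin> \<int>" by (rule n(3)[OF p(1) q(2) x(2)])
    show "q' - p \<notin> \<int>" "x' - p \<notin> \<int>"
      using n(1,2)[OF p(1) q(2) x(2)] Ints_diff_commute[of p q'] Ints_diff_commute[of p x'] by simp_all
  qed
  also have "\<dots> \<longleftrightarrow> circ q' x' p'" by (rule circ_arc_third[OF l(1) o(5,6) p])
  also have "\<dots> \<longleftrightarrow> circ p' q' x'"
  proof (rule circ_rotate[symmetric])
    show "q' - x' \<notin> \<int>" by (rule n(3)[OF p(1) q(2) x(2)])
    show "q' - p' \<notin> \<int>" "x' - p' \<notin> \<int>"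
      using n(1,2)[OF p(2) q(2) x(2)] Ints_diff_commute[of p' q'] Ints_diff_commute[of p' x'] by simp_all
  qed
  finally show ?thesis .
qed

text \<open>At its final end the strand points out of the disc: expanding the equal distances of
  both ends from the centre shows that twice the product is \<open>d - c\<close> times the squared
  length of \<open>v\<close>.\<close>

lemma (in strand) inner_end: "inner (x + d *\<^sub>R v - z) v > 0"
proof -
  define w k where "w = x + d *\<^sub>R v - z" and "k = d - c"
  have e: "x + c *\<^sub>R v - z = w - k *\<^sub>R v" by (simp add: w_def k_def algebra_simps)
  have "(norm (w - k *\<^sub>R v))\<^sup>2 = (norm w)\<^sup>2" using norm_ends unfolding e w_def[symmetric] by (simp only:)
  then have "inner (w - k *\<^sub>R v) (w - k *\<^sub>R v) = inner w w" by (simp only: power2_norm_eq_inner)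
  then have "k * (2 * inner w v) = k * (k * inner v v)"
    by (auto simp: inner_diff_left inner_diff_right inner_commute[of v w] algebra_simps)
  moreover have "k > 0" using cd(1) by (simp add: k_def)
  ultimately have "2 * inner w v = k * inner v v" by simp
  moreover have "k * inner v v > 0" using \<open>k > 0\<close> v_nz by simp
  ultimately have "inner w v > 0" by simp
  then show ?thesis by (simp add: w_def)
qed

text \<open>If the arc started on the line, its initial point would be an end of the strand; a curve
  continuing the strand beyond its final end leaves the disc.\<close>

lemma (in strand) side_start:
  assumes ab: "a < b" and disj: "arc a b \<inter> arc c d = {}"
    and disc: "\<And>t. t \<in> arc a b \<Longrightarrow> curve D t \<in> ball z r" and start: "curve D a \<notin> ball z r"
    and sphere: "\<And>s t. meets D s t \<Longrightarrow> curve D s \<notin> sphere z r"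
  shows "cross v (curve D a - x) \<noteq> 0"
proof
  assume "cross v (curve D a - x) = 0"
  then obtain t where t: "curve D a = x + t *\<^sub>R v" by (rule on_line)
  have "norm (curve D a - z) \<le> r"
  proof (rule continuous_le_on_closure[where S = "{a<..<b}" and f = "\<lambda>t. norm (curve D t - z)"])
    show "continuous_on (closure {a<..<b}) (\<lambda>t. norm (curve D t - z))"
      by (intro continuous_intros continuous_curve[OF D])
    show "a \<in> closure {a<..<b}" using ab by simp
    show "norm (curve D y - z) \<le> r" if "y \<in> {a<..<b}" for y
      using disc[OF mem_arc[of a y b]] that by (simp add: dist_norm norm_minus_commute)
  qed
  then have na: "norm (curve D a - z) = r" using start by (simp add: dist_norm norm_minus_commute)
  then have "t = c \<or> t = d" using line_on_sphere t by simp
  then have e: "curve D a = curve D t" using tangent_strand_closed(2)[of t] t cd(1) by auto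
  \<comment> \<open>No crossing lies on the boundary circle, so \<open>a\<close> and
    \<open>t\<close> must be the same time modulo 1.\<close>
  have "a - t \<in> \<int>"
  proof (rule ccontr)
    assume "a - t \<notin> \<int>"
    then have "meets D a t" using e by (simp add: meets_def)
    then show False using sphere na by (force simp: dist_norm norm_minus_commute)
  qed
  from \<open>t = c \<or> t = d\<close> show False
  proof
    assume t: "t = c"
    define h where "h = min (b - a) (d - c) / 2"
    have h: "0 < h" "a + h < b" "c + h < d" using ab cd(1) by (auto simp: h_def min_def field_simps)
    have "a + h \<in> arc a b" "c + h \<in> arc c d" using h mem_arc[of a "a + h" b] mem_arc[of c "c + h" d] by auto
    moreover have "(a + h) - (c + h) \<in> \<int>" using \<open>a - t \<in> \<int>\<close> t by simp
    ultimately show False using arc_cong disj by blast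
  next
    assume td: "t = d"
    have "tangent D a = v"
      using tangent_cong[OF D \<open>a - t \<in> \<int>\<close>] tangent_strand_closed(1)[of d] td cd(1) by simp
    moreover have "((\<lambda>u. curve D u - z) has_vector_derivative tangent D a - 0) (at a)"
      by (intro has_vector_derivative_diff curve_has_derivative[OF D] has_vector_derivative_const)
    ultimately have "((\<lambda>u. curve D u - z) has_vector_derivative v) (at a)" by simp
    from bounded_bilinear.has_vector_derivative[OF bounded_bilinear_inner this this]
    have "((\<lambda>u. inner (curve D u - z) (curve D u - z)) has_real_derivative 2 * inner (curve D a - z) v) (at a)"
      by (simp add: has_real_derivative_iff_has_vector_derivative inner_commute)
    moreover have "2 * inner (curve D a - z) v > 0" using inner_end t td by simp
    ultimately obtain e where e: "e > 0"
      "\<And>h. 0 < h \<Longrightarrow> h < e \<Longrightarrow> inner (curve D a - z) (curve D a - z) < inner (curve D (a + h) - z) (curve D (a + h) - z)"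
      using DERIV_pos_inc_right by blast
    define h where "h = min (e / 2) ((b - a) / 2)"
    have h: "0 < h" "h < e" "a + h < b" using ab e(1) by (auto simp: h_def min_def field_simps)
    have "r\<^sup>2 < (norm (curve D (a + h) - z))\<^sup>2" using e(2)[OF h(1,2)] na by (simp add: power2_norm_eq_inner[symmetric])
    then have "r < norm (curve D (a + h) - z)" by (rule power_less_imp_less_base) simp
    moreover have "curve D (a + h) \<in> ball z r" using disc mem_arc[of a "a + h" b] h by simp
    ultimately show False by (simp add: dist_norm norm_minus_commute)
  qed
qed

text \<open>A third strand, parametrized by \<open>arc a b\<close>, crosses two straight strands at the times \<open>s1\<close> and \<open>s2\<close>;
  the straight strands cross each other at their times \<open>\<xi>\<close> and \<open>\<eta>\<close>.\<close>

locale triangle =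
  S1: strand D z r c1 d1 x1 v1 + S2: strand D z r c2 d2 x2 v2 for D z r c1 d1 x1 v1 c2 d2 x2 v2 +
  fixes a b s1 s2 s1' s2' \<xi> \<eta> :: real
  assumes ab: "a < b" "b < a + 1"
    and in_disc: "t \<in> arc a b \<Longrightarrow> curve D t \<in> ball z r"
    and not_on_sphere: "meets D s t \<Longrightarrow> curve D s \<notin> sphere z r"
    and cover: "t \<notin> arc a b \<Longrightarrow> curve D t \<in> ball z r \<Longrightarrow> t \<in> arc c1 d1 \<union> arc c2 d2"
    and disj: "arc a b \<inter> arc c1 d1 = {}" "arc a b \<inter> arc c2 d2 = {}" "arc c1 d1 \<inter> arc c2 d2 = {}"
    and \<xi>: "c1 < \<xi>" "\<xi> < d1" and \<eta>: "c2 < \<eta>" "\<eta> < d2" and \<xi>\<eta>: "classical D \<xi> \<eta>"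
    and times: "crossing_times a b D = {s1, s2}" "s1 \<noteq> s2"
    and s1': "c1 < s1'" "s1' < d1" "classical D s1 s1'" "s1 \<in> over D"
    and s2': "c2 < s2'" "s2' < d2" "classical D s2 s2'" "s2 \<in> over D"
begin

text \<open>The two straight strands play symmetric roles, so facts proved for the first carry over
  to the second.\<close>

lemma swap: "triangle D z r c2 d2 x2 v2 c1 d1 x1 v1 a b s2 s1 s2' s1' \<eta> \<xi>"
proof
  show "t \<in> arc c2 d2 \<union> arc c1 d1" if "t \<notin> arc a b" "curve D t \<in> ball z r" for t using cover[OF that] by blast
  show "arc c2 d2 \<inter> arc c1 d1 = {}" using disj(3) by blast
  show "classical D \<eta> \<xi>" using \<xi>\<eta> classical_commute by blast
  show "crossing_times a b D = {s2, s1}" using times(1) by blast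
qed (use ab in_disc not_on_sphere disj \<xi> \<eta> times s1' s2' in \<open>simp_all\<close>)

lemma s12: "a < s1" "s1 < b" "a < s2" "s2 < b"
  using crossing_timesD[of s1 a b D] crossing_timesD[of s2 a b D] times(1) by auto

lemma arcs: "s1 \<in> arc a b" "s2 \<in> arc a b" "s1' \<in> arc c1 d1" "s2' \<in> arc c2 d2" "\<xi> \<in> arc c1 d1" "\<eta> \<in> arc c2 d2"
  using mem_arc s12 s1'(1,2) s2'(1,2) \<xi> \<eta> by blast+

lemma start_outside: "curve D a \<notin> ball z r"
proof
  assume i: "curve D a \<in> ball z r"
  have "open (arc c1 d1 \<union> arc c2 d2)" "(arc c1 d1 \<union> arc c2 d2) \<inter> arc a b = {}" using open_arc disj by auto
  then have "a \<notin> arc c1 d1 \<union> arc c2 d2" using open_disjoint_arc_ends(1) ab(1) by blast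
  then show False using cover[OF _ i] arc_end_notin[OF ab] by blast
qed

lemma tangent1: "tangent D s1' = v1"
  using S1.tangent_strand s1'(1,2) .

lemma transversal1: "cross v1 (tangent D s1) \<noteq> 0"
proof -
  have "meets D s1' s1" using s1'(3) meets_commute unfolding classical_def by blast
  from knot_diagramD(5)[OF S1.D this] show ?thesis by (simp add: tangent1)
qed

text \<open>A zero is a crossing time on the first strand. It cannot be \<open>s2\<close>, whose
  partner lies on the second strand, because there are no triple points.\<close>

lemma zero1:
  assumes "a < u" "u < b"
  shows "cross v1 (curve D u - x1) = 0 \<longleftrightarrow> u = s1"
proof
  assume "u = s1"
  then show "cross v1 (curve D u - x1) = 0"
    using S1.side_strand[OF s1'(1,2)] s1'(3) by (simp add: classical_def meets_def)
next
  assume g: "cross v1 (curve D u - x1) = 0"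
  have u: "u \<in> arc a b" using assms by (rule mem_arc)
  obtain w where w: "c1 < w" "w < d1" "curve D u = curve D w" using in_disc[OF u] g by (rule S1.meets_strand)
  have wa: "w \<in> arc c1 d1" using w mem_arc by blast
  then have "w - u \<notin> \<int>" using arc_diff_notin_Ints[OF wa, of u] disj(1) u by blast
  then have m: "meets D w u" using w(3) by (simp add: meets_def)
  then have "u \<in> crossing_times a b D" using assms unfolding crossing_times_def by blast
  moreover have "u \<noteq> s2"
  proof
    assume "u = s2"
    then have "w - s2' \<in> \<int>" using knot_diagramD(6)[OF S1.D, of w s2 s2'] m s2'(3) unfolding classical_def by blast
    then show False using arc_cong wa arcs(4) disj(3) by blast
  qed
  ultimately show "u = s1" using times(1) by blast
qed

lemma side1: "cross v1 (curve D a - x1) \<noteq> 0"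
  by (rule S1.side_start[OF ab(1) disj(1) in_disc start_outside not_on_sphere])

lemmas signs1 = simple_zero[OF continuous_side[OF S1.D] s12(1,2) side1 zero1 side_has_derivative[OF S1.D] transversal1]

lemma lines_meet: "x1 + \<xi> *\<^sub>R v1 = x2 + \<eta> *\<^sub>R v2"
  using S1.straight[OF \<xi>] S2.straight[OF \<eta>] \<xi>\<eta> by (simp add: classical_def meets_def)

lemma cross_v: "cross v1 v2 \<noteq> 0"
  using knot_diagramD(5)[OF S1.D, of \<xi> \<eta>] \<xi>\<eta> S1.tangent_strand[OF \<xi>] S2.tangent_strand[OF \<eta>]
  by (simp add: classical_def)

text \<open>Both lines pass through the crossing at \<xi> and \<eta>, so along the second strand the
  side function of the first is linear with zero \<eta>.\<close>

lemma side1_on2: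
  assumes "c2 < u" "u < d2"
  shows "cross v1 (curve D u - x1) = (u - \<eta>) * cross v1 v2"
proof -
  have "x2 = x1 + \<xi> *\<^sub>R v1 - \<eta> *\<^sub>R v2" using lines_meet by (simp add: algebra_simps)
  then have e: "curve D u - x1 = \<xi> *\<^sub>R v1 + (u - \<eta>) *\<^sub>R v2" using S2.straight[OF assms] by (simp add: algebra_simps)
  show ?thesis unfolding e by (simp add: cross_def algebra_simps)
qed

text \<open>The sign of the first side function at \<open>s2\<close> is found in two ways: from the
  position of \<open>s2'\<close> on the second strand, and from the side at the start together with
  the order of \<open>s1\<close> and \<open>s2\<close>. Of these data the move changes only the
  position and the order, so reversing the order moves \<open>s2'\<close> across \<eta>.\<close>

lemma position2:
  "s2' < \<eta> \<longleftrightarrow> ((cross v1 v2 > 0) = ((cross v1 (curve D a - x1) > 0) = (s1 < s2)))"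
proof -
  have e: "cross v1 (curve D s2 - x1) = (s2' - \<eta>) * cross v1 v2"
    using side1_on2[OF s2'(1,2)] s2'(3) by (simp add: classical_def meets_def)
  have "cross v1 (curve D s2 - x1) \<noteq> 0" using zero1[OF s12(3,4)] times(2) by simp
  then have n: "s2' \<noteq> \<eta>" using e by auto
  have "cross v1 (curve D s2 - x1) > 0 \<longleftrightarrow> ((cross v1 (curve D a - x1) > 0) = (\<not> s1 < s2))"
    using signs1(2)[of s2] signs1(3)[of s2] s12 times(2) side1 by (cases "s1 < s2") auto
  then show ?thesis unfolding e using n cross_v by (auto simp: zero_less_mult_iff)
qed

lemma cross_v_swap: "cross v2 v1 > 0 \<longleftrightarrow> \<not> cross v1 v2 > 0"
  using cross_v cross_commute[of v2 v1] by auto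

lemma position1:
  "s1' < \<xi> \<longleftrightarrow> ((cross v1 v2 > 0) = ((cross v2 (curve D a - x2) > 0) = (s1 < s2)))"
  using triangle.position2[OF swap] cross_v_swap times(2) by auto

abbreviation "P \<equiv> chord s1 s1'"
abbreviation "Q \<equiv> chord s2 s2'"
abbreviation "X \<equiv> chord \<xi> \<eta>"

text \<open>The side on which the upper strand starts determines the direction in which it crosses,
  so the writhe survives the move.\<close>

lemma gauss_PP: "gauss_matrix D P P = of_bool (\<not> cross v1 (curve D a - x1) > 0)"
  unfolding gauss_matrix_diagonal[OF S1.D s1'(3,4)] tangent1 cross_commute[of "tangent D s1" v1]
  using signs1(1) transversal1 by auto

lemma gauss_QQ: "gauss_matrix D Q Q = of_bool (\<not> cross v2 (curve D a - x2) > 0)"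
  by (rule triangle.gauss_PP[OF swap])

lemma PQ_ne: "P \<noteq> Q"
proof
  assume "P = Q"
  then have "s1 - s2 \<in> \<int> \<or> s1 - s2' \<in> \<int>" using chord_eqD by blast
  then show False
    using arc_inner_notin_Ints[OF ab(2) s12 times(2)] arc_diff_notin_Ints[OF arcs(1), of s2'] disj(2) arcs(4) by blast
qed

lemma PX_ne: "P \<noteq> X"
proof
  assume "P = X"
  then have "s1 - \<xi> \<in> \<int> \<or> s1 - \<eta> \<in> \<int>" using chord_eqD by blast
  then show False
    using arc_diff_notin_Ints[OF arcs(1), of \<xi>] arc_diff_notin_Ints[OF arcs(1), of \<eta>] disj arcs by blast
qed

text \<open>The circular order of the three arcs; the midpoints are mere representatives.\<close>

definition order :: bool where
  "order = circ ((a + b) / 2) ((c1 + d1) / 2) ((c2 + d2) / 2)"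

lemma order:
  assumes "p \<in> arc a b" "q \<in> arc c1 d1" "x \<in> arc c2 d2"
  shows "circ p q x \<longleftrightarrow> order"
proof -
  have m: "(a + b) / 2 \<in> arc a b" "(c1 + d1) / 2 \<in> arc c1 d1" "(c2 + d2) / 2 \<in> arc c2 d2"
    using ab(1) S1.cd(1) S2.cd(1) by (simp_all add: mem_arc)
  show ?thesis
    unfolding order_def
    by (rule circ_three_arcs[OF ab(1) S1.cd(1) S2.cd(1) disj assms(1) m(1) assms(2) m(2) assms(3) m(3)])
qed

lemma notin_Ints:
  assumes "p \<in> arc a b" "q \<in> arc c1 d1" "x \<in> arc c2 d2"
  shows "p - q \<notin> \<int>" "p - x \<notin> \<int>" "q - x \<notin> \<int>"
  using arc_diff_notin_Ints[OF assms(1), of q] arc_diff_notin_Ints[OF assms(1), of x]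
    arc_diff_notin_Ints[OF assms(2), of x] assms disj by blast+

text \<open>Alternation compares \<open>s2\<close>, which lies on the arc of \<open>s1\<close>, with
  \<open>s2'\<close>, which lies on the third arc: the first comparison is \<open>s1 < s2\<close>,
  the second is \<open>order\<close>.\<close>

lemma gauss_PQ: "gauss_matrix D P Q = of_bool ((s1 < s2) \<noteq> order)"
proof -
  have "circ s1 s1' s2 \<longleftrightarrow> s1 < s2"
    using arcs(3) disj(1) by (intro circ_within_arc[OF ab(1)] s12 times(2)) blast
  then show ?thesis
    unfolding gauss_matrix_chords[OF S1.D s1'(3) s2'(3) PQ_ne] alternate_def order[OF arcs(1,3,4)] by simp
qed

lemma gauss_PX: "gauss_matrix D P X = of_bool ((s1' < \<xi>) = order)"
proof -
  have "meets D s1 s1'" "s1' \<noteq> \<xi>"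
  proof -
    show "meets D s1 s1'" using s1'(3) by (simp add: classical_def)
    show "s1' \<noteq> \<xi>" using distinct_chords(3)[OF S1.D s1'(3) \<xi>\<eta> PX_ne] by auto
  qed
  then have 1: "circ s1' s1 \<xi> \<longleftrightarrow> s1' < \<xi>"
    using arcs(1) disj(1) by (intro circ_within_arc[OF S1.cd(1)] s1' \<xi>) blast+
  have 2: "circ s1' s1 \<eta> \<longleftrightarrow> \<not> order"
    using circ_swap[OF notin_Ints[OF arcs(1,3,6)]] order[OF arcs(1,3,6)] by simp
  note d = distinct_chords[OF S1.D s1'(3) \<xi>\<eta> PX_ne]
  have "alternate s1 s1' \<xi> \<eta> \<longleftrightarrow> alternate s1' s1 \<xi> \<eta>"
    using alternate_swap[OF classical_notin_Ints[OF s1'(3)] d(1,3,2,4)] by simp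
  then show ?thesis unfolding gauss_matrix_chords[OF S1.D s1'(3) \<xi>\<eta> PX_ne] alternate_def 1 2 by simp
qed

lemma order_swap: "triangle.order c2 d2 c1 d1 a b \<longleftrightarrow> \<not> order"
proof -
  have "circ s1 s2' s1' \<longleftrightarrow> \<not> circ s1 s1' s2'"
  proof -
    note n = notin_Ints[OF arcs(1,3,4)]
    have "circ s1 s2' s1' \<longleftrightarrow> circ s2' s1' s1"
      using n Ints_diff_commute[of s1' s2'] Ints_diff_commute[of s2' s1] Ints_diff_commute[of s1' s1]
      by (intro circ_rotate) auto
    also have "\<dots> \<longleftrightarrow> \<not> circ s1' s2' s1"
      using n Ints_diff_commute[of s1' s2'] Ints_diff_commute[of s2' s1] Ints_diff_commute[of s1' s1]
      by (intro circ_swap) auto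
    also have "circ s1' s2' s1 \<longleftrightarrow> circ s1 s1' s2'"
      using n Ints_diff_commute[of s1' s2'] Ints_diff_commute[of s2' s1] Ints_diff_commute[of s1' s1]
      by (intro circ_rotate[symmetric]) auto
    finally show ?thesis .
  qed
  then show ?thesis using order[OF arcs(1,3,4)] triangle.order[OF swap arcs(1,4,3)] by simp
qed

lemma gauss_QX: "gauss_matrix D Q X = of_bool ((s2' < \<eta>) \<noteq> order)"
  using triangle.gauss_PX[OF swap] chord_commute[of \<xi> \<eta>] order_swap by simp

lemma crossing_of_lines:
  assumes "classical D p q" "p \<in> arc c1 d1" "q \<in> arc c2 d2"
  shows "chord p q = X"
proof (rule ccontr)
  assume ne: "chord p q \<noteq> X"
  obtain q' where q': "c2 < q'" "q' < d2" "q - q' \<in> \<int>" using assms(3) by (rule arcE)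
  obtain p' where p': "c1 < p'" "p' < d1" "p - p' \<in> \<int>" using assms(2) by (rule arcE)
  have "curve D q' = curve D p'"
    using assms(1) curve_cong[OF S1.D p'(3)] curve_cong[OF S1.D q'(3)] by (simp add: classical_def meets_def)
  then have "(q' - \<eta>) * cross v1 v2 = 0" using side1_on2[OF q'(1,2)] S1.side_strand[OF p'(1,2)] by simp
  then have "q' = \<eta>" using cross_v by simp
  then show False using distinct_chords(4)[OF S1.D assms(1) \<xi>\<eta> ne] q'(3) by simp
qed

lemma other_ends1:
  assumes "classical D p q" "p \<notin> arc a b" "q \<notin> arc a b" "chord p q \<noteq> X"
  shows "p \<notin> arc c1 d1"
proof
  assume p: "p \<in> arc c1 d1"
  have e: "curve D p = curve D q" using assms(1) by (simp add: classical_def meets_def)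
  then have "curve D q \<in> ball z r" using S1.inside[OF p] by simp
  then have "q \<in> arc c1 d1 \<union> arc c2 d2" using cover assms(3) by blast
  then show False
    using S1.inj_strand[OF p _ e] classical_notin_Ints[OF assms(1)] crossing_of_lines[OF assms(1) p] assms(4) by blast
qed

lemma other_ends:
  assumes "classical D p q" "p \<notin> arc a b" "q \<notin> arc a b" "chord p q \<noteq> X"
  shows "p \<notin> arc c1 d1" "p \<notin> arc c2 d2"
proof -
  show "p \<notin> arc c1 d1" using assms by (rule other_ends1)
  have "chord p q \<noteq> chord \<eta> \<xi>" using assms(4) chord_commute[of \<xi> \<eta>] by simp
  then show "p \<notin> arc c2 d2" using triangle.other_ends1[OF swap assms(1-3)] by blast
qed

text \<open>No end of a foreign chord lies on the three arcs, so such a chord only sees on which arc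
  an end of \<open>P\<close>, \<open>Q\<close> or \<open>X\<close> lies. Hence these entries add up
  to 0 and do not change under the move.\<close>

lemma gauss_other:
  assumes "classical D p q" "p \<notin> arc a b" "q \<notin> arc a b" "chord p q \<noteq> X"
  shows "gauss_matrix D P (chord p q) = of_bool (circ p q ((a + b) / 2) \<noteq> circ p q \<xi>)"
    "gauss_matrix D Q (chord p q) = of_bool (circ p q ((a + b) / 2) \<noteq> circ p q \<eta>)"
    "gauss_matrix D X (chord p q) = of_bool (circ p q \<xi> \<noteq> circ p q \<eta>)"
proof -
  have c: "classical D q p" "chord q p \<noteq> X" using assms(1,4) classical_commute chord_commute[of p q] by auto
  note o = other_ends[OF assms] other_ends[OF c(1) assms(3,2) c(2)]
  have m: "(a + b) / 2 \<in> arc a b" using ab(1) by (intro mem_arc) simp_all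
  have 1: "circ p q s \<longleftrightarrow> circ p q ((a + b) / 2)" if "s \<in> arc a b" for s
    by (rule circ_arc_third[OF ab(1) assms(2,3) that m])
  have 2: "circ p q s1' \<longleftrightarrow> circ p q \<xi>" by (rule circ_arc_third[OF S1.cd(1) o(1,3) arcs(3,5)])
  have 3: "circ p q s2' \<longleftrightarrow> circ p q \<eta>" by (rule circ_arc_third[OF S2.cd(1) o(2,4) arcs(4,6)])
  have ne: "P \<noteq> chord p q" "Q \<noteq> chord p q"
  proof -
    have "chord p q \<noteq> chord s s'" if "s \<in> arc a b" for s s'
    proof
      assume "chord p q = chord s s'"
      then have "p - s \<in> \<int> \<or> q - s \<in> \<int>" using chord_eqD by blast
      then show False using arc_cong that assms(2,3) by blast
    qed
    then show "P \<noteq> chord p q" "Q \<noteq> chord p q" using arcs(1,2) by metis+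
  qed
  have alt: "gauss_matrix D (chord s t) (chord p q) = of_bool (circ p q s \<noteq> circ p q t)"
    if "classical D s t" "chord s t \<noteq> chord p q" for s t
  proof -
    note d = distinct_chords[OF S1.D that(1) assms(1) that(2)]
    have "alternate s t p q \<longleftrightarrow> alternate p q s t"
      by (rule alternate_commute[OF classical_notin_Ints[OF that(1)] d(1,3,2,4) classical_notin_Ints[OF assms(1)]])
    then show ?thesis using gauss_matrix_chords[OF S1.D that(1) assms(1) that(2)] by (simp add: alternate_def)
  qed
  show "gauss_matrix D P (chord p q) = of_bool (circ p q ((a + b) / 2) \<noteq> circ p q \<xi>)"
    using alt[OF s1'(3) ne(1)] 1[OF arcs(1)] 2 by simp
  show "gauss_matrix D Q (chord p q) = of_bool (circ p q ((a + b) / 2) \<noteq> circ p q \<eta>)"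
    using alt[OF s2'(3) ne(2)] 1[OF arcs(2)] 3 by simp
  show "gauss_matrix D X (chord p q) = of_bool (circ p q \<xi> \<noteq> circ p q \<eta>)" using alt[OF \<xi>\<eta>] assms(4) by simp
qed

text \<open>In the sum on the left, \<open>order\<close>, the orientation of \<open>v1, v2\<close>
  and the comparison of \<open>s1\<close> with \<open>s2\<close> cancel; what remains are the two
  starting sides, which are the writhes.\<close>

lemma gauss_writhes: "gauss_matrix D P X + gauss_matrix D Q X = 1 + gauss_matrix D P P + gauss_matrix D Q Q"
  unfolding gauss_PX gauss_QX gauss_PP gauss_QQ position1 position2
  by (cases "cross v1 v2 > 0"; cases "s1 < s2"; cases "cross v1 (curve D a - x1) > 0";
      cases "cross v2 (curve D a - x2) > 0"; cases order) simp_all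

end

text \<open>Two of the crossings have new times after the move, so they are renamed from
  \<open>p, q\<close> to \<open>p', q'\<close>; up to this renaming the second matrix is the toggled
  first one.\<close>

lemma homotopy_class_of_triangle_move:
  fixes n m :: "'v \<Rightarrow> 'v \<Rightarrow> bit"
  assumes fin: "finite V" and x: "x \<in> V"
    and p: "p \<notin> V" "q \<notin> V" "p \<noteq> q" and p': "p' \<notin> V" "q' \<notin> V" "p' \<noteq> q'"
    and n: "\<And>i j. n i j = n j i" and m: "\<And>i j. m i j = m j i"
    and d: "m p' p' = n p p" "m q' q' = n q q" and pq: "m p' q' = n p q + 1"
    and px: "\<And>k. k \<in> V \<Longrightarrow> m p' k = n p k + of_bool (k = x)"
    and qx: "\<And>k. k \<in> V \<Longrightarrow> m q' k = n q k + of_bool (k = x)"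
    and old: "\<And>i j. i \<in> V \<Longrightarrow> j \<in> V \<Longrightarrow> m i j = n i j"
    and even: "\<And>k. k \<in> V \<Longrightarrow> k \<noteq> x \<Longrightarrow> n p k + n q k + n x k = 0"
    and wr: "n p x + n q x = 1 + n p p + n q q"
  shows "homotopy_class_of (looped_of (insert p (insert q V)) n) =
    homotopy_class_of (looped_of (insert p' (insert q' V)) m)"
proof -
  let ?W = "insert p (insert q V)" and ?W' = "insert p' (insert q' V)"
  define f where "f = id(p := p', q := q')"
  have f: "f p = p'" "f q = q'" "\<And>k. k \<in> V \<Longrightarrow> f k = k" using p by (auto simp: f_def)
  have "f ` V = V" using f(3) by simp
  moreover have "inj_on f ?W"
  proof (rule inj_onI)
    fix i j assume ij: "i \<in> ?W" "j \<in> ?W" "f i = f j"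
    consider "i = p" | "i = q" | "i \<in> V" using ij(1) by blast
    then show "i = j" using ij(2,3) f p' by cases auto
  qed
  ultimately have bij: "bij_betw f ?W ?W'" using f(1,2) by (simp add: bij_betw_def)
  have qp: "m q' p' = n q p + 1" using pq m[of q' p'] n[of q p] by simp
  have xp: "m k p' = n k p + of_bool (k = x)" "m k q' = n k q + of_bool (k = x)" if "k \<in> V" for k
    using px[OF that] qx[OF that] m n by metis+
  have ne: "k \<noteq> p" "k \<noteq> q" "p \<noteq> k" "q \<noteq> k" if "k \<in> V" for k using that p by blast+
  have e: "m (f i) (f j) = toggle3 p q x n i j" if i: "i \<in> ?W" and j: "j \<in> ?W" for i j
  proof -
    consider "i = p" | "i = q" | "i \<in> V" using i by blast
    then show ?thesis
    proof cases
      case 1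
      consider "j = p" | "j = q" | "j \<in> V" using j by blast
      then show ?thesis using 1 f d pq px ne p(3) by cases (simp_all add: toggle3_def)
    next
      case 2
      consider "j = p" | "j = q" | "j \<in> V" using j by blast
      then show ?thesis using 2 f d qp qx ne p(3) by cases (simp_all add: toggle3_def)
    next
      case 3
      consider "j = p" | "j = q" | "j \<in> V" using j by blast
      then show ?thesis
      proof cases
        case j: 3
        have "\<not> (i \<noteq> j \<and> i \<in> {p, q, x} \<and> j \<in> {p, q, x})" using ne[OF 3] ne[OF j] by blast
        then show ?thesis using f(3)[OF 3] f(3)[OF j] old[OF 3 j] by (simp add: toggle3_def)
      qed (use 3 f xp ne x in \<open>simp_all add: toggle3_def\<close>)
    qed
  qed
  have s: "sym_mat ?W n" unfolding sym_mat_def using n by blast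
  have wf: "looped_graph (looped_of ?W (toggle3 p q x n))"
    using fin by (simp add: looped_graph_looped_of)
  have "homotopy_class_of (looped_of ?W n) = homotopy_class_of (looped_of ?W (toggle3 p q x n))"
  proof (rule homotopy_class_of_toggle3)
    show "n k p + n k q + n k x = 0" if "k \<in> ?W - {p, q, x}" for k
      using even[of k] that unfolding n[of k] by simp
  qed (use fin s x p wr in auto)
  also have "\<dots> = homotopy_class_of (looped_of ?W' m)"
    by (rule homotopy_class_of_iso[OF _ wf], rule graph_iso_looped_ofI[OF bij]) (rule e)
  finally show ?thesis .
qed

lemma homotopy_class_reidemeister3:
  assumes D: "knot_diagram D" and D': "knot_diagram D'" and R: "reidemeister3 D D'"
  shows "homotopy_class_of (gauss_graph D) = homotopy_class_of (gauss_graph D')"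
proof -
  obtain a b c1 d1 c2 d2 z r s1 s2 t1 t2 where ch: "changes_in_disc a b z r D D'"
    and S: "{x. x \<notin> arc a b \<and> curve D x \<in> ball z r} = arc c1 d1 \<union> arc c2 d2"
    and d12: "arc c1 d1 \<inter> arc c2 d2 = {}" and str: "straight_strand c1 d1 D" "straight_strand c2 d2 D"
    and xy: "\<exists>x\<in>arc c1 d1. \<exists>y\<in>arc c2 d2. classical D x y"
    and s: "s1 < s2" "crossing_times a b D = {s1, s2}" "over_strand D s1 c1 d1" "over_strand D s2 c2 d2"
    and t: "t2 < t1" "crossing_times a b D' = {t1, t2}" "over_strand D' t1 c1 d1" "over_strand D' t2 c2 d2"
    using R unfolding reidemeister3_def by (elim exE conjE) (rule that)
  interpret disc_change a b D D' z r using D D' ch by unfold_locales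
  have S': "{x. x \<notin> arc a b \<and> curve D x \<in> ball z r} = arc c2 d2 \<union> arc c1 d1" and d21: "arc c2 d2 \<inter> arc c1 d1 = {}"
    using S d12 by blast+
  obtain x1 v1 where st1: "strand D z r c1 d1 x1 v1" "strand D' z r c1 d1 x1 v1"
    by (rule strands[OF S open_arc d21 str(1)])
  obtain x2 v2 where st2: "strand D z r c2 d2 x2 v2" "strand D' z r c2 d2 x2 v2"
    by (rule strands[OF S' open_arc d12 str(2)])
  have disj: "arc a b \<inter> arc c1 d1 = {}" "arc a b \<inter> arc c2 d2 = {}" using S by blast+
  obtain x y where x: "x \<in> arc c1 d1" and y: "y \<in> arc c2 d2" and cxy: "classical D x y" using xy by blast
  obtain \<xi> where \<xi>: "c1 < \<xi>" "\<xi> < d1" "x - \<xi> \<in> \<int>" using x by (rule arcE)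
  obtain \<eta> where \<eta>: "c2 < \<eta>" "\<eta> < d2" "y - \<eta> \<in> \<int>" using y by (rule arcE)
  have X: "classical D \<xi> \<eta>" using classical_cong[OF D \<xi>(3) \<eta>(3)] cxy by simp
  have out: "\<xi> \<notin> arc a b" "\<eta> \<notin> arc a b" using mem_arc[OF \<xi>(1,2)] mem_arc[OF \<eta>(1,2)] disj by blast+
  then have X': "classical D' \<xi> \<eta>" using classical_outside X by simp
  obtain s1' where s1': "c1 < s1'" "s1' < d1" "classical D s1 s1'" "s1 \<in> over D" using D s(3) by (rule over_strandE)
  obtain s2' where s2': "c2 < s2'" "s2' < d2" "classical D s2 s2'" "s2 \<in> over D" using D s(4) by (rule over_strandE)
  obtain t1' where t1': "c1 < t1'" "t1' < d1" "classical D' t1 t1'" "t1 \<in> over D'" using D' t(3) by (rule over_strandE)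
  obtain t2' where t2': "c2 < t2'" "t2' < d2" "classical D' t2 t2'" "t2 \<in> over D'" using D' t(4) by (rule over_strandE)
  interpret T: triangle D z r c1 d1 x1 v1 c2 d2 x2 v2 a b s1 s2 s1' s2' \<xi> \<eta>
  proof (intro triangle.intro triangle_axioms.intro st1 st2)
    show "w \<in> arc c1 d1 \<union> arc c2 d2" if "w \<notin> arc a b" "curve D w \<in> ball z r" for w using S that by blast
  qed (use ab in_disc not_on_sphere disj d12 \<xi> \<eta> X s s1' s2' in simp_all)
  interpret T': triangle D' z r c1 d1 x1 v1 c2 d2 x2 v2 a b t1 t2 t1' t2' \<xi> \<eta>
  proof (intro triangle.intro triangle_axioms.intro st1 st2)
    show "w \<in> arc c1 d1 \<union> arc c2 d2" if "w \<notin> arc a b" "curve D' w \<in> ball z r" for w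
      using S that outside(1) by auto
    \<comment> \<open>\<open>changes_in_disc\<close> keeps the crossings of \<open>D\<close> off the
      circle. Those of \<open>D'\<close> on the changed arc lie in the open disc, and all others are
      crossings of \<open>D\<close>.\<close>
    show "curve D' p \<notin> sphere z r" if m: "meets D' p q" for p q
    proof (cases "p \<in> arc a b \<or> q \<in> arc a b")
      case True
      then have "curve D' p \<in> ball z r" using in_disc(2)[of p] in_disc(2)[of q] m unfolding meets_def by fastforce
      then show ?thesis by simp
    next
      case False
      then have "meets D p q" "curve D' p = curve D p" using m meets_outside outside(1) by simp_all
      then show ?thesis using not_on_sphere by simp
    qed
  qed (use ab in_disc disj d12 \<xi> \<eta> X' t t1' t2' in simp_all)
  let ?n = "gauss_matrix D" and ?m = "gauss_matrix D'"
  let ?P = "chord s1 s1'" and ?Q = "chord s2 s2'" and ?P' = "chord t1 t1'" and ?Q' = "chord t2 t2'" and ?X = "chord \<xi> \<eta>"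
  have Xold: "?X \<in> old_crossings" using old_crossing_chord[OF X] out by simp
  have new: "?P \<notin> old_crossings" "?Q \<notin> old_crossings" "?P' \<notin> old_crossings" "?Q' \<notin> old_crossings"
    using old_crossing_chord[OF s1'(3)] old_crossing_chord[OF s2'(3)] old_crossing_chord'[OF t1'(3)]
      old_crossing_chord'[OF t2'(3)] T.arcs(1,2) T'.arcs(1,2) by blast+
  have cr: "crossings D = insert ?P (insert ?Q old_crossings)"
  proof
    show "insert ?P (insert ?Q old_crossings) \<subseteq> crossings D"
      using old_crossings_subset chord_mem[OF D s1'(3)] chord_mem[OF D s2'(3)] by blast
    show "crossings D \<subseteq> insert ?P (insert ?Q old_crossings)"
    proof
      fix k assume "k \<in> crossings D"
      then obtain p q where pq: "k = chord p q" "classical D p q" by (rule crossing_chordE)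
      then show "k \<in> insert ?P (insert ?Q old_crossings)"
        using old_crossing_chord[OF pq(2)] crossing_of_times[OF D s(2) s1'(3) s2'(3) pq(2)] by blast
    qed
  qed
  have cr': "crossings D' = insert ?P' (insert ?Q' old_crossings)"
  proof
    show "insert ?P' (insert ?Q' old_crossings) \<subseteq> crossings D'"
      using old_crossings_subset chord_mem[OF D' t1'(3)] chord_mem[OF D' t2'(3)] by blast
    show "crossings D' \<subseteq> insert ?P' (insert ?Q' old_crossings)"
    proof
      fix k assume "k \<in> crossings D'"
      then obtain p q where pq: "k = chord p q" "classical D' p q" by (rule crossing_chordE)
      then show "k \<in> insert ?P' (insert ?Q' old_crossings)"
        using old_crossing_chord'[OF pq(2)] crossing_of_times[OF D' t(2) t1'(3) t2'(3) pq(2)] by blast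
    qed
  qed
  have start: "curve D' a = curve D a" using arc_end_notin[OF ab] outside(1) by blast
  have lt: "s1 < s2" "\<not> t1 < t2" using s(1) t(1) by simp_all
  have other: "?m ?P' k = ?n ?P k" "?m ?Q' k = ?n ?Q k" "?n ?P k + ?n ?Q k + ?n ?X k = 0"
    if k: "k \<in> old_crossings" "k \<noteq> ?X" for k
  proof -
    obtain p q where pq: "k = chord p q" "classical D p q" "classical D' p q" "p \<in> over D" "p \<in> over D'"
      "p \<notin> arc a b" "q \<notin> arc a b" using k(1) by (rule old_crossingE)
    have ne: "chord p q \<noteq> ?X" using k(2) pq(1) by simp
    note g = T.gauss_other[OF pq(2,6,7) ne] T'.gauss_other[OF pq(3,6,7) ne]
    show "?m ?P' k = ?n ?P k" "?m ?Q' k = ?n ?Q k" unfolding pq(1) g by (rule refl)+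
    show "?n ?P k + ?n ?Q k + ?n ?X k = 0"
      unfolding pq(1) g
      by (cases "circ p q ((a + b) / 2)"; cases "circ p q \<xi>"; cases "circ p q \<eta>") simp_all
  qed
  \<comment> \<open>The start of the arc is the same and the order of its two crossings is reversed,
    so every linking bit within the triangle flips.\<close>
  have flip: "?m ?P' ?X = ?n ?P ?X + 1" "?m ?Q' ?X = ?n ?Q ?X + 1" "?m ?P' ?Q' = ?n ?P ?Q + 1"
  proof -
    have "(t1' < \<xi>) = (\<not> s1' < \<xi>)" "(t2' < \<eta>) = (\<not> s2' < \<eta>)"
      unfolding T.position1 T.position2 T'.position1 T'.position2 start using lt by auto
    then show "?m ?P' ?X = ?n ?P ?X + 1" "?m ?Q' ?X = ?n ?Q ?X + 1"
      unfolding T.gauss_PX T.gauss_QX T'.gauss_PX T'.gauss_QX by auto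
    show "?m ?P' ?Q' = ?n ?P ?Q + 1" unfolding T.gauss_PQ T'.gauss_PQ using lt by auto
  qed
  have "homotopy_class_of (looped_of (insert ?P (insert ?Q old_crossings)) ?n) =
    homotopy_class_of (looped_of (insert ?P' (insert ?Q' old_crossings)) ?m)"
  proof (rule homotopy_class_of_triangle_move)
    show "finite old_crossings" using finite_crossings[OF D] cr by simp
    show "?n i j = ?n j i" "?m i j = ?m j i" for i j by (rule loop_matrix_commute)+
    show "?m ?P' ?P' = ?n ?P ?P" unfolding T.gauss_PP T'.gauss_PP start by (rule refl)
    show "?m ?Q' ?Q' = ?n ?Q ?Q" unfolding T.gauss_QQ T'.gauss_QQ start by (rule refl)
    show "?m ?P' k = ?n ?P k + of_bool (k = ?X)" "?m ?Q' k = ?n ?Q k + of_bool (k = ?X)"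
      if "k \<in> old_crossings" for k
      using other(1,2)[OF that] flip(1,2) by (cases "k = ?X"; simp)+
  qed (fact Xold new T.PQ_ne T'.PQ_ne flip(3) gauss_matrix_old other(3) T.gauss_writhes)+
  then show ?thesis using gauss_graph_looped_of[OF D] gauss_graph_looped_of[OF D'] cr cr' by simp
qed

section \<open>Knots\<close>

lemma homotopy_class_vdiagram_step:
  assumes "vdiagram_step D D'"
  shows "homotopy_class_of (gauss_graph D) = homotopy_class_of (gauss_graph D')"
  using assms homotopy_class_isotopic homotopy_class_detour homotopy_class_reidemeister1
    homotopy_class_reidemeister2 homotopy_class_reidemeister3
  unfolding vdiagram_step_def by (elim conjE disjE) assumption+

lemma homotopy_class_equivclp:
  assumes "equivclp vdiagram_step D D'"
  shows "homotopy_class_of (gauss_graph D) = homotopy_class_of (gauss_graph D')"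
  using assms
proof (induction rule: equivclp_induct)
  case (step y z)
  then show ?case using homotopy_class_vdiagram_step[of y z] homotopy_class_vdiagram_step[of z y] by auto
qed (rule refl)

lemma homotopy_class_virtual_knot:
  assumes "K \<in> virtual_knots" "D \<in> K" "D' \<in> K"
  shows "knot_diagram D" "homotopy_class_of (gauss_graph D) = homotopy_class_of (gauss_graph D')"
proof -
  obtain D0 where K: "K = virtual_knot_rel `` {D0}" using assms(1) unfolding virtual_knots_def by (rule quotientE)
  have "knot_diagram D" "equivclp vdiagram_step D0 D" "equivclp vdiagram_step D0 D'"
    using assms(2,3) unfolding K virtual_knot_rel_def by auto
  then show "knot_diagram D" "homotopy_class_of (gauss_graph D) = homotopy_class_of (gauss_graph D')"
    using homotopy_class_equivclp[of D0 D] homotopy_class_equivclp[of D0 D'] by simp_all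
qed

theorem theorem3p1:
  shows "\<exists>\<Phi>. bij_betw \<Phi> graph_knots homotopy_classes \<and>
    (\<forall>K\<in>virtual_knots. \<forall>F L. graph_knot_from K F \<and> homotopy_class_from K L \<longrightarrow>
       F \<in> graph_knots \<and> L \<in> homotopy_classes \<and> \<Phi> F = L)"
proof (intro exI[of _ writhe_class] conjI ballI allI impI; (elim conjE)?)
  show "bij_betw writhe_class graph_knots homotopy_classes" by (rule bij_betw_writhe_class)
  fix K F L assume K: "K \<in> virtual_knots" and F: "graph_knot_from K F" and L: "homotopy_class_from K L"
  obtain D C where D: "D \<in> K" "crossings D \<noteq> {}" "rotating_circuit D C" "F = graph_link_of (circuit_graph D C)"
    using F unfolding graph_knot_from_def by blast
  obtain D' where D': "D' \<in> K" "L = homotopy_class_of (gauss_graph D')"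
    using L unfolding homotopy_class_from_def by blast
  have "circuit D C" using homotopy_class_virtual_knot(1)[OF K D(1) D(1)] D(2,3) by unfold_locales
  then have r: "realizes (circuit_graph D C) (gauss_graph D)" by (rule circuit.realizes_circuit_graph)
  \<comment> \<open>The two constructions may use different diagrams of \<open>K\<close>; invariance
    of the homotopy class moves the Gauss diagram to the diagram that carries the circuit.\<close>
  have L: "L = homotopy_class_of (gauss_graph D)"
    using homotopy_class_virtual_knot(2)[OF K D(1) D'(1)] D'(2) by simp
  show "F \<in> graph_knots" "L \<in> homotopy_classes" "writhe_class F = L"
    unfolding D(4) L using realizes_classes[OF r] by blast+
qed

end
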